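(* Let $p\geq 2$ and let $(a,-b_1,\dots,-b_p)$ be a partition of $-2$ with $a,b_1,\dots,b_p\geq 1$ integers (so $a=\sum_{j=1}^p b_j-2$). Then the isoresidual fibration of the stratum $\mathcal{H}(a,-b_1,\dots,-b_p)$ of meromorphic $1$-forms on $\mathbb{CP}^1$ is, over $\mathcal{R}_p\setminus\mathcal{A}_p$, a non-ramified cover of degree $$\frac{a!}{(a+2-p)!}.$$ That is, the restriction $\operatorname{res}\colon \operatorname{res}^{-1}(\mathcal{R}_p\setminus\mathcal{A}_p)\to\mathcal{R}_p\setminus\mathcal{A}_p$ of the residual map is an unramified covering of this degree.
   Context: The stratum $\mathcal{H}(a,-b_1,\dots,-b_p)$ is the space of meromorphic $1$-forms $\omega$ on $\mathbb{CP}^1$ having exactly one zero, of order $a$, and exactly $p$ poles, labeled by $1,\dots,p$, the $j$-th one of order $b_j$, considered up to biholomorphisms (pulling back forms and preserving the labels of the poles). It is a complex manifold of dimension $p-1$, namely the quotient by the automorphism group of $\mathbb{CP}^1$ of the space of all such forms, which are parametrized by the positions of the zero and of the poles and a nonzero multiplicative constant. The residue of $\omega$ at a pole is the period of $\omega$ over a positively oriented simple loop around it (so it is $2i\pi$ times the usual residue). The residual space is $\mathcal{R}_p=\{(\lambda_1,\dots,\lambda_p)\in\mathbb{C}^p : \sum_{j=1}^p\lambda_j=0\}$. The residual map $\operatorname{res}\colon\mathcal{H}(a,-b_1,\dots,-b_p)\to\mathcal{R}_p$ sends $\omega$ to the tuple of its residues at the poles $1,\dots,p$; it defines the isoresidual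 fibration. For a nonempty proper subset $I\subset\{1,\dots,p\}$ the resonance hyperplane is $A_I=\{\lambda\in\mathcal{R}_p:\sum_{j\in I}\lambda_j=0\}$. The resonance arrangement $\mathcal{A}_p\subset\mathcal{R}_p$ is the union of all the $A_I$. *)

theory Defs
  imports "HOL-Complex_Analysis.Complex_Analysis"
begin

section \<open>The Riemann sphere\<close>

text \<open>
  A point of $CP^1$ is a \<^typ>\<open>complex option\<close>: \<^term>\<open>Some z\<close> is the finite point \<open>z\<close> and
  \<^term>\<open>None\<close> is the point at infinity. The two standard charts are \<open>z\<close> on the complement of
  infinity and \<open>1/z\<close> on the complement of \<open>0\<close>; \<open>point i\<close> is the inverse of the chart \<open>coord i\<close>.
\<close>

type_synonym sphere = "complex option"

definition sphere_top :: "sphere topology" where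
  "sphere_top = Alexandroff_compactification euclidean"

datatype chart = Chart0 | Chart1

fun point :: "chart \<Rightarrow> complex \<Rightarrow> sphere" where
  "point Chart0 w = Some w"
| "point Chart1 w = (if w = 0 then None else Some (1 / w))"

definition chart_dom :: "chart \<Rightarrow> sphere set" where
  "chart_dom i = range (point i)"

text \<open>Only the values of \<open>coord i\<close> on \<open>chart_dom i\<close> are meaningful.\<close>

fun coord :: "chart \<Rightarrow> sphere \<Rightarrow> complex" where
  "coord Chart0 (Some z) = z"
| "coord Chart0 None = 0"
| "coord Chart1 (Some z) = 1 / z"
| "coord Chart1 None = 0"

text \<open>The set in the second clause is open by continuity of \<open>\<phi>\<close>.\<close>

definition holomorphic_sphere_map :: "(sphere \<Rightarrow> sphere) \<Rightarrow> bool" where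
  "holomorphic_sphere_map \<phi> \<longleftrightarrow>
     continuous_map sphere_top sphere_top \<phi> \<and>
     (\<forall>i k. (\<lambda>w. coord k (\<phi> (point i w))) holomorphic_on {w. \<phi> (point i w) \<in> chart_dom k})"

definition sphere_biholomorphism :: "(sphere \<Rightarrow> sphere) \<Rightarrow> bool" where
  "sphere_biholomorphism \<phi> \<longleftrightarrow>
     bij \<phi> \<and> holomorphic_sphere_map \<phi> \<and> holomorphic_sphere_map (inv \<phi>)"


section \<open>Meromorphic 1-forms\<close>

text \<open>
  A meromorphic 1-form is given by its coefficient functions in the two charts: it is
  \<open>F Chart0 z dz\<close> and \<open>F Chart1 w dw\<close>, and \<open>w = 1/z\<close> gives the compatibility condition. By
  \<open>nicely_meromorphic_on\<close> the coefficients take the value \<open>0\<close> at poles and have no removable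
  singularities, so that equality of functions is equality of forms.
\<close>

type_synonym form = "chart \<Rightarrow> complex \<Rightarrow> complex"

definition meromorphic_form :: "form \<Rightarrow> bool" where
  "meromorphic_form F \<longleftrightarrow>
     (\<forall>i. F i nicely_meromorphic_on UNIV) \<and>
     (\<forall>w. w \<noteq> 0 \<longrightarrow> F Chart1 w = F Chart0 (1 / w) * (- 1 / w\<^sup>2))"

definition pullback :: "(sphere \<Rightarrow> sphere) \<Rightarrow> form \<Rightarrow> form" where
  "pullback \<phi> F = (\<lambda>i w.
     let k = (if \<phi> (point i w) = None then Chart1 else Chart0);
         h = (\<lambda>u. coord k (\<phi> (point i u)))
     in F k (h w) * deriv h w)"

definition form_order :: "form \<Rightarrow> sphere \<Rightarrow> int" where
  "form_order F x =
     (case x of Some z \<Rightarrow> zorder (F Chart0) z | None \<Rightarrow> zorder (F Chart1) 0)"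

text \<open>The residue is the period over a small positive loop, hence the factor $2 i \pi$.\<close>

definition form_residue :: "form \<Rightarrow> sphere \<Rightarrow> complex" where
  "form_residue F x = 2 * of_real pi * \<i> *
     (case x of Some z \<Rightarrow> residue (F Chart0) z | None \<Rightarrow> residue (F Chart1) 0)"


section \<open>The stratum\<close>

text \<open>
  A form with labelled poles is a pair \<open>(F, P)\<close>, where \<open>P j\<close> is the pole with label
  \<open>j \<in> {1..p}\<close>. The numbers \<open>a\<close> and \<open>b j\<close> are the orders of the zero and of the poles.
  The zero form is excluded because \<open>zorder\<close> is meaningless for it.
\<close>

definition labelled_forms :: "nat \<Rightarrow> nat \<Rightarrow> (nat \<Rightarrow> nat) \<Rightarrow> (form \<times> (nat \<Rightarrow> sphere)) set" where
  "labelled_forms p a b = {(F, P).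
     meromorphic_form F \<and> F \<noteq> (\<lambda>i w. 0) \<and>
     (\<exists>Z. {x. form_order F x > 0} = {Z} \<and> form_order F Z = int a) \<and>
     P \<in> extensional {1..p} \<and> inj_on P {1..p} \<and>
     {x. form_order F x < 0} = P ` {1..p} \<and>
     (\<forall>j\<in>{1..p}. form_order F (P j) = - int (b j))}"

definition iso_forms :: "nat \<Rightarrow> nat \<Rightarrow> (nat \<Rightarrow> nat) \<Rightarrow>
    ((form \<times> (nat \<Rightarrow> sphere)) \<times> (form \<times> (nat \<Rightarrow> sphere))) set" where
  "iso_forms p a b = {((F, P), (G, Q)).
     (F, P) \<in> labelled_forms p a b \<and> (G, Q) \<in> labelled_forms p a b \<and>
     (\<exists>\<phi>. sphere_biholomorphism \<phi> \<and> F = pullback \<phi> G \<and> (\<forall>j\<in>{1..p}. \<phi> (P j) = Q j))}"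

definition stratum :: "nat \<Rightarrow> nat \<Rightarrow> (nat \<Rightarrow> nat) \<Rightarrow> (form \<times> (nat \<Rightarrow> sphere)) set set" where
  "stratum p a b = labelled_forms p a b // iso_forms p a b"

text \<open>
  Parametrization of the labelled forms. The position of the zero (index \<open>0\<close>) and the positions
  of the poles (indices \<open>1..p\<close>) are given by homogeneous coordinates \<open>q i = (u, v)\<close>, standing
  for the point \<open>u / v\<close> of the sphere (infinity if \<open>v = 0\<close>); \<open>c\<close> is the multiplicative constant.
  As \<open>(u, v)\<close> gives the linear form \<open>z v - u\<close> vanishing exactly there, the form is
  \<open>c (z v\<^sub>0 - u\<^sub>0) ^ a / (\<Prod>j. (z v\<^sub>j - u\<^sub>j) ^ b\<^sub>j) dz\<close>. Homogeneous coordinates put positions at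
  infinity on the same footing as finite ones. Every labelled form is reached, with a
  parameter that is unique up to rescaling the \<open>q i\<close> and adjusting \<open>c\<close>.
\<close>

definition params :: "nat \<Rightarrow> (complex \<times> (nat \<Rightarrow> complex \<times> complex)) topology" where
  "params p = subtopology
     (prod_topology euclidean (product_topology (\<lambda>_. euclidean) {0..p}))
     {(c, q). c \<noteq> 0 \<and>
        (\<forall>i\<in>{0..p}. q i \<noteq> 0) \<and>
        (\<forall>i\<in>{0..p}. \<forall>j\<in>{0..p}. i \<noteq> j \<longrightarrow> fst (q i) * snd (q j) \<noteq> fst (q j) * snd (q i))}"

fun linear_factor :: "complex \<times> complex \<Rightarrow> chart \<Rightarrow> complex \<Rightarrow> complex" where
  "linear_factor (u, v) Chart0 z = z * v - u"
| "linear_factor (u, v) Chart1 w = v - w * u"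

definition param_form :: "nat \<Rightarrow> nat \<Rightarrow> (nat \<Rightarrow> nat) \<Rightarrow>
    complex \<times> (nat \<Rightarrow> complex \<times> complex) \<Rightarrow> form \<times> (nat \<Rightarrow> sphere)" where
  "param_form p a b = (\<lambda>(c, q).
     ((\<lambda>i w. (case i of Chart0 \<Rightarrow> c | Chart1 \<Rightarrow> - c) *
          linear_factor (q 0) i w ^ a / (\<Prod>j=1..p. linear_factor (q j) i w ^ b j)),
      restrict (\<lambda>j. if snd (q j) = 0 then None else Some (fst (q j) / snd (q j))) {1..p}))"

text \<open>The finest topology on \<open>S\<close> making \<open>f\<close> continuous on \<open>X\<close>.\<close>

definition final_topology :: "'b set \<Rightarrow> 'a topology \<Rightarrow> ('a \<Rightarrow> 'b) \<Rightarrow> 'b topology" where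
  "final_topology S X f =
     topology (\<lambda>U. U \<subseteq> S \<and> openin X {x \<in> topspace X. f x \<in> U})"

lemma openin_final_topology:
  "openin (final_topology S X f) U \<longleftrightarrow> U \<subseteq> S \<and> openin X {x \<in> topspace X. f x \<in> U}"
proof -
  have "istopology (\<lambda>U. U \<subseteq> S \<and> openin X {x \<in> topspace X. f x \<in> U})"
    unfolding istopology_def
  proof (rule conjI; clarify)
    fix A B
    assume "openin X {x \<in> topspace X. f x \<in> A}" "openin X {x \<in> topspace X. f x \<in> B}"
    then have "openin X ({x \<in> topspace X. f x \<in> A} \<inter> {x \<in> topspace X. f x \<in> B})"
      by (rule openin_Int)
    moreover have "{x \<in> topspace X. f x \<in> A} \<inter> {x \<in> topspace X. f x \<in> B}
        = {x \<in> topspace X. f x \<in> A \<inter> B}" by auto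
    moreover assume "A \<subseteq> S"
    ultimately show "A \<inter> B \<subseteq> S \<and> openin X {x \<in> topspace X. f x \<in> A \<inter> B}" by auto
  next
    fix \<K>
    assume *: "\<forall>K\<in>\<K>. K \<subseteq> S \<and> openin X {x \<in> topspace X. f x \<in> K}"
    then have "openin X (\<Union>K\<in>\<K>. {x \<in> topspace X. f x \<in> K})" by auto
    moreover have "(\<Union>K\<in>\<K>. {x \<in> topspace X. f x \<in> K}) = {x \<in> topspace X. f x \<in> \<Union>\<K>}" by auto
    ultimately show "\<Union>\<K> \<subseteq> S \<and> openin X {x \<in> topspace X. f x \<in> \<Union>\<K>}" using * by auto
  qed
  then show ?thesis by (simp add: final_topology_def)
qed

definition labelled_forms_top ::
    "nat \<Rightarrow> nat \<Rightarrow> (nat \<Rightarrow> nat) \<Rightarrow> (form \<times> (nat \<Rightarrow> sphere)) topology" where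
  "labelled_forms_top p a b = final_topology (labelled_forms p a b) (params p) (param_form p a b)"

definition stratum_top ::
    "nat \<Rightarrow> nat \<Rightarrow> (nat \<Rightarrow> nat) \<Rightarrow> (form \<times> (nat \<Rightarrow> sphere)) set topology" where
  "stratum_top p a b =
     final_topology (stratum p a b) (labelled_forms_top p a b) (\<lambda>x. iso_forms p a b `` {x})"


section \<open>The residual map and the resonance arrangement\<close>

definition residual_space :: "nat \<Rightarrow> (nat \<Rightarrow> complex) set" where
  "residual_space p = {l \<in> {1..p} \<rightarrow>\<^sub>E UNIV. (\<Sum>j=1..p. l j) = 0}"

definition residual_space_top :: "nat \<Rightarrow> (nat \<Rightarrow> complex) topology" where
  "residual_space_top p =
     subtopology (product_topology (\<lambda>_. euclidean) {1..p}) (residual_space p)"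

definition resonance_hyperplane :: "nat \<Rightarrow> nat set \<Rightarrow> (nat \<Rightarrow> complex) set" where
  "resonance_hyperplane p I = {l \<in> residual_space p. (\<Sum>j\<in>I. l j) = 0}"

definition resonance_arrangement :: "nat \<Rightarrow> (nat \<Rightarrow> complex) set" where
  "resonance_arrangement p = (\<Union>I\<in>{I. I \<noteq> {} \<and> I \<subset> {1..p}}. resonance_hyperplane p I)"

definition residues :: "nat \<Rightarrow> form \<times> (nat \<Rightarrow> sphere) \<Rightarrow> nat \<Rightarrow> complex" where
  "residues p = (\<lambda>(F, P). restrict (\<lambda>j. form_residue F (P j)) {1..p})"

text \<open>Isomorphic labelled forms have equal residues, so \<open>residues p ` C\<close> is a singleton.\<close>

definition residual_map :: "nat \<Rightarrow> (form \<times> (nat \<Rightarrow> sphere)) set \<Rightarrow> nat \<Rightarrow> complex" where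
  "residual_map p C = the_elem (residues p ` C)"


section \<open>Covering maps\<close>

text \<open>
  \<open>covering_space\<close> for abstract topologies; there it is only available for subsets of
  type-class topological spaces, which does not apply to the quotient above.
\<close>

definition covering_map :: "'a topology \<Rightarrow> 'b topology \<Rightarrow> ('a \<Rightarrow> 'b) \<Rightarrow> bool" where
  "covering_map X Y f \<longleftrightarrow>
     continuous_map X Y f \<and> f ` topspace X = topspace Y \<and>
     (\<forall>y\<in>topspace Y. \<exists>V. y \<in> V \<and> openin Y V \<and>
        (\<exists>\<U>. \<Union>\<U> = {x \<in> topspace X. f x \<in> V} \<and>
             (\<forall>U\<in>\<U>. openin X U) \<and> pairwise disjnt \<U> \<and>
             (\<forall>U\<in>\<U>. homeomorphic_map (subtopology X U) (subtopology Y V) f)))"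

definition covering_map_of_degree :: "nat \<Rightarrow> 'a topology \<Rightarrow> 'b topology \<Rightarrow> ('a \<Rightarrow> 'b) \<Rightarrow> bool" where
  "covering_map_of_degree d X Y f \<longleftrightarrow>
     covering_map X Y f \<and>
     (\<forall>y\<in>topspace Y. finite {x \<in> topspace X. f x = y} \<and> card {x \<in> topspace X. f x = y} = d)"

end

theory Submission
  imports Defs "HOL-Homology.Invariance_of_Domain"
begin

text \<open>
  Move the zero to infinity, pole \<open>p\<close> to \<open>0\<close> and pole \<open>p - 1\<close> to \<open>1\<close>; the remaining \<open>N = p - 2\<close> poles
  \<open>x\<^sub>1, \<dots>, x\<^sub>N\<close> and the multiplicative constant are then coordinates on the stratum. In the
  coordinate \<open>u = 1/z\<close>, prescribing the residues up to a common factor becomes \<open>N\<close> equations on the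
  nonzero poles \<open>x\<^sub>0, \<dots>, x\<^sub>N\<close>, homogeneous of degrees \<open>d + 1, \<dots>, d + N\<close> where \<open>d = a + 2 - p\<close>. Off the
  resonance arrangement every nonzero solution consists of distinct nonzero numbers and is
  nondegenerate: a first order deformation with constant residues changes the form by an exact form,
  whose order of vanishing at the zero forces it to come from a rescaling. Bezout's theorem gives
  \<open>(d + 1) \<cdots> (d + N) = a! / (a + 2 - p)!\<close> solutions; it is obtained by a homotopy to the system
  \<open>x\<^sub>i ^ d\<^sub>i = x\<^sub>0 ^ d\<^sub>i\<close>, along which all but finitely many systems are nondegenerate. Finally,
  nondegeneracy and invariance of domain make the residual map open, and an open continuous map on a
  Hausdorff space with fibres of constant finite cardinality is a covering of its image.
\<close>

section \<open>Linear algebra over finite index sets\<close>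

text \<open>The number d is the sum of all b_j - 1, the degree available to the numerator q of the
  primitive q / D. Coefficients up to d of D times the logarithms are absorbed by q; the zero of
  order a = d + N in u imposes that exactly the coefficients d + 1, ..., d + N vanish, and as these
  are weighted homogeneous in the poles, their degrees are the factors of the count. Colliding poles
  stay inside the same polynomial system, so they have to be excluded: with fewer than N + 1
  distinct nonzero poles there is no room for a zero of order d + N, the logarithmic differential
  becomes exact, and the residues of each colliding group sum to zero. This is where the resonance
  arrangement enters. Derivatives occur only as divided differences. They are continuous in pairs of
  points, so an injective differential at a point gives injectivity nearby, and invariance of domain
  turns this into openness; no inverse function is constructed. The homotopy parameter is complex
  because the plane minus the finitely many degenerate parameters is connected.\<close>

lemma underdetermined_system:
  fixes A :: "'i \<Rightarrow> 'j \<Rightarrow> 'a::field"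
  assumes "finite I" "finite J" "card I < card J"
  shows "\<exists>c. (\<exists>j\<in>J. c j \<noteq> 0) \<and> (\<forall>i\<in>I. (\<Sum>j\<in>J. A i j * c j) = 0)"
  using assms
proof (induction I arbitrary: A J rule: finite_induct)
  case empty
  then have "J \<noteq> {}" by auto
  then show ?case by (intro exI[of _ "\<lambda>_. 1"]) auto
next
  case (insert i I)
  show ?case
  proof (cases "\<forall>j\<in>J. A i j = 0")
    case True
    from insert have "card I < card J" by simp
    from insert.IH[OF insert.prems(1) this, of A] obtain c where
      c: "\<exists>j\<in>J. c j \<noteq> 0" "\<forall>i\<in>I. (\<Sum>j\<in>J. A i j * c j) = 0" by auto
    with True show ?thesis by (intro exI[of _ c]) auto
  next
    case False
    then obtain k where k: "k \<in> J" "A i k \<noteq> 0" by auto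
    let ?J = "J - {k}"
    \<comment> \<open>Elimination of the unknown \<open>k\<close> by the pivot \<open>A i k\<close>;
      \<open>c'\<close> below is the back substitution.\<close>
    define B where "B l j = A l j - A l k * A i j / A i k" for l j
    have "card I < card ?J" using insert k by simp
    from insert.IH[OF _ this, of B] insert.prems obtain c where
      c: "\<exists>j\<in>?J. c j \<noteq> 0" "\<forall>l\<in>I. (\<Sum>j\<in>?J. B l j * c j) = 0" by auto
    define c' where "c' = c(k := - (\<Sum>j\<in>?J. A i j * c j) / A i k)"
    have split: "(\<Sum>j\<in>J. A l j * c' j) = A l k * c' k + (\<Sum>j\<in>?J. A l j * c j)" for l
    proof -
      have "(\<Sum>j\<in>J. A l j * c' j) = A l k * c' k + (\<Sum>j\<in>?J. A l j * c' j)"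
        using insert.prems(1) k(1) by (rule sum.remove)
      also have "(\<Sum>j\<in>?J. A l j * c' j) = (\<Sum>j\<in>?J. A l j * c j)"
        by (rule sum.cong) (auto simp: c'_def)
      finally show ?thesis .
    qed
    have "(\<Sum>j\<in>J. A l j * c' j) = 0" if "l \<in> I" for l
    proof -
      have "(\<Sum>j\<in>?J. B l j * c j) =
          (\<Sum>j\<in>?J. A l j * c j) - (A l k / A i k) * (\<Sum>j\<in>?J. A i j * c j)"
        unfolding B_def sum_distrib_left sum_subtractf[symmetric]
        by (rule sum.cong) (auto simp: field_simps)
      with c(2) that have "(\<Sum>j\<in>?J. A l j * c j) = (A l k / A i k) * (\<Sum>j\<in>?J. A i j * c j)"
        by auto
      then show ?thesis unfolding split by (simp add: c'_def)
    qed
    moreover have "(\<Sum>j\<in>J. A i j * c' j) = 0"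
      unfolding split using k by (simp add: c'_def)
    moreover have "\<exists>j\<in>J. c' j \<noteq> 0" using c(1) by (auto simp: c'_def)
    ultimately show ?thesis by (intro exI[of _ c']) auto
  qed
qed

text \<open>More eigenvalues than coordinates would give a linear relation between eigenvectors.
  Applying the matrix repeatedly weights this relation by every power of \<mu>, hence by every
  polynomial in \<mu>, and a polynomial vanishing at all chosen eigenvalues but one isolates a
  single nonzero eigenvector.\<close>

lemma finite_eigenvalues:
  fixes m :: "'e \<Rightarrow> 'e \<Rightarrow> complex"
  assumes E: "finite E"
  shows "finite {\<mu>. \<exists>y. (\<exists>e\<in>E. y e \<noteq> 0) \<and> (\<forall>e\<in>E. (\<Sum>e'\<in>E. m e e' * y e') = \<mu> * y e)}"
    (is "finite ?S")
proof (rule ccontr)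
  assume inf: "infinite ?S"
  then obtain T where T: "T \<subseteq> ?S" "finite T" "card T = Suc (card E)"
    by (meson infinite_arbitrarily_large)
  obtain y where y: "\<And>\<mu>. \<mu> \<in> T \<Longrightarrow> \<exists>e\<in>E. y \<mu> e \<noteq> 0"
      "\<And>\<mu> e. \<mu> \<in> T \<Longrightarrow> e \<in> E \<Longrightarrow> (\<Sum>e'\<in>E. m e e' * y \<mu> e') = \<mu> * y \<mu> e"
    using T(1) by (simp add: subset_iff) metis
  obtain c where c: "\<exists>\<mu>\<in>T. c \<mu> \<noteq> 0" "\<forall>e\<in>E. (\<Sum>\<mu>\<in>T. y \<mu> e * c \<mu>) = 0"
    using underdetermined_system[of E T "\<lambda>e \<mu>. y \<mu> e"] E T by auto
  have pow: "\<forall>e\<in>E. (\<Sum>\<mu>\<in>T. y \<mu> e * c \<mu> * \<mu> ^ k) = 0" for k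
  proof (induction k)
    case 0
    then show ?case using c by simp
  next
    case (Suc k)
    show ?case
    proof
      fix e assume e: "e \<in> E"
      have "(\<Sum>\<mu>\<in>T. y \<mu> e * c \<mu> * \<mu> ^ Suc k) =
          (\<Sum>\<mu>\<in>T. (\<Sum>e'\<in>E. m e e' * y \<mu> e') * (c \<mu> * \<mu> ^ k))"
        using y(2) e by (intro sum.cong) (auto simp: algebra_simps)
      also have "\<dots> = (\<Sum>e'\<in>E. m e e' * (\<Sum>\<mu>\<in>T. y \<mu> e' * c \<mu> * \<mu> ^ k))"
        unfolding sum_distrib_left sum_distrib_right
        by (subst sum.swap) (auto intro!: sum.cong simp: algebra_simps)
      also have "\<dots> = 0" using Suc by simp
      finally show "(\<Sum>\<mu>\<in>T. y \<mu> e * c \<mu> * \<mu> ^ Suc k) = 0" .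
    qed
  qed
  have poly: "(\<Sum>\<mu>\<in>T. y \<mu> e * c \<mu> * poly q \<mu>) = 0" if e: "e \<in> E" for e q
  proof -
    have "(\<Sum>\<mu>\<in>T. y \<mu> e * c \<mu> * poly q \<mu>) =
        (\<Sum>k\<le>Polynomial.degree q. Polynomial.coeff q k * (\<Sum>\<mu>\<in>T. y \<mu> e * c \<mu> * \<mu> ^ k))"
      unfolding poly_altdef sum_distrib_left
      by (subst sum.swap) (auto intro!: sum.cong simp: algebra_simps)
    with pow e show ?thesis by simp
  qed
  obtain \<nu> where \<nu>: "\<nu> \<in> T" "c \<nu> \<noteq> 0" using c by auto
  obtain e where e: "e \<in> E" "y \<nu> e \<noteq> 0" using y(1) \<nu> by auto
  define q where "q = (\<Prod>\<mu>\<in>T - {\<nu>}. [:-\<mu>, 1:])"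
  have q0: "poly q \<mu> = 0" if "\<mu> \<in> T - {\<nu>}" for \<mu>
    unfolding q_def poly_prod using T(2) that by (subst prod_zero_iff) auto
  have "poly q \<nu> \<noteq> 0"
    unfolding q_def poly_prod using T(2) by (subst prod_zero_iff) auto
  moreover have "(\<Sum>\<mu>\<in>T. y \<mu> e * c \<mu> * poly q \<mu>) = y \<nu> e * c \<nu> * poly q \<nu>"
    using T(2) \<nu>(1) q0 by (subst sum.remove[of T \<nu>]) (auto intro!: sum.neutral)
  ultimately show False using poly[OF e(1), of q] \<nu> e by simp
qed

lemma coordinatewise_convergent_subsequence:
  fixes x :: "nat \<Rightarrow> 'i \<Rightarrow> complex"
  assumes "finite I" "\<And>i k. i \<in> I \<Longrightarrow> norm (x k i) \<le> B"
  shows "\<exists>l r. strict_mono (r :: nat \<Rightarrow> nat) \<and> (\<forall>i\<in>I. (\<lambda>k. x (r k) i) \<longlonglongrightarrow> l i)"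
  using assms
proof (induction I rule: finite_induct)
  case empty
  then show ?case by (auto intro!: exI[of _ id] strict_mono_id)
next
  case (insert i I)
  then obtain l r where r: "strict_mono r" "\<forall>i\<in>I. (\<lambda>k. x (r k) i) \<longlonglongrightarrow> l i" by auto
  have "bounded (range (\<lambda>k. x (r k) i))"
    unfolding bounded_iff using insert.prems by auto
  from bounded_imp_convergent_subsequence[OF this] obtain l' r' where
    r': "strict_mono r'" "((\<lambda>k. x (r k) i) \<circ> r') \<longlonglongrightarrow> l'" by auto
  have "(\<lambda>k. x ((r \<circ> r') k) j) \<longlonglongrightarrow> (l(i := l')) j" if "j \<in> insert i I" for j
  proof (cases "j = i")
    case True
    with r' show ?thesis by (simp add: o_def)
  next
    case False
    with that r(2) have "(\<lambda>k. x (r k) j) \<longlonglongrightarrow> l j" by auto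
    from LIMSEQ_subseq_LIMSEQ[OF this r'(1)] False show ?thesis by (simp add: o_def)
  qed
  with strict_mono_o[OF r(1) r'(1)] show ?case by blast
qed

text \<open>Compactness of the unit sphere: kernel vectors of matrices tending to \<open>A\<close>,
  normalized in the 1-norm, accumulate at a kernel vector of \<open>A\<close> of norm 1.\<close>

lemma injective_matrix_open:
  fixes A :: "'i \<Rightarrow> 'j \<Rightarrow> complex"
  assumes fin: "finite I" "finite J"
    and inj: "\<And>w. (\<forall>i\<in>I. (\<Sum>j\<in>J. A i j * w j) = 0) \<Longrightarrow> \<forall>j\<in>J. w j = 0"
  shows "\<exists>\<epsilon>>0. \<forall>B w. (\<forall>i\<in>I. \<forall>j\<in>J. norm (B i j - A i j) < \<epsilon>) \<longrightarrow>
           (\<forall>i\<in>I. (\<Sum>j\<in>J. B i j * w j) = 0) \<longrightarrow> (\<forall>j\<in>J. w j = 0)"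
proof (rule ccontr)
  assume "\<not> ?thesis"
  then have neg: "\<And>\<epsilon>. \<epsilon> > 0 \<Longrightarrow> \<exists>B w. (\<forall>i\<in>I. \<forall>j\<in>J. norm (B i j - A i j) < \<epsilon>) \<and>
      (\<forall>i\<in>I. (\<Sum>j\<in>J. B i j * w j) = 0) \<and> \<not> (\<forall>j\<in>J. w j = 0)"
    by simp
  have "\<forall>k. \<exists>B w. (\<forall>i\<in>I. \<forall>j\<in>J. norm (B i j - A i j) < inverse (Suc k)) \<and>
      (\<forall>i\<in>I. (\<Sum>j\<in>J. B i j * w j) = 0) \<and> \<not> (\<forall>j\<in>J. w j = 0)"
    by (intro allI neg) simp
  from this[unfolded choice_iff]
  obtain B w where B: "\<And>k i j. i \<in> I \<Longrightarrow> j \<in> J \<Longrightarrow> norm (B k i j - A i j) < inverse (Suc k)"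
    and Bw: "\<And>k i. i \<in> I \<Longrightarrow> (\<Sum>j\<in>J. B k i j * w k j) = 0"
    and w: "\<And>k. \<exists>j\<in>J. w k j \<noteq> 0"
    by fast
  define n where "n k = (\<Sum>j\<in>J. norm (w k j))" for k
  have n: "n k > 0" for k
  proof -
    obtain j where "j \<in> J" "w k j \<noteq> 0" using w by blast
    then have "0 < norm (w k j)" by simp
    also have "\<dots> \<le> n k" unfolding n_def using \<open>j \<in> J\<close> fin by (intro member_le_sum) auto
    finally show ?thesis .
  qed
  define u where "u k j = w k j / of_real (n k)" for k j
  have nu: "norm (u k j) = norm (w k j) / n k" for k j
    unfolding u_def using n[of k] by (simp add: norm_divide)
  have usum: "(\<Sum>j\<in>J. norm (u k j)) = 1" for k
    unfolding nu sum_divide_distrib[symmetric] using n[of k] by (simp add: n_def)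
  have ule: "norm (u k j) \<le> 1" if "j \<in> J" for k j
    using member_le_sum[of j J "\<lambda>j. norm (u k j)"] that fin usum by auto
  obtain l r where r: "strict_mono r" and l: "\<And>j. j \<in> J \<Longrightarrow> (\<lambda>k. u (r k) j) \<longlonglongrightarrow> l j"
    using coordinatewise_convergent_subsequence[OF fin(2), of u 1] ule by blast
  have lim: "(\<lambda>k. B (r k) i j) \<longlonglongrightarrow> A i j" if "i \<in> I" "j \<in> J" for i j
  proof -
    have "(\<lambda>k. B k i j - A i j) \<longlonglongrightarrow> 0"
      by (rule Lim_null_comparison[OF _ LIMSEQ_inverse_real_of_nat])
        (use B that in \<open>auto intro!: always_eventually less_imp_le\<close>)
    from LIMSEQ_subseq_LIMSEQ[OF this r] show ?thesis by (simp add: o_def LIM_zero_iff)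
  qed
  have "(\<Sum>j\<in>J. A i j * l j) = 0" if "i \<in> I" for i
  proof -
    have "(\<Sum>j\<in>J. B k i j * u k j) = 0" for k
      using Bw[OF that, of k] unfolding u_def times_divide_eq_right sum_divide_distrib[symmetric] by simp
    moreover have "(\<lambda>k. \<Sum>j\<in>J. B (r k) i j * u (r k) j) \<longlonglongrightarrow> (\<Sum>j\<in>J. A i j * l j)"
      using lim l that by (intro tendsto_sum tendsto_mult) auto
    ultimately show ?thesis by (simp add: LIMSEQ_const_iff)
  qed
  with inj[of l] have "\<forall>j\<in>J. l j = 0" by auto
  moreover have "(\<lambda>k. \<Sum>j\<in>J. norm (u (r k) j)) \<longlonglongrightarrow> (\<Sum>j\<in>J. norm (l j))"
    using l by (intro tendsto_sum tendsto_norm) auto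
  ultimately show False unfolding usum by (simp add: LIMSEQ_const_iff)
qed

section \<open>Invariance of domain in complex coordinates\<close>

text \<open>Complex n-space as sequences vanishing from index n on, in parallel to the real
  \<open>Euclidean_space\<close>, to which \<open>re_im\<close> transports it.\<close>

definition cspace :: "nat \<Rightarrow> (nat \<Rightarrow> complex) set" where
  "cspace n = {x. \<forall>i\<ge>n. x i = 0}"

definition re_im :: "(nat \<Rightarrow> complex) \<Rightarrow> nat \<Rightarrow> real" where
  "re_im x k = (if even k then Re (x (k div 2)) else Im (x (k div 2)))"

definition of_re_im :: "(nat \<Rightarrow> real) \<Rightarrow> nat \<Rightarrow> complex" where
  "of_re_im y k = Complex (y (2 * k)) (y (2 * k + 1))"

lemma of_re_im_re_im [simp]: "of_re_im (re_im x) = x"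
  by (auto simp: of_re_im_def re_im_def fun_eq_iff complex_eq_iff)

lemma re_im_of_re_im [simp]: "re_im (of_re_im y) = y"
proof
  fix k
  have "odd k \<Longrightarrow> Suc (2 * (k div 2)) = k" by presburger
  then show "re_im (of_re_im y) k = y k"
    by (auto simp: of_re_im_def re_im_def)
qed

lemma continuous_on_re_im: "continuous_on S re_im"
proof (rule continuous_on_coordinatewise_then_product)
  fix i
  have c: "continuous_on S (\<lambda>x. x (i div 2))"
    by (rule continuous_on_subset[OF continuous_on_product_coordinates]) auto
  show "continuous_on S (\<lambda>x. re_im x i)"
    unfolding re_im_def by (cases "even i") (auto intro!: continuous_intros c)
qed

lemma continuous_on_of_re_im: "continuous_on S of_re_im"
proof (rule continuous_on_coordinatewise_then_product)
  fix i
  have c: "continuous_on S (\<lambda>x. x k)" for k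
    by (rule continuous_on_subset[OF continuous_on_product_coordinates]) auto
  show "continuous_on S (\<lambda>x. of_re_im x i)"
    unfolding of_re_im_def Complex_eq by (auto intro!: continuous_intros c)
qed

lemma re_im_image_cspace: "re_im x \<in> topspace (Euclidean_space (2 * n)) \<longleftrightarrow> x \<in> cspace n"
proof
  assume "re_im x \<in> topspace (Euclidean_space (2 * n))"
  then have *: "re_im x i = 0" if "i \<ge> 2 * n" for i using that by (auto simp: topspace_Euclidean_space)
  have "x i = 0" if "i \<ge> n" for i
    using *[of "2 * i"] *[of "2 * i + 1"] that by (auto simp: re_im_def complex_eq_iff)
  then show "x \<in> cspace n" by (auto simp: cspace_def)
next
  assume "x \<in> cspace n"
  then show "re_im x \<in> topspace (Euclidean_space (2 * n))"
    by (auto simp: cspace_def re_im_def topspace_Euclidean_space)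
qed

lemma Euclidean_space_top_of_set: "Euclidean_space n = top_of_set (topspace (Euclidean_space n))"
  by (simp add: Euclidean_space_def euclidean_product_topology)

text \<open>The real theorem in dimension 2n, conjugated by the homeomorphism that interleaves real
  and imaginary parts.\<close>

lemma invariance_of_domain_cspace:
  assumes U: "openin (top_of_set (cspace n)) U"
    and f: "continuous_on U f" "f ` U \<subseteq> cspace n" "inj_on f U"
  shows "openin (top_of_set (cspace n)) (f ` U)"
proof -
  let ?E = "Euclidean_space (2 * n)"
  have vim: "of_re_im -` W \<inter> topspace ?E = re_im ` W" if "W \<subseteq> cspace n" for W
  proof -
    have "y \<in> re_im ` W" if "of_re_im y \<in> W" for y
      using that by (metis imageI re_im_of_re_im)
    then show ?thesis using that re_im_image_cspace[of _ n] by auto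
  qed
  have Usub: "U \<subseteq> cspace n" using U openin_imp_subset by blast
  have mapsto: "of_re_im ` topspace ?E \<subseteq> cspace n"
    by (metis image_subsetI re_im_image_cspace re_im_of_re_im)
  have opU: "openin ?E (re_im ` U)"
  proof -
    have "openin (top_of_set (topspace ?E)) (topspace ?E \<inter> of_re_im -` U)"
      by (rule continuous_openin_preimage[OF continuous_on_of_re_im _ U]) (use mapsto in auto)
    then show ?thesis using vim[OF Usub] Euclidean_space_top_of_set[of "2 * n"] by (simp add: Int_commute)
  qed
  let ?g = "re_im \<circ> f \<circ> of_re_im"
  have "openin ?E (?g ` (re_im ` U))"
  proof (rule invariance_of_domain_Euclidean_space[OF opU])
    have t: "topspace (subtopology ?E (re_im ` U)) = re_im ` U"
      using opU by (simp add: Int_absorb1 openin_subset)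
    have "continuous_on (re_im ` U) ?g"
      by (intro continuous_on_compose continuous_on_of_re_im continuous_on_re_im)
        (use f(1) in \<open>simp add: image_image\<close>)
    moreover have "?g \<in> re_im ` U \<rightarrow> topspace ?E"
      using f(2) re_im_image_cspace[of _ n] by auto
    ultimately show "continuous_map (subtopology ?E (re_im ` U)) ?E ?g"
      unfolding cm_Euclidean_space_iff_continuous_on t by blast
    show "inj_on ?g (re_im ` U)"
      using f(3) by (auto simp: inj_on_def) (metis of_re_im_re_im)
  qed
  then have op: "openin (top_of_set (topspace ?E)) (re_im ` (f ` U))"
    using Euclidean_space_top_of_set[of "2 * n"] by (simp add: image_image)
  have "openin (top_of_set (cspace n)) (cspace n \<inter> re_im -` (re_im ` (f ` U)))"
    by (rule continuous_openin_preimage[OF continuous_on_re_im _ op])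
      (auto simp: re_im_image_cspace)
  moreover have "cspace n \<inter> re_im -` (re_im ` (f ` U)) = f ` U"
    using f(2) by auto (metis of_re_im_re_im image_eqI)
  ultimately show ?thesis by simp
qed

section \<open>Forms in several variables\<close>

text \<open>Polynomials in several variables are treated as functions in the span of monomials; only
  the existence of coefficients matters, never their uniqueness.\<close>

definition lin_span :: "'e set \<Rightarrow> ('e \<Rightarrow> 'p \<Rightarrow> complex) \<Rightarrow> ('p \<Rightarrow> complex) set" where
  "lin_span E f = {F. \<exists>c. \<forall>x. F x = (\<Sum>a\<in>E. c a * f a x)}"

lemma lin_span_zero: "(\<lambda>_. 0) \<in> lin_span E f"
  by (auto simp: lin_span_def intro!: exI[of _ "\<lambda>_. 0"])

lemma lin_span_add:
  assumes "F \<in> lin_span E f" "G \<in> lin_span E f"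
  shows "(\<lambda>x. F x + G x) \<in> lin_span E f"
proof -
  from assms obtain c c' where "\<forall>x. F x = (\<Sum>a\<in>E. c a * f a x)" "\<forall>x. G x = (\<Sum>a\<in>E. c' a * f a x)"
    by (auto simp: lin_span_def)
  then have "\<forall>x. F x + G x = (\<Sum>a\<in>E. (c a + c' a) * f a x)"
    by (simp add: sum.distrib distrib_right)
  then show ?thesis by (auto simp: lin_span_def)
qed

lemma lin_span_cmult:
  assumes "F \<in> lin_span E f"
  shows "(\<lambda>x. k * F x) \<in> lin_span E f"
proof -
  from assms obtain c where "\<forall>x. F x = (\<Sum>a\<in>E. c a * f a x)"
    by (auto simp: lin_span_def)
  then have "\<forall>x. k * F x = (\<Sum>a\<in>E. (k * c a) * f a x)"
    by (simp add: sum_distrib_left mult.assoc)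
  then show ?thesis by (auto simp: lin_span_def)
qed

lemma lin_span_sum:
  assumes "\<And>i. i \<in> I \<Longrightarrow> F i \<in> lin_span E f"
  shows "(\<lambda>x. \<Sum>i\<in>I. F i x) \<in> lin_span E f"
proof (cases "finite I")
  case True
  from this assms show ?thesis
    by (induction I rule: finite_induct) (simp_all add: lin_span_zero lin_span_add)
qed (simp add: lin_span_zero)

lemma lin_span_base:
  assumes "finite E" "a \<in> E"
  shows "f a \<in> lin_span E f"
proof -
  have "f a x = (\<Sum>b\<in>E. (if b = a then 1 else 0) * f b x)" for x
    using assms by (simp add: if_distrib[of "\<lambda>c. c * _"] cong: if_cong)
  then show ?thesis unfolding lin_span_def
    by (intro CollectI exI[of _ "\<lambda>b. if b = a then 1 else 0"]) blast
qed

lemma lin_span_mult: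
  assumes "F \<in> lin_span E f" "G \<in> lin_span E' g"
    and fg: "\<And>a b. a \<in> E \<Longrightarrow> b \<in> E' \<Longrightarrow> (\<lambda>x. f a (p x) * g b (q x)) \<in> lin_span E'' h"
  shows "(\<lambda>x. F (p x) * G (q x)) \<in> lin_span E'' h"
proof -
  from assms(1,2) obtain c c' where
    "\<And>x. F x = (\<Sum>a\<in>E. c a * f a x)" "\<And>x. G x = (\<Sum>b\<in>E'. c' b * g b x)"
    by (auto simp: lin_span_def)
  then have eq: "(\<lambda>x. F (p x) * G (q x)) =
      (\<lambda>x. \<Sum>a\<in>E. \<Sum>b\<in>E'. (c a * c' b) * (f a (p x) * g b (q x)))"
    by (simp add: sum_product mult_ac)
  show ?thesis unfolding eq by (intro lin_span_sum lin_span_cmult fg)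
qed

definition monomials :: "nat \<Rightarrow> nat \<Rightarrow> (nat \<Rightarrow> nat) set" where
  "monomials N m = {\<alpha>. (\<forall>i>N. \<alpha> i = 0) \<and> (\<Sum>i\<le>N. \<alpha> i) = m}"

definition mval :: "nat \<Rightarrow> (nat \<Rightarrow> nat) \<Rightarrow> (nat \<Rightarrow> complex) \<Rightarrow> complex" where
  "mval N \<alpha> x = (\<Prod>i\<le>N. x i ^ \<alpha> i)"

definition forms :: "nat \<Rightarrow> nat \<Rightarrow> ((nat \<Rightarrow> complex) \<Rightarrow> complex) set" where
  "forms N m = lin_span (monomials N m) (mval N)"

definition bival :: "nat \<Rightarrow> (nat \<Rightarrow> nat) \<times> nat \<Rightarrow> (nat \<Rightarrow> complex) \<times> (nat \<Rightarrow> complex) \<Rightarrow> complex" where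
  "bival N e p = mval N (fst e) (fst p) * snd p (snd e)"

text \<open>Homogeneous of degree m in the point and linear in a tangent vector. The tangent vector
  has components 1 to N only, because \<open>x 0\<close> will be normalized and does not
  move.\<close>

definition biforms :: "nat \<Rightarrow> nat \<Rightarrow> ((nat \<Rightarrow> complex) \<times> (nat \<Rightarrow> complex) \<Rightarrow> complex) set" where
  "biforms N m = lin_span (monomials N m \<times> {1..N}) (bival N)"

lemma finite_monomials: "finite (monomials N m)"
proof (rule finite_subset)
  show "monomials N m \<subseteq> {\<alpha>. \<forall>i. (i \<in> {..N} \<longrightarrow> \<alpha> i \<in> {..m}) \<and> (i \<notin> {..N} \<longrightarrow> \<alpha> i = 0)}"
  proof (clarsimp simp: monomials_def not_le)
    fix \<alpha> :: "nat \<Rightarrow> nat" and i assume "i \<le> N"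
    then show "\<alpha> i \<le> sum \<alpha> {..N}" by (intro member_le_sum) auto
  qed
  show "finite {\<alpha> :: nat \<Rightarrow> nat. \<forall>i. (i \<in> {..N} \<longrightarrow> \<alpha> i \<in> {..m}) \<and> (i \<notin> {..N} \<longrightarrow> \<alpha> i = 0)}"
    by (rule finite_set_of_finite_funs) auto
qed

lemma monomials_add:
  "\<alpha> \<in> monomials N m \<Longrightarrow> \<beta> \<in> monomials N k \<Longrightarrow> (\<lambda>i. \<alpha> i + \<beta> i) \<in> monomials N (m + k)"
  by (auto simp: monomials_def sum.distrib)

lemma mval_add: "mval N (\<lambda>i. \<alpha> i + \<beta> i) x = mval N \<alpha> x * mval N \<beta> x"
  by (simp add: mval_def power_add prod.distrib)

lemma forms_mult:
  assumes "F \<in> forms N m" "G \<in> forms N k"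
  shows "(\<lambda>x. F x * G x) \<in> forms N (m + k)"
  using assms unfolding forms_def
  by (rule lin_span_mult[where p = "\<lambda>x. x" and q = "\<lambda>x. x"])
    (use lin_span_base[OF finite_monomials monomials_add, of _ N m _ k "mval N"]
      in \<open>simp add: mval_add[abs_def] fun_eq_iff[symmetric]\<close>)

lemma forms_biforms_mult:
  assumes "F \<in> forms N m" "G \<in> biforms N k"
  shows "(\<lambda>p. F (fst p) * G p) \<in> biforms N (m + k)"
  using assms unfolding forms_def biforms_def
proof (rule lin_span_mult[where p = fst and q = "\<lambda>x. x"])
  fix a b assume ab: "a \<in> monomials N m" "b \<in> monomials N k \<times> {1..N}"
  have "(\<lambda>x. mval N a (fst x) * bival N b x) = bival N (\<lambda>i. a i + fst b i, snd b)"
    by (auto simp: fun_eq_iff bival_def mval_add)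
  also have "\<dots> \<in> lin_span (monomials N (m + k) \<times> {1..N}) (bival N)"
    by (rule lin_span_base) (use ab finite_monomials monomials_add in auto)
  finally show "(\<lambda>x. mval N a (fst x) * bival N b x) \<in> lin_span (monomials N (m + k) \<times> {1..N}) (bival N)" .
qed

lemma forms_coord_mult:
  assumes "F \<in> forms N m" "j \<in> {1..N}"
  shows "(\<lambda>p. F (fst p) * snd p j) \<in> biforms N m"
proof -
  from assms obtain c where c: "\<And>x. F x = (\<Sum>a\<in>monomials N m. c a * mval N a x)"
    by (auto simp: forms_def lin_span_def)
  have eq: "(\<lambda>p. F (fst p) * snd p j) = (\<lambda>p. \<Sum>a\<in>monomials N m. c a * bival N (a, j) p)"
    by (simp add: c sum_distrib_right bival_def mult.assoc)
  show ?thesis unfolding eq biforms_def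
    by (intro lin_span_sum lin_span_cmult lin_span_base) (use assms finite_monomials in auto)
qed

lemma forms_const: "(\<lambda>_. c) \<in> forms N 0"
proof -
  have *: "(\<lambda>_. 0) \<in> monomials N 0" by (simp add: monomials_def)
  have "(\<lambda>x. c * mval N (\<lambda>_. 0) x) \<in> forms N 0" unfolding forms_def
    by (rule lin_span_cmult, rule lin_span_base[OF finite_monomials *])
  then show ?thesis by (simp add: mval_def)
qed

lemma forms_var:
  assumes "i \<le> N"
  shows "(\<lambda>x. x i) \<in> forms N 1"
proof -
  have *: "(\<lambda>j. if j = i then 1 else 0) \<in> monomials N 1" using assms by (auto simp: monomials_def)
  have "mval N (\<lambda>j. if j = i then 1 else 0) = (\<lambda>x. x i)"
    using assms by (auto simp: mval_def fun_eq_iff if_distrib[of "\<lambda>k. _ ^ k"] cong: if_cong)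
  with lin_span_base[OF finite_monomials *, of "mval N"] show ?thesis by (simp add: forms_def)
qed

lemma forms_homogeneous:
  assumes "F \<in> forms N m"
  shows "F (\<lambda>i. t * x i) = t ^ m * F x"
proof -
  from assms obtain c where c: "\<And>x. F x = (\<Sum>a\<in>monomials N m. c a * mval N a x)"
    by (auto simp: forms_def lin_span_def)
  have "mval N a (\<lambda>i. t * x i) = t ^ m * mval N a x" if "a \<in> monomials N m" for a
    using that by (auto simp: mval_def monomials_def power_mult_distrib prod.distrib power_sum[symmetric])
  then show ?thesis by (simp add: c sum_distrib_left mult_ac)
qed

text \<open>
  In \<open>form_dd N m F \<Delta>\<close>, the family \<open>\<Delta>\<close> is a system of divided differences
  of the form \<open>F\<close> of degree \<open>m\<close>; on the diagonal, \<open>\<Delta> j\<close> is the \<open>j\<close>-th partial derivative.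
\<close>

inductive form_dd :: "nat \<Rightarrow> nat \<Rightarrow> ((nat \<Rightarrow> complex) \<Rightarrow> complex) \<Rightarrow>
    (nat \<Rightarrow> (nat \<Rightarrow> complex) \<Rightarrow> (nat \<Rightarrow> complex) \<Rightarrow> complex) \<Rightarrow> bool" for N where
  zero: "form_dd N m (\<lambda>_. 0) (\<lambda>_ _ _. 0)"
| const: "form_dd N 0 (\<lambda>_. c) (\<lambda>_ _ _. 0)"
| var: "i \<le> N \<Longrightarrow> form_dd N 1 (\<lambda>x. x i) (\<lambda>j _ _. if j = i then 1 else 0)"
| add: "form_dd N m F \<Delta> \<Longrightarrow> form_dd N m G \<Delta>' \<Longrightarrow>
    form_dd N m (\<lambda>x. F x + G x) (\<lambda>j x y. \<Delta> j x y + \<Delta>' j x y)"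
| mult: "form_dd N m F \<Delta> \<Longrightarrow> form_dd N k G \<Delta>' \<Longrightarrow>
    form_dd N (m + k) (\<lambda>x. F x * G x) (\<lambda>j x y. F x * \<Delta>' j x y + \<Delta> j x y * G y)"

lemma form_dd_forms: "form_dd N m F \<Delta> \<Longrightarrow> F \<in> forms N m"
proof (induction rule: form_dd.induct)
  case (zero m)
  then show ?case by (simp add: forms_def lin_span_zero)
next
  case (add m F \<Delta> G \<Delta>')
  then show ?case by (simp add: forms_def lin_span_add)
next
  case (var i)
  then show ?case by (rule forms_var)
qed (simp_all add: forms_const forms_mult)

lemma form_dd_diff:
  "form_dd N m F \<Delta> \<Longrightarrow> F x - F y = (\<Sum>j\<le>N. \<Delta> j x y * (x j - y j))"
proof (induction rule: form_dd.induct)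
  case (var i)
  then show ?case by (simp add: if_distrib[of "\<lambda>c. c * _"] cong: if_cong)
next
  case (mult m F \<Delta> k G \<Delta>')
  have "F x * G x - F y * G y = F x * (G x - G y) + (F x - F y) * G y" by (simp add: algebra_simps)
  then show ?case
    by (simp add: mult sum_distrib_left sum_distrib_right sum.distrib[symmetric] algebra_simps)
next
  case (add m F \<Delta> G \<Delta>')
  have "F x + G x - (F y + G y) = (F x - F y) + (G x - G y)" by simp
  then show ?case by (simp add: add sum.distrib[symmetric] distrib_right)
qed auto

lemma form_dd_continuous:
  assumes "form_dd N m F \<Delta>"
  shows "continuous_on UNIV F \<and> (\<forall>j. continuous_on UNIV (\<lambda>p. \<Delta> j (fst p) (snd p)))"
  using assms
proof (induction rule: form_dd.induct)
  case (mult m F \<Delta> k G \<Delta>')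
  have "continuous_on UNIV (\<lambda>p :: (nat \<Rightarrow> complex) \<times> (nat \<Rightarrow> complex). F (fst p))"
    by (rule continuous_on_compose2[of UNIV F]) (use mult in \<open>auto intro!: continuous_on_fst continuous_on_id\<close>)
  moreover have "continuous_on UNIV (\<lambda>p :: (nat \<Rightarrow> complex) \<times> (nat \<Rightarrow> complex). G (snd p))"
    by (rule continuous_on_compose2[of UNIV G]) (use mult in \<open>auto intro!: continuous_on_snd continuous_on_id\<close>)
  ultimately show ?case using mult by (auto intro!: continuous_intros)
qed (auto intro!: continuous_intros)

text \<open>The degree \<open>m - 1\<close> is truncated at 0, so the vanishing of the derivative in
  degree 0 is carried along; without it the degrees in the product case would be wrong.\<close>

lemma form_dd_diag:
  assumes "form_dd N m F \<Delta>"
  shows "(\<lambda>x. \<Delta> j x x) \<in> forms N (m - 1) \<and> (m = 0 \<longrightarrow> (\<forall>x. \<Delta> j x x = 0))"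
  using assms
proof (induction rule: form_dd.induct)
  case (zero m)
  then show ?case by (simp add: forms_def lin_span_zero)
next
  case (add m F \<Delta> G \<Delta>')
  then show ?case by (simp add: forms_def lin_span_add)
next
  case (mult m F \<Delta> k G \<Delta>')
  have z: "(\<lambda>_. 0) \<in> forms N n" for n by (simp add: forms_def lin_span_zero)
  have "(\<lambda>x. F x * \<Delta>' j x x) \<in> forms N (m + k - 1)"
  proof (cases "k = 0")
    case False
    with forms_mult[OF form_dd_forms[OF mult.hyps(1)] conjunct1[OF mult.IH(2)]] show ?thesis by simp
  qed (use mult z in simp)
  moreover have "(\<lambda>x. \<Delta> j x x * G x) \<in> forms N (m + k - 1)"
  proof (cases "m = 0")
    case False
    with forms_mult[OF conjunct1[OF mult.IH(1)] form_dd_forms[OF mult.hyps(2)]] show ?thesis by simp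
  qed (use mult z in simp)
  ultimately have "(\<lambda>x. F x * \<Delta>' j x x + \<Delta> j x x * G x) \<in> forms N (m + k - 1)"
    unfolding forms_def by (rule lin_span_add)
  with mult show ?case by simp
qed (auto simp: forms_const)

text \<open>Euler's identity for homogeneous functions. It turns a zero with \<open>x 0 = 0\<close>
  into a kernel vector of the differential in the remaining variables, which is how solutions at
  infinity are ruled out.\<close>

lemma form_dd_euler:
  "form_dd N m F \<Delta> \<Longrightarrow> (\<Sum>j\<le>N. \<Delta> j x x * x j) = of_nat m * F x"
proof (induction rule: form_dd.induct)
  case (var i)
  then show ?case by (simp add: if_distrib[of "\<lambda>c. c * _"] cong: if_cong)
next
  case (mult m F \<Delta> k G \<Delta>')
  have "(\<Sum>j\<le>N. (F x * \<Delta>' j x x + \<Delta> j x x * G x) * x j) =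
      F x * (\<Sum>j\<le>N. \<Delta>' j x x * x j) + (\<Sum>j\<le>N. \<Delta> j x x * x j) * G x"
    by (simp add: sum_distrib_left sum_distrib_right sum.distrib[symmetric] algebra_simps)
  also have "\<dots> = F x * (of_nat k * G x) + (of_nat m * F x) * G x" by (simp only: mult.IH)
  finally show ?case by (simp add: algebra_simps)
next
  case (add m F \<Delta> G \<Delta>')
  then show ?case by (simp add: sum.distrib distrib_right distrib_left)
qed auto

lemma form_dd_cmult:
  assumes "form_dd N m F \<Delta>"
  shows "form_dd N m (\<lambda>x. c * F x) (\<lambda>j x y. c * \<Delta> j x y)"
  using form_dd.mult[OF form_dd.const assms, of c] by simp

lemma form_dd_power:
  assumes "i \<le> N"
  shows "\<exists>\<Delta>. form_dd N m (\<lambda>x. x i ^ m) \<Delta> \<and>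
    (\<forall>j x. \<Delta> j x x = (if j = i then of_nat m * x i ^ (m - 1) else 0))"
proof (induction m)
  case 0
  show ?case by (intro exI[of _ "\<lambda>_ _ _. 0"]) (auto intro: form_dd.const)
next
  case (Suc m)
  then obtain \<Delta> where \<Delta>: "form_dd N m (\<lambda>x. x i ^ m) \<Delta>"
    "\<forall>j x. \<Delta> j x x = (if j = i then of_nat m * x i ^ (m - 1) else 0)" by auto
  have "form_dd N (Suc m) (\<lambda>x. x i ^ Suc m)
      (\<lambda>j x y. x i * \<Delta> j x y + (if j = i then 1 else 0) * y i ^ m)"
    using form_dd.mult[OF form_dd.var[OF assms] \<Delta>(1)] by simp
  moreover have "x i * \<Delta> j x x + (if j = i then 1 else 0) * x i ^ m =
      (if j = i then of_nat (Suc m) * x i ^ (Suc m - 1) else 0)" for j x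
    using \<Delta>(2) by (cases m) (auto simp: algebra_simps)
  ultimately show ?case by blast
qed

section \<open>A Bezout theorem for nondegenerate systems\<close>

text \<open>
  The system \<open>x\<^sub>i ^ d\<^sub>i = x\<^sub>0 ^ d\<^sub>i\<close> has no degenerate zeros because the monomials \<open>x ^ \<alpha> v\<^sub>j\<close> of large degree lie in the ideal generated by the system
  and its differential. Deforming the system linearly, the same combinations express these monomials
  up to a matrix that is linear in the parameter \<open>s\<close> and hence is invertible for all but finitely many \<open>s\<close>.
\<close>

lemma finite_degenerate_parameters:
  fixes F0 F1 :: "nat \<Rightarrow> (nat \<Rightarrow> complex) \<Rightarrow> complex" and d :: "nat \<Rightarrow> nat"
    and \<Delta>0 \<Delta>1 :: "nat \<Rightarrow> nat \<Rightarrow> (nat \<Rightarrow> complex) \<Rightarrow> (nat \<Rightarrow> complex) \<Rightarrow> complex"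
  assumes d: "\<And>i. i \<in> {1..N} \<Longrightarrow> d i \<ge> 1"
    and F0: "\<And>i x. i \<in> {1..N} \<Longrightarrow> F0 i x = x i ^ d i - x 0 ^ d i"
    and \<Delta>0: "\<And>i x v. i \<in> {1..N} \<Longrightarrow>
      (\<Sum>j=1..N. \<Delta>0 i j x x * v j) = of_nat (d i) * x i ^ (d i - 1) * v i"
    and F1: "\<And>i. i \<in> {1..N} \<Longrightarrow> form_dd N (d i) (F1 i) (\<Delta>1 i)"
  defines "Z \<equiv> \<lambda>s x v. \<forall>i\<in>{1..N}. (1 - s) * F0 i x + s * F1 i x = 0 \<and>
      (\<Sum>j=1..N. ((1 - s) * \<Delta>0 i j x x + s * \<Delta>1 i j x x) * v j) = 0"
  defines "Bad \<equiv> {s. \<exists>x v. (\<exists>i\<le>N. x i \<noteq> 0) \<and> (\<exists>j\<in>{1..N}. v j \<noteq> 0) \<and> Z s x v}"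
  shows "finite Bad \<and> 0 \<notin> Bad"
proof -
  \<comment> \<open>This degree forces every monomial either to contain some factor
    \<open>x i ^ d i\<close> with i at least 1, or to contain \<open>x 0\<close> with exponent at
    least the sum of all \<open>d i\<close>.\<close>
  define M where "M = 2 * (\<Sum>i=1..N. d i)"
  let ?E = "monomials N M \<times> {1..N}"
  \<comment> \<open>\<open>g0\<close> stands for a combination of \<open>F0\<close> and its
    differential, \<open>g1\<close> for the same combination of \<open>F1\<close> and its
    differential. What is recorded is only that the interpolated combination vanishes at every
    degenerate zero, and that \<open>g1\<close> is again of degree \<open>M\<close>.\<close>
  define Tr where "Tr g0 g1 \<longleftrightarrow> g1 \<in> biforms N M \<and>
    (\<forall>s x v. Z s x v \<longrightarrow> (1 - s) * g0 (x, v) + s * g1 (x, v) = 0)" for g0 g1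
  have Tr_add: "Tr (\<lambda>p. g0 p + g0' p) (\<lambda>p. g1 p + g1' p)" if "Tr g0 g1" "Tr g0' g1'" for g0 g1 g0' g1'
  proof -
    have "(1 - s) * (g0 p + g0' p) + s * (g1 p + g1' p) =
      ((1 - s) * g0 p + s * g1 p) + ((1 - s) * g0' p + s * g1' p)" for s p
      by (simp add: algebra_simps)
    with that show ?thesis by (auto simp: Tr_def biforms_def lin_span_add)
  qed
  have Tr_F: "Tr (\<lambda>p. A p * F0 i (fst p)) (\<lambda>p. A p * F1 i (fst p))"
    if "A \<in> biforms N (M - d i)" "d i \<le> M" "i \<in> {1..N}" for A i
  proof -
    have "(\<lambda>p. F1 i (fst p) * A p) \<in> biforms N (d i + (M - d i))"
      by (rule forms_biforms_mult[OF form_dd_forms[OF F1]]) (use that in auto)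
    then have "(\<lambda>p. A p * F1 i (fst p)) \<in> biforms N M" using that by (simp add: mult.commute)
    moreover have "(1 - s) * (A p * F0 i x) + s * (A p * F1 i x) = A p * ((1 - s) * F0 i x + s * F1 i x)"
      for s p x by (simp add: algebra_simps)
    ultimately show ?thesis using that by (auto simp: Tr_def Z_def)
  qed
  have Tr_D: "Tr (\<lambda>p. B (fst p) * (\<Sum>j=1..N. \<Delta>0 i j (fst p) (fst p) * snd p j))
      (\<lambda>p. B (fst p) * (\<Sum>j=1..N. \<Delta>1 i j (fst p) (fst p) * snd p j))"
    if "B \<in> forms N (Suc (M - d i))" "d i \<le> M" "i \<in> {1..N}" for B i
  proof -
    have "(\<lambda>p. (\<Sum>j=1..N. \<Delta>1 i j (fst p) (fst p) * snd p j)) \<in> biforms N (d i - 1)"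
      unfolding biforms_def
    proof (rule lin_span_sum)
      fix j assume "j \<in> {1..N}"
      from forms_coord_mult[OF conjunct1[OF form_dd_diag[OF F1[OF that(3)], of j]] this]
      show "(\<lambda>p. \<Delta>1 i j (fst p) (fst p) * snd p j) \<in> lin_span (monomials N (d i - 1) \<times> {1..N}) (bival N)"
        by (simp add: biforms_def)
    qed
    from forms_biforms_mult[OF that(1) this]
    have "(\<lambda>p. B (fst p) * (\<Sum>j=1..N. \<Delta>1 i j (fst p) (fst p) * snd p j)) \<in> biforms N M"
      using that d[OF that(3)] by simp
    moreover have "(1 - s) * (B x * (\<Sum>j=1..N. \<Delta>0 i j x x * v j)) + s * (B x * (\<Sum>j=1..N. \<Delta>1 i j x x * v j))
        = B x * (\<Sum>j=1..N. ((1 - s) * \<Delta>0 i j x x + s * \<Delta>1 i j x x) * v j)" for s x v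
      by (simp add: sum_distrib_left sum.distrib[symmetric] algebra_simps)
    ultimately show ?thesis using that by (auto simp: Tr_def Z_def)
  qed
  have dM: "d i \<le> M" if "i \<in> {1..N}" for i
    using member_le_sum[of i "{1..N}" d] that by (simp add: M_def)
  have mono_split: "\<exists>\<gamma>. \<gamma> \<in> monomials N (m - n) \<and> n \<le> m \<and> (\<forall>x. mval N \<alpha> x = mval N \<gamma> x * x i ^ n) \<and>
      \<gamma> = \<alpha>(i := \<alpha> i - n)"
    if "\<alpha> \<in> monomials N m" "i \<le> N" "n \<le> \<alpha> i" for \<alpha> i n m
  proof -
    let ?\<gamma> = "\<alpha>(i := \<alpha> i - n)"
    have "sum \<alpha> {..N} = \<alpha> i + sum \<alpha> ({..N} - {i})" using that by (intro sum.remove) auto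
    moreover have "sum ?\<gamma> {..N} = (\<alpha> i - n) + sum ?\<gamma> ({..N} - {i})"
      using that by (subst sum.remove[of _ i]) auto
    moreover have "sum ?\<gamma> ({..N} - {i}) = sum \<alpha> ({..N} - {i})" by (rule sum.cong) auto
    ultimately have "?\<gamma> \<in> monomials N (m - n)" "n \<le> m" using that by (auto simp: monomials_def)
    moreover have "mval N \<alpha> x = mval N ?\<gamma> x * x i ^ n" for x
    proof -
      have "mval N \<alpha> x = x i ^ \<alpha> i * (\<Prod>k\<in>{..N} - {i}. x k ^ \<alpha> k)"
        unfolding mval_def using that by (intro prod.remove) auto
      moreover have "mval N ?\<gamma> x = x i ^ (\<alpha> i - n) * (\<Prod>k\<in>{..N} - {i}. x k ^ ?\<gamma> k)"
        unfolding mval_def using that by (subst prod.remove[of _ i]) auto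
      moreover have "(\<Prod>k\<in>{..N} - {i}. x k ^ ?\<gamma> k) = (\<Prod>k\<in>{..N} - {i}. x k ^ \<alpha> k)"
        by (rule prod.cong) auto
      moreover have "x i ^ \<alpha> i = x i ^ (\<alpha> i - n) * x i ^ n"
        using that by (simp add: power_add[symmetric])
      ultimately show ?thesis by (simp add: mult_ac)
    qed
    ultimately show ?thesis by blast
  qed
  have mval_forms: "mval N \<gamma> \<in> forms N m" if "\<gamma> \<in> monomials N m" for \<gamma> m
    unfolding forms_def by (rule lin_span_base[OF finite_monomials that])
  \<comment> \<open>Induction on the total exponent in the variables 1 to N: modulo
    \<open>F0 i\<close>, a factor \<open>x i ^ d i\<close> may be traded for
    \<open>x 0 ^ d i\<close>. When no such factor is left, \<open>x 0 ^ d j\<close> divides the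
    monomial, and \<open>x 0 ^ d j * v j\<close> is \<open>x j ^ d j * v j\<close> minus a multiple
    of \<open>F0 j\<close>, the former being \<open>x j / d j\<close> times the differential of
    \<open>F0 j\<close>.\<close>
  have key: "\<exists>g1. Tr (bival N (\<alpha>, j)) g1" if "\<alpha> \<in> monomials N M" "j \<in> {1..N}" for \<alpha> j
    using that(1)
  proof (induction "\<Sum>i=1..N. \<alpha> i" arbitrary: \<alpha> rule: less_induct)
    case less
    show ?case
    proof (cases "\<exists>i\<in>{1..N}. d i \<le> \<alpha> i")
      case True
      then obtain i where i: "i \<in> {1..N}" "d i \<le> \<alpha> i" by auto
      from mono_split[OF less.prems _ i(2)] i(1) obtain \<gamma> where
        \<gamma>: "\<gamma> \<in> monomials N (M - d i)" "\<And>x. mval N \<alpha> x = mval N \<gamma> x * x i ^ d i" "\<gamma> = \<alpha>(i := \<alpha> i - d i)"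
        by auto
      let ?\<alpha> = "\<lambda>k. \<gamma> k + (if k = 0 then d i else 0)"
      have "(\<lambda>k. if k = 0 then d i else 0) \<in> monomials N (d i)" by (simp add: monomials_def)
      from monomials_add[OF \<gamma>(1) this] dM[OF i(1)] have \<alpha>: "?\<alpha> \<in> monomials N M" by simp
      have \<alpha>v: "mval N ?\<alpha> x = mval N \<gamma> x * x 0 ^ d i" for x
      proof -
        have "mval N (\<lambda>k. if k = 0 then d i else 0) x = x 0 ^ d i"
          by (simp add: mval_def if_distrib[of "\<lambda>k. _ ^ k"] cong: if_cong)
        then show ?thesis by (simp add: mval_add)
      qed
      have "(\<Sum>k=1..N. ?\<alpha> k) = (\<Sum>k=1..N. \<gamma> k)" by (intro sum.cong) auto
      also have "\<dots> < (\<Sum>k=1..N. \<alpha> k)"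
        by (rule sum_strict_mono_ex1) (use i d[OF i(1)] \<gamma>(3) in auto)
      finally obtain g1 where g1: "Tr (bival N (?\<alpha>, j)) g1" using less.hyps \<alpha> by blast
      have eq: "bival N (\<alpha>, j) = (\<lambda>p. bival N (\<gamma>, j) p * F0 i (fst p) + bival N (?\<alpha>, j) p)"
        by (simp add: fun_eq_iff bival_def \<gamma>(2) \<alpha>v F0[OF i(1)] algebra_simps)
      have A: "bival N (\<gamma>, j) \<in> biforms N (M - d i)" unfolding biforms_def
        by (rule lin_span_base) (use finite_monomials \<gamma>(1) that in auto)
      from Tr_add[OF Tr_F[OF A dM[OF i(1)] i(1)] g1] show ?thesis unfolding eq by blast
    next
      case False
      have "d j \<le> \<alpha> 0"
      proof -
        have "sum \<alpha> {..N} = \<alpha> 0 + sum \<alpha> {1..N}"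
          by (simp add: sum.atMost_shift sum.atLeast1_atMost_eq)
        then have "M = \<alpha> 0 + sum \<alpha> {1..N}" using less.prems by (simp add: monomials_def)
        moreover have "sum \<alpha> {1..N} \<le> (\<Sum>i=1..N. d i)" using False by (intro sum_mono) force
        moreover have "d j \<le> (\<Sum>i=1..N. d i)" using that by (intro member_le_sum) auto
        ultimately show ?thesis by (simp add: M_def)
      qed
      from mono_split[OF less.prems _ this] obtain \<gamma> where
        \<gamma>: "\<gamma> \<in> monomials N (M - d j)" "\<And>x. mval N \<alpha> x = mval N \<gamma> x * x 0 ^ d j"
        by auto
      have dj: "d j \<ge> 1" using d that by auto
      have A: "(\<lambda>p. - 1 * bival N (\<gamma>, j) p) \<in> biforms N (M - d j)" unfolding biforms_def
        by (rule lin_span_cmult, rule lin_span_base) (use finite_monomials \<gamma>(1) that in auto)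
      have B: "(\<lambda>x. (1 / of_nat (d j)) * (mval N \<gamma> x * x j)) \<in> forms N (Suc (M - d j))"
        using forms_mult[OF mval_forms[OF \<gamma>(1)] forms_var[of j N]] that
        by (simp add: forms_def lin_span_cmult del: times_divide_eq_left)
      have pw: "x j ^ d j = x j * x j ^ (d j - 1)" for x :: "nat \<Rightarrow> complex"
        using dj by (cases "d j") auto
      have eq: "bival N (\<alpha>, j) = (\<lambda>p. (- 1 * bival N (\<gamma>, j) p) * F0 j (fst p) +
          ((1 / of_nat (d j)) * (mval N \<gamma> (fst p) * fst p j)) * (\<Sum>k=1..N. \<Delta>0 j k (fst p) (fst p) * snd p k))"
        (is "_ = ?rhs")
      proof
        fix p :: "(nat \<Rightarrow> complex) \<times> (nat \<Rightarrow> complex)"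
        have "?rhs p = - (mval N \<gamma> (fst p) * snd p j * (fst p j ^ d j - fst p 0 ^ d j)) +
            mval N \<gamma> (fst p) * snd p j * (fst p j * fst p j ^ (d j - 1))"
          unfolding F0[OF that(2)] \<Delta>0[OF that(2)] using dj by (simp add: bival_def)
        also have "\<dots> = mval N \<gamma> (fst p) * snd p j * fst p 0 ^ d j"
          unfolding pw[of "fst p", symmetric] by (simp add: algebra_simps)
        finally show "bival N (\<alpha>, j) p = ?rhs p" by (simp add: bival_def \<gamma>(2))
      qed
      note T = Tr_add[OF Tr_F[OF A dM[OF that(2)] that(2)] Tr_D[OF B dM[OF that(2)] that(2)]]
      show ?thesis by (rule exI, subst eq, rule T)
    qed
  qed
  then have "\<forall>e\<in>?E. \<exists>g1. Tr (bival N e) g1" by auto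
  from this[unfolded bchoice_iff] obtain g1 where g1: "\<And>e. e \<in> ?E \<Longrightarrow> Tr (bival N e) (g1 e)"
    by blast
  then have "\<forall>e\<in>?E. \<exists>c. \<forall>p. g1 e p = (\<Sum>e'\<in>?E. c e' * bival N e' p)"
    unfolding Tr_def biforms_def lin_span_def by blast
  from this[unfolded bchoice_iff] obtain c where
    c: "\<And>e p. e \<in> ?E \<Longrightarrow> g1 e p = (\<Sum>e'\<in>?E. c e e' * bival N e' p)"
    by blast
  \<comment> \<open>The values of all monomials at a degenerate pair (x, v) form the vector
    \<open>y\<close>; it is nonzero because of the pure power of a nonzero coordinate
    \<open>x i\<close> times a nonzero \<open>v j\<close>.\<close>
  have main: "\<exists>y. (\<exists>e\<in>?E. y e \<noteq> 0) \<and> (\<forall>e\<in>?E. (1 - s) * y e + s * (\<Sum>e'\<in>?E. c e e' * y e') = 0)"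
    if "s \<in> Bad" for s
  proof -
    from that obtain x v i j where x: "i \<le> N" "x i \<noteq> 0" "j \<in> {1..N}" "v j \<noteq> 0" "Z s x v"
      by (auto simp: Bad_def)
    let ?y = "\<lambda>e. bival N e (x, v)"
    let ?e = "((\<lambda>k. if k = i then M else 0), j)"
    have "?e \<in> ?E" using x by (auto simp: monomials_def)
    moreover have "?y ?e \<noteq> 0" using x by (auto simp: bival_def mval_def)
    moreover have "(1 - s) * ?y e + s * (\<Sum>e'\<in>?E. c e e' * ?y e') = 0" if "e \<in> ?E" for e
    proof -
      have "(1 - s) * ?y e + s * g1 e (x, v) = 0" using g1[OF that] x(5) by (simp add: Tr_def)
      then show ?thesis unfolding c[OF that] .
    qed
    ultimately show ?thesis by (intro exI[of _ ?y]) blast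
  qed
  have "0 \<notin> Bad" using main[of 0] by auto
  moreover have "finite Bad"
  proof (rule finite_subset)
    let ?S = "{\<mu>. \<exists>y. (\<exists>e\<in>?E. y e \<noteq> 0) \<and> (\<forall>e\<in>?E. (\<Sum>e'\<in>?E. c e e' * y e') = \<mu> * y e)}"
    \<comment> \<open>A bad s makes \<mu> = (s - 1) / s an eigenvalue of the matrix
      \<open>c\<close>; solving for s gives this parametrization.\<close>
    show "Bad \<subseteq> (\<lambda>\<mu>. 1 / (1 - \<mu>)) ` ?S"
    proof
      fix s assume s: "s \<in> Bad"
      then have "s \<noteq> 0" using \<open>0 \<notin> Bad\<close> by auto
      from main[OF s] obtain y where y: "\<exists>e\<in>?E. y e \<noteq> 0"
        "\<forall>e\<in>?E. (1 - s) * y e + s * (\<Sum>e'\<in>?E. c e e' * y e') = 0" by auto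
      have "(\<Sum>e'\<in>?E. c e e' * y e') = ((s - 1) / s) * y e" if "e \<in> ?E" for e
      proof -
        have "s * (\<Sum>e'\<in>?E. c e e' * y e') = (s - 1) * y e"
          using y(2)[rule_format, OF that] by (simp add: algebra_simps add_eq_0_iff)
        with \<open>s \<noteq> 0\<close> show ?thesis by (simp add: field_simps)
      qed
      with y(1) have "(s - 1) / s \<in> ?S" by blast
      moreover have "s = 1 / (1 - (s - 1) / s)" using \<open>s \<noteq> 0\<close> by (simp add: field_simps)
      ultimately show "s \<in> (\<lambda>\<mu>. 1 / (1 - \<mu>)) ` ?S" by blast
    qed
    show "finite ((\<lambda>\<mu>. 1 / (1 - \<mu>)) ` ?S)"
      by (intro finite_imageI finite_eigenvalues finite_cartesian_product finite_monomials) auto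
  qed
  ultimately show ?thesis by blast
qed

section \<open>Topological tools: fibres of constant cardinality and local injectivity\<close>

lemma tendsto_coordinatewise:
  fixes x :: "'b \<Rightarrow> 'i \<Rightarrow> 'a::topological_space"
  assumes "\<And>i. ((\<lambda>k. x k i) \<longlongrightarrow> l i) F"
  shows "(x \<longlongrightarrow> l) F"
proof -
  have "limitin (product_topology (\<lambda>_. euclidean) UNIV) x l F"
    using assms by (simp add: limitin_componentwise)
  then show ?thesis by (simp add: euclidean_product_topology)
qed

lemma tendsto_coordinate:
  fixes x :: "'b \<Rightarrow> 'i \<Rightarrow> 'a::topological_space"
  assumes "(x \<longlongrightarrow> l) F"
  shows "((\<lambda>k. x k i) \<longlongrightarrow> l i) F"
  by (rule continuous_on_tendsto_compose[OF continuous_on_product_coordinates[of i] assms]) auto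

lemma finite_separating_balls:
  fixes A :: "'a::metric_space set"
  assumes "finite A"
  shows "\<exists>e>0. \<forall>x\<in>A. \<forall>y\<in>A. x \<noteq> y \<longrightarrow> ball x e \<inter> ball y e = {}"
proof -
  define D where "D = (\<lambda>(x, y). dist x y) ` {p \<in> A \<times> A. fst p \<noteq> snd p}"
  \<comment> \<open>The inserted 1 keeps the minimum defined when \<open>A\<close> has at most one
    point.\<close>
  have fin: "finite (insert 1 D)" unfolding D_def using assms by auto
  define e where "e = Min (insert 1 D) / 2"
  have "Min (insert 1 D) \<in> insert 1 D" using fin by (rule Min_in) auto
  then have "e > 0" by (auto simp: e_def D_def)
  moreover have "ball x e \<inter> ball y e = {}" if "x \<in> A" "y \<in> A" "x \<noteq> y" for x y
  proof -
    have "dist x y \<in> D" using that by (force simp: D_def)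
    then have "2 * e \<le> dist x y" using fin by (auto simp: e_def)
    then have "\<not> (dist x z < e \<and> dist y z < e)" for z
      using dist_triangle2[of x y z] by linarith
    then show ?thesis by auto
  qed
  ultimately show ?thesis by blast
qed

lemma locally_constant_on_connected:
  assumes "connected S" "open S"
    and loc: "\<And>s. s \<in> S \<Longrightarrow> \<exists>T. open T \<and> s \<in> T \<and> (\<forall>t\<in>T. t \<in> S \<longrightarrow> f t = f s)"
    and "s \<in> S" "t \<in> S"
  shows "f s = f t"
proof (rule ccontr)
  assume ne: "f s \<noteq> f t"
  have op: "open {u \<in> S. P (f u)}" for P
  proof (subst open_subopen, safe)
    fix u assume u: "u \<in> S" "P (f u)"
    from loc[OF u(1)] obtain T where "open T" "u \<in> T" "\<forall>t\<in>T. t \<in> S \<longrightarrow> f t = f u" by auto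
    moreover have "P (f t)" if "t \<in> T" "t \<in> S" for t using calculation(3) that u(2) by metis
    ultimately show "\<exists>T. open T \<and> u \<in> T \<and> T \<subseteq> {u \<in> S. P (f u)}"
      using u(1) \<open>open S\<close> by (intro exI[of _ "T \<inter> S"] conjI open_Int IntI subsetI CollectI) blast+
  qed
  let ?A = "{u \<in> S. f u = f s}" and ?B = "{u \<in> S. f u \<noteq> f s}"
  have "?A \<inter> S = {} \<or> ?B \<inter> S = {}"
    by (rule connectedD[OF \<open>connected S\<close> op[of "\<lambda>v. v = f s"] op[of "\<lambda>v. v \<noteq> f s"]]) auto
  moreover have "s \<in> ?A \<inter> S" "t \<in> ?B \<inter> S" using ne assms(4,5) by auto
  ultimately show False by blast
qed

text \<open>Near a point s of the base, \<open>loc\<close> continues each point of the fibre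
  uniquely and \<open>proper\<close> prevents further points from appearing, so the cardinality is
  locally constant on the connected base. Finiteness has the same source: infinitely many points
  over s would accumulate in the fibre, against the uniqueness in \<open>loc\<close>.\<close>

lemma card_fibre_constant:
  fixes Z :: "'a::metric_space set" and \<pi> :: "'a \<Rightarrow> complex"
  assumes S: "open S" "connected S"
    and loc: "\<And>w V. w \<in> Z \<Longrightarrow> \<pi> w \<in> S \<Longrightarrow> open V \<Longrightarrow> w \<in> V \<Longrightarrow>
      \<exists>U T. open U \<and> w \<in> U \<and> U \<subseteq> V \<and> open T \<and> \<pi> w \<in> T \<and> (\<forall>s\<in>T. \<exists>!u. u \<in> U \<and> u \<in> Z \<and> \<pi> u = s)"
    and proper: "\<And>w s. (\<And>k. w k \<in> Z) \<Longrightarrow> (\<lambda>k. \<pi> (w k)) \<longlonglongrightarrow> s \<Longrightarrow> s \<in> S \<Longrightarrow>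
      \<exists>l r. l \<in> Z \<and> \<pi> l = s \<and> strict_mono (r :: nat \<Rightarrow> nat) \<and> (w \<circ> r) \<longlonglongrightarrow> l"
    and s: "s \<in> S" and t: "t \<in> S"
  shows "finite {w \<in> Z. \<pi> w = s} \<and> card {w \<in> Z. \<pi> w = s} = card {w \<in> Z. \<pi> w = t}"
proof -
  let ?Z = "\<lambda>s. {w \<in> Z. \<pi> w = s}"
  have fin: "finite (?Z s)" if "s \<in> S" for s
  proof (rule ccontr)
    assume "infinite (?Z s)"
    then obtain w :: "nat \<Rightarrow> 'a" where w: "inj w" "range w \<subseteq> ?Z s"
      using infinite_countable_subset by blast
    then have wk: "w k \<in> Z" "\<pi> (w k) = s" for k by auto
    then have "(\<lambda>k. \<pi> (w k)) \<longlonglongrightarrow> s" by simp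
    from proper[OF wk(1) this that]
    obtain l r where l: "l \<in> Z" "\<pi> l = s" "strict_mono (r :: nat \<Rightarrow> nat)" "(w \<circ> r) \<longlonglongrightarrow> l"
      by blast
    from loc[OF l(1) _ open_UNIV] l(2) that obtain U T where
      U: "open U" "l \<in> U" "s \<in> T" "\<forall>s\<in>T. \<exists>!u. u \<in> U \<and> u \<in> Z \<and> \<pi> u = s" by auto
    from topological_tendstoD[OF l(4) U(1,2)] obtain K where "\<And>k. k \<ge> K \<Longrightarrow> w (r k) \<in> U"
      by (auto simp: eventually_sequentially)
    then have "w (r K) \<in> U" "w (r (Suc K)) \<in> U" by auto
    with U w have "w (r K) = w (r (Suc K))" using wk by blast
    with w(1) l(3) show False by (metis injD n_not_Suc_n strict_mono_eq)
  qed
  have "\<exists>T. open T \<and> s \<in> T \<and> (\<forall>t\<in>T. t \<in> S \<longrightarrow> card (?Z t) = card (?Z s))" if s: "s \<in> S" for s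
  proof -
    from finite_separating_balls[OF fin[OF s]] obtain e where
      e: "e > 0" "\<And>x y. x \<in> ?Z s \<Longrightarrow> y \<in> ?Z s \<Longrightarrow> x \<noteq> y \<Longrightarrow> ball x e \<inter> ball y e = {}" by blast
    have "\<forall>w\<in>?Z s. \<exists>U T. open U \<and> w \<in> U \<and> U \<subseteq> ball w e \<and> open T \<and> s \<in> T \<and>
        (\<forall>s\<in>T. \<exists>!u. u \<in> U \<and> u \<in> Z \<and> \<pi> u = s)"
    proof
      fix w assume "w \<in> ?Z s"
      with loc[of w "ball w e"] e(1) s show "\<exists>U T. open U \<and> w \<in> U \<and> U \<subseteq> ball w e \<and> open T \<and> s \<in> T \<and>
        (\<forall>s\<in>T. \<exists>!u. u \<in> U \<and> u \<in> Z \<and> \<pi> u = s)" by auto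
    qed
    from this[unfolded bchoice_iff] obtain U T where
      UT0: "\<forall>w\<in>?Z s. open (U w) \<and> w \<in> U w \<and> U w \<subseteq> ball w e \<and> open (T w) \<and> s \<in> T w \<and>
        (\<forall>s\<in>T w. \<exists>!u. u \<in> U w \<and> u \<in> Z \<and> \<pi> u = s)" by (elim exE)
    have UT: "open (U w) \<and> w \<in> U w \<and> U w \<subseteq> ball w e \<and> open (T w) \<and> s \<in> T w" if "w \<in> ?Z s" for w
      using bspec[OF UT0 that] by (elim conjE) (intro conjI)
    have ex1: "\<exists>!u. u \<in> U w \<and> u \<in> Z \<and> \<pi> u = t" if "w \<in> ?Z s" "t \<in> T w" for w t
      using bspec[OF UT0 that(1)] that(2) by (elim conjE) (rule bspec)
    \<comment> \<open>Otherwise points over parameters tending to s would stay outside all the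
      chosen neighbourhoods, while \<open>proper\<close> gives them a limit in the fibre over
      s.\<close>
    have "\<exists>\<delta>>0. \<forall>w\<in>Z. dist (\<pi> w) s < \<delta> \<longrightarrow> w \<in> (\<Union>v\<in>?Z s. U v)"
    proof (rule ccontr)
      assume "\<not> ?thesis"
      then have neg: "\<And>\<delta>. \<delta> > 0 \<Longrightarrow> \<exists>w. w \<in> Z \<and> dist (\<pi> w) s < \<delta> \<and> w \<notin> (\<Union>v\<in>?Z s. U v)" by blast
      have "\<forall>k. \<exists>w. w \<in> Z \<and> dist (\<pi> w) s < inverse (Suc k) \<and> w \<notin> (\<Union>v\<in>?Z s. U v)"
        by (intro allI neg) simp
      from this[unfolded choice_iff] obtain w where
        w: "\<And>k. w k \<in> Z" "\<And>k. dist (\<pi> (w k)) s < inverse (Suc k)" "\<And>k. w k \<notin> (\<Union>v\<in>?Z s. U v)"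
        by blast
      have "(\<lambda>k. \<pi> (w k)) \<longlonglongrightarrow> s"
        by (rule metric_tendsto_imp_tendsto[OF LIMSEQ_inverse_real_of_nat])
          (use w(2) in \<open>auto intro!: always_eventually less_imp_le simp: dist_real_def\<close>)
      from proper[OF w(1) this s] obtain l r where
        l: "l \<in> ?Z s" "(w \<circ> r) \<longlonglongrightarrow> l" by auto
      from topological_tendstoD[OF l(2), of "U l"] UT[OF l(1)] obtain k where "w (r k) \<in> U l"
        by (auto simp: eventually_sequentially)
      with w(3) l(1) show False by blast
    qed
    then obtain \<delta> where \<delta>: "\<delta> > 0" "\<And>w. w \<in> Z \<Longrightarrow> dist (\<pi> w) s < \<delta> \<Longrightarrow> w \<in> (\<Union>v\<in>?Z s. U v)" by blast
    define V where "V = ball s \<delta> \<inter> (\<Inter>w\<in>?Z s. T w)"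
    have "open V" unfolding V_def using UT fin[OF s] by (intro open_Int open_INT) auto
    moreover have "s \<in> V" using UT \<delta> by (auto simp: V_def)
    moreover have "card (?Z t) = card (?Z s)" if t: "t \<in> V" for t
    proof -
      define g where "g w = (THE u. u \<in> U w \<and> u \<in> Z \<and> \<pi> u = t)" for w
      have tT: "t \<in> T w" if "w \<in> ?Z s" for w
        using t that unfolding V_def by blast
      have g: "g w \<in> U w \<and> g w \<in> Z \<and> \<pi> (g w) = t" if "w \<in> ?Z s" for w
        unfolding g_def by (rule theI'[OF ex1[OF that tT[OF that]]])
      have "inj_on g (?Z s)"
      proof (rule inj_onI, rule ccontr)
        fix w v assume wv: "w \<in> ?Z s" "v \<in> ?Z s" "g w = g v" "w \<noteq> v"
        have "g w \<in> ball w e" using g[OF wv(1)] UT[OF wv(1)] by blast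
        moreover have "g w \<in> ball v e" unfolding wv(3) using g[OF wv(2)] UT[OF wv(2)] by blast
        ultimately show False using e(2)[OF wv(1,2,4)] by blast
      qed
      moreover have "g ` ?Z s = ?Z t"
      proof (intro subset_antisym subsetI)
        fix u assume u: "u \<in> ?Z t"
        with t have "dist (\<pi> u) s < \<delta>" by (simp add: V_def dist_commute)
        with \<delta>(2)[of u] u obtain v where v: "v \<in> ?Z s" "u \<in> U v" by blast
        have "u \<in> U v \<and> u \<in> Z \<and> \<pi> u = t" using u v by blast
        with ex1[OF v(1) tT[OF v(1)]] g[OF v(1)] have "u = g v" by blast
        with v show "u \<in> g ` ?Z s" by blast
      next
        fix u assume "u \<in> g ` ?Z s"
        then show "u \<in> ?Z t" using g by blast
      qed
      ultimately show ?thesis using card_image[of g "?Z s"] by simp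
    qed
    ultimately show ?thesis by blast
  qed
  from locally_constant_on_connected[OF S(2,1) this s t] fin[OF s] show ?thesis by blast
qed

text \<open>For w and w' near \<open>w0\<close> the matrix of divided differences is close to the
  injective differential at \<open>w0\<close>, hence injective; it annihilates
  \<open>X w - X w'\<close> when the values of \<open>F\<close> agree. The column of index 0 drops
  out since both points have coordinate 1 there. The parameter \<open>\<theta>\<close> may vary, but
  is the same for the two points compared.\<close>

lemma nondegenerate_locally_injective:
  fixes F :: "'c::topological_space \<Rightarrow> nat \<Rightarrow> (nat \<Rightarrow> complex) \<Rightarrow> complex"
    and \<Delta> :: "'c \<Rightarrow> nat \<Rightarrow> nat \<Rightarrow> (nat \<Rightarrow> complex) \<Rightarrow> (nat \<Rightarrow> complex) \<Rightarrow> complex"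
    and \<theta> :: "'w::topological_space \<Rightarrow> 'c" and X :: "'w \<Rightarrow> nat \<Rightarrow> complex"
  assumes diff: "\<And>s i x y. i \<in> {1..N} \<Longrightarrow> F s i x - F s i y = (\<Sum>j\<le>N. \<Delta> s i j x y * (x j - y j))"
    and cont: "\<And>i j. i \<in> {1..N} \<Longrightarrow> j \<in> {1..N} \<Longrightarrow>
      continuous_on (W \<times> W) (\<lambda>p. \<Delta> (\<theta> (fst p)) i j (X (fst p)) (X (snd p)))"
    and X0: "\<And>w. w \<in> W \<Longrightarrow> X w 0 = 1"
    and w0: "w0 \<in> W"
    and inj: "\<And>v. (\<forall>i\<in>{1..N}. (\<Sum>j=1..N. \<Delta> (\<theta> w0) i j (X w0) (X w0) * v j) = 0) \<Longrightarrow> \<forall>j\<in>{1..N}. v j = 0"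
  shows "\<exists>U. open U \<and> w0 \<in> U \<and> (\<forall>w\<in>U \<inter> W. \<forall>w'\<in>U \<inter> W. \<theta> w = \<theta> w' \<longrightarrow>
    (\<forall>i\<in>{1..N}. F (\<theta> w) i (X w) = F (\<theta> w) i (X w')) \<longrightarrow> (\<forall>i\<le>N. X w i = X w' i))"
proof -
  from injective_matrix_open[of "{1..N}" "{1..N}" "\<lambda>i j. \<Delta> (\<theta> w0) i j (X w0) (X w0)", OF _ _ inj]
  obtain \<epsilon> where \<epsilon>: "\<epsilon> > 0" "\<And>B w. (\<forall>i\<in>{1..N}. \<forall>j\<in>{1..N}. norm (B i j - \<Delta> (\<theta> w0) i j (X w0) (X w0)) < \<epsilon>) \<Longrightarrow>
      (\<forall>i\<in>{1..N}. (\<Sum>j=1..N. B i j * w j) = 0) \<Longrightarrow> (\<forall>j\<in>{1..N}. w j = 0)" by blast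
  let ?g = "\<lambda>i j p. \<Delta> (\<theta> (fst p)) i j (X (fst p)) (X (snd p))"
  have "\<exists>A. open A \<and> (w0, w0) \<in> A \<and> (\<forall>p\<in>A \<inter> W \<times> W. norm (?g i j p - ?g i j (w0, w0)) < \<epsilon>)"
    if ij: "i \<in> {1..N}" "j \<in> {1..N}" for i j
  proof -
    from cont[OF ij, unfolded continuous_on_topological, rule_format, of "(w0, w0)" "ball (?g i j (w0, w0)) \<epsilon>"]
    obtain A where A: "open A" "(w0, w0) \<in> A" "\<And>p. p \<in> W \<times> W \<Longrightarrow> p \<in> A \<Longrightarrow> ?g i j p \<in> ball (?g i j (w0, w0)) \<epsilon>"
      using w0 \<epsilon>(1) by auto
    then show ?thesis by (intro exI[of _ A]) (auto simp: dist_norm norm_minus_commute)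
  qed
  then have "\<forall>q\<in>{1..N} \<times> {1..N}. \<exists>A. open A \<and> (w0, w0) \<in> A \<and>
      (\<forall>p\<in>A \<inter> W \<times> W. norm (?g (fst q) (snd q) p - ?g (fst q) (snd q) (w0, w0)) < \<epsilon>)" by simp
  from this[unfolded bchoice_iff] obtain A where
    A0: "\<forall>q\<in>{1..N} \<times> {1..N}. open (A q) \<and> (w0, w0) \<in> A q \<and>
      (\<forall>p\<in>A q \<inter> W \<times> W. norm (?g (fst q) (snd q) p - ?g (fst q) (snd q) (w0, w0)) < \<epsilon>)"
    by (elim exE)
  have A: "open (A q) \<and> (w0, w0) \<in> A q" if "q \<in> {1..N} \<times> {1..N}" for q
    using bspec[OF A0 that] by (elim conjE) (intro conjI)
  have A2: "norm (?g (fst q) (snd q) p - ?g (fst q) (snd q) (w0, w0)) < \<epsilon>"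
    if "q \<in> {1..N} \<times> {1..N}" "p \<in> A q \<inter> W \<times> W" for p q
    using bspec[OF A0 that(1)] that(2) by (elim conjE) (rule bspec)
  have "open (\<Inter>q\<in>{1..N} \<times> {1..N}. A q)" using A by (intro open_INT) auto
  moreover have "(w0, w0) \<in> (\<Inter>q\<in>{1..N} \<times> {1..N}. A q)" using A by auto
  ultimately obtain U1 U2 where U: "open U1" "open U2" "w0 \<in> U1" "w0 \<in> U2"
    "U1 \<times> U2 \<subseteq> (\<Inter>q\<in>{1..N} \<times> {1..N}. A q)"
    by (elim open_prod_elim) auto
  have "\<forall>i\<le>N. X w i = X w' i"
    if w: "w \<in> (U1 \<inter> U2) \<inter> W" "w' \<in> (U1 \<inter> U2) \<inter> W" "\<theta> w = \<theta> w'"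
      and eq: "\<forall>i\<in>{1..N}. F (\<theta> w) i (X w) = F (\<theta> w) i (X w')" for w w'
  proof -
    have "\<forall>j\<in>{1..N}. X w j - X w' j = 0"
    proof (rule \<epsilon>(2)[of "\<lambda>i j. ?g i j (w, w')" "\<lambda>j. X w j - X w' j"]; intro ballI)
      fix i j assume ij: "i \<in> {1..N}" "j \<in> {1..N}"
      have "(w, w') \<in> A (i, j) \<inter> W \<times> W" using U(5) w(1,2) ij by blast
      from A2[OF _ this] ij show "norm (?g i j (w, w') - \<Delta> (\<theta> w0) i j (X w0) (X w0)) < \<epsilon>" by simp
    next
      fix i assume i: "i \<in> {1..N}"
      have "(\<Sum>j\<le>N. \<Delta> (\<theta> w) i j (X w) (X w') * (X w j - X w' j)) = 0"
        using diff[OF i, of "\<theta> w" "X w" "X w'"] eq i by simp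
      also have "{..N} = insert 0 {1..N}" by auto
      finally show "(\<Sum>j=1..N. ?g i j (w, w') * (X w j - X w' j)) = 0"
        using X0[of w] X0[of w'] w by simp
    qed
    moreover have "X w 0 = X w' 0" using X0 w by simp
    moreover have "i = 0 \<or> i \<in> {1..N}" if "i \<le> N" for i using that by auto
    ultimately show ?thesis by fastforce
  qed
  then show ?thesis using U(1-4) by (intro exI[of _ "U1 \<inter> U2"] conjI open_Int ballI impI IntI) blast+
qed

text \<open>The solutions along the linear homotopy from the diagonal system \<open>F0\<close> form
  a space over the nondegenerate parameters to which \<open>card_fibre_constant\<close> applies;
  both ends are nondegenerate, and over 0 the solutions are tuples of roots of unity.\<close>

theorem bezout_nondegenerate:
  fixes F :: "nat \<Rightarrow> (nat \<Rightarrow> complex) \<Rightarrow> complex" and d :: "nat \<Rightarrow> nat"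
  assumes d: "\<And>i. i \<in> {1..N} \<Longrightarrow> d i \<ge> 1"
    and F: "\<And>i. i \<in> {1..N} \<Longrightarrow> form_dd N (d i) (F i) (\<Delta> i)"
    and nondeg: "\<And>x v. \<exists>i\<le>N. x i \<noteq> 0 \<Longrightarrow> \<forall>i\<in>{1..N}. F i x = 0 \<Longrightarrow>
      \<forall>i\<in>{1..N}. (\<Sum>j=1..N. \<Delta> i j x x * v j) = 0 \<Longrightarrow> \<forall>j\<in>{1..N}. v j = 0"
  shows "finite {w \<in> cspace (Suc N). w 0 = 1 \<and> (\<forall>i\<in>{1..N}. F i w = 0)} \<and>
    card {w \<in> cspace (Suc N). w 0 = 1 \<and> (\<forall>i\<in>{1..N}. F i w = 0)} = (\<Prod>i=1..N. d i)"
proof -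
  define F0 :: "nat \<Rightarrow> (nat \<Rightarrow> complex) \<Rightarrow> complex" where "F0 i x = x i ^ d i - x 0 ^ d i" for i x
  have "\<forall>i\<in>{1..N}. \<exists>D. form_dd N (d i) (F0 i) D \<and>
      (\<forall>x v. (\<Sum>j=1..N. D j x x * v j) = of_nat (d i) * x i ^ (d i - 1) * v i)"
  proof
    fix i assume i: "i \<in> {1..N}"
    obtain D where D: "form_dd N (d i) (\<lambda>x. x i ^ d i) D"
      "\<And>j x. D j x x = (if j = i then of_nat (d i) * x i ^ (d i - 1) else 0)"
      using form_dd_power[of i N "d i"] i by auto
    obtain D' where D': "form_dd N (d i) (\<lambda>x. x 0 ^ d i) D'"
      "\<And>j x. D' j x x = (if j = 0 then of_nat (d i) * x 0 ^ (d i - 1) else 0)"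
      using form_dd_power[of 0 N "d i"] by auto
    have "form_dd N (d i) (F0 i) (\<lambda>j x y. D j x y + (- 1) * D' j x y)"
      using form_dd.add[OF D(1) form_dd_cmult[OF D'(1), of "- 1"]] by (simp add: F0_def[abs_def])
    moreover have "(\<Sum>j=1..N. (D j x x + (- 1) * D' j x x) * v j) = of_nat (d i) * x i ^ (d i - 1) * v i"
      for x v :: "nat \<Rightarrow> complex"
    proof -
      have "(\<Sum>j=1..N. (D j x x + (- 1) * D' j x x) * v j) =
          (\<Sum>j=1..N. if j = i then of_nat (d i) * x i ^ (d i - 1) * v i else 0)"
        by (rule sum.cong) (auto simp: D D')
      with i show ?thesis by simp
    qed
    ultimately show "\<exists>D. form_dd N (d i) (F0 i) D \<and>
      (\<forall>x v. (\<Sum>j=1..N. D j x x * v j) = of_nat (d i) * x i ^ (d i - 1) * v i)" by blast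
  qed
  from this[unfolded bchoice_iff] obtain \<Delta>0 where
    \<Delta>0: "\<And>i. i \<in> {1..N} \<Longrightarrow> form_dd N (d i) (F0 i) (\<Delta>0 i)"
      "\<And>i x v. i \<in> {1..N} \<Longrightarrow> (\<Sum>j=1..N. \<Delta>0 i j x x * v j) = of_nat (d i) * x i ^ (d i - 1) * v i"
    by blast
  define Fs where "Fs s i x = (1 - s) * F0 i x + s * F i x" for s i x
  define Ds where "Ds s i j x y = (1 - s) * \<Delta>0 i j x y + s * \<Delta> i j x y" for s i j x y
  have Fs: "form_dd N (d i) (Fs s i) (Ds s i)" if "i \<in> {1..N}" for s i
    using form_dd.add[OF form_dd_cmult[OF \<Delta>0(1)[OF that]] form_dd_cmult[OF F[OF that]], of "1 - s" s]
    by (simp add: Fs_def[abs_def] Ds_def[abs_def])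
  define Bad where "Bad = {s. \<exists>x v. (\<exists>i\<le>N. x i \<noteq> 0) \<and> (\<exists>j\<in>{1..N}. v j \<noteq> 0) \<and>
    (\<forall>i\<in>{1..N}. Fs s i x = 0 \<and> (\<Sum>j=1..N. Ds s i j x x * v j) = 0)}"
  have Bad: "finite Bad" "0 \<notin> Bad"
    using finite_degenerate_parameters[of N d F0 \<Delta>0 F \<Delta>, OF d F0_def \<Delta>0(2) F]
    unfolding Bad_def Fs_def Ds_def by blast+
  have "1 \<notin> Bad"
  proof
    assume "1 \<in> Bad"
    then obtain x v where xv: "\<exists>i\<le>N. x i \<noteq> 0" "\<exists>j\<in>{1..N}. v j \<noteq> 0"
      "\<forall>i\<in>{1..N}. Fs 1 i x = 0 \<and> (\<Sum>j=1..N. Ds 1 i j x x * v j) = 0"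
      unfolding Bad_def by blast
    then have "\<forall>i\<in>{1..N}. F i x = 0" "\<forall>i\<in>{1..N}. (\<Sum>j=1..N. \<Delta> i j x x * v j) = 0"
      by (simp_all add: Fs_def Ds_def)
    from nondeg[OF xv(1) this] xv(2) show False by blast
  qed
  \<comment> \<open>Since \<open>x 0\<close> is normalized to 1, slot 0 of the sequence is free and
    carries the homotopy parameter; \<open>X\<close> restores the point.\<close>
  define X where "X w = w(0 := 1)" for w :: "nat \<Rightarrow> complex"
  have contX: "continuous_on A X" for A
  proof (rule continuous_on_coordinatewise_then_product)
    fix i show "continuous_on A (\<lambda>x. X x i)"
      by (cases "i = 0") (auto simp: X_def intro!: continuous_on_subset[OF continuous_on_product_coordinates])
  qed
  have cont0: "continuous_on A (\<lambda>w :: nat \<Rightarrow> complex. w i)" for A i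
    by (rule continuous_on_subset[OF continuous_on_product_coordinates]) auto
  have contF: "continuous_on UNIV (F i)" "continuous_on UNIV (F0 i)"
    "continuous_on UNIV (\<lambda>p. \<Delta> i j (fst p) (snd p))" "continuous_on UNIV (\<lambda>p. \<Delta>0 i j (fst p) (snd p))"
    if "i \<in> {1..N}" for i j
    using form_dd_continuous[OF F[OF that]] form_dd_continuous[OF \<Delta>0(1)[OF that]] by auto
  have contFs: "continuous_on A (\<lambda>w. Fs (w 0) i (X w))" if "i \<in> {1..N}" for i A
    unfolding Fs_def
    by (intro continuous_intros cont0 continuous_on_compose2[OF contF(1)[OF that] contX]
        continuous_on_compose2[OF contF(2)[OF that] contX]) auto
  define Z where "Z = {w \<in> cspace (Suc N). \<forall>i\<in>{1..N}. Fs (w 0) i (X w) = 0}"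
  have conn: "connected (- Bad)" "open (- Bad)"
    using connected_open_delete_finite[of "UNIV :: complex set" Bad] Bad
    by (auto simp: Compl_eq_Diff_UNIV finite_imp_closed)
  have count: "finite {w \<in> Z. w 0 = s} \<and> card {w \<in> Z. w 0 = s} = card {w \<in> Z. w 0 = t}"
    if "s \<in> - Bad" "t \<in> - Bad" for s t
  proof (rule card_fibre_constant[where S = "- Bad" and \<pi> = "\<lambda>w. w 0", OF conn(2,1) _ _ that])
    fix w0 :: "nat \<Rightarrow> complex" and O'
    assume w0: "w0 \<in> Z" "w0 0 \<in> - Bad" and O': "open O'" "w0 \<in> O'"
    \<comment> \<open>Keeping the parameter as a component gives source and target the same
      dimension, so invariance of domain applies to \<open>\<Phi>\<close>.\<close>
    define \<Phi> where "\<Phi> w = (\<lambda>i. if i = 0 then w 0 else if i \<le> N then Fs (w 0) i (X w) else 0)" for w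
    have "\<exists>U. open U \<and> w0 \<in> U \<and> (\<forall>w\<in>U \<inter> UNIV. \<forall>w'\<in>U \<inter> UNIV. w 0 = w' 0 \<longrightarrow>
      (\<forall>i\<in>{1..N}. Fs (w 0) i (X w) = Fs (w 0) i (X w')) \<longrightarrow> (\<forall>i\<le>N. X w i = X w' i))"
    proof (rule nondegenerate_locally_injective[where \<Delta> = Ds and \<theta> = "\<lambda>w. w 0" and X = X])
      fix i j assume i: "i \<in> {1..N}"
      show "continuous_on (UNIV \<times> UNIV) (\<lambda>p. Ds (fst p 0) i j (X (fst p)) (X (snd p)))"
      proof -
        have 1: "continuous_on UNIV (\<lambda>p :: (nat \<Rightarrow> complex) \<times> (nat \<Rightarrow> complex). (X (fst p), X (snd p)))"
          by (intro continuous_on_Pair continuous_on_compose2[OF contX continuous_on_fst[OF continuous_on_id]]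
              continuous_on_compose2[OF contX continuous_on_snd[OF continuous_on_id]]) auto
        have 2: "continuous_on UNIV (\<lambda>p :: (nat \<Rightarrow> complex) \<times> (nat \<Rightarrow> complex). fst p 0)"
          by (rule continuous_on_compose2[OF cont0 continuous_on_fst[OF continuous_on_id]]) auto
        show ?thesis unfolding Ds_def UNIV_Times_UNIV
          using continuous_on_compose2[OF contF(3)[OF i] 1] continuous_on_compose2[OF contF(4)[OF i] 1]
          by (intro continuous_intros 2) auto
      qed
    next
      fix v assume v: "\<forall>i\<in>{1..N}. (\<Sum>j=1..N. Ds (w0 0) i j (X w0) (X w0) * v j) = 0"
      have "\<forall>i\<in>{1..N}. Fs (w0 0) i (X w0) = 0" using w0(1) by (simp add: Z_def)
      moreover have "X w0 0 \<noteq> 0" by (simp add: X_def)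
      ultimately show "\<forall>j\<in>{1..N}. v j = 0" using v w0(2) unfolding Bad_def by blast
    qed (use form_dd_diff[OF Fs] in \<open>auto simp: X_def\<close>)
    then obtain U where "open U" "w0 \<in> U" and U3: "\<forall>w\<in>U \<inter> UNIV. \<forall>w'\<in>U \<inter> UNIV. w 0 = w' 0 \<longrightarrow>
      (\<forall>i\<in>{1..N}. Fs (w 0) i (X w) = Fs (w 0) i (X w')) \<longrightarrow> (\<forall>i\<le>N. X w i = X w' i)"
      by (elim exE conjE)
    have U: "open U" "w0 \<in> U" by fact+
    have U3: "\<forall>i\<le>N. X w i = X w' i" if ww: "w \<in> U" "w' \<in> U" "w 0 = w' 0"
      "\<forall>i\<in>{1..N}. Fs (w 0) i (X w) = Fs (w 0) i (X w')" for w w'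
    proof -
      have ww': "w \<in> U \<inter> UNIV" "w' \<in> U \<inter> UNIV" using ww(1,2) by simp_all
      show ?thesis by (rule mp[OF mp[OF bspec[OF bspec[OF U3 ww'(1)] ww'(2)] ww(3)] ww(4)])
    qed
    define U' where "U' = U \<inter> O' \<inter> cspace (Suc N)"
    have inj: "w = w'" if "w \<in> U'" "w' \<in> U'" "w 0 = w' 0"
      "\<forall>i\<in>{1..N}. Fs (w 0) i (X w) = Fs (w 0) i (X w')" for w w'
    proof
      fix i
      have eq: "\<forall>i\<le>N. X w i = X w' i" using U3[of w w'] that unfolding U'_def by blast
      consider "i = 0" | "0 < i" "i \<le> N" | "i > N" by force
      then show "w i = w' i"
      proof cases
        case 2
        with eq have "X w i = X w' i" by blast
        with 2 show ?thesis by (simp add: X_def)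
      next
        case 3
        have "w \<in> cspace (Suc N)" "w' \<in> cspace (Suc N)" using that by (simp_all add: U'_def)
        with 3 show ?thesis by (simp add: cspace_def)
      qed (use that(3) in simp)
    qed
    have "openin (top_of_set (cspace (Suc N))) (\<Phi> ` U')"
    proof (rule invariance_of_domain_cspace)
      show "openin (top_of_set (cspace (Suc N))) U'"
        using U(1) O'(1) by (auto simp: U'_def openin_open intro!: exI[of _ "U \<inter> O'"])
      show "continuous_on U' \<Phi>"
      proof (rule continuous_on_coordinatewise_then_product)
        fix i
        consider "i = 0" | "i \<in> {1..N}" | "i > N" by force
        then show "continuous_on U' (\<lambda>x. \<Phi> x i)"
          by cases (auto simp: \<Phi>_def intro: cont0 contFs)
      qed
      show "\<Phi> ` U' \<subseteq> cspace (Suc N)" by (auto simp: \<Phi>_def cspace_def)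
      show "inj_on \<Phi> U'"
      proof (rule inj_onI)
        fix w w' assume w: "w \<in> U'" "w' \<in> U'" and eq: "\<Phi> w = \<Phi> w'"
        have e0: "w 0 = w' 0" using fun_cong[OF eq, of 0] by (simp add: \<Phi>_def)
        have "\<forall>i\<in>{1..N}. Fs (w 0) i (X w) = Fs (w 0) i (X w')"
        proof
          fix i assume "i \<in> {1..N}"
          with fun_cong[OF eq, of i] e0 show "Fs (w 0) i (X w) = Fs (w 0) i (X w')" by (auto simp: \<Phi>_def)
        qed
        with inj w e0 show "w = w'" by blast
      qed
    qed
    then obtain V where V: "open V" "\<Phi> ` U' = cspace (Suc N) \<inter> V" by (auto simp: openin_open)
    \<comment> \<open>The image of the solutions over the parameter s: all equations zero. A
      preimage of \<open>e s\<close> under \<open>\<Phi>\<close> is the continued solution.\<close>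
    define e where "e s = (\<lambda>i :: nat. if i = 0 then s else 0)" for s :: complex
    have "continuous_on UNIV e"
    proof (rule continuous_on_coordinatewise_then_product)
      fix i show "continuous_on UNIV (\<lambda>s. e s i)" by (cases "i = 0") (auto simp: e_def)
    qed
    then have "open (e -` V)" using V(1) by (simp add: continuous_on_open_vimage)
    moreover have "w0 0 \<in> e -` V"
    proof -
      have "\<Phi> w0 = e (w0 0)" using w0 by (auto simp: \<Phi>_def e_def Z_def fun_eq_iff)
      moreover have "w0 \<in> U'" using w0 U(2) O'(2) by (auto simp: U'_def Z_def)
      ultimately show ?thesis using V(2) by (metis IntD2 imageI vimageI)
    qed
    moreover have "\<exists>!u. u \<in> U \<inter> O' \<and> u \<in> Z \<and> u 0 = s" if s: "s \<in> e -` V" for s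
    proof -
      have "e s \<in> \<Phi> ` U'" using s V(2) by (auto simp: e_def cspace_def)
      then obtain u where u: "u \<in> U'" "\<Phi> u = e s" by auto
      have "u 0 = s" using fun_cong[OF u(2), of 0] by (simp add: \<Phi>_def e_def)
      moreover have "Fs (u 0) i (X u) = 0" if "i \<in> {1..N}" for i
        using fun_cong[OF u(2), of i] that by (auto simp: \<Phi>_def e_def)
      ultimately have mem: "u \<in> U \<inter> O' \<and> u \<in> Z \<and> u 0 = s" using u(1) by (auto simp: U'_def Z_def)
      have "u' = u" if u': "u' \<in> U \<inter> O' \<and> u' \<in> Z \<and> u' 0 = s" for u'
      proof (rule inj)
        show "u' \<in> U'" using u' by (auto simp: U'_def Z_def)
        show "\<forall>i\<in>{1..N}. Fs (u' 0) i (X u') = Fs (u' 0) i (X u)"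
          using u' mem by (auto simp: Z_def)
      qed (use u' mem u(1) in simp_all)
      with mem show ?thesis by blast
    qed
    ultimately show "\<exists>U T. open U \<and> w0 \<in> U \<and> U \<subseteq> O' \<and> open T \<and> w0 0 \<in> T \<and>
        (\<forall>s\<in>T. \<exists>!u. u \<in> U \<and> u \<in> Z \<and> u 0 = s)"
      using U(1,2) O' by (intro exI[of _ "U \<inter> O'"] exI[of _ "e -` V"]) auto
  next
    fix w :: "nat \<Rightarrow> nat \<Rightarrow> complex" and s
    assume w: "\<And>k. w k \<in> Z" and lim: "(\<lambda>k. w k 0) \<longlonglongrightarrow> s" and s: "s \<in> - Bad"
    \<comment> \<open>Solutions over converging parameters may be unbounded. They are rescaled to
      norm 1, which keeps them solutions by homogeneity, and a limit \<open>l\<close> is taken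
      projectively.\<close>
    define n where "n k = (\<Sum>i\<le>N. norm (X (w k) i))" for k
    have n: "n k \<ge> 1" for k
      using member_le_sum[of 0 "{..N}" "\<lambda>i. norm (X (w k) i)"] by (simp add: n_def X_def)
    define y where "y k i = X (w k) i / of_real (n k)" for k i
    have ny: "norm (y k i) = norm (X (w k) i) / n k" for k i
      using n[of k] by (simp add: y_def norm_divide)
    have ysum: "(\<Sum>i\<le>N. norm (y k i)) = 1" for k
      unfolding ny sum_divide_distrib[symmetric] using n[of k] by (simp add: n_def)
    have yle: "norm (y k i) \<le> 1" if "i \<in> {..N}" for k i
      using member_le_sum[of i "{..N}" "\<lambda>i. norm (y k i)"] that ysum by auto
    obtain l0 r where r: "strict_mono r" and l0: "\<And>i. i \<le> N \<Longrightarrow> (\<lambda>k. y (r k) i) \<longlonglongrightarrow> l0 i"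
      using coordinatewise_convergent_subsequence[of "{..N}" y 1, OF finite_atMost yle] by blast
    define l where "l i = (if i \<le> N then l0 i else 0)" for i
    have y0: "y k i = 0" if "i > N" for k i
      using w[of k] that by (auto simp: y_def X_def Z_def cspace_def)
    have yl: "(\<lambda>k. y (r k)) \<longlonglongrightarrow> l"
      by (rule tendsto_coordinatewise) (use l0 y0 in \<open>auto simp: l_def not_le\<close>)
    have slim: "(\<lambda>k. w (r k) 0) \<longlonglongrightarrow> s"
      using LIMSEQ_subseq_LIMSEQ[OF lim r] by (simp add: o_def)
    have hom: "Fs t i (y k) = (1 / of_real (n k)) ^ d i * Fs t i (X (w k))" if "i \<in> {1..N}" for t i k
      using forms_homogeneous[OF form_dd_forms[OF Fs[OF that]], of t "1 / of_real (n k)" "X (w k)"]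
      by (simp add: y_def[abs_def])
    have zero: "Fs s i l = 0" if "i \<in> {1..N}" for i
    proof -
      have "Fs (w (r k) 0) i (y (r k)) = 0" for k
        using w[of "r k"] that hom[OF that] by (auto simp: Z_def)
      moreover have "(\<lambda>k. Fs (w (r k) 0) i (y (r k))) \<longlonglongrightarrow> Fs s i l"
        unfolding Fs_def
        by (intro tendsto_intros slim continuous_on_tendsto_compose[OF contF(1)[OF that] yl]
            continuous_on_tendsto_compose[OF contF(2)[OF that] yl]) auto
      ultimately show ?thesis by (simp add: LIMSEQ_const_iff)
    qed
    have lsum: "(\<Sum>i\<le>N. norm (l i)) = 1"
    proof -
      have "(\<lambda>k. \<Sum>i\<le>N. norm (y (r k) i)) \<longlonglongrightarrow> (\<Sum>i\<le>N. norm (l i))"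
        by (intro tendsto_sum tendsto_norm tendsto_coordinate[OF yl])
      then show ?thesis unfolding ysum by (simp add: LIMSEQ_const_iff)
    qed
    \<comment> \<open>A limit at infinity would be degenerate: with \<open>l 0 = 0\<close>, Euler's
      identity makes \<open>l\<close> itself a nonzero kernel vector, so s would lie in
      \<open>Bad\<close>.\<close>
    have "l 0 \<noteq> 0"
    proof
      assume l0: "l 0 = 0"
      have "(\<Sum>j=1..N. Ds s i j l l * l j) = 0" if "i \<in> {1..N}" for i
      proof -
        have "(\<Sum>j\<le>N. Ds s i j l l * l j) = 0"
          using form_dd_euler[OF Fs[OF that], of s l] zero[OF that] by simp
        moreover have "{..N} = insert 0 {1..N}" by auto
        ultimately show ?thesis using l0 by simp
      qed
      moreover have "\<exists>i\<le>N. l i \<noteq> 0"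
      proof (rule ccontr)
        assume "\<not> (\<exists>i\<le>N. l i \<noteq> 0)"
        then have "(\<Sum>i\<le>N. norm (l i)) = 0" by simp
        with lsum show False by simp
      qed
      then obtain i where "i \<le> N" "l i \<noteq> 0" by blast
      moreover from this l0 have "i \<in> {1..N}" by (cases i) auto
      ultimately have "s \<in> Bad" using zero unfolding Bad_def by blast
      with s show False by simp
    qed
    have Xy: "X (w k) i = y k i / y k 0" for k i
      using n[of k] by (simp add: y_def X_def)
    define m where "m i = (if i = 0 then s else l i / l 0)" for i
    have wm: "(w \<circ> r) \<longlonglongrightarrow> m"
    proof (rule tendsto_coordinatewise)
      fix i
      show "(\<lambda>k. (w \<circ> r) k i) \<longlonglongrightarrow> m i"
      proof (cases "i = 0")
        case False
        then have "(w \<circ> r) k i = y (r k) i / y (r k) 0" for k using Xy[of "r k" i] by (simp add: X_def)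
        with False \<open>l 0 \<noteq> 0\<close> show ?thesis
          by (auto simp: m_def intro!: tendsto_divide tendsto_coordinate[OF yl])
      qed (use slim in \<open>simp add: m_def\<close>)
    qed
    have "m \<in> Z"
    proof -
      have "m \<in> cspace (Suc N)" by (auto simp: m_def cspace_def l_def)
      moreover have "Fs (m 0) i (X m) = 0" if "i \<in> {1..N}" for i
      proof -
        have "Fs (w (r k) 0) i (X (w (r k))) = 0" for k using w[of "r k"] that by (auto simp: Z_def)
        moreover have "(\<lambda>k. Fs ((w \<circ> r) k 0) i (X ((w \<circ> r) k))) \<longlonglongrightarrow> Fs (m 0) i (X m)"
          by (rule continuous_on_tendsto_compose[OF contFs[OF that, of UNIV] wm]) auto
        ultimately show ?thesis by (simp add: LIMSEQ_const_iff)
      qed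
      ultimately show ?thesis by (simp add: Z_def)
    qed
    then show "\<exists>l r. l \<in> Z \<and> l 0 = s \<and> strict_mono (r :: nat \<Rightarrow> nat) \<and> (w \<circ> r) \<longlonglongrightarrow> l"
      using wm r by (intro exI[of _ m] exI[of _ r]) (simp add: m_def)
  qed
  have Z1: "{w \<in> Z. w 0 = 1} = {w \<in> cspace (Suc N). w 0 = 1 \<and> (\<forall>i\<in>{1..N}. F i w = 0)}"
  proof -
    have "X w = w" if "w 0 = 1" for w using that by (auto simp: X_def fun_eq_iff)
    then show ?thesis by (auto simp: Z_def Fs_def)
  qed
  have "card {w \<in> Z. w 0 = 0} = (\<Prod>i=1..N. d i)"
  proof -
    let ?P = "PiE {1..N} (\<lambda>i. {z :: complex. z ^ d i = 1})"
    have Z0: "{w \<in> Z. w 0 = 0} = {w \<in> cspace (Suc N). w 0 = 0 \<and> (\<forall>i\<in>{1..N}. w i ^ d i = 1)}"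
      by (auto simp: Z_def Fs_def F0_def X_def)
    have "bij_betw (\<lambda>w. restrict w {1..N}) {w \<in> Z. w 0 = 0} ?P"
    proof (rule bij_betwI[where g = "\<lambda>f i. if i \<in> {1..N} then f i else 0"])
      show "(\<lambda>f i. if i \<in> {1..N} then f i else 0) \<in> ?P \<rightarrow> {w \<in> Z. w 0 = 0}"
        unfolding Z0 by (auto simp: cspace_def PiE_def Pi_def)
      show "(\<lambda>w. restrict w {1..N}) \<in> {w \<in> Z. w 0 = 0} \<rightarrow> ?P"
        unfolding Z0 by auto
      show "(\<lambda>i. if i \<in> {1..N} then restrict w {1..N} i else 0) = w" if "w \<in> {w \<in> Z. w 0 = 0}" for w
      proof
        fix i show "(if i \<in> {1..N} then restrict w {1..N} i else 0) = w i"
          using that unfolding Z0 by (cases "i = 0") (auto simp: cspace_def)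
      qed
      show "restrict (\<lambda>i. if i \<in> {1..N} then f i else 0) {1..N} = f" if "f \<in> ?P" for f
      proof
        fix i show "restrict (\<lambda>i. if i \<in> {1..N} then f i else 0) {1..N} i = f i"
          using that by (cases "i \<in> {1..N}") (auto simp: PiE_def extensional_def)
      qed
    qed
    then have "card {w \<in> Z. w 0 = 0} = card ?P" by (rule bij_betw_same_card)
    also have "\<dots> = (\<Prod>i=1..N. card {z :: complex. z ^ d i = 1})" by (rule card_PiE) simp
    also have "\<dots> = (\<Prod>i=1..N. d i)"
    proof (rule prod.cong)
      fix i assume "i \<in> {1..N}"
      with d[of i] show "card {z :: complex. z ^ d i = 1} = d i" by (intro card_roots_unity_eq) auto
    qed simp
    finally show ?thesis .
  qed
  with count[of 1 0] Bad(2) \<open>1 \<notin> Bad\<close> show ?thesis by (simp add: Z1)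
qed

section \<open>The equations of an isoresidual fibre\<close>

text \<open>
  A form with zero at infinity and poles at \<open>x\<^sub>0, \<dots>, x\<^sub>N\<close> and \<open>0\<close> with residues \<open>l\<^sub>0, \<dots>, l\<^sub>N\<close> at the
  former is \<open>\<Sum>\<^sub>j l\<^sub>j d log(1 - x\<^sub>j u) - d(q / D)\<close> in the coordinate \<open>u = 1/z\<close>, with \<open>D\<close> the polynomial
  \<open>reduced_poles\<close> below and \<open>degree q \<le> d\<close>. It vanishes to high order at \<open>u = 0\<close> iff \<open>D \<cdot> log_sum\<close> has no
  coefficients in degrees \<open>d + 1, \<dots>, d + N\<close>.
\<close>

definition reduced_poles :: "nat set \<Rightarrow> (nat \<Rightarrow> nat) \<Rightarrow> (nat \<Rightarrow> complex) \<Rightarrow> complex poly" where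
  "reduced_poles J \<beta> x = (\<Prod>j\<in>J. [:1, - x j:] ^ (\<beta> j - 1))"

text \<open>The expansion of log (1 - y u). Its coefficient of index k has degree k in y, which is
  what makes \<open>fibre_eq\<close> with index k a form of degree k in the poles.\<close>

definition log_fps :: "complex \<Rightarrow> complex fps" where
  "log_fps y = Abs_fps (\<lambda>k. if k = 0 then 0 else - (y ^ k) / of_nat k)"

definition log_sum :: "nat \<Rightarrow> (nat \<Rightarrow> complex) \<Rightarrow> (nat \<Rightarrow> complex) \<Rightarrow> complex fps" where
  "log_sum N l x = (\<Sum>i\<le>N. fps_const (l i) * log_fps (x i))"

definition fibre_fps :: "nat \<Rightarrow> (nat \<Rightarrow> nat) \<Rightarrow> (nat \<Rightarrow> complex) \<Rightarrow> (nat \<Rightarrow> complex) \<Rightarrow> complex fps" where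
  "fibre_fps N \<beta> l x = fps_of_poly (reduced_poles {..N} \<beta> x) * log_sum N l x"

definition fibre_eq :: "nat \<Rightarrow> (nat \<Rightarrow> nat) \<Rightarrow> (nat \<Rightarrow> complex) \<Rightarrow> nat \<Rightarrow> (nat \<Rightarrow> complex) \<Rightarrow> complex" where
  "fibre_eq N \<beta> l k x = fps_nth (fibre_fps N \<beta> l x) k"

text \<open>Power series in u whose k-th coefficient is a form of degree k. Only the diagonal values
  of the divided differences, the partial derivatives, are tied to the series \<open>g\<close>; off
  the diagonal no formula is required.\<close>

definition fps_dd :: "nat \<Rightarrow> ((nat \<Rightarrow> complex) \<Rightarrow> complex fps) \<Rightarrow>
    (nat \<Rightarrow> (nat \<Rightarrow> complex) \<Rightarrow> complex fps) \<Rightarrow> bool" where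
  "fps_dd N f g \<longleftrightarrow> (\<forall>k. \<exists>\<Delta>. form_dd N k (\<lambda>x. fps_nth (f x) k) \<Delta> \<and>
     (\<forall>j x. \<Delta> j x x = fps_nth (g j x) k))"

lemma form_dd_sum:
  assumes "\<And>i. i \<in> I \<Longrightarrow> form_dd N m (F i) (\<Delta> i)"
  shows "form_dd N m (\<lambda>x. \<Sum>i\<in>I. F i x) (\<lambda>j x y. \<Sum>i\<in>I. \<Delta> i j x y)"
proof (cases "finite I")
  case True
  from this assms show ?thesis
    by (induction I rule: finite_induct) (simp_all add: form_dd.zero form_dd.add)
qed (simp add: form_dd.zero)

lemma fps_mult_linear_nth:
  "fps_nth (f * fps_of_poly [:1, - y:]) k = fps_nth f k - (if k = 0 then 0 else y * fps_nth f (k - 1))"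
  for y :: complex
proof -
  have "f * fps_of_poly [:1, - y:] = f - fps_const y * (f * fps_X)"
    by (simp add: fps_of_poly_pCons fps_const_neg[symmetric] algebra_simps del: fps_const_neg)
  then show ?thesis by (simp add: fps_X_mult_right_nth del: fps_of_poly_pCons)
qed

lemma fps_dd_mult:
  assumes "fps_dd N f g" "fps_dd N f' g'"
  shows "fps_dd N (\<lambda>x. f x * f' x) (\<lambda>j x. f x * g' j x + g j x * f' x)"
  unfolding fps_dd_def
proof
  fix k
  from assms(1)[unfolded fps_dd_def] have "\<exists>\<Delta>. \<forall>k. form_dd N k (\<lambda>x. fps_nth (f x) k) (\<Delta> k) \<and>
     (\<forall>j x. \<Delta> k j x x = fps_nth (g j x) k)" by (rule choice)
  then obtain \<Delta> where \<Delta>: "\<And>k. form_dd N k (\<lambda>x. fps_nth (f x) k) (\<Delta> k)"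
     "\<And>k j x. \<Delta> k j x x = fps_nth (g j x) k" by blast
  from assms(2)[unfolded fps_dd_def] have "\<exists>\<Delta>. \<forall>k. form_dd N k (\<lambda>x. fps_nth (f' x) k) (\<Delta> k) \<and>
     (\<forall>j x. \<Delta> k j x x = fps_nth (g' j x) k)" by (rule choice)
  then obtain \<Delta>' where \<Delta>': "\<And>k. form_dd N k (\<lambda>x. fps_nth (f' x) k) (\<Delta>' k)"
     "\<And>k j x. \<Delta>' k j x x = fps_nth (g' j x) k" by blast
  let ?D = "\<lambda>j x y. \<Sum>i=0..k. fps_nth (f x) i * \<Delta>' (k - i) j x y + \<Delta> i j x y * fps_nth (f' y) (k - i)"
  have "form_dd N k (\<lambda>x. \<Sum>i=0..k. fps_nth (f x) i * fps_nth (f' x) (k - i)) ?D"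
  proof (rule form_dd_sum)
    fix i assume "i \<in> {0..k}"
    with form_dd.mult[OF \<Delta>(1)[of i] \<Delta>'(1)[of "k - i"]]
    show "form_dd N k (\<lambda>x. fps_nth (f x) i * fps_nth (f' x) (k - i))
        (\<lambda>j x y. fps_nth (f x) i * \<Delta>' (k - i) j x y + \<Delta> i j x y * fps_nth (f' y) (k - i))"
      by simp
  qed
  moreover have "?D j x x = fps_nth (f x * g' j x + g j x * f' x) k" for j x
    by (simp add: \<Delta>(2) \<Delta>'(2) fps_mult_nth sum.distrib)
  ultimately show "\<exists>\<Delta>. form_dd N k (\<lambda>x. fps_nth (f x * f' x) k) \<Delta> \<and>
     (\<forall>j x. \<Delta> j x x = fps_nth (f x * g' j x + g j x * f' x) k)"
    unfolding fps_mult_nth[of "f _" "f' _"] by blast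
qed

lemma fps_dd_one: "fps_dd N (\<lambda>_. 1) (\<lambda>_ _. 0)"
  unfolding fps_dd_def
proof
  fix k show "\<exists>\<Delta>. form_dd N k (\<lambda>x. fps_nth 1 k) \<Delta> \<and> (\<forall>j x. \<Delta> j x x = fps_nth 0 k)"
    by (cases k) (auto intro!: exI[of _ "\<lambda>_ _ _. 0"] form_dd.const form_dd.zero)
qed

lemma fps_dd_linear:
  assumes "i \<le> N"
  shows "fps_dd N (\<lambda>x. fps_of_poly [:1, - x i:]) (\<lambda>j x. if j = i then - fps_X else 0)"
  unfolding fps_dd_def
proof
  fix k :: nat
  consider "k = 0" | "k = 1" | "k \<ge> 2" by linarith
  then show "\<exists>\<Delta>. form_dd N k (\<lambda>x. fps_nth (fps_of_poly [:1, - x i:]) k) \<Delta> \<and>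
      (\<forall>j x. \<Delta> j x x = fps_nth (if j = i then - fps_X else 0) k)"
  proof cases
    case 1
    then show ?thesis by (auto intro!: exI[of _ "\<lambda>_ _ _. 0"] form_dd.const)
  next
    case 2
    from form_dd_cmult[OF form_dd.var[OF assms], of "- 1"] 2 show ?thesis
      by (intro exI[of _ "\<lambda>j x y. - 1 * (if j = i then 1 else 0)"]) simp
  next
    case 3
    then have "fps_nth (fps_of_poly [:1, - y:]) k = 0" for y :: complex
      by (simp add: coeff_eq_0)
    with 3 show ?thesis by (auto intro!: exI[of _ "\<lambda>_ _ _. 0"] form_dd.zero)
  qed
qed

text \<open>The logarithmic derivative with respect to \<open>x j\<close>, which is -
  (\<open>\<beta> j\<close> - 1) u / (1 - x_j u), multiplied out so that no division occurs.\<close>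

lemma fps_dd_reduced_poles:
  assumes "finite J" "J \<subseteq> {..N}"
  shows "\<exists>g. fps_dd N (\<lambda>x. fps_of_poly (reduced_poles J \<beta> x)) g \<and>
    (\<forall>j x. g j x * fps_of_poly [:1, - x j:] =
      - (of_nat (if j \<in> J then \<beta> j - 1 else 0) * fps_X * fps_of_poly (reduced_poles J \<beta> x)))"
  using assms
proof (induction J rule: finite_induct)
  case empty
  show ?case using fps_dd_one by (intro exI[of _ "\<lambda>_ _. 0"]) (auto simp: reduced_poles_def)
next
  case (insert i J)
  have pow: "\<exists>g. fps_dd N (\<lambda>x. fps_of_poly [:1, - x i:] ^ n) g \<and>
    (\<forall>j x. g j x * fps_of_poly [:1, - x j:] =
      - (of_nat (if j = i then n else 0) * fps_X * fps_of_poly [:1, - x i:] ^ n))" for n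
  proof (induction n)
    case 0
    show ?case using fps_dd_one by (intro exI[of _ "\<lambda>_ _. 0"]) auto
  next
    case (Suc n)
    then obtain g where g: "fps_dd N (\<lambda>x. fps_of_poly [:1, - x i:] ^ n) g"
      "\<And>j x. g j x * fps_of_poly [:1, - x j:] =
        - (of_nat (if j = i then n else 0) * fps_X * fps_of_poly [:1, - x i:] ^ n)" by blast
    have "i \<le> N" using insert by auto
    note dd = fps_dd_mult[OF fps_dd_linear[OF this] g(1)]
    have "(fps_of_poly [:1, - x i:] * g j x + (if j = i then - fps_X else 0) * fps_of_poly [:1, - x i:] ^ n) *
        fps_of_poly [:1, - x j:] =
        - (of_nat (if j = i then Suc n else 0) * fps_X * fps_of_poly [:1, - x i:] ^ Suc n)" (is "?l = ?r") for j x
    proof -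
      have "?l = fps_of_poly [:1, - x i:] * (g j x * fps_of_poly [:1, - x j:]) +
        (if j = i then - fps_X * fps_of_poly [:1, - x i:] ^ Suc n else 0)"
        by (simp add: algebra_simps)
      also have "\<dots> = ?r" unfolding g(2) by (simp add: algebra_simps)
      finally show ?thesis .
    qed
    with dd show ?case unfolding power_Suc by blast
  qed
  obtain g where g: "fps_dd N (\<lambda>x. fps_of_poly [:1, - x i:] ^ (\<beta> i - 1)) g"
    "\<And>j x. g j x * fps_of_poly [:1, - x j:] =
      - (of_nat (if j = i then \<beta> i - 1 else 0) * fps_X * fps_of_poly [:1, - x i:] ^ (\<beta> i - 1))"
    using pow by blast
  obtain g' where g': "fps_dd N (\<lambda>x. fps_of_poly (reduced_poles J \<beta> x)) g'"
    "\<And>j x. g' j x * fps_of_poly [:1, - x j:] =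
      - (of_nat (if j \<in> J then \<beta> j - 1 else 0) * fps_X * fps_of_poly (reduced_poles J \<beta> x))"
    using insert by auto
  have eq: "fps_of_poly (reduced_poles (insert i J) \<beta> x) =
      fps_of_poly [:1, - x i:] ^ (\<beta> i - 1) * fps_of_poly (reduced_poles J \<beta> x)" for x
    using insert by (simp add: reduced_poles_def fps_of_poly_mult fps_of_poly_power)
  have "(fps_of_poly [:1, - x i:] ^ (\<beta> i - 1) * g' j x + g j x * fps_of_poly (reduced_poles J \<beta> x)) *
      fps_of_poly [:1, - x j:] =
      - (of_nat (if j \<in> insert i J then \<beta> j - 1 else 0) * fps_X *
        (fps_of_poly [:1, - x i:] ^ (\<beta> i - 1) * fps_of_poly (reduced_poles J \<beta> x)))" (is "?l = ?r") for j x
  proof -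
    have "?l = fps_of_poly [:1, - x i:] ^ (\<beta> i - 1) * (g' j x * fps_of_poly [:1, - x j:]) +
        (g j x * fps_of_poly [:1, - x j:]) * fps_of_poly (reduced_poles J \<beta> x)"
      by (simp only: algebra_simps)
    also have "\<dots> = ?r" unfolding g(2) g'(2) using insert.hyps by (auto simp: algebra_simps)
    finally show ?thesis .
  qed
  with fps_dd_mult[OF g(1) g'(1)] show ?case unfolding eq by blast
qed

lemma fps_dd_log:
  assumes "i \<le> N"
  shows "\<exists>g. fps_dd N (\<lambda>x. log_fps (x i)) g \<and>
    (\<forall>j x. g j x * fps_of_poly [:1, - x j:] = (if j = i then - fps_X else 0))"
proof -
  define g where "g j x = (if j = i then Abs_fps (\<lambda>k. if k = 0 then 0 else - (x i ^ (k - 1))) else 0)"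
    for j and x :: "nat \<Rightarrow> complex"
  have "fps_dd N (\<lambda>x. log_fps (x i)) g" unfolding fps_dd_def
  proof
    fix k
    show "\<exists>\<Delta>. form_dd N k (\<lambda>x. fps_nth (log_fps (x i)) k) \<Delta> \<and> (\<forall>j x. \<Delta> j x x = fps_nth (g j x) k)"
    proof (cases "k = 0")
      case True
      then show ?thesis
        by (auto simp: log_fps_def g_def intro!: exI[of _ "\<lambda>_ _ _. 0"] form_dd.const)
    next
      case False
      obtain \<Delta> where \<Delta>: "form_dd N k (\<lambda>x. x i ^ k) \<Delta>"
        "\<forall>j x. \<Delta> j x x = (if j = i then of_nat k * x i ^ (k - 1) else 0)"
        using form_dd_power[OF assms] by blast
      from form_dd_cmult[OF \<Delta>(1), of "- 1 / of_nat k"] \<Delta>(2) False show ?thesis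
        by (intro exI[of _ "\<lambda>j x y. - 1 / of_nat k * \<Delta> j x y"]) (auto simp: log_fps_def g_def)
    qed
  qed
  moreover have "g j x * fps_of_poly [:1, - x j:] = (if j = i then - fps_X else 0)" for j x
  proof (cases "j = i")
    case True
    have "g i x * fps_of_poly [:1, - x i:] = - fps_X"
    proof (rule fps_ext)
      fix k
      consider "k = 0" | "k = 1" | m where "k = Suc (Suc m)" by (metis One_nat_def nat.exhaust)
      then show "fps_nth (g i x * fps_of_poly [:1, - x i:]) k = fps_nth (- fps_X) k"
        unfolding fps_mult_linear_nth by cases (auto simp: g_def)
    qed
    with True show ?thesis by simp
  qed (simp add: g_def)
  ultimately show ?thesis by blast
qed

text \<open>
  The gradient of the fibre equations: \<open>g i j\<close> is the derivative with respect to \<open>x\<^sub>j\<close> of the part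
  belonging to the residue \<open>l\<^sub>i\<close>.
\<close>

lemma fibre_eq_form_dd:
  "\<exists>\<Delta> g. (\<forall>l k. form_dd N k (fibre_eq N \<beta> l k) (\<lambda>j x y. \<Sum>i\<le>N. l i * \<Delta> i k j x y)) \<and>
    (\<forall>i\<le>N. \<forall>k j. continuous_on UNIV (\<lambda>p. \<Delta> i k j (fst p) (snd p))) \<and>
    (\<forall>l k j x. (\<Sum>i\<le>N. l i * \<Delta> i k j x x) = fps_nth (g l j x) k) \<and>
    (\<forall>l x. \<forall>j\<le>N. g l j x * fps_of_poly [:1, - x j:] =
       - fps_X * (fps_const (l j) * fps_of_poly (reduced_poles {..N} \<beta> x) +
         of_nat (\<beta> j - 1) * fibre_fps N \<beta> l x))"
proof -
  let ?D = "\<lambda>x. fps_of_poly (reduced_poles {..N} \<beta> x)"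
  obtain gD where gD: "fps_dd N ?D gD"
    "\<And>j x. gD j x * fps_of_poly [:1, - x j:] =
      - (of_nat (if j \<in> {..N} then \<beta> j - 1 else 0) * fps_X * ?D x)"
    using fps_dd_reduced_poles[of "{..N}" N \<beta>] by auto
  have "\<forall>i\<in>{..N}. \<exists>g. fps_dd N (\<lambda>x. log_fps (x i)) g \<and>
    (\<forall>j x. g j x * fps_of_poly [:1, - x j:] = (if j = i then - fps_X else 0))"
    using fps_dd_log by simp
  from this[unfolded bchoice_iff] obtain gL where
    gL: "\<And>i. i \<le> N \<Longrightarrow> fps_dd N (\<lambda>x. log_fps (x i)) (gL i)"
    "\<And>i j x. i \<le> N \<Longrightarrow> gL i j x * fps_of_poly [:1, - x j:] = (if j = i then - fps_X else 0)"
    unfolding atMost_iff by blast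
  \<comment> \<open>The series is linear in the residues. Splitting it by residue makes the divided
    differences independent of \<open>l\<close>, so that continuity is available when the residues
    vary together with the poles.\<close>
  define gi where "gi i j x = ?D x * gL i j x + gD j x * log_fps (x i)" for i j x
  have gi: "fps_dd N (\<lambda>x. ?D x * log_fps (x i)) (gi i)" if "i \<le> N" for i
    using fps_dd_mult[OF gD(1) gL(1)[OF that]] by (simp add: gi_def[abs_def])
  then have "\<forall>q\<in>{..N} \<times> UNIV. \<exists>\<Delta>. form_dd N (snd q) (\<lambda>x. fps_nth (?D x * log_fps (x (fst q))) (snd q)) \<Delta> \<and>
     (\<forall>j x. \<Delta> j x x = fps_nth (gi (fst q) j x) (snd q))"
    unfolding fps_dd_def by auto
  from this[unfolded bchoice_iff] obtain \<Delta>q where \<Delta>q: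
    "\<forall>q\<in>{..N} \<times> UNIV. form_dd N (snd q) (\<lambda>x. fps_nth (?D x * log_fps (x (fst q))) (snd q)) (\<Delta>q q) \<and>
     (\<forall>j x. \<Delta>q q j x x = fps_nth (gi (fst q) j x) (snd q))" by (elim exE)
  define \<Delta> where "\<Delta> i k = \<Delta>q (i, k)" for i k
  have \<Delta>: "form_dd N k (\<lambda>x. fps_nth (?D x * log_fps (x i)) k) (\<Delta> i k)"
    "\<Delta> i k j x x = fps_nth (gi i j x) k" if "i \<le> N" for i k j x
    using bspec[OF \<Delta>q, of "(i, k)"] that by (simp_all add: \<Delta>_def)
  define g where "g l j x = (\<Sum>i\<le>N. fps_const (l i) * gi i j x)" for l j x
  have ff: "fibre_fps N \<beta> l x = (\<Sum>i\<le>N. fps_const (l i) * (?D x * log_fps (x i)))" for l x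
    by (simp add: fibre_fps_def log_sum_def sum_distrib_left mult_ac)
  have "form_dd N k (fibre_eq N \<beta> l k) (\<lambda>j x y. \<Sum>i\<le>N. l i * \<Delta> i k j x y)" for l k
  proof -
    have "fibre_eq N \<beta> l k = (\<lambda>x. \<Sum>i\<le>N. l i * fps_nth (?D x * log_fps (x i)) k)"
      by (simp add: fun_eq_iff fibre_eq_def ff fps_sum_nth)
    moreover have "form_dd N k (\<lambda>x. \<Sum>i\<le>N. l i * fps_nth (?D x * log_fps (x i)) k)
        (\<lambda>j x y. \<Sum>i\<le>N. l i * \<Delta> i k j x y)"
      by (intro form_dd_sum form_dd_cmult \<Delta>(1)) auto
    ultimately show ?thesis by simp
  qed
  moreover have "continuous_on UNIV (\<lambda>p. \<Delta> i k j (fst p) (snd p))" if "i \<le> N" for i k j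
    using form_dd_continuous[OF \<Delta>(1)[OF that]] by blast
  moreover have "(\<Sum>i\<le>N. l i * \<Delta> i k j x x) = fps_nth (g l j x) k" for l k j x
    by (simp add: g_def \<Delta>(2) fps_sum_nth)
  moreover have "g l j x * fps_of_poly [:1, - x j:] =
       - fps_X * (fps_const (l j) * ?D x + of_nat (\<beta> j - 1) * fibre_fps N \<beta> l x)" if "j \<le> N" for l j x
  proof -
    have "g l j x * fps_of_poly [:1, - x j:] = (\<Sum>i\<le>N. fps_const (l i) *
        (?D x * (gL i j x * fps_of_poly [:1, - x j:]) + (gD j x * fps_of_poly [:1, - x j:]) * log_fps (x i)))"
      by (simp add: g_def gi_def sum_distrib_right sum_distrib_left algebra_simps)
    also have "\<dots> = (\<Sum>i\<le>N. (if i = j then - fps_X * (fps_const (l j) * ?D x) else 0) -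
        fps_X * (of_nat (\<beta> j - 1) * (fps_const (l i) * (?D x * log_fps (x i)))))"
      unfolding gD(2) using gL(2) that by (intro sum.cong) (auto simp: algebra_simps)
    also have "\<dots> = - fps_X * (fps_const (l j) * ?D x) - fps_X * (of_nat (\<beta> j - 1) * fibre_fps N \<beta> l x)"
      using that by (simp add: sum_subtractf ff sum_distrib_left)
    finally show ?thesis by (simp add: algebra_simps)
  qed
  ultimately show ?thesis by blast
qed

section \<open>The differential equation satisfied by the truncated primitive\<close>

definition nonzero_values :: "nat \<Rightarrow> (nat \<Rightarrow> complex) \<Rightarrow> complex set" where
  "nonzero_values N x = x ` {..N} - {0}"

definition radical_poly :: "complex set \<Rightarrow> complex poly" where
  "radical_poly Y = (\<Prod>y\<in>Y. [:1, - y:])"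

text \<open>The numerator of the sum of w_j / (1 - x_j u) over the common denominator
  \<open>radical_poly (nonzero_values N x)\<close>. Coinciding and vanishing \<open>x j\<close> are
  permitted, since solutions are not yet known to be separated; for \<open>x j = 0\<close> the
  cofactor is the whole radical.\<close>

definition weighted_cofactors :: "nat \<Rightarrow> (nat \<Rightarrow> complex) \<Rightarrow> (nat \<Rightarrow> complex) \<Rightarrow> complex poly" where
  "weighted_cofactors N x w = (\<Sum>j\<le>N. Polynomial.smult (w j) (radical_poly (nonzero_values N x - {x j})))"

definition fibre_trunc :: "nat \<Rightarrow> (nat \<Rightarrow> nat) \<Rightarrow> (nat \<Rightarrow> complex) \<Rightarrow> nat \<Rightarrow> (nat \<Rightarrow> complex) \<Rightarrow> complex poly" where
  "fibre_trunc N \<beta> l d x = (\<Sum>k\<le>d. Polynomial.monom (fibre_eq N \<beta> l k x) k)"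

lemma finite_nonzero_values [simp]: "finite (nonzero_values N x)"
  by (simp add: nonzero_values_def)

lemma radical_poly_remove: "finite Y \<Longrightarrow> y \<in> Y \<Longrightarrow> radical_poly Y = [:1, - y:] * radical_poly (Y - {y})"
  by (simp add: radical_poly_def prod.remove)

lemma poly_radical_eq_0_iff:
  assumes "finite Y"
  shows "poly (radical_poly Y) u = 0 \<longleftrightarrow> u \<noteq> 0 \<and> 1 / u \<in> Y"
proof -
  have "poly (radical_poly Y) u = 0 \<longleftrightarrow> (\<exists>y\<in>Y. 1 - u * y = 0)"
    using assms by (simp add: radical_poly_def poly_prod)
  also have "\<dots> \<longleftrightarrow> u \<noteq> 0 \<and> 1 / u \<in> Y"
  proof
    assume "\<exists>y\<in>Y. 1 - u * y = 0"
    then obtain y where y: "y \<in> Y" "u * y = 1" by auto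
    then have "u \<noteq> 0" by auto
    with y have "y = 1 / u" by (simp add: field_simps)
    with y \<open>u \<noteq> 0\<close> show "u \<noteq> 0 \<and> 1 / u \<in> Y" by simp
  next
    assume "u \<noteq> 0 \<and> 1 / u \<in> Y"
    then show "\<exists>y\<in>Y. 1 - u * y = 0" by (intro bexI[of _ "1 / u"]) auto
  qed
  finally show ?thesis .
qed

lemma degree_radical: "finite Y \<Longrightarrow> Polynomial.degree (radical_poly Y) \<le> card Y"
proof -
  assume "finite Y"
  then have "Polynomial.degree (radical_poly Y) \<le> sum (Polynomial.degree \<circ> (\<lambda>y. [:1, - y:])) Y"
    unfolding radical_poly_def by (rule degree_prod_sum_le)
  also have "\<dots> \<le> (\<Sum>y\<in>Y. 1)" by (rule sum_mono) simp
  finally show ?thesis by simp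
qed

lemma degree_reduced_poles:
  "finite J \<Longrightarrow> Polynomial.degree (reduced_poles J \<beta> x) \<le> (\<Sum>j\<in>J. \<beta> j - 1)"
proof -
  assume J: "finite J"
  have "Polynomial.degree (reduced_poles J \<beta> x) \<le>
      sum (Polynomial.degree \<circ> (\<lambda>j. [:1, - x j:] ^ (\<beta> j - 1))) J"
    unfolding reduced_poles_def by (rule degree_prod_sum_le[OF J])
  also have "\<dots> \<le> (\<Sum>j\<in>J. \<beta> j - 1)"
  proof (rule sum_mono)
    fix j
    have "Polynomial.degree ([:1, - x j:] ^ (\<beta> j - 1)) \<le> Polynomial.degree [:1, - x j:] * (\<beta> j - 1)"
      by (rule degree_power_le)
    also have "\<dots> \<le> \<beta> j - 1" by simp
    finally show "(Polynomial.degree \<circ> (\<lambda>j. [:1, - x j:] ^ (\<beta> j - 1))) j \<le> \<beta> j - 1" by simp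
  qed
  finally show ?thesis .
qed

lemma degree_fibre_trunc: "Polynomial.degree (fibre_trunc N \<beta> l d x) \<le> d"
  unfolding fibre_trunc_def
  by (rule degree_sum_le) (auto intro: order_trans[OF degree_monom_le])

lemma degree_weighted_cofactors:
  assumes "\<And>j. j \<le> N \<Longrightarrow> w j \<noteq> 0 \<Longrightarrow> x j \<noteq> 0" "nonzero_values N x \<noteq> {}"
  shows "Polynomial.degree (weighted_cofactors N x w) \<le> card (nonzero_values N x) - 1"
  unfolding weighted_cofactors_def
proof (rule degree_sum_le)
  fix j assume j: "j \<in> {..N}"
  show "Polynomial.degree (Polynomial.smult (w j) (radical_poly (nonzero_values N x - {x j}))) \<le> card (nonzero_values N x) - 1"
  proof (cases "w j = 0")
    case False
    with assms(1)[of j] j have "x j \<in> nonzero_values N x" by (auto simp: nonzero_values_def)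
    then show ?thesis using False degree_radical[of "nonzero_values N x - {x j}"] by simp
  qed simp
qed simp

text \<open>The logarithmic derivative of D with denominators cleared by the radical. The product
  runs over \<open>J\<close> to permit induction, while the radical remains that of all the
  points.\<close>

lemma pderiv_reduced_poles:
  assumes "finite J" "J \<subseteq> {..N}"
  shows "pderiv (reduced_poles J \<beta> x) * radical_poly (nonzero_values N x) =
    - (\<Sum>j\<in>J. Polynomial.smult (of_nat (\<beta> j - 1) * x j) (radical_poly (nonzero_values N x - {x j}))) * reduced_poles J \<beta> x"
  using assms
proof (induction J rule: finite_induct)
  case empty
  then show ?case by (simp add: reduced_poles_def)
next
  case (insert i J)
  let ?Y = "nonzero_values N x"
  let ?n = "\<beta> i - 1"
  have pw: "pderiv ([:1, - x i:] ^ n) * radical_poly ?Y =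
      - Polynomial.smult (of_nat n * x i) (radical_poly (?Y - {x i})) * [:1, - x i:] ^ n" for n
  proof (cases "x i = 0")
    case False
    then have "x i \<in> ?Y" using insert by (auto simp: nonzero_values_def)
    then have E: "radical_poly ?Y = [:1, - x i:] * radical_poly (?Y - {x i})" by (intro radical_poly_remove) simp
    show ?thesis
    proof (cases n)
      case (Suc m)
      have "pderiv ([:1, - x i:] ^ Suc m) = Polynomial.smult (- (of_nat (Suc m) * x i)) ([:1, - x i:] ^ m)"
        by (subst pderiv_power_Suc) (simp add: pderiv_pCons mult.commute[of "x i"])
      moreover have "Polynomial.smult (- c) P * (L * R) = - Polynomial.smult c R * (L * P)"
        for c and P L R :: "complex poly" by (simp add: mult_ac)
      ultimately show ?thesis unfolding E Suc power_Suc by (simp only:)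
    qed (simp add: pderiv_1)
  qed (simp add: one_pCons[symmetric] pderiv_1)
  have eq: "reduced_poles (insert i J) \<beta> x = [:1, - x i:] ^ ?n * reduced_poles J \<beta> x"
    using insert by (simp add: reduced_poles_def)
  have "pderiv (reduced_poles (insert i J) \<beta> x) * radical_poly ?Y =
      [:1, - x i:] ^ ?n * (pderiv (reduced_poles J \<beta> x) * radical_poly ?Y) +
      reduced_poles J \<beta> x * (pderiv ([:1, - x i:] ^ ?n) * radical_poly ?Y)"
    unfolding eq pderiv_mult by (simp add: algebra_simps)
  also have "pderiv (reduced_poles J \<beta> x) * radical_poly ?Y =
    - (\<Sum>j\<in>J. Polynomial.smult (of_nat (\<beta> j - 1) * x j) (radical_poly (?Y - {x j}))) * reduced_poles J \<beta> x"
    using insert by simp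
  finally have *: "pderiv (reduced_poles (insert i J) \<beta> x) * radical_poly ?Y =
      [:1, - x i:] ^ ?n * (- (\<Sum>j\<in>J. Polynomial.smult (of_nat (\<beta> j - 1) * x j) (radical_poly (?Y - {x j}))) * reduced_poles J \<beta> x) +
      reduced_poles J \<beta> x * (- Polynomial.smult (of_nat ?n * x i) (radical_poly (?Y - {x i})) * [:1, - x i:] ^ ?n)"
    unfolding pw .
  have alg: "P * (- S * R) + R * (- T * P) = - (T + S) * (P * R)" for P S R T :: "complex poly"
    by (simp add: algebra_simps)
  show ?case unfolding * alg sum.insert[OF insert.hyps] unfolding eq ..
qed

lemma fps_deriv_log_fps: "fps_deriv (log_fps y) * fps_of_poly [:1, - y:] = - fps_const y"
proof (rule fps_ext)
  fix k
  show "fps_nth (fps_deriv (log_fps y) * fps_of_poly [:1, - y:]) k = fps_nth (- fps_const y) k"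
    unfolding fps_mult_linear_nth
    by (cases k) (auto simp: log_fps_def field_simps of_nat_Suc[symmetric] simp del: of_nat_Suc)
qed

lemma fps_deriv_log_sum:
  "fps_deriv (log_sum N l x) * fps_of_poly (radical_poly (nonzero_values N x)) =
    - fps_of_poly (weighted_cofactors N x (\<lambda>j. l j * x j))"
proof -
  let ?Y = "nonzero_values N x"
  have "fps_deriv (log_fps (x j)) * fps_of_poly (radical_poly ?Y) =
      - fps_of_poly (Polynomial.smult (x j) (radical_poly (?Y - {x j})))" if "j \<le> N" for j
  proof (cases "x j = 0")
    case True
    then have "fps_deriv (log_fps (x j)) = 0"
      using fps_deriv_log_fps[of "x j"] by (simp add: one_pCons[symmetric])
    with True show ?thesis by simp
  next
    case False
    then have "x j \<in> ?Y" using that by (auto simp: nonzero_values_def)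
    then have E: "radical_poly ?Y = [:1, - x j:] * radical_poly (?Y - {x j})" by (intro radical_poly_remove) simp
    have "fps_deriv (log_fps (x j)) * fps_of_poly (radical_poly ?Y) =
       (fps_deriv (log_fps (x j)) * fps_of_poly [:1, - x j:]) * fps_of_poly (radical_poly (?Y - {x j}))"
      unfolding E fps_of_poly_mult by (simp only: mult.assoc)
    then show ?thesis unfolding fps_deriv_log_fps by (simp add: fps_of_poly_smult)
  qed
  then have "(\<Sum>j\<le>N. fps_const (l j) * (fps_deriv (log_fps (x j)) * fps_of_poly (radical_poly ?Y))) =
     (\<Sum>j\<le>N. fps_const (l j) * - fps_of_poly (Polynomial.smult (x j) (radical_poly (?Y - {x j}))))"
    by (intro sum.cong) auto
  then show ?thesis
    by (simp add: log_sum_def weighted_cofactors_def fps_deriv_sum sum_distrib_right fps_of_poly_sum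
        fps_of_poly_smult sum_negf mult.assoc fps_const_mult[symmetric] del: fps_const_mult)
qed

lemma fibre_fps_split:
  assumes "\<forall>k\<in>{d+1..d+N}. fibre_eq N \<beta> l k x = 0"
  shows "\<exists>\<rho>. fibre_fps N \<beta> l x = fps_of_poly (fibre_trunc N \<beta> l d x) + fps_X ^ (d + N + 1) * \<rho>"
proof (intro exI fps_ext)
  fix k
  have c: "Polynomial.coeff (fibre_trunc N \<beta> l d x) k = (if k \<le> d then fibre_eq N \<beta> l k x else 0)"
    by (simp add: fibre_trunc_def coeff_sum)
  show "fps_nth (fibre_fps N \<beta> l x) k =
    fps_nth (fps_of_poly (fibre_trunc N \<beta> l d x) + fps_X ^ (d + N + 1) * fps_shift (d + N + 1) (fibre_fps N \<beta> l x)) k"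
    using assms unfolding fps_add_nth fps_X_power_mult_nth fps_of_poly_nth c fps_shift_nth
    by (cases "k \<le> d"; cases "k \<le> d + N") (auto simp: fibre_eq_def)
qed

lemma poly_eq_monomI:
  assumes "Polynomial.degree p \<le> n" "\<And>k. k < n \<Longrightarrow> Polynomial.coeff p k = 0"
  shows "p = Polynomial.monom (Polynomial.coeff p n) n"
proof (rule poly_eqI)
  fix k
  show "Polynomial.coeff p k = Polynomial.coeff (Polynomial.monom (Polynomial.coeff p n) n) k"
    using assms by (cases k n rule: linorder_cases) (auto simp: coeff_eq_0)
qed

text \<open>
  With \<open>q\<close> the truncation, this is the identity \<open>(q/D)' = \<Sum>\<^sub>j - l\<^sub>j x\<^sub>j / (1 - x\<^sub>j u) + \<kappa> u^(d+N) / (D E)\<close>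
  after clearing denominators, \<open>E\<close> being the radical.
\<close>

lemma fibre_identity:
  assumes eq: "\<forall>k\<in>{d+1..d+N}. fibre_eq N \<beta> l k x = 0"
    and e: "(\<Sum>j\<le>N. \<beta> j - 1) \<le> d"
    and ne: "nonzero_values N x \<noteq> {}"
  shows "\<exists>\<kappa>. radical_poly (nonzero_values N x) * pderiv (fibre_trunc N \<beta> l d x) +
      weighted_cofactors N x (\<lambda>j. of_nat (\<beta> j - 1) * x j) * fibre_trunc N \<beta> l d x +
      weighted_cofactors N x (\<lambda>j. l j * x j) * reduced_poles {..N} \<beta> x = Polynomial.monom \<kappa> (d + N) \<and>
      (card (nonzero_values N x) \<le> N \<longrightarrow> \<kappa> = 0)"
proof -
  let ?Y = "nonzero_values N x"
  let ?E = "radical_poly ?Y" and ?q = "fibre_trunc N \<beta> l d x" and ?D = "reduced_poles {..N} \<beta> x"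
  let ?K1 = "weighted_cofactors N x (\<lambda>j. of_nat (\<beta> j - 1) * x j)"
  let ?K2 = "weighted_cofactors N x (\<lambda>j. l j * x j)"
  let ?W = "?E * pderiv ?q + ?K1 * ?q + ?K2 * ?D"
  let ?n = "d + N + 1"
  obtain \<rho> where \<rho>: "fibre_fps N \<beta> l x = fps_of_poly ?q + fps_X ^ ?n * \<rho>"
    using fibre_fps_split[OF eq] by blast
  have K1: "pderiv ?D * ?E = - ?K1 * ?D"
    using pderiv_reduced_poles[of "{..N}" N \<beta> x] by (simp add: weighted_cofactors_def)
  have "fps_deriv (fibre_fps N \<beta> l x) * fps_of_poly ?E =
      fps_of_poly (pderiv ?D * ?E) * log_sum N l x + fps_of_poly ?D * (fps_deriv (log_sum N l x) * fps_of_poly ?E)"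
    by (simp add: fibre_fps_def fps_of_poly_mult fps_of_poly_pderiv algebra_simps)
  also have "\<dots> = - fps_of_poly ?K1 * fibre_fps N \<beta> l x - fps_of_poly ?D * fps_of_poly ?K2"
    unfolding K1 fps_deriv_log_sum by (simp add: fps_of_poly_mult fps_of_poly_uminus fibre_fps_def mult.assoc)
  finally have "(fps_of_poly (pderiv ?q) + fps_deriv (fps_X ^ ?n * \<rho>)) * fps_of_poly ?E =
      - fps_of_poly ?K1 * (fps_of_poly ?q + fps_X ^ ?n * \<rho>) - fps_of_poly ?D * fps_of_poly ?K2"
    unfolding \<rho> by (simp add: fps_of_poly_pderiv)
  moreover have "e * a + k1 * q + k2 * r = - (b * e + k1 * c)"
    if "(a + b) * e = - k1 * (q + c) - r * k2" for a b c e k1 k2 q r :: "complex fps"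
  proof -
    have "e * a + k1 * q + k2 * r = (a + b) * e - b * e + k1 * q + k2 * r" by (simp add: algebra_simps)
    then show ?thesis unfolding that by (simp add: algebra_simps)
  qed
  ultimately have W: "fps_of_poly ?W = - (fps_deriv (fps_X ^ ?n * \<rho>) * fps_of_poly ?E + fps_of_poly ?K1 * (fps_X ^ ?n * \<rho>))"
    unfolding fps_of_poly_add fps_of_poly_mult by blast
  have dX: "fps_deriv (fps_X ^ ?n * \<rho>) = fps_X ^ (d + N) * (of_nat ?n * \<rho> + fps_X * fps_deriv \<rho>)"
  proof -
    have "fps_deriv (fps_X ^ ?n :: complex fps) = of_nat ?n * fps_X ^ (d + N)"
      unfolding fps_deriv_power fps_of_nat fps_deriv_fps_X by simp
    then show ?thesis unfolding fps_deriv_mult by (simp add: algebra_simps)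
  qed
  have W2: "fps_of_poly ?W = fps_X ^ (d + N) * - ((of_nat ?n * \<rho> + fps_X * fps_deriv \<rho>) * fps_of_poly ?E +
      fps_of_poly ?K1 * (fps_X * \<rho>))"
    unfolding W dX by (simp add: algebra_simps)
  \<comment> \<open>Differentiating the remainder, which starts in degree d + N + 1, lowers its
    order by one only.\<close>
  have low: "Polynomial.coeff ?W k = 0" if "k < d + N" for k
  proof -
    have "fps_nth (fps_of_poly ?W) k = 0" unfolding W2 using that by (simp only: fps_X_power_mult_nth if_True)
    then show ?thesis by simp
  qed
  have cY: "card ?Y \<ge> 1" using ne by (simp add: Suc_le_eq card_gt_0_iff)
  have dE: "Polynomial.degree ?E \<le> card ?Y" by (rule degree_radical) simp
  have dK: "Polynomial.degree ?K1 \<le> card ?Y - 1" "Polynomial.degree ?K2 \<le> card ?Y - 1"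
    by (rule degree_weighted_cofactors[OF _ ne]; simp)+
  have dq: "Polynomial.degree ?q \<le> d" by (rule degree_fibre_trunc)
  have dD: "Polynomial.degree ?D \<le> d" using degree_reduced_poles[of "{..N}" \<beta> x] e by simp
  have "Polynomial.degree (?E * pderiv ?q) \<le> card ?Y + d - 1"
  proof (cases "Polynomial.degree ?q = 0")
    case True
    then show ?thesis by (simp add: pderiv_eq_0_iff[THEN iffD2])
  next
    case False
    then show ?thesis using degree_mult_le[of ?E "pderiv ?q"] dE dq by (simp add: degree_pderiv)
  qed
  moreover have "Polynomial.degree (?K1 * ?q) \<le> card ?Y + d - 1"
    using degree_mult_le[of ?K1 ?q] dK dq cY by linarith
  moreover have "Polynomial.degree (?K2 * ?D) \<le> card ?Y + d - 1"
    using degree_mult_le[of ?K2 ?D] dK dD cY by linarith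
  \<comment> \<open>The number of distinct nonzero poles is at most N + 1, so degree and order of
    vanishing leave a single monomial of degree d + N, and nothing at all if two poles coincide or
    one is 0.\<close>
  ultimately have dW: "Polynomial.degree ?W \<le> card ?Y + d - 1" by (intro degree_add_le)
  have "card ?Y \<le> card (x ` {..N})" unfolding nonzero_values_def by (rule card_mono) auto
  also have "\<dots> \<le> N + 1" using card_image_le[of "{..N}" x] by simp
  finally have "Polynomial.degree ?W \<le> d + N" using dW by simp
  from poly_eq_monomI[OF this low] have "?W = Polynomial.monom (Polynomial.coeff ?W (d + N)) (d + N)" .
  moreover have "Polynomial.coeff ?W (d + N) = 0" if "card ?Y \<le> N"
    by (rule coeff_eq_0) (use dW that cY in linarith)
  ultimately show ?thesis by blast
qed

text \<open>At u = 1/y all cofactors vanish except those of the indices with \<open>x j = y\<close>;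
  this evaluation plays the part of taking a residue there.\<close>

lemma poly_weighted_cofactors:
  assumes "y \<in> nonzero_values N x"
  shows "poly (weighted_cofactors N x w) (1 / y) =
    (\<Sum>j | j \<le> N \<and> x j = y. w j) * poly (radical_poly (nonzero_values N x - {y})) (1 / y)"
proof -
  let ?Y = "nonzero_values N x"
  have y: "y \<noteq> 0" using assms by (simp add: nonzero_values_def)
  have "poly (weighted_cofactors N x w) (1 / y) =
      (\<Sum>j\<le>N. w j * poly (radical_poly (?Y - {x j})) (1 / y))"
    by (simp add: weighted_cofactors_def poly_sum)
  also have "\<dots> = (\<Sum>j\<in>{j. j \<le> N \<and> x j = y}. w j * poly (radical_poly (?Y - {x j})) (1 / y))"
  proof (rule sum.mono_neutral_right)
    show "\<forall>i\<in>{..N} - {j. j \<le> N \<and> x j = y}. w i * poly (radical_poly (?Y - {x i})) (1 / y) = 0"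
    proof
      fix i assume "i \<in> {..N} - {j. j \<le> N \<and> x j = y}"
      then have "y \<in> ?Y - {x i}" using assms by auto
      then show "w i * poly (radical_poly (?Y - {x i})) (1 / y) = 0"
        using y by (simp add: poly_radical_eq_0_iff)
    qed
  qed auto
  also have "\<dots> = (\<Sum>j | j \<le> N \<and> x j = y. w j) * poly (radical_poly (?Y - {y})) (1 / y)"
    unfolding sum_distrib_right by (rule sum.cong) auto
  finally show ?thesis .
qed

lemma poly_radical_remove_nonzero:
  assumes "y \<in> nonzero_values N x"
  shows "poly (radical_poly (nonzero_values N x - {y})) (1 / y) \<noteq> 0"
  using assms by (simp add: poly_radical_eq_0_iff)

text \<open>
  The logarithmic differential \<open>\<Sum>\<^sub>j - l\<^sub>j x\<^sub>j / (1 - x\<^sub>j u) du\<close> is then the differential of the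
  rational function \<open>q / D\<close>, so its residue at \<open>u = 1/y\<close> vanishes; algebraically, one compares the
  orders of vanishing at \<open>1/y\<close>.
\<close>

lemma exact_imp_group_residue_zero:
  assumes id: "radical_poly (nonzero_values N x) * pderiv q +
      weighted_cofactors N x (\<lambda>j. of_nat (\<beta> j - 1) * x j) * q +
      weighted_cofactors N x (\<lambda>j. l j * x j) * reduced_poles {..N} \<beta> x = 0"
    and y: "y \<in> nonzero_values N x"
  shows "(\<Sum>j | j \<le> N \<and> x j = y. l j) = 0"
proof -
  let ?Y = "nonzero_values N x" and ?t = "[:1, - y:]"
  let ?J = "{j. j \<le> N \<and> x j = y}"
  define K1 where "K1 = weighted_cofactors N x (\<lambda>j. of_nat (\<beta> j - 1) * x j)"
  define K2 where "K2 = weighted_cofactors N x (\<lambda>j. l j * x j)"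
  define Ey where "Ey = radical_poly (?Y - {y})"
  define m where "m = (\<Sum>j\<in>?J. \<beta> j - 1)"
  define D1 where "D1 = reduced_poles ({..N} - ?J) \<beta> x"
  have y0: "y \<noteq> 0" using y by (simp add: nonzero_values_def)
  have t0: "poly ?t (1 / y) = 0" using y0 by simp
  have tne: "?t \<noteq> 0" by simp
  have E: "radical_poly ?Y = ?t * Ey" unfolding Ey_def by (rule radical_poly_remove) (use y in auto)
  have Ey0: "poly Ey (1 / y) \<noteq> 0" unfolding Ey_def by (rule poly_radical_remove_nonzero[OF y])
  have D: "reduced_poles {..N} \<beta> x = ?t ^ m * D1"
  proof -
    have "reduced_poles {..N} \<beta> x = reduced_poles ?J \<beta> x * D1"
      unfolding reduced_poles_def D1_def
      by (subst prod.union_disjoint[symmetric]) (auto intro: prod.cong)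
    moreover have "reduced_poles ?J \<beta> x = (\<Prod>j\<in>?J. ?t ^ (\<beta> j - 1))"
      unfolding reduced_poles_def by (rule prod.cong) auto
    ultimately show ?thesis by (simp add: m_def power_sum)
  qed
  have D10: "poly D1 (1 / y) \<noteq> 0"
    unfolding D1_def reduced_poles_def poly_prod
    using y0 by (auto simp: field_simps)
  have K1y: "poly K1 (1 / y) = of_nat m * y * poly Ey (1 / y)"
  proof -
    have "(\<Sum>j\<in>?J. of_nat (\<beta> j - 1) * x j) = (\<Sum>j\<in>?J. of_nat (\<beta> j - 1)) * y"
      unfolding sum_distrib_right by (rule sum.cong) auto
    then show ?thesis unfolding K1_def poly_weighted_cofactors[OF y] Ey_def m_def by simp
  qed
  have K2y: "poly K2 (1 / y) = (\<Sum>j\<in>?J. l j) * y * poly Ey (1 / y)"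
  proof -
    have "(\<Sum>j\<in>?J. l j * x j) = (\<Sum>j\<in>?J. l j) * y"
      unfolding sum_distrib_right by (rule sum.cong) auto
    then show ?thesis unfolding K2_def poly_weighted_cofactors[OF y] Ey_def by simp
  qed
  have "poly K2 (1 / y) = 0"
  proof (cases "q = 0")
    case True
    then have "K2 * (?t ^ m * D1) = 0" using id unfolding K1_def[symmetric] K2_def[symmetric] D by simp
    then have "K2 * D1 = 0" using tne by (auto simp del: mult_pCons_left mult_pCons_right)
    then have "poly K2 (1 / y) * poly D1 (1 / y) = 0" by (metis poly_mult poly_0)
    with D10 show ?thesis by simp
  next
    case False
    \<comment> \<open>The orders of vanishing at 1/y to be compared are n for \<open>q\<close> and m
      for D.\<close>
    define n where "n = Polynomial.order (1 / y) q"
    from order_decomp[OF False, of "1 / y"] obtain q0 where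
      q0: "q = [:- (1 / y), 1:] ^ n * q0" "\<not> [:- (1 / y), 1:] dvd q0" unfolding n_def by auto
    define q1 where "q1 = Polynomial.smult ((- 1 / y) ^ n) q0"
    have lin: "[:- (1 / y), 1:] = Polynomial.smult (- 1 / y) ?t" using y0 by simp
    have q: "q = ?t ^ n * q1" unfolding q0(1) lin q1_def smult_power by simp
    have q10: "poly q1 (1 / y) \<noteq> 0" using q0(2) y0 by (simp add: q1_def poly_eq_0_iff_dvd)
    \<comment> \<open>\<open>B\<close> is what remains of the first two summands after extracting
      the n-th power of \<open>?t\<close>. Its value at 1/y carries the factor m - n, as for the
      derivative of a function of order n - m.\<close>
    define B where "B = (K1 - Polynomial.smult (of_nat n * y) Ey) * q1 + ?t * Ey * pderiv q1"
    have By: "poly B (1 / y) = (of_nat m - of_nat n) * y * poly Ey (1 / y) * poly q1 (1 / y)"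
      unfolding B_def poly_add poly_mult poly_diff poly_smult t0 K1y by (simp add: algebra_simps)
    have dq: "radical_poly ?Y * pderiv q = ?t ^ n * (?t * Ey * pderiv q1 - Polynomial.smult (of_nat n * y) Ey * q1)"
    proof (cases n)
      case 0
      then show ?thesis unfolding q E by simp
    next
      case (Suc k)
      have "pderiv (?t ^ Suc k) = Polynomial.smult (- (of_nat (Suc k) * y)) (?t ^ k)"
        by (subst pderiv_power_Suc) (simp add: pderiv_pCons mult.commute[of y])
      moreover have "T * Ey * (T * P * R + r * Polynomial.smult (- c) P) =
         (T * P) * (T * Ey * R - Polynomial.smult c Ey * r)" for T P R r :: "complex poly" and c
        by (simp add: algebra_simps)
      ultimately show ?thesis unfolding q E Suc pderiv_mult power_Suc by (simp only:)
    qed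
    have "?t ^ n * B + ?t ^ m * (K2 * D1) = 0"
    proof -
      have "?t ^ n * B + ?t ^ m * (K2 * D1) = radical_poly ?Y * pderiv q + K1 * q + K2 * reduced_poles {..N} \<beta> x"
        unfolding dq D B_def unfolding q by (simp only: algebra_simps)
      with id show ?thesis unfolding K1_def K2_def by simp
    qed
    then have sum0: "?t ^ n * B + ?t ^ m * (K2 * D1) = 0" .
    show ?thesis
    \<comment> \<open>If n < m, the factor m - n would have to vanish, which is absurd. Otherwise
      the contribution of \<open>B\<close> vanishes at 1/y, by a positive power of \<open>?t\<close>
      if n > m and by the factor m - n if n = m, and \<open>K2\<close> has to vanish there.\<close>
    proof (cases "n < m")
      case True
      then have "?t ^ m = ?t ^ n * ?t ^ (m - n)" by (simp add: power_add[symmetric])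
      with sum0 have "?t ^ n * (B + ?t ^ (m - n) * (K2 * D1)) = 0" by (simp only: algebra_simps)
      then have "B + ?t ^ (m - n) * (K2 * D1) = 0" using tne by (metis mult_eq_0_iff power_not_zero)
      then have "poly B (1 / y) + poly ?t (1 / y) ^ (m - n) * poly (K2 * D1) (1 / y) = 0"
        by (metis poly_0 poly_add poly_mult poly_power)
      then have "poly B (1 / y) = 0" using True unfolding t0 by (simp add: power_0_left)
      then have "(of_nat m - of_nat n :: complex) = 0" unfolding By using y0 Ey0 q10 by simp
      with True show ?thesis by simp
    next
      case False
      then have "?t ^ n = ?t ^ m * ?t ^ (n - m)" by (simp add: power_add[symmetric])
      with sum0 have "?t ^ m * (?t ^ (n - m) * B + K2 * D1) = 0" by (simp only: algebra_simps)
      then have "?t ^ (n - m) * B + K2 * D1 = 0" using tne by (metis mult_eq_0_iff power_not_zero)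
      then have sum1: "poly ?t (1 / y) ^ (n - m) * poly B (1 / y) + poly K2 (1 / y) * poly D1 (1 / y) = 0"
        by (metis poly_0 poly_add poly_mult poly_power)
      have "poly ?t (1 / y) ^ (n - m) * poly B (1 / y) = 0"
      proof (cases "n = m")
        case True
        then show ?thesis unfolding By by simp
      next
        case n: False
        then show ?thesis unfolding t0 using \<open>\<not> n < m\<close> by (simp add: power_0_left)
      qed
      from sum1[unfolded this] show ?thesis using D10 by simp
    qed
  qed
  then show ?thesis unfolding K2y using y0 Ey0 by simp
qed

text \<open>Only sets avoiding the pole at 0 are listed: all residues sum to zero, so a set
  containing that pole has, up to sign, the sum of its complement.\<close>

definition nonresonant :: "nat \<Rightarrow> (nat \<Rightarrow> complex) \<Rightarrow> bool" where
  "nonresonant N l \<longleftrightarrow> (\<forall>J. J \<noteq> {} \<and> J \<subseteq> {..N} \<longrightarrow> (\<Sum>j\<in>J. l j) \<noteq> 0)"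

definition separated :: "nat \<Rightarrow> (nat \<Rightarrow> complex) \<Rightarrow> bool" where
  "separated N x \<longleftrightarrow> inj_on x {..N} \<and> (\<forall>j\<le>N. x j \<noteq> 0)"

lemma separated_nonzero_values:
  assumes "separated N x"
  shows "nonzero_values N x = x ` {..N}" "card (nonzero_values N x) = Suc N" "nonzero_values N x \<noteq> {}"
proof -
  show *: "nonzero_values N x = x ` {..N}" using assms by (auto simp: nonzero_values_def separated_def)
  show "card (nonzero_values N x) = Suc N"
    unfolding * using assms by (simp add: separated_def card_image)
  then show "nonzero_values N x \<noteq> {}" by auto
qed

text \<open>If \<kappa> were 0 in the fibre identity, each group of coinciding nonzero poles would
  have residue sum 0. Hence \<kappa> is nonzero, which requires N + 1 distinct nonzero
  values.\<close>

lemma nonresonant_fibre_separated: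
  assumes eq: "\<forall>k\<in>{d+1..d+N}. fibre_eq N \<beta> l k x = 0"
    and e: "(\<Sum>j\<le>N. \<beta> j - 1) \<le> d"
    and l: "nonresonant N l" and x: "\<exists>i\<le>N. x i \<noteq> 0"
  shows "separated N x"
proof -
  let ?Y = "nonzero_values N x"
  have ne: "?Y \<noteq> {}" using x by (auto simp: nonzero_values_def)
  obtain \<kappa> where \<kappa>: "radical_poly ?Y * pderiv (fibre_trunc N \<beta> l d x) +
      weighted_cofactors N x (\<lambda>j. of_nat (\<beta> j - 1) * x j) * fibre_trunc N \<beta> l d x +
      weighted_cofactors N x (\<lambda>j. l j * x j) * reduced_poles {..N} \<beta> x = Polynomial.monom \<kappa> (d + N)"
      "card ?Y \<le> N \<Longrightarrow> \<kappa> = 0"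
    using fibre_identity[OF eq e ne] by blast
  have "\<kappa> \<noteq> 0"
  proof
    assume "\<kappa> = 0"
    obtain y where y: "y \<in> ?Y" using ne by blast
    have "(\<Sum>j | j \<le> N \<and> x j = y. l j) = 0"
      by (rule exact_imp_group_residue_zero[OF _ y]) (use \<kappa>(1) \<open>\<kappa> = 0\<close> in simp)
    moreover have "{j. j \<le> N \<and> x j = y} \<noteq> {} \<and> {j. j \<le> N \<and> x j = y} \<subseteq> {..N}"
      using y by (auto simp: nonzero_values_def)
    ultimately show False using l[unfolded nonresonant_def, rule_format, of "{j. j \<le> N \<and> x j = y}"] by simp
  qed
  then have c: "Suc N \<le> card ?Y" using \<kappa>(2) by (meson not_less_eq_eq)
  have "card ?Y \<le> card (x ` {..N})" by (rule card_mono) (auto simp: nonzero_values_def)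
  with c have "card (x ` {..N}) = card {..N}" using card_image_le[of "{..N}" x] by simp
  then have inj: "inj_on x {..N}" by (simp add: eq_card_imp_inj_on)
  moreover have "x j \<noteq> 0" if "j \<le> N" for j
  proof
    assume "x j = 0"
    have "?Y \<subseteq> x ` ({..N} - {j})" using \<open>x j = 0\<close> by (auto simp: nonzero_values_def)
    then have "card ?Y \<le> card (x ` ({..N} - {j}))" by (rule card_mono[rotated]) simp
    also have "\<dots> \<le> card ({..N} - {j})" by (rule card_image_le) simp
    finally show False using c that by simp
  qed
  ultimately show ?thesis by (simp add: separated_def)
qed

lemma separated_group: "separated N x \<Longrightarrow> j \<le> N \<Longrightarrow> {i. i \<le> N \<and> x i = x j} = {j}"
  by (auto simp: separated_def inj_on_def)

text \<open>For separated poles the groups are singletons, so one nonzero residue already forces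
  \<kappa> to be nonzero; no nonresonance enters.\<close>

lemma separated_identity:
  assumes eq: "\<forall>k\<in>{d+1..d+N}. fibre_eq N \<beta> l k x = 0"
    and e: "(\<Sum>j\<le>N. \<beta> j - 1) \<le> d"
    and x: "separated N x" and l: "\<exists>j\<le>N. l j \<noteq> 0"
  shows "\<exists>\<kappa>. \<kappa> \<noteq> 0 \<and> radical_poly (nonzero_values N x) * pderiv (fibre_trunc N \<beta> l d x) +
      weighted_cofactors N x (\<lambda>j. of_nat (\<beta> j - 1) * x j) * fibre_trunc N \<beta> l d x +
      weighted_cofactors N x (\<lambda>j. l j * x j) * reduced_poles {..N} \<beta> x = Polynomial.monom \<kappa> (d + N)"
proof -
  obtain \<kappa> where \<kappa>: "radical_poly (nonzero_values N x) * pderiv (fibre_trunc N \<beta> l d x) +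
      weighted_cofactors N x (\<lambda>j. of_nat (\<beta> j - 1) * x j) * fibre_trunc N \<beta> l d x +
      weighted_cofactors N x (\<lambda>j. l j * x j) * reduced_poles {..N} \<beta> x = Polynomial.monom \<kappa> (d + N)"
    using fibre_identity[OF eq e separated_nonzero_values(3)[OF x]] by blast
  have "\<kappa> \<noteq> 0"
  proof
    assume "\<kappa> = 0"
    obtain j where j: "j \<le> N" "l j \<noteq> 0" using l by blast
    have "x j \<in> nonzero_values N x" using separated_nonzero_values(1)[OF x] j by simp
    then have "(\<Sum>i | i \<le> N \<and> x i = x j. l i) = 0"
      by (rule exact_imp_group_residue_zero[rotated]) (use \<kappa> \<open>\<kappa> = 0\<close> in simp)
    then show False using j unfolding separated_group[OF x j(1)] by simp
  qed
  with \<kappa> show ?thesis by blast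
qed

text \<open>The derivative of the fibre series in the direction v satisfies a second polynomial
  identity, again with a single monomial \<mu> u^(d+N+1) on the right. Comparing it with the fibre
  identity at each 1/x_j shows that v is proportional to x, the direction of rescaling, while its
  component of index 0 is zero.\<close>

lemma fibre_nondegenerate:
  assumes eq: "\<forall>k\<in>{d+1..d+N}. fibre_eq N \<beta> l k x = 0"
    and e: "(\<Sum>j\<le>N. \<beta> j - 1) \<le> d"
    and x: "separated N x" and l: "\<exists>j\<le>N. l j \<noteq> 0"
    and g: "\<And>j. j \<le> N \<Longrightarrow> g j * fps_of_poly [:1, - x j:] =
       - fps_X * (fps_const (l j) * fps_of_poly (reduced_poles {..N} \<beta> x) +
         of_nat (\<beta> j - 1) * fibre_fps N \<beta> l x)"
    and v: "\<forall>k\<in>{d+1..d+N}. (\<Sum>j=1..N. fps_nth (g j) k * v j) = 0"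
  shows "\<forall>j\<in>{1..N}. v j = 0"
proof -
  \<comment> \<open>The normalized pole \<open>x 0\<close> does not move.\<close>
  define w where "w = v(0 := 0)"
  let ?Y = "nonzero_values N x"
  let ?E = "radical_poly ?Y" and ?q = "fibre_trunc N \<beta> l d x" and ?D = "reduced_poles {..N} \<beta> x"
  let ?K1 = "weighted_cofactors N x (\<lambda>j. of_nat (\<beta> j - 1) * w j)"
  let ?K2 = "weighted_cofactors N x (\<lambda>j. l j * w j)"
  let ?n = "d + N + 1"
  have x0: "x j \<noteq> 0" if "j \<le> N" for j using x that by (simp add: separated_def)
  have xY: "x j \<in> ?Y" if "j \<le> N" for j using separated_nonzero_values(1)[OF x] that by simp
  obtain \<kappa> where \<kappa>: "\<kappa> \<noteq> 0" "?E * pderiv ?q +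
      weighted_cofactors N x (\<lambda>j. of_nat (\<beta> j - 1) * x j) * ?q +
      weighted_cofactors N x (\<lambda>j. l j * x j) * ?D = Polynomial.monom \<kappa> (d + N)"
    using separated_identity[OF eq e x l] by blast
  obtain \<rho> where \<rho>: "fibre_fps N \<beta> l x = fps_of_poly ?q + fps_X ^ ?n * \<rho>"
    using fibre_fps_split[OF eq] by blast
  define G where "G = (\<Sum>j\<le>N. fps_const (w j) * g j)"
  have Gk: "fps_nth G k = 0" if "k \<in> {d+1..d+N}" for k
  proof -
    have "{..N} = insert 0 {1..N}" by auto
    then have "fps_nth G k = (\<Sum>j=1..N. w j * fps_nth (g j) k)"
      by (simp add: G_def fps_sum_nth w_def)
    also have "\<dots> = (\<Sum>j=1..N. fps_nth (g j) k * v j)" by (rule sum.cong) (auto simp: w_def)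
    finally show ?thesis using v that by simp
  qed
  define r where "r = (\<Sum>k\<le>d. Polynomial.monom (fps_nth G k) k)"
  have rc: "Polynomial.coeff r k = (if k \<le> d then fps_nth G k else 0)" for k
    by (simp add: r_def coeff_sum)
  have G: "G = fps_of_poly r + fps_X ^ ?n * fps_shift ?n G"
  proof (rule fps_ext)
    fix k
    show "fps_nth G k = fps_nth (fps_of_poly r + fps_X ^ ?n * fps_shift ?n G) k"
      unfolding fps_add_nth fps_X_power_mult_nth fps_of_poly_nth rc fps_shift_nth
      using Gk[of k] by (cases "k \<le> d"; cases "k \<le> d + N") auto
  qed
  have EG: "fps_of_poly ?E * G = - fps_X * (fps_of_poly ?K2 * fps_of_poly ?D + fps_of_poly ?K1 * fibre_fps N \<beta> l x)"
  proof -
    have "fps_of_poly ?E * g j = - fps_X * fps_of_poly (radical_poly (?Y - {x j})) *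
        (fps_const (l j) * fps_of_poly ?D + of_nat (\<beta> j - 1) * fibre_fps N \<beta> l x)" if "j \<le> N" for j
    proof -
      have "?E = [:1, - x j:] * radical_poly (?Y - {x j})" by (rule radical_poly_remove) (use xY that in auto)
      then have "fps_of_poly ?E * g j = fps_of_poly (radical_poly (?Y - {x j})) * (g j * fps_of_poly [:1, - x j:])"
        by (simp only: fps_of_poly_mult mult_ac)
      then show ?thesis unfolding g[OF that] by (simp only: mult_ac minus_mult_left minus_mult_right)
    qed
    then have "fps_of_poly ?E * G = (\<Sum>j\<le>N. fps_const (w j) * (- fps_X * fps_of_poly (radical_poly (?Y - {x j})) *
        (fps_const (l j) * fps_of_poly ?D + of_nat (\<beta> j - 1) * fibre_fps N \<beta> l x)))"
      unfolding G_def sum_distrib_left by (intro sum.cong) (simp_all only: atMost_iff mult.left_commute)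
    also have "\<dots> = (\<Sum>j\<le>N. - fps_X * (fps_of_poly (Polynomial.smult (l j * w j) (radical_poly (?Y - {x j}))) * fps_of_poly ?D +
        fps_of_poly (Polynomial.smult (of_nat (\<beta> j - 1) * w j) (radical_poly (?Y - {x j}))) * fibre_fps N \<beta> l x))"
      by (intro sum.cong refl)
        (simp add: fps_of_poly_smult fps_const_mult[symmetric] fps_of_nat algebra_simps del: fps_const_mult)
    also have "\<dots> = - fps_X * (fps_of_poly ?K2 * fps_of_poly ?D + fps_of_poly ?K1 * fibre_fps N \<beta> l x)"
      unfolding weighted_cofactors_def fps_of_poly_sum sum_distrib_right
        sum.distrib[symmetric] sum_distrib_left ..
    finally show ?thesis .
  qed
  \<comment> \<open>\<open>EG\<close> with \<open>G\<close> and the fibre series replaced by their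
    truncations. The error starts in degree d + N + 1, which is also the degree bound of
    \<open>?T\<close>, so \<open>?T\<close> is a monomial.\<close>
  let ?T = "?E * r + [:0, 1:] * (?K2 * ?D + ?K1 * ?q)"
  have T: "fps_of_poly ?T = fps_X ^ ?n * - (fps_of_poly ?E * fps_shift ?n G + fps_X * fps_of_poly ?K1 * \<rho>)"
  proof -
    have X: "fps_of_poly [:0, 1:] = (fps_X :: complex fps)" by (simp add: fps_of_poly_pCons)
    have "fps_of_poly ?T = fps_of_poly ?E * (G - fps_X ^ ?n * fps_shift ?n G) +
        fps_X * (fps_of_poly ?K2 * fps_of_poly ?D + fps_of_poly ?K1 * (fibre_fps N \<beta> l x - fps_X ^ ?n * \<rho>))"
    proof -
      have "fps_of_poly r = G - fps_X ^ ?n * fps_shift ?n G" by (subst (1) G) simp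
      moreover have "fps_of_poly ?q = fibre_fps N \<beta> l x - fps_X ^ ?n * \<rho>" unfolding \<rho> by simp
      ultimately show ?thesis unfolding fps_of_poly_add fps_of_poly_mult X by simp
    qed
    also have "\<dots> = fps_of_poly ?E * G + fps_X * (fps_of_poly ?K2 * fps_of_poly ?D + fps_of_poly ?K1 * fibre_fps N \<beta> l x)
        - fps_X ^ ?n * (fps_of_poly ?E * fps_shift ?n G + fps_X * fps_of_poly ?K1 * \<rho>)"
      by (simp add: algebra_simps del: power_Suc)
    also have "\<dots> = fps_X ^ ?n * - (fps_of_poly ?E * fps_shift ?n G + fps_X * fps_of_poly ?K1 * \<rho>)"
    proof -
      have "- X * Z + X * Z - P * S = P * - S" for X Z P S :: "complex fps" by simp
      then show ?thesis unfolding EG by (simp only:)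
    qed
    finally show ?thesis .
  qed
  have low: "Polynomial.coeff ?T k = 0" if "k < ?n" for k
  proof -
    have "fps_nth (fps_of_poly ?T) k = 0" unfolding T using that by (simp only: fps_X_power_mult_nth if_True)
    then show ?thesis by simp
  qed
  have cY: "card ?Y = Suc N" by (rule separated_nonzero_values[OF x])
  have dE: "Polynomial.degree ?E \<le> Suc N" using degree_radical[of ?Y] cY by simp
  have dK: "Polynomial.degree ?K1 \<le> N" "Polynomial.degree ?K2 \<le> N"
    using degree_weighted_cofactors[OF _ separated_nonzero_values(3)[OF x]] x0 cY by auto
  have dq: "Polynomial.degree ?q \<le> d" by (rule degree_fibre_trunc)
  have dr: "Polynomial.degree r \<le> d" unfolding r_def
    by (rule degree_sum_le) (auto intro: order_trans[OF degree_monom_le])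
  have dD: "Polynomial.degree ?D \<le> d" using degree_reduced_poles[of "{..N}" \<beta> x] e by simp
  have "Polynomial.degree (?E * r) \<le> ?n" using degree_mult_le[of ?E r] dE dr by simp
  moreover have "Polynomial.degree (?K2 * ?D + ?K1 * ?q) \<le> N + d"
    using degree_mult_le[of ?K2 ?D] degree_mult_le[of ?K1 ?q] dK dD dq by (intro degree_add_le) auto
  then have "Polynomial.degree ([:0, 1:] * (?K2 * ?D + ?K1 * ?q)) \<le> ?n"
    using degree_mult_le[of "[:0, 1:]" "?K2 * ?D + ?K1 * ?q"] by simp
  ultimately have "Polynomial.degree ?T \<le> ?n" by (rule degree_add_le)
  from poly_eq_monomI[OF this low] obtain \<mu> where \<mu>: "?T = Polynomial.monom \<mu> ?n" by blast
  \<comment> \<open>At u = 1/x_j the radical vanishes and in both identities only the cofactor of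
    index j survives, multiplied by the same quantity \<open>A\<close>; the direction x enters one,
    the direction w the other.\<close>
  have key: "w j * \<kappa> = \<mu> * x j" if j: "j \<le> N" for j
  proof -
    let ?u = "1 / x j" and ?e = "poly (radical_poly (?Y - {x j})) (1 / x j)"
    define A where "A = of_nat (\<beta> j - 1) * poly ?q ?u + l j * poly ?D ?u"
    have E0: "poly ?E ?u = 0" using xY[OF j] x0[OF j] by (simp add: poly_radical_eq_0_iff)
    have wc: "poly (weighted_cofactors N x c) ?u = c j * ?e" for c
      unfolding poly_weighted_cofactors[OF xY[OF j]] separated_group[OF x j] by simp
    have 1: "x j * ?e * A = \<kappa> * ?u ^ (d + N)"
    proof -
      have "poly (?E * pderiv ?q + weighted_cofactors N x (\<lambda>j. of_nat (\<beta> j - 1) * x j) * ?q +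
        weighted_cofactors N x (\<lambda>j. l j * x j) * ?D) ?u = \<kappa> * ?u ^ (d + N)" unfolding \<kappa>(2) poly_monom ..
      then show ?thesis unfolding poly_add poly_mult E0 wc by (simp add: A_def algebra_simps)
    qed
    have 2: "?u * (w j * ?e * A) = \<mu> * ?u ^ ?n"
    proof -
      have "poly ?T ?u = \<mu> * ?u ^ ?n" unfolding \<mu> poly_monom ..
      moreover have "poly [:0, 1:] ?u = ?u" by simp
      ultimately show ?thesis unfolding poly_add poly_mult E0 wc by (simp only: A_def algebra_simps mult_zero_left add_0_left)
    qed
    have "w j * (x j * ?e * A) = x j * x j * (?u * (w j * ?e * A))" using x0[OF j] by simp
    also have "\<dots> = x j * x j * (\<mu> * ?u ^ ?n)" unfolding 2 ..
    also have "\<dots> = \<mu> * x j * ?u ^ (d + N)" using x0[OF j] by simp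
    finally have "w j * \<kappa> * ?u ^ (d + N) = \<mu> * x j * ?u ^ (d + N)" unfolding 1 by (simp only: mult.assoc)
    then show ?thesis using x0[OF j] by simp
  qed
  have "\<mu> = 0" using key[of 0] x0[of 0] by (simp add: w_def)
  then have "w j = 0" if "j \<le> N" for j using key[OF that] \<kappa>(1) by simp
  then show ?thesis by (metis One_nat_def atLeastAtMost_iff fun_upd_other not_one_le_zero w_def)
qed

lemma fibre_count:
  assumes l: "nonresonant N l" and e: "(\<Sum>j\<le>N. \<beta> j - 1) \<le> d"
  shows "finite {w \<in> cspace (Suc N). w 0 = 1 \<and> (\<forall>k\<in>{d+1..d+N}. fibre_eq N \<beta> l k w = 0)} \<and>
    card {w \<in> cspace (Suc N). w 0 = 1 \<and> (\<forall>k\<in>{d+1..d+N}. fibre_eq N \<beta> l k w = 0)} = (\<Prod>i=1..N. d + i)"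
proof -
  obtain \<Delta> g where dd: "\<forall>l k. form_dd N k (fibre_eq N \<beta> l k) (\<lambda>j x y. \<Sum>i\<le>N. l i * \<Delta> i k j x y)"
    and diag: "\<forall>l k j x. (\<Sum>i\<le>N. l i * \<Delta> i k j x x) = fps_nth (g l j x) k"
    and g: "\<forall>l x. \<forall>j\<le>N. g l j x * fps_of_poly [:1, - x j:] =
       - fps_X * (fps_const (l j) * fps_of_poly (reduced_poles {..N} \<beta> x) +
         of_nat (\<beta> j - 1) * fibre_fps N \<beta> l x)"
    using fibre_eq_form_dd[of N \<beta>] by blast
  have range: "(\<forall>k\<in>{d+1..d+N}. P k) \<longleftrightarrow> (\<forall>i\<in>{1..N}. P (d + i))" for P
  proof
    assume *: "\<forall>i\<in>{1..N}. P (d + i)"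
    show "\<forall>k\<in>{d+1..d+N}. P k"
    proof
      fix k assume "k \<in> {d+1..d+N}"
      then have "k - d \<in> {1..N}" "k = d + (k - d)" by auto
      with * show "P k" by metis
    qed
  qed auto
  have l0: "\<exists>j\<le>N. l j \<noteq> 0"
    using l[unfolded nonresonant_def, rule_format, of "{0}"] by auto
  show ?thesis unfolding range
  proof (rule bezout_nondegenerate[where \<Delta> = "\<lambda>i j x y. \<Sum>m\<le>N. l m * \<Delta> m (d + i) j x y"])
    fix x v :: "nat \<Rightarrow> complex"
    assume x: "\<exists>i\<le>N. x i \<noteq> 0" and z: "\<forall>i\<in>{1..N}. fibre_eq N \<beta> l (d + i) x = 0"
      and v: "\<forall>i\<in>{1..N}. (\<Sum>j=1..N. (\<Sum>m\<le>N. l m * \<Delta> m (d + i) j x x) * v j) = 0"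
    have eq: "\<forall>k\<in>{d+1..d+N}. fibre_eq N \<beta> l k x = 0" unfolding range by (rule z)
    show "\<forall>j\<in>{1..N}. v j = 0"
    proof (rule fibre_nondegenerate[OF eq e nonresonant_fibre_separated[OF eq e l x] l0])
      show "\<forall>k\<in>{d+1..d+N}. (\<Sum>j=1..N. fps_nth (g l j x) k * v j) = 0"
        unfolding range using v unfolding diag[rule_format] .
      show "g l j x * fps_of_poly [:1, - x j:] =
       - fps_X * (fps_const (l j) * fps_of_poly (reduced_poles {..N} \<beta> x) +
         of_nat (\<beta> j - 1) * fibre_fps N \<beta> l x)" if "j \<le> N" for j using g that by blast
    qed
  qed (use dd in auto)
qed

text \<open>Residues and poles both vary over \<open>W\<close>, but only points with equal residues
  are compared. This is the source of the local injectivity of the residue map.\<close>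

lemma fibre_locally_unique:
  assumes l0: "\<And>j. j \<le> N \<Longrightarrow> continuous_on W (\<lambda>w. l w j)"
    and X: "\<And>j. continuous_on W (\<lambda>w :: 'w::topological_space. X w j)" "\<And>w. w \<in> W \<Longrightarrow> X w 0 = 1"
    and w0: "w0 \<in> W" and e: "(\<Sum>j\<le>N. \<beta> j - 1) \<le> d"
    and eq: "\<forall>k\<in>{d+1..d+N}. fibre_eq N \<beta> (l w0) k (X w0) = 0"
    and sep: "separated N (X w0)" and ne: "\<exists>j\<le>N. l w0 j \<noteq> 0"
  shows "\<exists>U. open U \<and> w0 \<in> U \<and> (\<forall>w\<in>U \<inter> W. \<forall>w'\<in>U \<inter> W. l w = l w' \<longrightarrow>
    (\<forall>k\<in>{d+1..d+N}. fibre_eq N \<beta> (l w) k (X w) = 0) \<longrightarrow>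
    (\<forall>k\<in>{d+1..d+N}. fibre_eq N \<beta> (l w) k (X w') = 0) \<longrightarrow> (\<forall>i\<le>N. X w i = X w' i))"
proof -
  obtain \<Delta> g where dd: "\<forall>l k. form_dd N k (fibre_eq N \<beta> l k) (\<lambda>j x y. \<Sum>i\<le>N. l i * \<Delta> i k j x y)"
    and cont: "\<forall>i\<le>N. \<forall>k j. continuous_on UNIV (\<lambda>p. \<Delta> i k j (fst p) (snd p))"
    and diag: "\<forall>l k j x. (\<Sum>i\<le>N. l i * \<Delta> i k j x x) = fps_nth (g l j x) k"
    and g: "\<forall>l x. \<forall>j\<le>N. g l j x * fps_of_poly [:1, - x j:] =
       - fps_X * (fps_const (l j) * fps_of_poly (reduced_poles {..N} \<beta> x) +
         of_nat (\<beta> j - 1) * fibre_fps N \<beta> l x)"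
    using fibre_eq_form_dd[of N \<beta>] by blast
  have "\<exists>U. open U \<and> w0 \<in> U \<and> (\<forall>w\<in>U \<inter> W. \<forall>w'\<in>U \<inter> W. l w = l w' \<longrightarrow>
    (\<forall>i\<in>{1..N}. fibre_eq N \<beta> (l w) (d + i) (X w) = fibre_eq N \<beta> (l w) (d + i) (X w')) \<longrightarrow> (\<forall>i\<le>N. X w i = X w' i))"
  proof (rule nondegenerate_locally_injective[where F = "\<lambda>l i. fibre_eq N \<beta> l (d + i)" and
        \<Delta> = "\<lambda>l i j x y. \<Sum>m\<le>N. l m * \<Delta> m (d + i) j x y"])
    fix i j assume ij: "i \<in> {1..N}" "j \<in> {1..N}"
    have cX: "continuous_on W X" by (rule continuous_on_coordinatewise_then_product[OF X(1)])
    have fs: "continuous_on (W \<times> W) (fst :: 'w \<times> 'w \<Rightarrow> 'w)" "continuous_on (W \<times> W) (snd :: 'w \<times> 'w \<Rightarrow> 'w)"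
      by (auto intro!: continuous_intros)
    have pr: "continuous_on (W \<times> W) (\<lambda>p. (X (fst p), X (snd p)))"
      by (intro continuous_on_Pair continuous_on_compose2[OF cX fs(1)] continuous_on_compose2[OF cX fs(2)]) auto
    show "continuous_on (W \<times> W) (\<lambda>p. \<Sum>m\<le>N. l (fst p) m * \<Delta> m (d + i) j (X (fst p)) (X (snd p)))"
    proof (intro continuous_on_sum continuous_on_mult)
      fix m assume m: "m \<in> {..N}"
      show "continuous_on (W \<times> W) (\<lambda>p. l (fst p) m)"
        by (rule continuous_on_compose2[OF l0 fs(1)]) (use m in auto)
      have "continuous_on UNIV (\<lambda>p. \<Delta> m (d + i) j (fst p) (snd p))" using cont m by simp
      from continuous_on_compose2[OF this pr]
      show "continuous_on (W \<times> W) (\<lambda>p. \<Delta> m (d + i) j (X (fst p)) (X (snd p)))" by simp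
    qed
  next
    fix v assume v: "\<forall>i\<in>{1..N}. (\<Sum>j=1..N. (\<Sum>m\<le>N. l w0 m * \<Delta> m (d + i) j (X w0) (X w0)) * v j) = 0"
    show "\<forall>j\<in>{1..N}. v j = 0"
    proof (rule fibre_nondegenerate[OF eq e sep ne])
      show "\<forall>k\<in>{d+1..d+N}. (\<Sum>j=1..N. fps_nth (g (l w0) j (X w0)) k * v j) = 0"
      proof
        fix k assume "k \<in> {d+1..d+N}"
        then have "k - d \<in> {1..N}" "d + (k - d) = k" by auto
        with bspec[OF v, of "k - d"] show "(\<Sum>j=1..N. fps_nth (g (l w0) j (X w0)) k * v j) = 0"
          unfolding diag[rule_format] by simp
      qed
      show "g (l w0) j (X w0) * fps_of_poly [:1, - X w0 j:] =
       - fps_X * (fps_const (l w0 j) * fps_of_poly (reduced_poles {..N} \<beta> (X w0)) +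
         of_nat (\<beta> j - 1) * fibre_fps N \<beta> (l w0) (X w0))" if "j \<le> N" for j using g that by blast
    qed
  qed (use form_dd_diff[OF dd[rule_format]] X(2) w0 in auto)
  then obtain U where U: "open U" "w0 \<in> U" and inj: "\<forall>w\<in>U \<inter> W. \<forall>w'\<in>U \<inter> W. l w = l w' \<longrightarrow>
    (\<forall>i\<in>{1..N}. fibre_eq N \<beta> (l w) (d + i) (X w) = fibre_eq N \<beta> (l w) (d + i) (X w')) \<longrightarrow> (\<forall>i\<le>N. X w i = X w' i)"
    by (elim exE conjE)
  have "\<forall>i\<le>N. X w i = X w' i" if w: "w \<in> U \<inter> W" "w' \<in> U \<inter> W" "l w = l w'"
    "\<forall>k\<in>{d+1..d+N}. fibre_eq N \<beta> (l w) k (X w) = 0" "\<forall>k\<in>{d+1..d+N}. fibre_eq N \<beta> (l w) k (X w') = 0" for w w'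
  proof -
    have "\<forall>i\<in>{1..N}. fibre_eq N \<beta> (l w) (d + i) (X w) = fibre_eq N \<beta> (l w) (d + i) (X w')"
      using w(4,5) by auto
    then show ?thesis by (rule mp[OF mp[OF bspec[OF bspec[OF inj w(1)] w(2)] w(3)]])
  qed
  then show ?thesis using U by (intro exI[of _ U] conjI ballI impI) assumption+
qed

section \<open>Residues\<close>

lemma residue_deriv_eq_0:
  assumes "open S" "z \<in> S" "h holomorphic_on S - {z}"
  shows "residue (deriv h) z = 0"
proof -
  obtain e where e: "e > 0" "cball z e \<subseteq> S" using assms open_contains_cball by blast
  have op: "open (S - {z})" using assms by auto
  have "(deriv h has_contour_integral 2 * pi * \<i> * residue (deriv h) z) (circlepath z e)"
    by (rule base_residue[OF assms(1,2) e(1) holomorphic_deriv[OF assms(3) op] e(2)])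
  moreover have "(deriv h has_contour_integral (h (pathfinish (circlepath z e)) - h (pathstart (circlepath z e)))) (circlepath z e)"
  proof (rule contour_integral_primitive)
    show "(h has_field_derivative deriv h x) (at x within S - {z})" if "x \<in> S - {z}" for x
      using holomorphic_derivI[OF assms(3) op that] .
    have "path_image (circlepath z e) \<subseteq> cball z e - {z}" using e(1) by (auto simp: sphere_def)
    with e(2) show "path_image (circlepath z e) \<subseteq> S - {z}" by blast
  qed simp
  ultimately have "2 * pi * \<i> * residue (deriv h) z = 0"
    using has_contour_integral_unique by fastforce
  then show ?thesis by simp
qed

text \<open>Simple polar parts plus the derivative of a single-valued function. The residues can be
  read off without expansions, whatever the orders of the poles, because the second part integrates
  to zero around each point.\<close>

definition log_decomp :: "'i set \<Rightarrow> ('i \<Rightarrow> complex) \<Rightarrow> ('i \<Rightarrow> complex) \<Rightarrow> (complex \<Rightarrow> complex) \<Rightarrow> bool" where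
  "log_decomp I a c f \<longleftrightarrow> (\<exists>h. h holomorphic_on - (a ` I) \<and>
     (\<forall>z. z \<notin> a ` I \<longrightarrow> f z = (\<Sum>i\<in>I. c i / (z - a i)) + deriv h z))"

lemma log_decomp_cmult:
  assumes "log_decomp I a c f" "finite I"
  shows "log_decomp I a (\<lambda>i. t * c i) (\<lambda>z. t * f z)"
proof -
  obtain h where h: "h holomorphic_on - (a ` I)"
    "\<And>z. z \<notin> a ` I \<Longrightarrow> f z = (\<Sum>i\<in>I. c i / (z - a i)) + deriv h z"
    using assms unfolding log_decomp_def by blast
  have op: "open (- (a ` I))" using assms by (simp add: finite_imp_closed open_Compl)
  have "t * f z = (\<Sum>i\<in>I. t * c i / (z - a i)) + deriv (\<lambda>z. t * h z) z" if "z \<notin> a ` I" for z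
  proof -
    have "h field_differentiable at z"
      using holomorphic_on_imp_differentiable_at[OF h(1) op] that by simp
    then have "deriv (\<lambda>z. t * h z) z = t * deriv h z" by (rule deriv_cmult)
    then show ?thesis by (simp add: h(2)[OF that] distrib_left sum_distrib_left)
  qed
  moreover have "(\<lambda>z. t * h z) holomorphic_on - (a ` I)" by (intro holomorphic_intros h)
  ultimately show ?thesis unfolding log_decomp_def by blast
qed

text \<open>Invariance of the residue under a local biholomorphism g. The derivative part pulls back
  to a derivative, the polar parts at other points become holomorphic, and what is left is c_k g' /
  (g - a_k), which has residue c_k since g - a_k = (w - w0) G with
  \<open>G w0 = deriv g w0\<close>.\<close>

lemma residue_pullback_log_decomp:
  assumes f: "log_decomp I a c f" and I: "finite I" "inj_on a I" "k \<in> I"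
    and g: "open S" "g holomorphic_on S" "w0 \<in> S" "g w0 = a k" "deriv g w0 \<noteq> 0"
    and F: "\<And>w. w \<in> S \<Longrightarrow> w \<noteq> w0 \<Longrightarrow> F w = f (g w) * deriv g w"
  shows "residue F w0 = c k"
proof -
  obtain h where h: "h holomorphic_on - (a ` I)"
    "\<And>z. z \<notin> a ` I \<Longrightarrow> f z = (\<Sum>i\<in>I. c i / (z - a i)) + deriv h z"
    using f unfolding log_decomp_def by blast
  have opI: "open (- (a ` I))" using I by (simp add: finite_imp_closed open_Compl)
  define G where "G w = (if w = w0 then deriv g w0 else (g w - g w0) / (w - w0))" for w
  have G: "G holomorphic_on S" unfolding G_def by (rule pole_lemma_open[OF g(2,1)])
  have gG: "g w - a k = (w - w0) * G w" for w by (simp add: G_def g(4))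
  \<comment> \<open>On this neighbourhood g meets no other pole, and it meets \<open>a k\<close>
    only at \<open>w0\<close>.\<close>
  define T where "T = {w \<in> S. G w \<in> - {0}} \<inter> {w \<in> S. g w \<in> - (a ` (I - {k}))}"
  have "open {w \<in> S. G w \<in> - {0}}"
    using continuous_open_preimage[OF holomorphic_on_imp_continuous_on[OF G] g(1) open_Compl[OF closed_singleton[of 0]]]
    by (simp add: vimage_def Int_def)
  moreover have "open {w \<in> S. g w \<in> - (a ` (I - {k}))}"
    using continuous_open_preimage[OF holomorphic_on_imp_continuous_on[OF g(2)] g(1), of "- (a ` (I - {k}))"] I
    by (simp add: vimage_def Int_def finite_imp_closed open_Compl)
  ultimately have T: "open T" unfolding T_def by (rule open_Int)
  have "a k \<notin> a ` (I - {k})" using I by (auto simp: inj_on_def)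
  then have w0T: "w0 \<in> T" using g by (auto simp: T_def G_def)
  have TS: "T \<subseteq> S" by (auto simp: T_def)
  have gT: "g holomorphic_on T" "G holomorphic_on T" using g(2) G TS holomorphic_on_subset by blast+
  have dg: "deriv g holomorphic_on T" by (rule holomorphic_deriv[OF gT(1) T])
  have away: "g w \<notin> a ` I" if "w \<in> T - {w0}" for w
  proof -
    have "g w \<noteq> a k" using gG[of w] that by (auto simp: T_def)
    moreover have "g w \<notin> a ` (I - {k})" using that by (auto simp: T_def)
    ultimately show ?thesis by auto
  qed
  define R where "R w = (\<Sum>i\<in>I - {k}. c i * deriv g w / (g w - a i))" for w
  have R: "R holomorphic_on T" unfolding R_def
    by (intro holomorphic_intros dg gT) (auto simp: T_def)
  have hg: "(h \<circ> g) holomorphic_on T - {w0}"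
    by (rule holomorphic_on_compose_gen[OF holomorphic_on_subset[OF gT(1)] h(1)]) (use away in auto)
  have opT: "open (T - {w0})" using T by auto
  have eq: "F w = (R w + (c k * (deriv g w / G w)) / (w - w0)) + deriv (h \<circ> g) w" if w: "w \<in> T - {w0}" for w
  proof -
    have "deriv (h \<circ> g) w = deriv h (g w) * deriv g w"
      by (rule deriv_chain)
        (use holomorphic_on_imp_differentiable_at[OF gT(1) T] holomorphic_on_imp_differentiable_at[OF h(1) opI]
          away[OF w] w in auto)
    moreover have "F w = ((\<Sum>i\<in>I. c i / (g w - a i)) + deriv h (g w)) * deriv g w"
      using F[of w] h(2)[OF away[OF w]] w TS by auto
    moreover have "(\<Sum>i\<in>I. c i / (g w - a i)) * deriv g w = c k / (g w - a k) * deriv g w + R w"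
      unfolding R_def sum.remove[OF I(1,3)] distrib_right sum_distrib_right by simp
    ultimately show ?thesis unfolding gG by (simp add: distrib_right)
  qed
  have s: "(\<lambda>w. c k * (deriv g w / G w)) holomorphic_on T"
    by (intro holomorphic_intros dg gT) (auto simp: T_def)
  have s': "(\<lambda>w. (c k * (deriv g w / G w)) / (w - w0)) holomorphic_on T - {w0}"
    by (intro holomorphic_intros holomorphic_on_subset[OF s]) auto
  have R': "R holomorphic_on T - {w0}" by (rule holomorphic_on_subset[OF R]) auto
  have dhg: "deriv (h \<circ> g) holomorphic_on T - {w0}" by (rule holomorphic_deriv[OF hg opT])
  have "eventually (\<lambda>w. F w = (R w + (c k * (deriv g w / G w)) / (w - w0)) + deriv (h \<circ> g) w) (at w0)"
    using eq T w0T by (auto simp: eventually_at_topological)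
  then have "residue F w0 = residue (\<lambda>w. (R w + (c k * (deriv g w / G w)) / (w - w0)) + deriv (h \<circ> g) w) w0"
    by (rule residue_cong) simp
  also have "\<dots> = residue (\<lambda>w. R w + (c k * (deriv g w / G w)) / (w - w0)) w0 + residue (deriv (h \<circ> g)) w0"
    by (rule residue_add[OF T w0T holomorphic_on_add[OF R' s'] dhg])
  also have "residue (\<lambda>w. R w + (c k * (deriv g w / G w)) / (w - w0)) w0 =
      residue R w0 + residue (\<lambda>w. (c k * (deriv g w / G w)) / (w - w0)) w0"
    by (rule residue_add[OF T w0T R' s'])
  also have "residue R w0 = 0" by (rule residue_holo[OF T w0T R])
  also have "residue (\<lambda>w. (c k * (deriv g w / G w)) / (w - w0)) w0 = c k * (deriv g w0 / G w0)"
    by (rule residue_simple[OF T w0T s])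
  also have "residue (deriv (h \<circ> g)) w0 = 0" by (rule residue_deriv_eq_0[OF T w0T hg])
  finally show ?thesis using g(5) by (simp add: G_def)
qed

corollary residue_log_decomp:
  assumes "log_decomp I a c f" "finite I" "inj_on a I" "k \<in> I"
  shows "residue f (a k) = c k"
  by (rule residue_pullback_log_decomp[OF assms, where g = "\<lambda>w. w" and S = UNIV]) auto

definition pole_form :: "nat \<Rightarrow> (nat \<Rightarrow> nat) \<Rightarrow> nat \<Rightarrow> (nat \<Rightarrow> complex) \<Rightarrow> complex \<Rightarrow> complex" where
  "pole_form N \<beta> n x z = 1 / (z ^ n * (\<Prod>j\<le>N. (z - x j) ^ \<beta> j))"

definition pole_residue :: "nat \<Rightarrow> (nat \<Rightarrow> nat) \<Rightarrow> nat \<Rightarrow> (nat \<Rightarrow> complex) \<Rightarrow> nat \<Rightarrow> complex" where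
  "pole_residue N \<beta> n x j = residue (pole_form N \<beta> n x) (x j)"

text \<open>Index \<open>Suc N\<close> stands for the pole at 0; in \<open>all_residues\<close> its
  residue is fixed by the vanishing of the total residue.\<close>

definition pole_pos :: "nat \<Rightarrow> (nat \<Rightarrow> complex) \<Rightarrow> nat \<Rightarrow> complex" where
  "pole_pos N x j = (if j \<le> N then x j else 0)"

definition all_residues :: "nat \<Rightarrow> (nat \<Rightarrow> complex) \<Rightarrow> nat \<Rightarrow> complex" where
  "all_residues N l j = (if j \<le> N then l j else - (\<Sum>i\<le>N. l i))"

lemma inj_on_pole_pos: "separated N x \<Longrightarrow> inj_on (pole_pos N x) {..Suc N}"
  by (auto simp: inj_on_def pole_pos_def separated_def le_Suc_eq)

lemma pole_pos_image: "pole_pos N x ` {..Suc N} = insert 0 (x ` {..N})"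
  unfolding atMost_Suc image_insert by (auto simp: pole_pos_def)

lemma poly_reduced_poles_radical:
  assumes x: "separated N x" and \<beta>: "\<forall>j\<le>N. \<beta> j \<ge> 1"
  shows "poly (reduced_poles {..N} \<beta> x) u * poly (radical_poly (nonzero_values N x)) u = (\<Prod>j\<le>N. (1 - x j * u) ^ \<beta> j)"
proof -
  have "poly (radical_poly (nonzero_values N x)) u = (\<Prod>j\<le>N. 1 - x j * u)"
    unfolding separated_nonzero_values(1)[OF x] radical_poly_def poly_prod
    using x by (subst prod.reindex) (auto simp: separated_def mult.commute)
  moreover have "poly (reduced_poles {..N} \<beta> x) u = (\<Prod>j\<le>N. (1 - x j * u) ^ (\<beta> j - 1))"
    by (simp add: reduced_poles_def poly_prod mult.commute)
  moreover have "(1 - x j * u) ^ (\<beta> j - 1) * (1 - x j * u) = (1 - x j * u) ^ \<beta> j" if "j \<le> N" for j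
    using \<beta> that by (metis One_nat_def Suc_pred le_eq_less_or_eq less_Suc_eq_le not_less power_Suc2 zero_less_Suc diff_Suc_1 not_less_zero)
  ultimately show ?thesis by (simp add: prod.distrib[symmetric])
qed

text \<open>
  The decomposition comes from the fibre identity through \<open>u = 1/z\<close>; \<open>h\<close> is the
  function \<open>- q / D\<close>.
\<close>

lemma fibre_log_decomp:
  assumes \<beta>: "\<forall>j\<le>N. \<beta> j \<ge> 1" and n: "n \<ge> 1" and d: "d = (\<Sum>j\<le>N. \<beta> j - 1) + (n - 1)"
    and eq: "\<forall>k\<in>{d+1..d+N}. fibre_eq N \<beta> l k x = 0"
    and x: "separated N x" and l: "\<exists>j\<le>N. l j \<noteq> 0"
  shows "\<exists>\<kappa>. \<kappa> \<noteq> 0 \<and> log_decomp {..Suc N} (pole_pos N x) (all_residues N l) (\<lambda>z. \<kappa> * pole_form N \<beta> n x z)"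
proof -
  let ?Y = "nonzero_values N x"
  let ?E = "radical_poly ?Y" and ?q = "fibre_trunc N \<beta> l d x" and ?D = "reduced_poles {..N} \<beta> x"
  let ?K1 = "weighted_cofactors N x (\<lambda>j. of_nat (\<beta> j - 1) * x j)"
  let ?K2 = "weighted_cofactors N x (\<lambda>j. l j * x j)"
  have "(\<Sum>j\<le>N. \<beta> j - 1) \<le> d" using d by simp
  from separated_identity[OF eq this x l] obtain \<kappa> where
    \<kappa>: "\<kappa> \<noteq> 0" "?E * pderiv ?q + ?K1 * ?q + ?K2 * ?D = Polynomial.monom \<kappa> (d + N)" by blast
  have K1: "pderiv ?D * ?E = - ?K1 * ?D"
    using pderiv_reduced_poles[of "{..N}" N \<beta> x] by (simp add: weighted_cofactors_def)
  define h where "h z = - (poly ?q (1 / z) / poly ?D (1 / z))" for z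
  have img: "- (pole_pos N x ` {..Suc N}) = {z. z \<noteq> 0 \<and> z \<notin> x ` {..N}}"
    unfolding pole_pos_image by auto
  have ne: "(\<Prod>j\<le>N. (1 - x j * (1 / z)) ^ \<beta> j) \<noteq> 0" if "z \<noteq> 0" "z \<notin> x ` {..N}" for z
  proof -
    have "1 - x j * (1 / z) \<noteq> 0" if "j \<le> N" for j
      using that \<open>z \<noteq> 0\<close> \<open>z \<notin> x ` {..N}\<close> by (auto simp: field_simps)
    then have "(1 - x j * (1 / z)) ^ \<beta> j \<noteq> 0" if "j \<le> N" for j using that by (metis power_not_zero)
    then show ?thesis using prod_zero_iff[of "{..N}" "\<lambda>j. (1 - x j * (1 / z)) ^ \<beta> j"] by blast
  qed
  have DE: "poly ?D (1 / z) \<noteq> 0 \<and> poly ?E (1 / z) \<noteq> 0" if "z \<noteq> 0" "z \<notin> x ` {..N}" for z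
    using ne[OF that] poly_reduced_poles_radical[OF x \<beta>, of "1 / z"] by (metis mult_zero_left mult_zero_right)
  \<comment> \<open>The 2 comes from du = - u^2 dz: the monomial of degree d + N in u then has
    exactly the exponent that cancels the powers of z in the denominators and leaves
    \<open>z ^ n\<close>.\<close>
  have sumb: "d + N + 2 = (\<Sum>j\<le>N. \<beta> j) + n"
  proof -
    have "(\<Sum>j\<le>N. \<beta> j) = (\<Sum>j\<le>N. (\<beta> j - 1) + 1)" using \<beta> by (intro sum.cong) auto
    also have "\<dots> = (\<Sum>j\<le>N. \<beta> j - 1) + (N + 1)" by (subst sum.distrib) simp
    finally show ?thesis using d n by simp
  qed
  have "h holomorphic_on - (pole_pos N x ` {..Suc N})"
    unfolding h_def img using DE by (auto intro!: holomorphic_intros)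
  moreover have "\<kappa> * pole_form N \<beta> n x z = (\<Sum>i\<in>{..Suc N}. all_residues N l i / (z - pole_pos N x i)) + deriv h z"
    if zz: "z \<notin> pole_pos N x ` {..Suc N}" for z
  proof -
    have z: "z \<noteq> 0" "z \<notin> x ` {..N}" using zz unfolding pole_pos_image by auto
    define u where "u = 1 / z"
    have Du: "poly ?D u \<noteq> 0" and Eu: "poly ?E u \<noteq> 0" using DE[OF z] by (simp_all add: u_def)
    have id: "poly ?E u * poly (pderiv ?q) u + poly ?K1 u * poly ?q u + poly ?K2 u * poly ?D u = \<kappa> * u ^ (d + N)"
      using arg_cong[OF \<kappa>(2), of "\<lambda>p. poly p u"] by (simp add: poly_monom)
    have k1: "poly (pderiv ?D) u * poly ?E u = - poly ?K1 u * poly ?D u"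
      using arg_cong[OF K1, of "\<lambda>p. poly p u"] by simp
    let ?Q = "(poly (pderiv ?q) u * poly ?D u - poly ?q u * poly (pderiv ?D) u) / (poly ?D u)\<^sup>2"
    have dh: "deriv h z = ?Q * u\<^sup>2"
    proof (rule DERIV_imp_deriv)
      have 1: "((\<lambda>z :: complex. 1 / z) has_field_derivative - (u\<^sup>2)) (at z)"
        using z(1) by (auto intro!: derivative_eq_intros simp: u_def power2_eq_square)
      have "((\<lambda>z. poly ?q (1 / z)) has_field_derivative poly (pderiv ?q) u * - (u\<^sup>2)) (at z)"
        using DERIV_chain2[OF poly_DERIV[of ?q "1 / z"] 1] by (simp add: u_def)
      moreover have "((\<lambda>z. poly ?D (1 / z)) has_field_derivative poly (pderiv ?D) u * - (u\<^sup>2)) (at z)"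
        using DERIV_chain2[OF poly_DERIV[of ?D "1 / z"] 1] by (simp add: u_def)
      ultimately have "((\<lambda>z. poly ?q (1 / z) / poly ?D (1 / z)) has_field_derivative
          (poly (pderiv ?q) u * - (u\<^sup>2) * poly ?D u - poly ?q u * (poly (pderiv ?D) u * - (u\<^sup>2))) / (poly ?D u * poly ?D u)) (at z)"
        using DERIV_divide Du unfolding u_def by blast
      then have "(h has_field_derivative
          - ((poly (pderiv ?q) u * - (u\<^sup>2) * poly ?D u - poly ?q u * (poly (pderiv ?D) u * - (u\<^sup>2))) / (poly ?D u * poly ?D u))) (at z)"
        unfolding h_def by (rule DERIV_minus)
      moreover have "- ((poly (pderiv ?q) u * - (u\<^sup>2) * poly ?D u - poly ?q u * (poly (pderiv ?D) u * - (u\<^sup>2))) / (poly ?D u * poly ?D u)) = ?Q * u\<^sup>2"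
        using Du by (simp add: field_simps power2_eq_square)
      ultimately show "(h has_field_derivative ?Q * u\<^sup>2) (at z)" by simp
    qed
    have Q: "?Q = \<kappa> * u ^ (d + N) / (poly ?D u * poly ?E u) - poly ?K2 u / poly ?E u"
    proof -
      have "poly ?E u * (poly (pderiv ?q) u * poly ?D u - poly ?q u * poly (pderiv ?D) u) =
          poly ?D u * (poly ?E u * poly (pderiv ?q) u) - poly ?q u * (poly (pderiv ?D) u * poly ?E u)"
        by (simp add: algebra_simps)
      also have "\<dots> = poly ?D u * (poly ?E u * poly (pderiv ?q) u + poly ?K1 u * poly ?q u)"
        unfolding k1 by (simp add: algebra_simps)
      also have "poly ?E u * poly (pderiv ?q) u + poly ?K1 u * poly ?q u = \<kappa> * u ^ (d + N) - poly ?K2 u * poly ?D u"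
        using id by (simp add: algebra_simps)
      finally have "poly (pderiv ?q) u * poly ?D u - poly ?q u * poly (pderiv ?D) u =
          poly ?D u * (\<kappa> * u ^ (d + N) - poly ?K2 u * poly ?D u) / poly ?E u"
        using Eu by (simp add: field_simps)
      then have "?Q = poly ?D u * (\<kappa> * u ^ (d + N) - poly ?K2 u * poly ?D u) / poly ?E u / (poly ?D u)\<^sup>2"
        by simp
      also have "\<dots> = \<kappa> * u ^ (d + N) / (poly ?D u * poly ?E u) - poly ?K2 u / poly ?E u"
        using Du Eu by (simp add: divide_simps power2_eq_square)
      finally show ?thesis .
    qed
    \<comment> \<open>In the coordinate z each logarithmic term gains - l_j / z; together these
      terms are the polar part at 0.\<close>
    have K2: "poly ?K2 u / poly ?E u * u\<^sup>2 = (\<Sum>j\<le>N. l j / (z - x j)) - (\<Sum>j\<le>N. l j) / z"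
    proof -
      have "l j * x j * poly (radical_poly (?Y - {x j})) u / poly ?E u * u\<^sup>2 = l j / (z - x j) - l j / z" if "j \<le> N" for j
      proof -
        have "x j \<in> ?Y" using separated_nonzero_values(1)[OF x] that by simp
        then have E: "poly ?E u = (1 - x j * u) * poly (radical_poly (?Y - {x j})) u"
          by (subst radical_poly_remove[of ?Y "x j"]) (auto simp: algebra_simps)
        with Eu have e0: "poly (radical_poly (?Y - {x j})) u \<noteq> 0" by auto
        have "z \<noteq> x j" using z that by auto
        have "l j * x j * poly (radical_poly (?Y - {x j})) u / poly ?E u * u\<^sup>2 = l j * x j / (1 - x j * u) * u\<^sup>2"
          unfolding E using e0 by simp
        also have "1 - x j * u = (z - x j) / z" using z(1) by (simp add: u_def field_simps)
        also have "l j * x j / ((z - x j) / z) * u\<^sup>2 = l j / (z - x j) - l j / z"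
          using z(1) \<open>z \<noteq> x j\<close> by (simp add: u_def divide_simps power2_eq_square) (simp add: algebra_simps)
        finally show ?thesis .
      qed
      then have "(\<Sum>j\<le>N. l j * x j * poly (radical_poly (?Y - {x j})) u / poly ?E u * u\<^sup>2) = (\<Sum>j\<le>N. l j / (z - x j) - l j / z)"
        by (intro sum.cong) auto
      then show ?thesis
        by (simp add: weighted_cofactors_def poly_sum sum_divide_distrib sum_distrib_right sum_subtractf)
    qed
    have pf: "\<kappa> * u ^ (d + N) / (poly ?D u * poly ?E u) * u\<^sup>2 = \<kappa> * pole_form N \<beta> n x z"
    proof -
      have "1 - x j * u = (z - x j) * u" if "j \<le> N" for j using z(1) by (simp add: u_def field_simps)
      then have "poly ?D u * poly ?E u = (\<Prod>j\<le>N. ((z - x j) * u) ^ \<beta> j)"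
        unfolding poly_reduced_poles_radical[OF x \<beta>] by simp
      also have "\<dots> = (\<Prod>j\<le>N. (z - x j) ^ \<beta> j) * u ^ (\<Sum>j\<le>N. \<beta> j)"
        by (simp add: power_mult_distrib prod.distrib power_sum)
      finally have "\<kappa> * u ^ (d + N) / (poly ?D u * poly ?E u) * u\<^sup>2 =
          \<kappa> * u ^ (d + N + 2) / ((\<Prod>j\<le>N. (z - x j) ^ \<beta> j) * u ^ (\<Sum>j\<le>N. \<beta> j))"
        by (simp add: power_add power2_eq_square)
      also have "\<dots> = \<kappa> * u ^ n / (\<Prod>j\<le>N. (z - x j) ^ \<beta> j)"
        unfolding sumb power_add using z(1) by (simp add: u_def)
      finally show ?thesis by (simp add: pole_form_def u_def power_one_over)
    qed
    have "deriv h z = \<kappa> * pole_form N \<beta> n x z - ((\<Sum>j\<le>N. l j / (z - x j)) - (\<Sum>j\<le>N. l j) / z)"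
      unfolding dh Q left_diff_distrib pf K2 ..
    moreover have "(\<Sum>i\<in>{..Suc N}. all_residues N l i / (z - pole_pos N x i)) = (\<Sum>j\<le>N. l j / (z - x j)) - (\<Sum>j\<le>N. l j) / z"
      by (simp add: all_residues_def pole_pos_def)
    ultimately show ?thesis by simp
  qed
  ultimately have "log_decomp {..Suc N} (pole_pos N x) (all_residues N l) (\<lambda>z. \<kappa> * pole_form N \<beta> n x z)"
    unfolding log_decomp_def by blast
  with \<kappa>(1) show ?thesis by blast
qed

lemma fibre_eq_linear:
  "fibre_eq N \<beta> l k x = (\<Sum>i\<le>N. l i * fps_nth (fps_of_poly (reduced_poles {..N} \<beta> x) * log_fps (x i)) k)"
proof -
  have "fibre_fps N \<beta> l x = (\<Sum>i\<le>N. fps_const (l i) * (fps_of_poly (reduced_poles {..N} \<beta> x) * log_fps (x i)))"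
    by (simp add: fibre_fps_def log_sum_def sum_distrib_left mult_ac)
  then show ?thesis by (simp add: fibre_eq_def fps_sum_nth)
qed

text \<open>
  A nonzero solution \<open>l\<close> of the \<open>N\<close> linear equations in \<open>N + 1\<close> unknowns has to be proportional to
  the residues of \<open>pole_form\<close>.
\<close>

lemma pole_form_residues:
  assumes \<beta>: "\<forall>j\<le>N. \<beta> j \<ge> 1" and n: "n \<ge> 1" and d: "d = (\<Sum>j\<le>N. \<beta> j - 1) + (n - 1)"
    and x: "separated N x"
  shows "\<forall>k\<in>{d+1..d+N}. fibre_eq N \<beta> (pole_residue N \<beta> n x) k x = 0"
    and "log_decomp {..Suc N} (pole_pos N x) (all_residues N (pole_residue N \<beta> n x)) (pole_form N \<beta> n x)"
proof -
  obtain l where l: "\<exists>j\<in>{..N}. l j \<noteq> 0"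
    "\<forall>k\<in>{d+1..d+N}. (\<Sum>i\<in>{..N}. fps_nth (fps_of_poly (reduced_poles {..N} \<beta> x) * log_fps (x i)) k * l i) = 0"
    using underdetermined_system[of "{d+1..d+N}" "{..N}"
        "\<lambda>k i. fps_nth (fps_of_poly (reduced_poles {..N} \<beta> x) * log_fps (x i)) k"] by auto
  have eq: "\<forall>k\<in>{d+1..d+N}. fibre_eq N \<beta> l k x = 0"
    using l(2) by (simp add: fibre_eq_linear mult.commute)
  from fibre_log_decomp[OF \<beta> n d eq x] l(1) obtain \<kappa> where
    \<kappa>: "\<kappa> \<noteq> 0" "log_decomp {..Suc N} (pole_pos N x) (all_residues N l) (\<lambda>z. \<kappa> * pole_form N \<beta> n x z)" by auto
  have dec: "log_decomp {..Suc N} (pole_pos N x) (\<lambda>i. 1 / \<kappa> * all_residues N l i) (pole_form N \<beta> n x)"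
    using log_decomp_cmult[OF \<kappa>(2), of "1 / \<kappa>"] \<kappa>(1) by simp
  have res: "pole_residue N \<beta> n x j = 1 / \<kappa> * l j" if "j \<le> N" for j
    using residue_log_decomp[OF dec _ inj_on_pole_pos[OF x], of j] that
    by (simp add: pole_residue_def pole_pos_def all_residues_def)
  have "fibre_eq N \<beta> (pole_residue N \<beta> n x) k x = 1 / \<kappa> * fibre_eq N \<beta> l k x" for k
    unfolding fibre_eq_linear sum_distrib_left using res by (intro sum.cong) auto
  with eq show "\<forall>k\<in>{d+1..d+N}. fibre_eq N \<beta> (pole_residue N \<beta> n x) k x = 0" by simp
  have "all_residues N (pole_residue N \<beta> n x) = (\<lambda>i. 1 / \<kappa> * all_residues N l i)"
    using res by (simp add: fun_eq_iff all_residues_def sum_divide_distrib)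
  then show "log_decomp {..Suc N} (pole_pos N x) (all_residues N (pole_residue N \<beta> n x)) (pole_form N \<beta> n x)"
    using dec by (simp only:)
qed

text \<open>The bridge between the polynomial system and the geometry. A solution decomposes a
  multiple of \<open>pole_form\<close> with logarithmic coefficients \<open>l\<close>, and these
  must be its residues; the converse is linearity in \<open>l\<close>.\<close>

lemma fibre_eq_iff_residues:
  assumes \<beta>: "\<forall>j\<le>N. \<beta> j \<ge> 1" and n: "n \<ge> 1" and d: "d = (\<Sum>j\<le>N. \<beta> j - 1) + (n - 1)"
    and x: "separated N x" and l: "\<exists>j\<le>N. l j \<noteq> 0"
  shows "(\<forall>k\<in>{d+1..d+N}. fibre_eq N \<beta> l k x = 0) \<longleftrightarrow>
    (\<exists>c. c \<noteq> 0 \<and> (\<forall>j\<le>N. l j = c * pole_residue N \<beta> n x j))"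
proof
  assume eq: "\<forall>k\<in>{d+1..d+N}. fibre_eq N \<beta> l k x = 0"
  from fibre_log_decomp[OF \<beta> n d eq x l] obtain \<kappa> where
    \<kappa>: "\<kappa> \<noteq> 0" "log_decomp {..Suc N} (pole_pos N x) (all_residues N l) (\<lambda>z. \<kappa> * pole_form N \<beta> n x z)" by blast
  from log_decomp_cmult[OF pole_form_residues(2)[OF \<beta> n d x], of \<kappa>]
  have dec: "log_decomp {..Suc N} (pole_pos N x) (\<lambda>i. \<kappa> * all_residues N (pole_residue N \<beta> n x) i) (\<lambda>z. \<kappa> * pole_form N \<beta> n x z)"
    by simp
  have "l j = \<kappa> * pole_residue N \<beta> n x j" if "j \<le> N" for j
    using residue_log_decomp[OF \<kappa>(2) _ inj_on_pole_pos[OF x], of j]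
      residue_log_decomp[OF dec _ inj_on_pole_pos[OF x], of j] that
    by (simp add: all_residues_def)
  with \<kappa>(1) show "\<exists>c. c \<noteq> 0 \<and> (\<forall>j\<le>N. l j = c * pole_residue N \<beta> n x j)" by blast
next
  assume "\<exists>c. c \<noteq> 0 \<and> (\<forall>j\<le>N. l j = c * pole_residue N \<beta> n x j)"
  then obtain c where c: "\<forall>j\<le>N. l j = c * pole_residue N \<beta> n x j" by blast
  have "fibre_eq N \<beta> l k x = c * fibre_eq N \<beta> (pole_residue N \<beta> n x) k x" for k
    unfolding fibre_eq_linear sum_distrib_left using c by (intro sum.cong) auto
  with pole_form_residues(1)[OF \<beta> n d x] show "\<forall>k\<in>{d+1..d+N}. fibre_eq N \<beta> l k x = 0" by simp
qed

section \<open>Continuity of the residues in the poles\<close>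

definition coeffs_continuous :: "'a::topological_space set \<Rightarrow> ('a \<Rightarrow> complex fps) \<Rightarrow> bool" where
  "coeffs_continuous A F \<longleftrightarrow> (\<forall>k. continuous_on A (\<lambda>x. fps_nth (F x) k))"

lemma coeffs_continuous_mult:
  "coeffs_continuous A F \<Longrightarrow> coeffs_continuous A G \<Longrightarrow> coeffs_continuous A (\<lambda>x. F x * G x)"
  unfolding coeffs_continuous_def fps_mult_nth by (auto intro!: continuous_intros)

lemma coeffs_continuous_one: "coeffs_continuous A (\<lambda>_. 1)"
  by (simp add: coeffs_continuous_def)

lemma coeffs_continuous_power:
  "coeffs_continuous A F \<Longrightarrow> coeffs_continuous A (\<lambda>x. F x ^ n)"
  by (induction n) (simp_all add: coeffs_continuous_mult coeffs_continuous_one)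

lemma coeffs_continuous_prod:
  assumes "\<And>i. i \<in> I \<Longrightarrow> coeffs_continuous A (F i)"
  shows "coeffs_continuous A (\<lambda>x. \<Prod>i\<in>I. F i x)"
  using assms
  by (induction I rule: infinite_finite_induct) (simp_all add: coeffs_continuous_mult coeffs_continuous_one)

lemma inverse_linear_fps:
  fixes w :: complex
  assumes "w \<noteq> 0"
  shows "inverse (fps_const w + fps_X) = Abs_fps (\<lambda>k. (- 1) ^ k / w ^ Suc k)"
proof (rule inverse_unique[symmetric] | rule fps_inverse_unique)
  show "(fps_const w + fps_X) * Abs_fps (\<lambda>k. (- 1) ^ k / w ^ Suc k) = 1"
  proof (rule fps_ext)
    fix k show "fps_nth ((fps_const w + fps_X) * Abs_fps (\<lambda>k. (- 1) ^ k / w ^ Suc k)) k = fps_nth 1 k"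
      using assms by (cases k) (auto simp: distrib_right field_simps)
  qed
qed

text \<open>At a pole of order \<open>\<beta> j\<close> the residue is the Taylor coefficient of
  index \<open>\<beta> j - 1\<close> of the product of the other factors, whose coefficients are
  rational in the poles without singularities as long as these are separated.\<close>

lemma continuous_pole_residue:
  assumes j: "j \<le> N" and \<beta>: "\<beta> j \<ge> 1"
  shows "continuous_on {x. separated N x} (\<lambda>x. pole_residue N \<beta> n x j)"
proof -
  define F where "F x = inverse (fps_const (x j) + fps_X) ^ n *
    (\<Prod>i\<in>{..N} - {j}. inverse (fps_const (x j - x i) + fps_X) ^ \<beta> i)" for x :: "nat \<Rightarrow> complex"
  have "pole_residue N \<beta> n x j = fps_nth (F x) (\<beta> j - 1)" if x: "separated N x" for x
  proof -
    define f where "f t = inverse (x j + t) ^ n * (\<Prod>i\<in>{..N} - {j}. inverse ((x j - x i) + t) ^ \<beta> i)" for t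
    have inv: "(\<lambda>t. inverse (w + t)) has_fps_expansion inverse (fps_const w + fps_X)" if "w \<noteq> 0" for w :: complex
      by (rule has_fps_expansion_inverse) (use that in \<open>auto intro!: fps_expansion_intros\<close>)
    have pw: "(\<lambda>t. inverse (w + t) ^ m) has_fps_expansion inverse (fps_const w + fps_X) ^ m"
      if "w \<noteq> 0" for w :: complex and m
      by (intro has_fps_expansion_power inv that)
    have "f has_fps_expansion F x" unfolding f_def F_def
      by (intro has_fps_expansion_mult has_fps_expansion_prod pw)
        (use x j in \<open>auto simp: separated_def inj_on_def\<close>)
    from residue_fps_expansion_over_power_at_0[OF this, of "\<beta> j - 1"]
    have "residue (\<lambda>z. f z / z ^ \<beta> j) 0 = fps_nth (F x) (\<beta> j - 1)" using \<beta> by simp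
    moreover have "pole_form N \<beta> n x (x j + z) = f z / z ^ \<beta> j" for z
    proof -
      have "(\<Prod>i\<le>N. (x j + z - x i) ^ \<beta> i) = z ^ \<beta> j * (\<Prod>i\<in>{..N} - {j}. (x j + z - x i) ^ \<beta> i)"
        using j by (subst prod.remove[of _ j]) auto
      moreover have "(\<Prod>i\<in>{..N} - {j}. inverse ((x j - x i) + z) ^ \<beta> i) = inverse (\<Prod>i\<in>{..N} - {j}. (x j + z - x i) ^ \<beta> i)"
        unfolding prod_inversef[symmetric] o_def by (rule prod.cong) (auto simp: power_inverse algebra_simps)
      ultimately show ?thesis by (simp add: pole_form_def f_def field_simps power_inverse)
    qed
    ultimately show ?thesis by (simp add: pole_residue_def residue_shift_0[of _ "x j"])
  qed
  moreover have "coeffs_continuous {x. separated N x} F" unfolding F_def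
  proof (intro coeffs_continuous_mult coeffs_continuous_prod coeffs_continuous_power)
    have c: "continuous_on {x. separated N x} (\<lambda>x. x i)" for i
      by (rule continuous_on_subset[OF continuous_on_product_coordinates]) auto
    have lin: "coeffs_continuous {x. separated N x} (\<lambda>x. inverse (fps_const (w x) + fps_X))"
      if w: "continuous_on {x. separated N x} w" "\<And>x. separated N x \<Longrightarrow> w x \<noteq> 0" for w
    proof -
      have "continuous_on {x. separated N x} (\<lambda>x. (- 1) ^ k / w x ^ Suc k)" for k
        by (intro continuous_intros w(1)) (use w(2) in auto)
      then have "continuous_on {x. separated N x} (\<lambda>x. fps_nth (inverse (fps_const (w x) + fps_X)) k)" for k
        by (rule continuous_on_eq) (use w(2) in \<open>auto simp: inverse_linear_fps\<close>)
      then show ?thesis by (simp add: coeffs_continuous_def)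
    qed
    show "coeffs_continuous {x. separated N x} (\<lambda>x. inverse (fps_const (x j) + fps_X))"
      by (rule lin[OF c]) (use j in \<open>auto simp: separated_def\<close>)
    show "coeffs_continuous {x. separated N x} (\<lambda>x. inverse (fps_const (x j - x i) + fps_X))"
      if "i \<in> {..N} - {j}" for i
      by (rule lin[OF continuous_on_diff[OF c c]]) (use that j in \<open>auto simp: separated_def inj_on_def\<close>)
  qed
  then have "continuous_on {x. separated N x} (\<lambda>x. fps_nth (F x) (\<beta> j - 1))" by (simp add: coeffs_continuous_def)
  ultimately show ?thesis by (auto elim: continuous_on_eq)
qed

section \<open>Moebius transformations\<close>

type_synonym hvec = "complex \<times> complex"
type_synonym mat2 = "complex \<times> complex \<times> complex \<times> complex"

text \<open>Homogeneous coordinates of the point with coordinate w in the given chart; the quotient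
  of \<open>num\<close> and \<open>den\<close> recovers the coordinate, so that both charts are
  handled by one formula.\<close>

fun hvec_of :: "chart \<Rightarrow> complex \<Rightarrow> hvec" where
  "hvec_of Chart0 w = (w, 1)"
| "hvec_of Chart1 w = (1, w)"

fun num :: "chart \<Rightarrow> hvec \<Rightarrow> complex" where
  "num Chart0 X = fst X"
| "num Chart1 X = snd X"

fun den :: "chart \<Rightarrow> hvec \<Rightarrow> complex" where
  "den Chart0 X = snd X"
| "den Chart1 X = fst X"

definition hpoint :: "hvec \<Rightarrow> sphere" where
  "hpoint X = (if snd X = 0 then None else Some (fst X / snd X))"

definition det2 :: "hvec \<Rightarrow> hvec \<Rightarrow> complex" where
  "det2 X Y = fst X * snd Y - snd X * fst Y"

fun act :: "mat2 \<Rightarrow> hvec \<Rightarrow> hvec" where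
  "act (a, b, c, d) X = (a * fst X + b * snd X, c * fst X + d * snd X)"

fun mdet :: "mat2 \<Rightarrow> complex" where
  "mdet (a, b, c, d) = a * d - b * c"

text \<open>The adjugate serves as inverse: the two differ by a scalar, which is invisible on the
  sphere.\<close>

fun adj :: "mat2 \<Rightarrow> mat2" where
  "adj (a, b, c, d) = (d, - b, - c, a)"

fun mmul :: "mat2 \<Rightarrow> mat2 \<Rightarrow> mat2" where
  "mmul (a, b, c, d) (a', b', c', d') = (a * a' + b * c', a * b' + b * d', c * a' + d * c', c * b' + d * d')"

fun hvec_at :: "sphere \<Rightarrow> hvec" where
  "hvec_at None = (1, 0)"
| "hvec_at (Some z) = (z, 1)"

definition mob :: "mat2 \<Rightarrow> sphere \<Rightarrow> sphere" where
  "mob A x = hpoint (act A (hvec_at x))"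

definition hscale :: "complex \<Rightarrow> hvec \<Rightarrow> hvec" where
  "hscale t X = (t * fst X, t * snd X)"

lemma hvec_of_nonzero [simp]: "hvec_of i w \<noteq> 0"
  by (cases i) (auto simp: zero_prod_def)

lemma hvec_at_nonzero [simp]: "hvec_at x \<noteq> 0"
  by (cases x) (auto simp: zero_prod_def)

lemma hpoint_hvec_at [simp]: "hpoint (hvec_at x) = x"
  by (cases x) (auto simp: hpoint_def)

lemma point_eq_hpoint: "point i w = hpoint (hvec_of i w)"
  by (cases i) (auto simp: hpoint_def)

lemma hpoint_in_chart_dom: "X \<noteq> 0 \<Longrightarrow> hpoint X \<in> chart_dom k \<longleftrightarrow> den k X \<noteq> 0"
proof (cases k)
  case Chart0
  then show ?thesis by (auto simp: chart_dom_def hpoint_def)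
next
  case Chart1
  assume X: "X \<noteq> 0"
  have "Some z \<in> range (point Chart1) \<longleftrightarrow> z \<noteq> 0" for z
  proof
    assume "z \<noteq> 0"
    then have "Some z = point Chart1 (1 / z)" by simp
    then show "Some z \<in> range (point Chart1)" by blast
  qed (auto split: if_splits)
  moreover have "None \<in> range (point Chart1)" by (rule range_eqI[of _ _ 0]) simp
  ultimately show ?thesis
    using X Chart1 by (cases X) (auto simp: chart_dom_def hpoint_def zero_prod_def)
qed

lemma coord_hpoint: "den k X \<noteq> 0 \<Longrightarrow> coord k (hpoint X) = num k X / den k X"
  by (cases k) (auto simp: hpoint_def)

lemma hpoint_eq_point: "den k X \<noteq> 0 \<Longrightarrow> hpoint X = point k (num k X / den k X)"
  by (cases k) (auto simp: hpoint_def)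

lemma hpoint_eq_iff:
  assumes "X \<noteq> 0" "Y \<noteq> 0"
  shows "hpoint X = hpoint Y \<longleftrightarrow> det2 X Y = 0"
  using assms by (cases X; cases Y) (auto simp: hpoint_def det2_def zero_prod_def field_simps)

lemma hpoint_hscale [simp]: "t \<noteq> 0 \<Longrightarrow> hpoint (hscale t X) = hpoint X"
  by (auto simp: hpoint_def hscale_def)

lemma hscale_hvec_at:
  assumes "X \<noteq> 0"
  shows "\<exists>t. t \<noteq> 0 \<and> X = hscale t (hvec_at (hpoint X))"
  using assms
  by (intro exI[of _ "if snd X = 0 then fst X else snd X"])
    (cases X, auto simp: hpoint_def hscale_def zero_prod_def)

lemma act_hscale: "act A (hscale t X) = hscale t (act A X)"
  by (cases A) (auto simp: hscale_def algebra_simps)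

lemma act_act: "act A (act B X) = act (mmul A B) X"
  by (cases A; cases B) (auto simp: algebra_simps)

lemma act_adj: "act A (act (adj A) X) = hscale (mdet A) X"
  by (cases A) (auto simp: hscale_def algebra_simps)

lemma adj_adj [simp]: "adj (adj A) = A"
  by (cases A) auto

lemma mdet_adj [simp]: "mdet (adj A) = mdet A"
  by (cases A) (auto simp: algebra_simps)

lemma mdet_mmul: "mdet (mmul A B) = mdet A * mdet B"
  by (cases A; cases B) (auto simp: algebra_simps)

lemma adj_mmul: "adj (mmul A B) = mmul (adj B) (adj A)"
  by (cases A; cases B) (auto simp: algebra_simps)

lemma det2_act: "det2 (act A X) Y = det2 X (act (adj A) Y)"
  by (cases A) (auto simp: det2_def algebra_simps)

lemma det2_act_act: "det2 (act A X) (act A Y) = mdet A * det2 X Y"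
  by (cases A) (auto simp: det2_def algebra_simps)

lemma hscale_eq_0_iff [simp]: "hscale t X = 0 \<longleftrightarrow> t = 0 \<or> X = 0"
  by (cases X) (auto simp: hscale_def zero_prod_def)

lemma act_zero [simp]: "act A 0 = 0"
  by (cases A) (auto simp: zero_prod_def)

lemma act_nonzero: "mdet A \<noteq> 0 \<Longrightarrow> X \<noteq> 0 \<Longrightarrow> act A X \<noteq> 0"
  using act_adj[of "adj A" X] by (metis act_zero adj_adj hscale_eq_0_iff mdet_adj)

lemma mob_hpoint:
  assumes "mdet A \<noteq> 0" "X \<noteq> 0"
  shows "mob A (hpoint X) = hpoint (act A X)"
proof -
  obtain t where t: "t \<noteq> 0" "X = hscale t (hvec_at (hpoint X))" using hscale_hvec_at[OF assms(2)] by blast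
  have "act A X = hscale t (act A (hvec_at (hpoint X)))" by (subst t(2)) (rule act_hscale)
  with t(1) show ?thesis by (simp add: mob_def)
qed

lemma mob_mob: "mdet A \<noteq> 0 \<Longrightarrow> mdet B \<noteq> 0 \<Longrightarrow> mob A (mob B x) = mob (mmul A B) x"
  unfolding mob_def[of B] by (subst mob_hpoint) (auto simp: act_nonzero act_act mob_def)

lemma mob_adj: "mdet A \<noteq> 0 \<Longrightarrow> mob A (mob (adj A) x) = x"
  unfolding mob_def[of "adj A"] by (subst mob_hpoint) (auto simp: act_nonzero act_adj)

lemma mob_adj': "mdet A \<noteq> 0 \<Longrightarrow> mob (adj A) (mob A x) = x"
  using mob_adj[of "adj A"] by simp

lemma bij_mob: "mdet A \<noteq> 0 \<Longrightarrow> bij (mob A)"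
  by (rule bij_betw_byWitness[where f' = "mob (adj A)"]) (auto simp: mob_adj mob_adj')

lemma inv_mob: "mdet A \<noteq> 0 \<Longrightarrow> inv_into UNIV (mob A) = mob (adj A)"
  by (rule inv_unique_comp) (auto simp: fun_eq_iff mob_adj mob_adj')

lemma mob_point: "mdet A \<noteq> 0 \<Longrightarrow> mob A (point i w) = hpoint (act A (hvec_of i w))"
  by (simp add: point_eq_hpoint mob_hpoint)

section \<open>Charts and the topology of the sphere\<close>

lemma point_coord:
  assumes "x \<in> chart_dom k"
  shows "point k (coord k x) = x"
proof -
  have "den k (hvec_at x) \<noteq> 0" using hpoint_in_chart_dom[of "hvec_at x" k] assms by simp
  from hpoint_eq_point[OF this] coord_hpoint[OF this] show ?thesis by simp
qed

lemma coord_point: "coord k (point k w) = w"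
  by (cases k) auto

lemma in_some_chart_dom: "\<exists>k. x \<in> chart_dom k"
proof -
  have "\<exists>k. den k (hvec_at x) \<noteq> 0"
    by (cases x) (auto intro: exI[of _ Chart0] exI[of _ Chart1])
  then show ?thesis using hpoint_in_chart_dom[of "hvec_at x"] by auto
qed

lemma continuous_map_point: "continuous_map euclidean sphere_top (point i)"
proof (cases i)
  case Chart0
  then have "point i = Some" by auto
  then show ?thesis unfolding sphere_top_def by (simp add: continuous_map_Some)
next
  case Chart1
  have inv: "continuous_on (- {0}) (\<lambda>w :: complex. 1 / w)" by (intro continuous_intros) auto
  have nz: "open {w. w \<noteq> 0 \<and> 1 / w \<in> V}" if "open V" for V :: "complex set"
    using continuous_open_preimage[OF inv _ that] by (auto simp: vimage_def Int_def conj_commute open_Compl)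
  have "open {w. point Chart1 w \<in> U}" if U: "openin sphere_top U" for U
  proof -
    from U consider V where "open V" "U = Some ` V" |
      C where "compact C" "U = insert None (Some ` (- C))"
      unfolding sphere_top_def openin_Alexandroff_compactification by (auto simp: Compl_eq_Diff_UNIV)
    then show ?thesis
    proof cases
      case 1
      then have "{w. point Chart1 w \<in> U} = {w. w \<noteq> 0 \<and> 1 / w \<in> V}" by auto
      with nz[OF 1(1)] show ?thesis by simp
    next
      case 2
      obtain B where B: "B > 0" "\<And>z. z \<in> C \<Longrightarrow> norm z < B"
        using compact_imp_bounded[OF 2(1)] bounded_pos_less by metis
      have "1 / w \<notin> C" if "w \<noteq> 0" "norm w < 1 / B" for w
      proof
        assume "1 / w \<in> C"
        then have "norm (1 / w) < B" by (rule B)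
        with that B(1) show False by (auto simp: norm_divide field_simps)
      qed
      then have "{w. point Chart1 w \<in> U} = ball 0 (1 / B) \<union> {w. w \<noteq> 0 \<and> 1 / w \<in> - C}"
        using 2 B(1) by auto
      moreover have "open (ball 0 (1 / B) \<union> {w. w \<noteq> 0 \<and> 1 / w \<in> - C})"
        using 2(1) by (intro open_Un nz open_ball open_Compl compact_imp_closed)
      ultimately show ?thesis by simp
    qed
  qed
  then show ?thesis using Chart1
    unfolding continuous_map_def by (auto simp: sphere_top_def image_iff)
qed

text \<open>Together with continuity of the charts, this says that openness on the sphere is tested
  in the two charts. A disc around 0 in the chart at infinity bounds the complement in the plane,
  which is therefore compact.\<close>

lemma openin_sphere_topI:
  assumes "\<And>i. open {w. point i w \<in> U}"
  shows "openin sphere_top U"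
proof -
  define V where "V = {z. Some z \<in> U}"
  have V: "open V" using assms[of Chart0] by (simp add: V_def)
  show ?thesis
  proof (cases "None \<in> U")
    case False
    then have "U = Some ` V" by (auto simp: V_def image_iff) (metis option.exhaust)
    with V show ?thesis unfolding sphere_top_def openin_Alexandroff_compactification by auto
  next
    case True
    have "open {w. point Chart1 w \<in> U}" by (rule assms)
    moreover have "0 \<in> {w. point Chart1 w \<in> U}" using True by simp
    ultimately obtain e where e: "e > 0" "ball 0 e \<subseteq> {w. point Chart1 w \<in> U}"
      by (meson open_contains_ball)
    have "norm z \<le> 1 / e" if "z \<notin> V" for z
    proof (rule ccontr)
      assume "\<not> norm z \<le> 1 / e"
      moreover from this have "z \<noteq> 0" using e(1) by auto
      ultimately have "norm (1 / z) < e" using e(1) by (simp add: norm_divide field_simps)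
      then have "1 / z \<in> ball 0 e" by simp
      with e(2) have "point Chart1 (1 / z) \<in> U" by blast
      with \<open>z \<noteq> 0\<close> that show False by (simp add: V_def)
    qed
    then have "bounded (- V)" unfolding bounded_iff by auto
    then have "compact (- V)" using V by (simp add: compact_eq_bounded_closed closed_Compl)
    moreover have "U = insert None (Some ` (topspace euclidean - - V))"
      using True by (auto simp: V_def image_iff) (metis option.exhaust)
    ultimately show ?thesis
      unfolding sphere_top_def openin_Alexandroff_compactification using V
      by (intro disjI2 exI[of _ "- V"]) (auto simp: closed_Compl)
  qed
qed

lemma topspace_sphere_top [simp]: "topspace sphere_top = UNIV"
  by (auto simp: sphere_top_def image_iff)

lemma open_point_preimage: "openin sphere_top U \<Longrightarrow> open {w. point i w \<in> U}"
  using openin_continuous_map_preimage[OF continuous_map_point, of U i] by simp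

lemma openin_chart_dom: "openin sphere_top (chart_dom k)"
proof (rule openin_sphere_topI)
  fix i
  have "{w. point i w \<in> chart_dom k} = {w. den k (hvec_of i w) \<noteq> 0}"
    by (simp add: point_eq_hpoint hpoint_in_chart_dom)
  also have "open \<dots>" by (cases i; cases k) (auto intro!: open_Collect_neq continuous_intros)
  finally show "open {w. point i w \<in> chart_dom k}" .
qed

lemma open_map_point_preimage:
  assumes "continuous_map sphere_top sphere_top \<phi>" "openin sphere_top U"
  shows "open {w. \<phi> (point i w) \<in> U}"
proof -
  have "openin sphere_top {x \<in> topspace sphere_top. \<phi> x \<in> U}"
    by (rule openin_continuous_map_preimage[OF assms])
  from open_point_preimage[OF this] show ?thesis by simp
qed

lemma act_hvec_holomorphic:
  "(\<lambda>w. num k (act A (hvec_of i w))) holomorphic_on S" "(\<lambda>w. den k (act A (hvec_of i w))) holomorphic_on S"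
  by (cases A; cases i; cases k; auto intro!: holomorphic_intros)+

lemma holomorphic_sphere_map_mob:
  assumes A: "mdet A \<noteq> 0"
  shows "holomorphic_sphere_map (mob A)"
  unfolding holomorphic_sphere_map_def
proof (intro conjI allI)
  let ?X = "\<lambda>i w. act A (hvec_of i w)"
  have nz: "?X i w \<noteq> 0" for i w using act_nonzero[OF A] by simp
  have opd: "open {w. den k (?X i w) \<noteq> 0}" for i k
    by (intro open_Collect_neq holomorphic_on_imp_continuous_on act_hvec_holomorphic continuous_intros)
  show "continuous_map sphere_top sphere_top (mob A)"
    unfolding continuous_map_def
  proof (intro conjI allI impI)
    fix U assume U: "openin sphere_top U"
    show "openin sphere_top {x \<in> topspace sphere_top. mob A x \<in> U}"
    proof (rule openin_sphere_topI)
      fix i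
      have "{w. point i w \<in> {x \<in> topspace sphere_top. mob A x \<in> U}} =
          (\<Union>k. {w. den k (?X i w) \<noteq> 0} \<inter> (\<lambda>w. num k (?X i w) / den k (?X i w)) -` {v. point k v \<in> U})"
        (is "?L = ?R")
      proof (intro subset_antisym subsetI)
        fix w assume w: "w \<in> ?L"
        obtain k where "hpoint (?X i w) \<in> chart_dom k" using in_some_chart_dom by blast
        then have k: "den k (?X i w) \<noteq> 0" using hpoint_in_chart_dom[OF nz] by blast
        with w show "w \<in> ?R" using hpoint_eq_point[OF k] by (auto simp: mob_point[OF A])
      next
        fix w assume "w \<in> ?R"
        then obtain k where k: "den k (?X i w) \<noteq> 0" "point k (num k (?X i w) / den k (?X i w)) \<in> U" by auto
        then show "w \<in> ?L" using hpoint_eq_point[OF k(1)] by (auto simp: mob_point[OF A])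
      qed
      also have "open \<dots>"
      proof (intro open_UN ballI)
        fix k
        have "continuous_on {w. den k (?X i w) \<noteq> 0} (\<lambda>w. num k (?X i w) / den k (?X i w))"
          by (intro holomorphic_on_imp_continuous_on holomorphic_on_divide act_hvec_holomorphic) auto
        from continuous_open_preimage[OF this opd open_point_preimage[OF U]]
        show "open ({w. den k (?X i w) \<noteq> 0} \<inter> (\<lambda>w. num k (?X i w) / den k (?X i w)) -` {v. point k v \<in> U})" .
      qed
      finally show "open {w. point i w \<in> {x \<in> topspace sphere_top. mob A x \<in> U}}" .
    qed
  qed auto
  fix i k
  have "{w. mob A (point i w) \<in> chart_dom k} = {w. den k (?X i w) \<noteq> 0}"
    by (simp add: mob_point[OF A] hpoint_in_chart_dom[OF nz])
  moreover have "(\<lambda>w. coord k (mob A (point i w))) holomorphic_on {w. den k (?X i w) \<noteq> 0}"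
  proof (rule holomorphic_transform)
    show "(\<lambda>w. num k (?X i w) / den k (?X i w)) holomorphic_on {w. den k (?X i w) \<noteq> 0}"
      by (intro holomorphic_on_divide act_hvec_holomorphic) auto
  qed (simp add: mob_point[OF A] coord_hpoint)
  ultimately show "(\<lambda>w. coord k (mob A (point i w))) holomorphic_on {w. mob A (point i w) \<in> chart_dom k}"
    by simp
qed

lemma sphere_biholomorphism_mob: "mdet A \<noteq> 0 \<Longrightarrow> sphere_biholomorphism (mob A)"
  unfolding sphere_biholomorphism_def by (simp add: bij_mob inv_mob holomorphic_sphere_map_mob)

lemma holomorphic_sphere_map_compose:
  assumes \<phi>: "holomorphic_sphere_map \<phi>" and \<psi>: "holomorphic_sphere_map \<psi>"
  shows "holomorphic_sphere_map (\<phi> \<circ> \<psi>)"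
  unfolding holomorphic_sphere_map_def
proof (intro conjI allI)
  have c: "continuous_map sphere_top sphere_top \<phi>" "continuous_map sphere_top sphere_top \<psi>"
    using assms by (auto simp: holomorphic_sphere_map_def)
  then show c': "continuous_map sphere_top sphere_top (\<phi> \<circ> \<psi>)" by (intro continuous_map_compose)
  fix i k
  let ?S = "{w. (\<phi> \<circ> \<psi>) (point i w) \<in> chart_dom k}"
  have opS: "open ?S" by (rule open_map_point_preimage[OF c' openin_chart_dom])
  have "\<exists>T. open T \<and> w0 \<in> T \<and> (\<lambda>w. coord k ((\<phi> \<circ> \<psi>) (point i w))) holomorphic_on T" if w0: "w0 \<in> ?S" for w0
  proof -
    obtain j where j: "\<psi> (point i w0) \<in> chart_dom j" using in_some_chart_dom by blast
    let ?T = "?S \<inter> {w. \<psi> (point i w) \<in> chart_dom j}"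
    have "open ?T" by (intro open_Int opS open_map_point_preimage[OF c(2) openin_chart_dom])
    moreover have "(\<lambda>w. coord k ((\<phi> \<circ> \<psi>) (point i w))) holomorphic_on ?T"
    proof (rule holomorphic_transform)
      have 1: "(\<lambda>w. coord j (\<psi> (point i w))) holomorphic_on ?T"
        using \<psi> unfolding holomorphic_sphere_map_def by (blast intro: holomorphic_on_subset)
      have 2: "(\<lambda>w. coord k (\<phi> (point j w))) holomorphic_on {w. \<phi> (point j w) \<in> chart_dom k}"
        using \<phi> unfolding holomorphic_sphere_map_def by blast
      show "((\<lambda>w. coord k (\<phi> (point j w))) \<circ> (\<lambda>w. coord j (\<psi> (point i w)))) holomorphic_on ?T"
        by (rule holomorphic_on_compose_gen[OF 1 2]) (auto simp: point_coord)
    qed (auto simp: point_coord)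
    ultimately show ?thesis using w0 j by blast
  qed
  then show "(\<lambda>w. coord k ((\<phi> \<circ> \<psi>) (point i w))) holomorphic_on ?S"
    unfolding holomorphic_on_def[of _ ?S]
    by (meson field_differentiable_at_within holomorphic_on_imp_differentiable_at)
qed

text \<open>Injectivity gives the map a nonzero derivative in the chart at infinity, so its finite
  part grows at most linearly, and Liouville's theorem for polynomials makes it affine.\<close>

lemma biholomorphism_fixing_infinity:
  assumes bij: "bij \<psi>" and hol: "holomorphic_sphere_map \<psi>" and inf: "\<psi> None = None"
  shows "\<exists>\<alpha> \<beta>. \<beta> \<noteq> 0 \<and> (\<forall>z. \<psi> (Some z) = Some (\<alpha> + \<beta> * z))"
proof -
  have inj: "\<psi> x = \<psi> y \<Longrightarrow> x = y" for x y using bij by (auto simp: bij_def inj_def)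
  have fin: "\<psi> (Some z) \<noteq> None" for z using inj[of "Some z" None] inf by auto
  define f where "f z = coord Chart0 (\<psi> (Some z))" for z
  have f: "\<psi> (Some z) = Some (f z)" for z using fin[of z] by (auto simp: f_def)
  have cont: "continuous_map sphere_top sphere_top \<psi>" using hol by (simp add: holomorphic_sphere_map_def)
  have "(\<lambda>w. coord Chart0 (\<psi> (point Chart0 w))) holomorphic_on {w. \<psi> (point Chart0 w) \<in> chart_dom Chart0}"
    using hol unfolding holomorphic_sphere_map_def by blast
  moreover have "{w. \<psi> (point Chart0 w) \<in> chart_dom Chart0} = UNIV"
    using f by (auto simp: chart_dom_def)
  ultimately have holf: "f holomorphic_on UNIV" by (simp add: f_def[abs_def])
  define g where "g w = coord Chart1 (\<psi> (point Chart1 w))" for w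
  define S where "S = {w. \<psi> (point Chart1 w) \<in> chart_dom Chart1}"
  have holg: "g holomorphic_on S"
    using hol unfolding holomorphic_sphere_map_def g_def[abs_def] S_def by blast
  have opS: "open S" unfolding S_def by (rule open_map_point_preimage[OF cont openin_chart_dom])
  have S0: "0 \<in> S" using hpoint_in_chart_dom[of "(1, 0)" Chart1] inf by (auto simp: S_def hpoint_def zero_prod_def)
  have g0: "g 0 = 0" by (simp add: g_def inf)
  have "inj_on g S"
  proof (rule inj_onI)
    fix w w' assume w: "w \<in> S" "w' \<in> S" "g w = g w'"
    then have "\<psi> (point Chart1 w) = \<psi> (point Chart1 w')"
      using point_coord[of "\<psi> (point Chart1 w)" Chart1] point_coord[of "\<psi> (point Chart1 w')" Chart1]
      by (simp add: S_def g_def)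
    then have "point Chart1 w = point Chart1 w'" by (rule inj)
    then show "w = w'" using coord_point[of Chart1 w] coord_point[of Chart1 w'] by simp
  qed
  from holomorphic_injective_imp_regular[OF holg opS this S0] have g': "deriv g 0 \<noteq> 0" .
  have "(g has_field_derivative deriv g 0) (at 0)" by (rule holomorphic_derivI[OF holg opS S0])
  then have "((\<lambda>w. g w / w) \<longlongrightarrow> deriv g 0) (at 0)" by (simp add: DERIV_def g0)
  then have "((\<lambda>w. norm (g w / w)) \<longlongrightarrow> norm (deriv g 0)) (at 0)" by (rule tendsto_norm)
  from order_tendstoD(1)[OF this, of "norm (deriv g 0) / 2"] g'
  have "eventually (\<lambda>w. norm (deriv g 0) / 2 < norm (g w / w)) (at 0)" by simp
  then obtain e where e: "e > 0" "\<And>w. w \<noteq> 0 \<Longrightarrow> norm w < e \<Longrightarrow> norm (deriv g 0) / 2 < norm (g w / w)"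
    by (auto simp: eventually_at)
  define c where "c = norm (deriv g 0) / 2"
  have c: "c > 0" using g' by (simp add: c_def)
  have bound: "norm (f z) \<le> (1 / c) * norm z ^ 1" if z: "2 / e \<le> norm z" for z
  proof -
    have z0: "z \<noteq> 0" using z e(1) by (auto simp: field_simps)
    have "norm z > 1 / e" using z e(1) by (smt (verit) divide_strict_right_mono)
    then have "norm (1 / z) < e" using e(1) z0 by (simp add: norm_divide field_simps)
    then have "c < norm (g (1 / z) / (1 / z))" using e(2)[of "1 / z"] z0 by (simp add: c_def)
    moreover have "g (1 / z) = 1 / f z" using z0 by (simp add: g_def f)
    ultimately have *: "c < norm z / norm (f z)" using z0 by (simp add: norm_divide norm_mult)
    then have "f z \<noteq> 0" using c by auto
    with * c show ?thesis by (simp add: field_simps)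
  qed
  have lin: "f z = f 0 + deriv f 0 * z" for z
  proof -
    have "f z = (\<Sum>k\<le>1. (deriv ^^ k) f 0 / fact k * z ^ k)"
      by (rule Liouville_polynomial[OF holf]) (rule bound)
    then show ?thesis by simp
  qed
  moreover have "deriv f 0 \<noteq> 0"
  proof
    assume "deriv f 0 = 0"
    then have "f 0 = f 1" using lin[of 1] by simp
    then show False using inj[of "Some 0" "Some 1"] f by simp
  qed
  moreover have "\<psi> (Some z) = Some (f 0 + deriv f 0 * z)" for z
    unfolding f using lin[of z] by (rule arg_cong)
  ultimately show ?thesis by blast
qed

theorem sphere_biholomorphism_iff: "sphere_biholomorphism \<phi> \<longleftrightarrow> (\<exists>A. mdet A \<noteq> 0 \<and> \<phi> = mob A)"
proof
  assume \<phi>: "sphere_biholomorphism \<phi>"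
  obtain x where x: "\<phi> x = None" using \<phi> by (metis bij_pointE sphere_biholomorphism_def)
  obtain A where A: "mdet A \<noteq> 0" "mob A None = x"
  proof (cases x)
    case None
    then show ?thesis by (intro that[of "(1, 0, 0, 1)"]) (auto simp: mob_def hpoint_def)
  next
    case (Some p)
    \<comment> \<open>The map z -> p - 1/z, sending infinity to p.\<close>
    then show ?thesis by (intro that[of "(p, - 1, 1, 0)"]) (auto simp: mob_def hpoint_def)
  qed
  have "\<exists>\<alpha> \<beta>. \<beta> \<noteq> 0 \<and> (\<forall>z. (\<phi> \<circ> mob A) (Some z) = Some (\<alpha> + \<beta> * z))"
  proof (rule biholomorphism_fixing_infinity)
    show "bij (\<phi> \<circ> mob A)" using \<phi> bij_mob[OF A(1)] by (auto simp: sphere_biholomorphism_def intro: bij_comp)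
    show "holomorphic_sphere_map (\<phi> \<circ> mob A)"
      using \<phi> holomorphic_sphere_map_mob[OF A(1)]
      by (auto simp: sphere_biholomorphism_def intro: holomorphic_sphere_map_compose)
  qed (simp add: A x)
  then obtain \<alpha> \<beta> where \<alpha>\<beta>: "\<beta> \<noteq> 0" "\<And>z. \<phi> (mob A (Some z)) = Some (\<alpha> + \<beta> * z)" by auto
  define B where "B = (\<beta>, \<alpha>, 0 :: complex, 1 :: complex)"
  have B: "mdet B \<noteq> 0" using \<alpha>\<beta> by (simp add: B_def)
  have "\<phi> (mob A y) = mob B y" for y
    by (cases y) (use A(2) x \<alpha>\<beta> in \<open>auto simp: B_def mob_def[of "(_, _, _, _)"] hpoint_def\<close>)
  then have "\<phi> y = mob (mmul B (adj A)) y" for y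
    using mob_adj[OF A(1), of y] mob_mob[OF B, of "adj A" y] A(1) by (metis mdet_adj)
  moreover have "mdet (mmul B (adj A)) \<noteq> 0" using A B by (simp add: mdet_mmul)
  ultimately show "\<exists>A. mdet A \<noteq> 0 \<and> \<phi> = mob A" by blast
qed (auto simp: sphere_biholomorphism_mob)

section \<open>Forms in homogeneous coordinates\<close>

definition admissible :: "nat \<Rightarrow> complex \<Rightarrow> (nat \<Rightarrow> hvec) \<Rightarrow> bool" where
  "admissible p c q \<longleftrightarrow> c \<noteq> 0 \<and> (\<forall>i\<in>{0..p}. q i \<noteq> 0) \<and>
     (\<forall>i\<in>{0..p}. \<forall>j\<in>{0..p}. i \<noteq> j \<longrightarrow> det2 (q i) (q j) \<noteq> 0)"

text \<open>The sign in dz = - dw / w^2.\<close>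

definition chart_sign :: "chart \<Rightarrow> complex" where
  "chart_sign i = (case i of Chart0 \<Rightarrow> 1 | Chart1 \<Rightarrow> - 1)"

lemma chart_sign_nonzero [simp]: "chart_sign i \<noteq> 0"
  by (cases i) (auto simp: chart_sign_def)

lemma topspace_params: "topspace (params p) = {(c, q). admissible p c q \<and> q \<in> extensional {0..p}}"
  by (auto simp: params_def admissible_def det2_def PiE_def mult.commute)

lemma linear_factor_eq_det2: "linear_factor X i w = det2 (hvec_of i w) X"
  by (cases X; cases i) (auto simp: det2_def)

lemma det2_eq_0_iff_point: "X \<noteq> 0 \<Longrightarrow> det2 (hvec_of i w) X = 0 \<longleftrightarrow> point i w = hpoint X"
  using hpoint_eq_iff[of "hvec_of i w" X] by (simp add: point_eq_hpoint)

definition slope :: "chart \<Rightarrow> hvec \<Rightarrow> complex" where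
  "slope i X = (case i of Chart0 \<Rightarrow> snd X | Chart1 \<Rightarrow> - fst X)"

lemma det2_hvec_of_shift: "det2 (hvec_of i w) X = det2 (hvec_of i w0) X + (w - w0) * slope i X"
  by (cases i) (auto simp: det2_def slope_def algebra_simps)

lemma slope_nonzero:
  assumes "X \<noteq> 0" "det2 (hvec_of i w0) X = 0"
  shows "slope i X \<noteq> 0"
  using assms by (cases i; cases X) (auto simp: det2_def slope_def zero_prod_def)

lemma det2_hvec_holomorphic [holomorphic_intros]: "(\<lambda>w. det2 (hvec_of i w) X) holomorphic_on S"
  by (cases i) (auto simp: det2_def intro!: holomorphic_intros)

text \<open>The value at a point is determined by the values nearby: it is the limit, or 0 at a
  pole.\<close>

lemma nicely_meromorphic_eqI:
  assumes "f nicely_meromorphic_on UNIV" "g nicely_meromorphic_on UNIV"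
    and ev: "eventually (\<lambda>w. f w = g w) (at z)"
  shows "f z = g z"
proof -
  have pole: "is_pole f z \<longleftrightarrow> is_pole g z" by (rule is_pole_cong[OF ev]) simp
  have f: "(is_pole f z \<and> f z = 0) \<or> f \<midarrow>z\<rightarrow> f z" and g: "(is_pole g z \<and> g z = 0) \<or> g \<midarrow>z\<rightarrow> g z"
    using assms by (auto simp: nicely_meromorphic_on_def)
  have np: "\<not> (h \<midarrow>z\<rightarrow> l)" if "is_pole h z" for h :: "complex \<Rightarrow> complex" and l
    using that unfolding is_pole_def by (meson at_neq_bot not_tendsto_and_filterlim_at_infinity)
  show ?thesis
  proof (cases "is_pole f z")
    case True
    then show ?thesis using f g pole np by metis
  next
    case False
    then have "f \<midarrow>z\<rightarrow> f z" "g \<midarrow>z\<rightarrow> g z" using f g pole by auto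
    moreover from this(2) have "f \<midarrow>z\<rightarrow> g z" using tendsto_cong[OF ev] by blast
    ultimately show ?thesis using LIM_unique by blast
  qed
qed

locale stratum_data =
  fixes p a N :: nat and b :: "nat \<Rightarrow> nat"
  assumes pN: "p = N + 2" and a1: "a \<ge> 1" and b1: "\<And>j. j \<in> {1..p} \<Longrightarrow> b j \<ge> 1"
    and order_sum: "(\<Sum>j=1..p. b j) = a + 2"
begin

lemma p2: "p \<ge> 2"
  by (simp add: pN)

abbreviation "Pf c q \<equiv> param_form p a b (c, q)"

lemma fst_param_form:
  "fst (Pf c q) i w = chart_sign i * c * (det2 (hvec_of i w) (q 0) ^ a / (\<Prod>j=1..p. det2 (hvec_of i w) (q j) ^ b j))"
  by (cases i) (auto simp: param_form_def linear_factor_eq_det2 chart_sign_def)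

lemma snd_param_form: "snd (Pf c q) = restrict (\<lambda>j. hpoint (q j)) {1..p}"
  by (auto simp: param_form_def hpoint_def)

definition expo :: "nat \<Rightarrow> int" where
  "expo m = (if m = 0 then int a else - int (b m))"

lemma fst_param_form_powi:
  "fst (Pf c q) i w = chart_sign i * c * (\<Prod>m\<in>{0..p}. det2 (hvec_of i w) (q m) powi expo m)"
proof -
  have eq: "{0..p} = insert 0 {1..p}" by auto
  have "(\<Prod>m\<in>{1..p}. det2 (hvec_of i w) (q m) powi expo m) = (\<Prod>m\<in>{1..p}. inverse (det2 (hvec_of i w) (q m) ^ b m))"
    by (rule prod.cong) (auto simp: expo_def power_int_minus)
  also have "\<dots> = inverse (\<Prod>m\<in>{1..p}. det2 (hvec_of i w) (q m) ^ b m)"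
    using prod_inversef[of "\<lambda>m. det2 (hvec_of i w) (q m) ^ b m" "{1..p}"] by (simp add: o_def)
  finally show ?thesis unfolding eq by (simp add: fst_param_form expo_def divide_inverse)
qed

text \<open>Near the m-th point its own factor is \<open>slope i (q m)\<close> times w - w0, and all
  other factors stay away from 0.\<close>

lemma zorder_param_form_at:
  assumes q: "admissible p c q" and m: "m \<in> {0..p}" "point i w0 = hpoint (q m)"
  shows "zorder (fst (Pf c q) i) w0 = expo m"
proof -
  have nz: "q k \<noteq> 0" if "k \<in> {0..p}" for k using q that by (auto simp: admissible_def)
  have d0: "det2 (hvec_of i w0) (q m) = 0" using det2_eq_0_iff_point[OF nz[OF m(1)]] m(2) by simp
  have other: "det2 (hvec_of i w0) (q k) \<noteq> 0" if "k \<in> {0..p} - {m}" for k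
  proof
    assume "det2 (hvec_of i w0) (q k) = 0"
    then have "hpoint (q k) = hpoint (q m)" using det2_eq_0_iff_point[OF nz[of k]] that m(2) by simp
    then have "det2 (q k) (q m) = 0" using hpoint_eq_iff nz that m(1) by simp
    with q that m(1) show False by (auto simp: admissible_def)
  qed
  have sl: "slope i (q m) \<noteq> 0" using slope_nonzero[OF nz[OF m(1)] d0] .
  define S where "S = {w. \<forall>k\<in>{0..p} - {m}. det2 (hvec_of i w) (q k) \<noteq> 0}"
  define g where "g w = chart_sign i * c * (slope i (q m) powi expo m *
    (\<Prod>k\<in>{0..p} - {m}. det2 (hvec_of i w) (q k) powi expo k))" for w
  have "S = (\<Inter>k\<in>{0..p} - {m}. {w. det2 (hvec_of i w) (q k) \<noteq> 0})" by (auto simp: S_def)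
  moreover have "open {w. det2 (hvec_of i w) X \<noteq> 0}" for X
    by (intro open_Collect_neq holomorphic_on_imp_continuous_on det2_hvec_holomorphic continuous_intros)
  ultimately have "open S" by (simp add: open_INT)
  then show ?thesis
  proof (rule zorder_eqI)
    show "w0 \<in> S" using other by (auto simp: S_def)
    show "g holomorphic_on S" unfolding g_def by (auto intro!: holomorphic_intros simp: S_def)
    show "g w0 \<noteq> 0" using sl q other by (auto simp: g_def admissible_def)
    fix w assume w: "w \<in> S" "w \<noteq> w0"
    have "det2 (hvec_of i w) (q m) = (w - w0) * slope i (q m)" using det2_hvec_of_shift[of i w "q m" w0] d0 by simp
    then have "det2 (hvec_of i w) (q m) powi expo m = (w - w0) powi expo m * slope i (q m) powi expo m"
      by (simp add: power_int_mult_distrib)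
    then show "fst (Pf c q) i w = g w * (w - w0) powi expo m"
      unfolding fst_param_form_powi g_def using m(1) by (subst prod.remove[of _ m]) auto
  qed
qed

lemma zorder_param_form_off:
  assumes q: "admissible p c q" and m: "\<And>m. m \<in> {0..p} \<Longrightarrow> point i w0 \<noteq> hpoint (q m)"
  shows "zorder (fst (Pf c q) i) w0 = 0"
proof -
  have nz: "q k \<noteq> 0" if "k \<in> {0..p}" for k using q that by (auto simp: admissible_def)
  define S where "S = {w. \<forall>k\<in>{0..p}. det2 (hvec_of i w) (q k) \<noteq> 0}"
  have "S = (\<Inter>k\<in>{0..p}. {w. det2 (hvec_of i w) (q k) \<noteq> 0})" by (auto simp: S_def)
  moreover have "open {w. det2 (hvec_of i w) X \<noteq> 0}" for X
    by (intro open_Collect_neq holomorphic_on_imp_continuous_on det2_hvec_holomorphic continuous_intros)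
  ultimately have S: "open S" by (simp add: open_INT)
  have w0: "w0 \<in> S" using det2_eq_0_iff_point[OF nz] m by (auto simp: S_def)
  show ?thesis
  proof (rule zorder_eqI[OF S w0])
    show "fst (Pf c q) i holomorphic_on S"
      unfolding fst_param_form_powi[abs_def] by (auto intro!: holomorphic_intros simp: S_def)
    show "fst (Pf c q) i w0 \<noteq> 0"
      using w0 q unfolding fst_param_form_powi by (auto simp: S_def admissible_def)
  qed simp
qed

lemma form_order_param_form:
  assumes q: "admissible p c q"
  shows "m \<in> {0..p} \<Longrightarrow> form_order (fst (Pf c q)) (hpoint (q m)) = expo m"
    and "(\<And>m. m \<in> {0..p} \<Longrightarrow> x \<noteq> hpoint (q m)) \<Longrightarrow> form_order (fst (Pf c q)) x = 0"
proof -
  have *: "\<exists>i w. form_order F x = zorder (F i) w \<and> x = point i w" for F x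
    by (cases x) (auto simp: form_order_def intro: exI[of _ Chart0] exI[of _ Chart1])
  show "form_order (fst (Pf c q)) (hpoint (q m)) = expo m" if "m \<in> {0..p}"
    using *[of "fst (Pf c q)" "hpoint (q m)"] zorder_param_form_at[OF q that] by metis
  show "form_order (fst (Pf c q)) x = 0" if "\<And>m. m \<in> {0..p} \<Longrightarrow> x \<noteq> hpoint (q m)"
    using *[of "fst (Pf c q)" x] zorder_param_form_off[OF q] that by metis
qed

lemma param_form_nicely_meromorphic:
  assumes q: "admissible p c q"
  shows "fst (Pf c q) i nicely_meromorphic_on UNIV"
  unfolding nicely_meromorphic_on_def
proof (intro conjI ballI)
  have mero: "(\<lambda>w. det2 (hvec_of i w) X) meromorphic_on UNIV" for X
    by (intro analytic_on_imp_meromorphic_on) (simp add: analytic_on_open det2_hvec_holomorphic)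
  show "fst (Pf c q) i meromorphic_on UNIV"
    unfolding fst_param_form[abs_def] by (intro meromorphic_intros mero)
  fix z :: complex
  let ?N = "\<lambda>w. chart_sign i * c * det2 (hvec_of i w) (q 0) ^ a"
  let ?D = "\<lambda>w. \<Prod>j=1..p. det2 (hvec_of i w) (q j) ^ b j"
  have F: "fst (Pf c q) i = (\<lambda>w. ?N w / ?D w)" by (simp add: fst_param_form fun_eq_iff)
  have cont: "isCont (\<lambda>w. det2 (hvec_of i w) X) z" for X
    using holomorphic_on_imp_continuous_on[OF det2_hvec_holomorphic, of UNIV i X]
    by (simp add: continuous_on_eq_continuous_at)
  have cN: "isCont ?N z" and cD: "isCont ?D z" by (intro continuous_intros cont)+
  show "is_pole (fst (Pf c q) i) z \<and> fst (Pf c q) i z = 0 \<or> fst (Pf c q) i \<midarrow>z\<rightarrow> fst (Pf c q) i z"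
  proof (cases "?D z = 0")
    case False
    then have "isCont (\<lambda>w. ?N w / ?D w) z" by (intro isCont_divide cN cD)
    then show ?thesis unfolding F by (simp add: isCont_def)
  next
    case True
    then obtain j where j: "j \<in> {1..p}" "det2 (hvec_of i z) (q j) = 0" by auto
    have nz: "q k \<noteq> 0" if "k \<in> {0..p}" for k using q that by (auto simp: admissible_def)
    have "det2 (hvec_of i z) (q 0) \<noteq> 0"
    proof
      assume "det2 (hvec_of i z) (q 0) = 0"
      then have "hpoint (q 0) = hpoint (q j)" using j det2_eq_0_iff_point[OF nz] by (metis atLeastAtMost_iff le_0_eq nat_le_linear)
      then have "det2 (q 0) (q j) = 0" using hpoint_eq_iff nz j(1) by simp
      then show False using q j(1) by (auto simp: admissible_def)
    qed
    then have N0: "?N z \<noteq> 0" using q by (auto simp: admissible_def)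
    have "eventually (\<lambda>w. ?D w \<noteq> 0) (at z)"
    proof -
      have fin: "finite {w. det2 (hvec_of i w) X = 0}" if "X \<noteq> 0" for X
      proof -
        have "w = w'" if "det2 (hvec_of i w) X = 0" "det2 (hvec_of i w') X = 0" for w w'
          using that det2_eq_0_iff_point[OF \<open>X \<noteq> 0\<close>, of i] coord_point by metis
        then have "{w. det2 (hvec_of i w) X = 0} \<subseteq> {w'}" if "det2 (hvec_of i w') X = 0" for w'
          using that by auto
        then show ?thesis by (cases "\<exists>w'. det2 (hvec_of i w') X = 0") (auto intro: finite_subset)
      qed
      have "{w. ?D w = 0} \<subseteq> (\<Union>j\<in>{1..p}. {w. det2 (hvec_of i w) (q j) = 0})" by auto
      moreover have "finite (\<Union>j\<in>{1..p}. {w. det2 (hvec_of i w) (q j) = 0})" using fin nz by auto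
      ultimately have "finite {w. ?D w = 0}" by (rule finite_subset)
      then have "eventually (\<lambda>w. w \<in> - ({w. ?D w = 0} - {z})) (nhds z)"
        by (intro eventually_nhds_in_open open_Compl finite_imp_closed) auto
      then show ?thesis unfolding eventually_at_filter by eventually_elim auto
    qed
    moreover have "?D \<midarrow>z\<rightarrow> 0" using cD unfolding isCont_def True .
    ultimately have "filterlim ?D (at 0) (at z)" by (rule filterlim_atI[rotated])
    \<comment> \<open>The value 0 demanded at poles is that of division by zero.\<close>
    from is_pole_divide[OF cN this N0] True show ?thesis unfolding F by simp
  qed
qed

text \<open>Each linear factor is divided by w under z = 1/w; as the total degree of the quotient is
  -2 by \<open>order_sum\<close>, this produces the factor w^2 that cancels the one in dz = - dw /
  w^2.\<close>

lemma param_form_meromorphic: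
  assumes q: "admissible p c q"
  shows "meromorphic_form (fst (Pf c q))"
  unfolding meromorphic_form_def
proof (intro conjI allI impI param_form_nicely_meromorphic[OF q])
  fix w :: complex assume w: "w \<noteq> 0"
  have d: "det2 (hvec_of Chart0 (1 / w)) X = det2 (hvec_of Chart1 w) X / w" for X
    using w by (simp add: det2_def field_simps)
  have "det2 (hvec_of Chart0 (1 / w)) (q 0) ^ a / (\<Prod>j=1..p. det2 (hvec_of Chart0 (1 / w)) (q j) ^ b j) =
     (det2 (hvec_of Chart1 w) (q 0) ^ a / w ^ a) / ((\<Prod>j=1..p. det2 (hvec_of Chart1 w) (q j) ^ b j) / w ^ (a + 2))"
    unfolding d order_sum[symmetric] by (simp add: power_divide prod_dividef power_sum)
  also have "\<dots> = det2 (hvec_of Chart1 w) (q 0) ^ a / (\<Prod>j=1..p. det2 (hvec_of Chart1 w) (q j) ^ b j) * w\<^sup>2"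
    using w by (simp add: power_add power2_eq_square)
  finally show "fst (Pf c q) Chart1 w = fst (Pf c q) Chart0 (1 / w) * (- 1 / w\<^sup>2)"
    using w by (simp add: fst_param_form chart_sign_def)
qed

lemma param_form_labelled:
  assumes q: "admissible p c q"
  shows "Pf c q \<in> labelled_forms p a b"
proof -
  note ord = form_order_param_form[OF q]
  have nz: "q k \<noteq> 0" if "k \<in> {0..p}" for k using q that by (auto simp: admissible_def)
  have inj: "hpoint (q k) = hpoint (q m) \<Longrightarrow> k = m" if "k \<in> {0..p}" "m \<in> {0..p}" for k m
    using hpoint_eq_iff[OF nz[OF that(1)] nz[OF that(2)]] q that unfolding admissible_def by blast
  have pos: "form_order (fst (Pf c q)) x > 0 \<longleftrightarrow> x = hpoint (q 0)" for x
  proof (cases "\<exists>m\<in>{0..p}. x = hpoint (q m)")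
    case True
    then obtain m where m: "m \<in> {0..p}" "x = hpoint (q m)" by blast
    then show ?thesis using ord(1)[OF m(1)] inj[OF m(1), of 0] a1 by (auto simp: expo_def)
  next
    case False
    then show ?thesis using ord(2)[of x] by auto
  qed
  have neg: "form_order (fst (Pf c q)) x < 0 \<longleftrightarrow> x \<in> (\<lambda>j. hpoint (q j)) ` {1..p}" for x
  proof (cases "\<exists>m\<in>{0..p}. x = hpoint (q m)")
    case True
    then obtain m where m: "m \<in> {0..p}" "x = hpoint (q m)" by blast
    show ?thesis
    proof (cases "m = 0")
      case True
      have "x \<notin> (\<lambda>j. hpoint (q j)) ` {1..p}"
      proof
        assume "x \<in> (\<lambda>j. hpoint (q j)) ` {1..p}"
        then obtain j where j: "j \<in> {1..p}" "x = hpoint (q j)" by blast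
        then have "0 = j" using inj[of 0 j] m(2) True by simp
        with j(1) show False by simp
      qed
      then show ?thesis using ord(1)[OF m(1)] m(2) True by (simp add: expo_def)
    next
      case False
      then show ?thesis using ord(1)[OF m(1)] m b1[of m] by (auto simp: expo_def)
    qed
  next
    case False
    then show ?thesis using ord(2)[of x] by auto
  qed
  have nonzero: "fst (Pf c q) \<noteq> (\<lambda>i w. 0)"
  proof
    assume z: "fst (Pf c q) = (\<lambda>i w. 0)"
    let ?V = "\<lambda>k. {w. point Chart0 w = hpoint (q k)}"
    have "finite (\<Union>k\<in>{0..p}. ?V k)"
    proof (intro finite_UN_I)
      fix k
      have "?V k \<subseteq> {coord Chart0 (hpoint (q k))}" using coord_point[of Chart0] by (auto simp del: point.simps) metis
      then show "finite (?V k)" by (rule finite_subset) simp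
    qed simp
    then obtain w where "w \<notin> (\<Union>k\<in>{0..p}. ?V k)"
      using ex_new_if_finite[OF infinite_UNIV_char_0] by blast
    then have "\<forall>k\<in>{0..p}. det2 (hvec_of Chart0 w) (q k) \<noteq> 0" using det2_eq_0_iff_point[OF nz] by blast
    then have "fst (Pf c q) Chart0 w \<noteq> 0" using q unfolding fst_param_form_powi by (auto simp: admissible_def)
    with z show False by simp
  qed
  show ?thesis
    unfolding labelled_forms_def
  proof (clarsimp simp: split_beta, intro conjI)
    show "meromorphic_form (fst (Pf c q))" by (rule param_form_meromorphic[OF q])
    show "fst (Pf c q) \<noteq> (\<lambda>i w. 0)" by (rule nonzero)
    show "\<exists>Z. {x. 0 < form_order (fst (Pf c q)) x} = {Z} \<and> form_order (fst (Pf c q)) Z = int a"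
      using pos ord(1)[of 0] by (intro exI[of _ "hpoint (q 0)"]) (auto simp: expo_def)
    show "snd (Pf c q) \<in> extensional {Suc 0..p}" by (simp add: snd_param_form)
    show "inj_on (snd (Pf c q)) {Suc 0..p}" using inj by (auto simp: snd_param_form inj_on_def)
    show "{x. form_order (fst (Pf c q)) x < 0} = snd (Pf c q) ` {Suc 0..p}"
      using neg by (auto simp: snd_param_form image_iff)
    show "\<forall>j\<in>{Suc 0..p}. form_order (fst (Pf c q)) (snd (Pf c q) j) = - int (b j)"
      using ord(1) by (auto simp: snd_param_form expo_def)
  qed
qed

text \<open>
  Chart by chart, a form with the divisor of \<open>Pf 1 q\<close> divided by \<open>Pf 1 q\<close> has a finite limit everywhere,
  hence is constant by Liouville's theorem.
\<close>

lemma labelled_form_is_param_form: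
  assumes "(F, P) \<in> labelled_forms p a b"
  shows "\<exists>c q. admissible p c q \<and> q \<in> extensional {0..p} \<and> (F, P) = Pf c q"
proof -
  from assms obtain Z where mero: "meromorphic_form F" and F0: "F \<noteq> (\<lambda>i w. 0)"
    and Z: "{x. form_order F x > 0} = {Z}" "form_order F Z = int a"
    and P: "P \<in> extensional {1..p}" "inj_on P {1..p}" "{x. form_order F x < 0} = P ` {1..p}"
      "\<And>j. j \<in> {1..p} \<Longrightarrow> form_order F (P j) = - int (b j)"
    by (auto simp: labelled_forms_def)
  have nice: "F i nicely_meromorphic_on UNIV" for i using mero by (simp add: meromorphic_form_def)
  have compat: "F Chart1 w = F Chart0 (1 / w) * (- 1 / w\<^sup>2)" if "w \<noteq> 0" for w
    using mero that by (simp add: meromorphic_form_def)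
  define pos where "pos m = (if m = 0 then Z else P m)" for m
  define q where "q = restrict (\<lambda>m. hvec_at (pos m)) {0..p}"
  have pos_inj: "pos m = pos k \<Longrightarrow> m = k" if "m \<in> {0..p}" "k \<in> {0..p}" for m k
  proof -
    have PZ: "P j \<noteq> Z" if "j \<in> {1..p}" for j using P(4)[OF that] Z(2) a1 by auto
    assume eq: "pos m = pos k"
    show "m = k"
    proof (cases "m = 0 \<or> k = 0")
      case True
      then show ?thesis using eq PZ[of m] PZ[of k] that by (cases "m = 0"; cases "k = 0") (auto simp: pos_def)
    next
      case False
      then show ?thesis using eq that inj_onD[OF P(2), of m k] by (simp add: pos_def)
    qed
  qed
  have hq: "hpoint (q m) = pos m" if "m \<in> {0..p}" for m using that by (simp add: q_def)
  have qnz: "q m \<noteq> 0" if "m \<in> {0..p}" for m using that by (simp add: q_def)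
  have adm1: "admissible p c q" if "c \<noteq> 0" for c
    unfolding admissible_def
  proof (intro conjI ballI impI that qnz)
    fix i j assume ij: "i \<in> {0..p}" "j \<in> {0..p}" "i \<noteq> j"
    with pos_inj[OF ij(1,2)] have "hpoint (q i) \<noteq> hpoint (q j)" unfolding hq[OF ij(1)] hq[OF ij(2)] by blast
    then show "det2 (q i) (q j) \<noteq> 0" using hpoint_eq_iff[OF qnz[OF ij(1)] qnz[OF ij(2)]] by blast
  qed
  let ?G = "fst (Pf 1 q)"
  have adm: "admissible p 1 q" by (rule adm1) simp
  have niceG: "?G i nicely_meromorphic_on UNIV" for i by (rule param_form_nicely_meromorphic[OF adm])
  have ord_eq: "form_order F x = form_order ?G x" for x
  proof (cases "\<exists>m\<in>{0..p}. x = pos m")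
    case True
    then obtain m where m: "m \<in> {0..p}" "x = pos m" by blast
    then have "form_order ?G x = expo m" using form_order_param_form(1)[OF adm m(1)] hq by simp
    moreover have "form_order F x = expo m"
      using m Z(2) P(4)[of m] by (cases "m = 0") (auto simp: pos_def expo_def)
    ultimately show ?thesis by simp
  next
    case False
    then have "form_order ?G x = 0" using form_order_param_form(2)[OF adm, of x] hq by auto
    moreover have "x \<noteq> Z" using False by (metis atLeastAtMost_iff le0 pos_def)
    moreover have "x \<notin> P ` {1..p}"
    proof
      assume "x \<in> P ` {1..p}"
      then obtain j where "j \<in> {1..p}" "x = P j" by blast
      then have "j \<in> {0..p}" "x = pos j" by (auto simp: pos_def)
      with False show False by blast
    qed
    ultimately show ?thesis using Z(1) P(3) by force
  qed
  \<comment> \<open>Vanishing identically in one chart would propagate to the other by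
    compatibility, first away from 0 and then at 0 by \<open>nicely_meromorphic_eqI\<close>.\<close>
  have ev_nz: "eventually (\<lambda>w. H i w \<noteq> 0) (at z)"
    if H: "\<And>i. H i nicely_meromorphic_on UNIV" "H \<noteq> (\<lambda>i w. 0)"
      "\<And>w. w \<noteq> 0 \<Longrightarrow> H Chart1 w = H Chart0 (1 / w) * (- 1 / w\<^sup>2)" for H :: form and i z
  proof -
    have alt: "(\<forall>x\<in>UNIV. H i x = 0) \<or> eventually (\<lambda>x. H i x \<noteq> 0) (cosparse UNIV)" for i
      by (rule nicely_meromorphic_imp_constant_or_avoid[OF H(1)]) auto
    have "\<not> (\<forall>x\<in>UNIV. H i x = 0)"
    proof
      assume z: "\<forall>x\<in>UNIV. H i x = 0"
      have "H j w = 0" if "j \<noteq> i" "w \<noteq> 0" for j w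
        using H(3)[of w] H(3)[of "1 / w"] z that by (cases i; cases j) auto
      moreover have "H j 0 = (\<lambda>_. 0) 0" if "j \<noteq> i" for j
        by (rule nicely_meromorphic_eqI[OF H(1) nicely_meromorphic_on_const])
          (use calculation[OF that] in \<open>auto simp: eventually_at_filter\<close>)
      ultimately have "H j w = 0" for j w using z by (cases "j = i"; cases "w = 0") auto
      then show False using H(2) by (auto simp: fun_eq_iff)
    qed
    with alt show ?thesis by (auto simp: eventually_cosparse_open_eq)
  qed
  have G0: "?G \<noteq> (\<lambda>i w. 0)" using param_form_labelled[OF adm] by (auto simp: labelled_forms_def split_beta)
  have compatG: "?G Chart1 w = ?G Chart0 (1 / w) * (- 1 / w\<^sup>2)" if "w \<noteq> 0" for w
    using param_form_meromorphic[OF adm] that by (simp add: meromorphic_form_def)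
  have nzF: "eventually (\<lambda>w. F i w \<noteq> 0) (at z)" for i z by (rule ev_nz[OF nice F0 compat])
  have nzG: "eventually (\<lambda>w. ?G i w \<noteq> 0) (at z)" for i z by (rule ev_nz[OF niceG G0 compatG])
  define r where "r i w = F i w / ?G i w" for i w
  have lim: "\<exists>l. l \<noteq> 0 \<and> r i \<midarrow>z\<rightarrow> l" if ze: "zorder (F i) z = zorder (?G i) z" for i z
  proof -
    have ex: "zor_poly h z z \<noteq> 0 \<and> (\<exists>e>0. zor_poly h z holomorphic_on cball z e \<and>
        (\<forall>w\<in>cball z e - {z}. h w = zor_poly h z w * (w - z) powi zorder h z \<and> zor_poly h z w \<noteq> 0))"
      if "h nicely_meromorphic_on UNIV" "eventually (\<lambda>w. h w \<noteq> 0) (at z)" for h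
    proof -
      have "h meromorphic_on {z}" using that(1) by (auto simp: nicely_meromorphic_on_def intro: meromorphic_on_subset)
      then show ?thesis
        using zorder_exist[of h z] meromorphic_on_isolated_singularity meromorphic_on_not_essential
          eventually_frequently[OF at_neq_bot that(2)] by auto
    qed
    from ex[OF nice nzF, of i] obtain e where e: "e > 0" "zor_poly (F i) z z \<noteq> 0" "zor_poly (F i) z holomorphic_on cball z e"
      "\<forall>w\<in>cball z e - {z}. F i w = zor_poly (F i) z w * (w - z) powi zorder (F i) z" by blast
    from ex[OF niceG nzG, of i] obtain e' where e': "e' > 0" "zor_poly (?G i) z z \<noteq> 0" "zor_poly (?G i) z holomorphic_on cball z e'"
      "\<forall>w\<in>cball z e' - {z}. ?G i w = zor_poly (?G i) z w * (w - z) powi zorder (?G i) z" by blast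
    have c: "isCont (zor_poly (F i) z) z"
      by (rule continuous_on_interior[OF holomorphic_on_imp_continuous_on[OF e(3)]]) (use e(1) in simp)
    have c': "isCont (zor_poly (?G i) z) z"
      by (rule continuous_on_interior[OF holomorphic_on_imp_continuous_on[OF e'(3)]]) (use e'(1) in simp)
    have "((\<lambda>w. zor_poly (F i) z w / zor_poly (?G i) z w) \<longlongrightarrow> zor_poly (F i) z z / zor_poly (?G i) z z) (at z)"
      using c c' e'(2) by (intro tendsto_divide) (auto simp: isCont_def)
    moreover have "eventually (\<lambda>w. w \<in> ball z (min e e') - {z}) (at z)"
      using e(1) e'(1) by (intro eventually_at_in_open) auto
    then have "eventually (\<lambda>w. zor_poly (F i) z w / zor_poly (?G i) z w = r i w) (at z)"
    proof eventually_elim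
      case (elim w)
      then have "w \<in> cball z e - {z}" "w \<in> cball z e' - {z}" by auto
      with e(4) e'(4) ze elim show ?case by (simp add: r_def)
    qed
    ultimately have "r i \<midarrow>z\<rightarrow> zor_poly (F i) z z / zor_poly (?G i) z z" using tendsto_cong by fast
    with e(2) e'(2) show ?thesis by (intro exI[of _ "zor_poly (F i) z z / zor_poly (?G i) z z"]) auto
  qed
  have z0: "zorder (F Chart0) z = zorder (?G Chart0) z" for z
    using ord_eq[of "Some z"] by (simp add: form_order_def)
  have z1: "zorder (F Chart1) 0 = zorder (?G Chart1) 0"
    using ord_eq[of None] by (simp add: form_order_def)
  have rmero: "r Chart0 meromorphic_on UNIV" unfolding r_def[abs_def]
    using nice niceG by (intro meromorphic_intros) (auto simp: nicely_meromorphic_on_def)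
  have riso: "isolated_singularity_at (r Chart0) z" for z
    using meromorphic_on_isolated_singularity[of "r Chart0" z] meromorphic_on_subset[OF rmero] by auto
  define R where "R = remove_sings (r Chart0)"
  have "R analytic_on {z}" for z unfolding R_def using remove_sings_analytic_at[OF riso] lim[OF z0] by blast
  then have holR: "R holomorphic_on UNIV" using analytic_on_analytic_at analytic_imp_holomorphic by blast
  have evR: "eventually (\<lambda>w. R w = r Chart0 w) (at z)" for z unfolding R_def by (rule eventually_remove_sings_eq_at[OF riso])
  have "bounded (range R)"
  proof -
    obtain l where "r Chart1 \<midarrow>0\<rightarrow> l" using lim[OF z1] by blast
    from tendsto_norm[OF this] have "eventually (\<lambda>w. norm (r Chart1 w) < norm l + 1) (at 0)"
      by (rule order_tendstoD) simp
    then obtain e where e: "e > 0" "\<And>w. w \<noteq> 0 \<Longrightarrow> norm w < e \<Longrightarrow> norm (r Chart1 w) < norm l + 1"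
      by (auto simp: eventually_at)
    have big: "norm (R z) \<le> norm l + 1" if "norm z > 1 / e" for z
    proof -
      have z0: "z \<noteq> 0" using that e(1) by (metis less_eq_real_def norm_zero not_less zero_less_divide_1_iff)
      \<comment> \<open>The transition factors cancel in the quotient of two forms, so the quotient
        is a function on the sphere and its limit at infinity bounds it for large z.\<close>
      have r1: "r Chart0 w = r Chart1 (1 / w)" if "w \<noteq> 0" for w
        using compat[of "1 / w"] compatG[of "1 / w"] that by (simp add: r_def)
      have "isCont R z" using holR by (metis UNIV_I continuous_on_eq_continuous_at holomorphic_on_imp_continuous_on open_UNIV)
      then have "((\<lambda>w. norm (R w)) \<longlongrightarrow> norm (R z)) (at z)" by (intro tendsto_norm) (simp add: isCont_def)
      moreover have "eventually (\<lambda>w. norm (R w) \<le> norm l + 1) (at z)"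
      proof -
        have "open {w. 1 / e < norm w}" by (intro open_Collect_less continuous_intros)
        then have "eventually (\<lambda>w. w \<in> {w. 1 / e < norm w} - {z}) (at z)"
          using that by (intro eventually_at_in_open) auto
        with evR[of z] show ?thesis
        proof eventually_elim
          case (elim w)
          then have w: "w \<noteq> 0" "1 / e < norm w" using e(1) by (auto simp: field_simps)
          then have "norm (1 / w) < e" using e(1) by (simp add: norm_divide field_simps)
          then show ?case using e(2)[of "1 / w"] elim r1[OF w(1)] w(1) by simp
        qed
      qed
      ultimately show ?thesis by (rule tendsto_upperbound) simp
    qed
    have "compact (R ` cball 0 (1 / e))"
      by (intro compact_continuous_image holomorphic_on_imp_continuous_on holomorphic_on_subset[OF holR]) auto
    then obtain B where B: "\<And>z. z \<in> cball 0 (1 / e) \<Longrightarrow> norm (R z) \<le> B"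
      using compact_imp_bounded bounded_iff by (metis imageI)
    have "norm (R z) \<le> max B (norm l + 1)" for z
      using B[of z] big[of z] by (cases "norm z \<le> 1 / e") auto
    then show ?thesis unfolding bounded_iff by blast
  qed
  from Liouville_theorem[OF holR this] obtain c where c: "\<And>z. R z = c" by (auto simp: constant_on_def)
  have ev: "eventually (\<lambda>w. F Chart0 w = c * ?G Chart0 w) (at z)" for z
    using evR[of z] nzG[of Chart0 z] by eventually_elim (simp add: r_def c field_simps)
  have cnz: "c \<noteq> 0"
  proof
    assume "c = 0"
    with ev[of 0] have "eventually (\<lambda>w. F Chart0 w = 0) (at 0)" by simp
    with nzF[of Chart0 0] have "eventually (\<lambda>w. False) (at (0 :: complex))"
      by eventually_elim simp
    then show False by simp
  qed
  have niceG': "(\<lambda>w. c * ?G i w) nicely_meromorphic_on UNIV" for i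
    by (intro nicely_meromorphic_on_cmult_left niceG)
  have F0eq: "F Chart0 z = c * ?G Chart0 z" for z by (rule nicely_meromorphic_eqI[OF nice niceG' ev])
  have F1eq: "F Chart1 w = c * ?G Chart1 w" if "w \<noteq> 0" for w
    using compat[OF that] compatG[OF that] F0eq[of "1 / w"] by simp
  have "F Chart1 0 = c * ?G Chart1 0"
    by (rule nicely_meromorphic_eqI[OF nice niceG']) (use F1eq in \<open>auto simp: eventually_at_filter\<close>)
  with F0eq F1eq have Fc: "F i w = c * ?G i w" for i w by (cases i; cases "w = 0") auto
  have "F = fst (Pf c q)" by (simp add: fun_eq_iff Fc fst_param_form)
  moreover have "P = snd (Pf c q)"
  proof
    fix j show "P j = snd (Pf c q) j"
      using P(1) hq[of j] by (cases "j \<in> {1..p}") (auto simp: snd_param_form pos_def extensional_def)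
  qed
  moreover have "q \<in> extensional {0..p}" by (simp add: q_def)
  ultimately show ?thesis using adm1[OF cnz] by (metis prod.collapse)
qed

end

text \<open>The pole to be placed at 1 receives index 0, because the polynomial systems are
  normalized by \<open>x 0 = 1\<close>; the pole to be placed at 0 receives the extra index.\<close>

definition label_index :: "nat \<Rightarrow> nat \<Rightarrow> nat" where
  "label_index N j = (if j = N + 2 then Suc N else if j = N + 1 then 0 else j)"

definition nonzero_orders :: "nat \<Rightarrow> (nat \<Rightarrow> nat) \<Rightarrow> nat \<Rightarrow> nat" where
  "nonzero_orders N b i = (if i = 0 then b (N + 1) else b i)"

context stratum_data
begin

section \<open>The action of Moebius transformations on forms\<close>

lemma hvec_of_num_den:
  assumes "den k X \<noteq> 0"
  shows "hvec_of k (num k X / den k X) = hscale (1 / den k X) X"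
  using assms by (cases k; cases X) (auto simp: hscale_def)

lemma det2_hscale: "det2 (hscale t X) Y = t * det2 X Y" "det2 X (hscale t Y) = t * det2 X Y"
  by (auto simp: det2_def hscale_def algebra_simps)

lemma param_form_hscale:
  assumes t: "\<And>j. j \<in> {0..p} \<Longrightarrow> t j \<noteq> 0"
  shows "Pf c (\<lambda>j. hscale (t j) (q j)) = Pf (c * t 0 ^ a / (\<Prod>j=1..p. t j ^ b j)) q"
proof (rule prod_eqI)
  show "fst (Pf c (\<lambda>j. hscale (t j) (q j))) = fst (Pf (c * t 0 ^ a / (\<Prod>j=1..p. t j ^ b j)) q)"
    by (simp add: fun_eq_iff fst_param_form det2_hscale power_mult_distrib prod.distrib)
  show "snd (Pf c (\<lambda>j. hscale (t j) (q j))) = snd (Pf (c * t 0 ^ a / (\<Prod>j=1..p. t j ^ b j)) q)"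
    using t by (auto simp: snd_param_form fun_eq_iff)
qed

lemma param_form_cong: "(\<And>j. j \<in> {0..p} \<Longrightarrow> q j = q' j) \<Longrightarrow> Pf c q = Pf c q'"
  by (rule prod_eqI) (auto simp: fun_eq_iff fst_param_form snd_param_form)

lemma mob_coord:
  assumes A: "mdet A \<noteq> 0" and d: "den k (act A (hvec_of i w)) \<noteq> 0"
  shows "coord k (mob A (point i w)) = num k (act A (hvec_of i w)) / den k (act A (hvec_of i w))"
  using d by (simp add: mob_point[OF A] coord_hpoint)

lemma deriv_mob_coord:
  assumes A: "mdet A \<noteq> 0" and d: "den k (act A (hvec_of i w)) \<noteq> 0"
  shows "((\<lambda>u. coord k (mob A (point i u))) has_field_derivative
    chart_sign k * chart_sign i * mdet A / (den k (act A (hvec_of i w)))\<^sup>2) (at w)"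
proof -
  let ?X = "\<lambda>w. act A (hvec_of i w)"
  have op: "open {u. den k (?X u) \<noteq> 0}"
    by (intro open_Collect_neq holomorphic_on_imp_continuous_on act_hvec_holomorphic continuous_intros)
  obtain m1 m2 m3 m4 where [simp]: "A = (m1, m2, m3, m4)" by (cases A)
  have "((\<lambda>u. num k (?X u) / den k (?X u)) has_field_derivative
    chart_sign k * chart_sign i * mdet A / (den k (?X w))\<^sup>2) (at w)"
    using d by (cases i; cases k) (auto intro!: derivative_eq_intros simp: chart_sign_def power2_eq_square algebra_simps)
  moreover have "eventually (\<lambda>u. coord k (mob A (point i u)) = num k (?X u) / den k (?X u)) (nhds w)"
  proof -
    have "eventually (\<lambda>u. u \<in> {u. den k (?X u) \<noteq> 0}) (nhds w)"
      using op d by (intro eventually_nhds_in_open) auto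
    then show ?thesis by eventually_elim (rule mob_coord[OF A], simp)
  qed
  ultimately show ?thesis by (simp only: DERIV_cong_ev[OF refl _ refl])
qed

text \<open>By \<open>det2_act\<close> the matrix moves to the zero and poles as its adjugate. The
  denominators of the chart coordinate contribute the power a - (a + 2) = -2 with opposite sign,
  cancelled by the square in the derivative.\<close>

lemma param_form_change_chart:
  assumes A: "mdet A \<noteq> 0" and d: "den k (act A (hvec_of i w)) \<noteq> 0"
  shows "fst (Pf c q) k (coord k (mob A (point i w))) * deriv (\<lambda>u. coord k (mob A (point i u))) w =
    fst (Pf (c * mdet A) (\<lambda>j. act (adj A) (q j))) i w"
proof -
  let ?X = "act A (hvec_of i w)"
  define e where "e = den k ?X"
  have e: "e \<noteq> 0" using d by (simp add: e_def)
  have X: "det2 (hvec_of k (coord k (mob A (point i w)))) Y = det2 (hvec_of i w) (act (adj A) Y) / e" for Y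
    unfolding mob_coord[OF A d] hvec_of_num_den[OF d] by (simp add: det2_hscale det2_act e_def)
  have "deriv (\<lambda>u. coord k (mob A (point i u))) w = chart_sign k * chart_sign i * mdet A / e\<^sup>2"
    unfolding e_def by (rule DERIV_imp_deriv[OF deriv_mob_coord[OF A d]])
  moreover have "fst (Pf c q) k (coord k (mob A (point i w))) = chart_sign k * c *
      ((det2 (hvec_of i w) (act (adj A) (q 0)) ^ a / e ^ a) /
       ((\<Prod>j=1..p. det2 (hvec_of i w) (act (adj A) (q j)) ^ b j) / e ^ (a + 2)))"
    unfolding fst_param_form X order_sum[symmetric] by (simp add: power_divide prod_dividef power_sum)
  moreover have "chart_sign k * chart_sign k = 1" by (cases k) (auto simp: chart_sign_def)
  ultimately show ?thesis using e
    by (simp add: fst_param_form power_add power2_eq_square mult_ac)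
qed

lemma pullback_param_form:
  assumes A: "mdet A \<noteq> 0"
  shows "pullback (mob A) (fst (Pf c q)) = fst (Pf (c * mdet A) (\<lambda>j. act (adj A) (q j)))"
proof (intro ext)
  fix i w
  define k where "k = (if mob A (point i w) = None then Chart1 else Chart0)"
  have X: "act A (hvec_of i w) \<noteq> 0" using act_nonzero[OF A] by simp
  have "den k (act A (hvec_of i w)) \<noteq> 0"
    using X unfolding k_def mob_point[OF A] by (cases "act A (hvec_of i w)") (auto simp: hpoint_def zero_prod_def)
  from param_form_change_chart[OF A this, of c q]
  show "pullback (mob A) (fst (Pf c q)) i w = fst (Pf (c * mdet A) (\<lambda>j. act (adj A) (q j))) i w"
    unfolding pullback_def Let_def k_def[symmetric] .
qed

lemma admissible_act:
  assumes "admissible p c q" "mdet A \<noteq> 0"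
  shows "admissible p (c * mdet A) (\<lambda>j. act (adj A) (q j))"
  using assms act_nonzero[of "adj A"] by (auto simp: admissible_def det2_act_act)

text \<open>Isomorphism becomes an orbit relation of matrices on parameters, since the
  biholomorphisms of the sphere are exactly the Moebius transformations.\<close>

lemma iso_forms_param_iff:
  assumes q: "admissible p c q"
  shows "(X, Pf c q) \<in> iso_forms p a b \<longleftrightarrow>
    (\<exists>A. mdet A \<noteq> 0 \<and> X = Pf (c * mdet A) (\<lambda>j. act (adj A) (q j)))"
proof
  assume iso: "(X, Pf c q) \<in> iso_forms p a b"
  obtain F P where X: "X = (F, P)" by (cases X)
  from iso obtain \<phi> where \<phi>: "sphere_biholomorphism \<phi>" "F = pullback \<phi> (fst (Pf c q))"
    "\<forall>j\<in>{1..p}. \<phi> (P j) = snd (Pf c q) j" and P: "P \<in> extensional {1..p}"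
    by (auto simp: iso_forms_def X labelled_forms_def split_beta)
  from \<phi>(1) obtain A where A: "mdet A \<noteq> 0" "\<phi> = mob A" unfolding sphere_biholomorphism_iff by blast
  have "F = fst (Pf (c * mdet A) (\<lambda>j. act (adj A) (q j)))" unfolding \<phi>(2) A(2) by (rule pullback_param_form[OF A(1)])
  moreover have "P = snd (Pf (c * mdet A) (\<lambda>j. act (adj A) (q j)))"
  proof
    fix j show "P j = snd (Pf (c * mdet A) (\<lambda>j. act (adj A) (q j))) j"
    proof (cases "j \<in> {1..p}")
      case True
      then have "mob A (P j) = hpoint (q j)" using \<phi>(3) by (simp add: A(2) snd_param_form)
      then have "P j = mob (adj A) (hpoint (q j))" using mob_adj'[OF A(1), of "P j"] by simp
      also have "\<dots> = hpoint (act (adj A) (q j))"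
        using q True A(1) by (intro mob_hpoint) (auto simp: admissible_def)
      finally show ?thesis using True by (simp add: snd_param_form)
    qed (use P in \<open>auto simp: snd_param_form extensional_def\<close>)
  qed
  ultimately show "\<exists>A. mdet A \<noteq> 0 \<and> X = Pf (c * mdet A) (\<lambda>j. act (adj A) (q j))"
    using A(1) X by (metis prod.collapse)
next
  assume "\<exists>A. mdet A \<noteq> 0 \<and> X = Pf (c * mdet A) (\<lambda>j. act (adj A) (q j))"
  then obtain A where A: "mdet A \<noteq> 0" "X = Pf (c * mdet A) (\<lambda>j. act (adj A) (q j))" by blast
  have "X \<in> labelled_forms p a b" unfolding A(2) by (rule param_form_labelled[OF admissible_act[OF q A(1)]])
  moreover have "Pf c q \<in> labelled_forms p a b" by (rule param_form_labelled[OF q])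
  moreover have "fst X = pullback (mob A) (fst (Pf c q))" unfolding A(2) pullback_param_form[OF A(1)] ..
  moreover have "\<forall>j\<in>{1..p}. mob A (snd X j) = snd (Pf c q) j"
  proof
    fix j assume j: "j \<in> {1..p}"
    then have "act (adj A) (q j) \<noteq> 0" using q A(1) by (intro act_nonzero) (auto simp: admissible_def)
    then show "mob A (snd X j) = snd (Pf c q) j"
      using j A(1) by (simp add: A(2) snd_param_form mob_hpoint act_adj)
  qed
  ultimately show "(X, Pf c q) \<in> iso_forms p a b"
    using sphere_biholomorphism_mob[OF A(1)] unfolding iso_forms_def
    by (cases X; cases "Pf c q") (simp, blast)
qed

lemma equiv_iso_forms: "equiv (labelled_forms p a b) (iso_forms p a b)"
proof (rule equivI)
  show "iso_forms p a b \<subseteq> labelled_forms p a b \<times> labelled_forms p a b" by (auto simp: iso_forms_def)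
  show "refl_on (labelled_forms p a b) (iso_forms p a b)"
  proof (rule refl_onI)
    fix X assume "X \<in> labelled_forms p a b"
    then obtain c q where q: "admissible p c q" "X = Pf c q" using labelled_form_is_param_form by (metis prod.collapse)
    have "X = Pf (c * mdet (1, 0, 0, 1)) (\<lambda>j. act (adj (1, 0, 0, 1)) (q j))" by (simp add: q(2))
    then show "(X, X) \<in> iso_forms p a b"
      using iso_forms_param_iff[OF q(1), of X] q(2) by (metis mdet.simps mult_1 mult_zero_left diff_zero one_neq_zero)
  qed
  show "sym (iso_forms p a b)"
  proof (rule symI)
    fix X Y assume iso: "(X, Y) \<in> iso_forms p a b"
    then have "Y \<in> labelled_forms p a b" by (auto simp: iso_forms_def)
    then obtain c q where q: "admissible p c q" "Y = Pf c q" using labelled_form_is_param_form by (metis prod.collapse)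
    from iso obtain A where A: "mdet A \<noteq> 0" "X = Pf (c * mdet A) (\<lambda>j. act (adj A) (q j))"
      using iso_forms_param_iff[OF q(1)] q(2) by blast
    have "Pf (c * mdet A * mdet (adj A)) (\<lambda>j. act (adj (adj A)) (act (adj A) (q j))) =
        Pf (c * mdet A * mdet A) (\<lambda>j. hscale (mdet A) (q j))" by (simp add: act_adj)
    also have "\<dots> = Pf (c * mdet A * mdet A * mdet A ^ a / (\<Prod>j=1..p. mdet A ^ b j)) q"
      by (rule param_form_hscale) (rule A(1))
    \<comment> \<open>Acting by the matrix and its adjugate scales all homogeneous coordinates by
      the determinant; as the orders sum to -2 this cancels the two determinants accumulated in the
      constant.\<close>
    also have "(\<Prod>j=1..p. mdet A ^ b j) = mdet A ^ (a + 2)" unfolding order_sum[symmetric] power_sum ..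
    also have "c * mdet A * mdet A * mdet A ^ a / mdet A ^ (a + 2) = c" using A(1) by (simp add: power_add power2_eq_square)
    finally have "Y = Pf (c * mdet A * mdet (adj A)) (\<lambda>j. act (adj (adj A)) (act (adj A) (q j)))" using q(2) by simp
    then show "(Y, X) \<in> iso_forms p a b"
      unfolding A(2) iso_forms_param_iff[OF admissible_act[OF q(1) A(1)]] using A(1) by (metis mdet_adj)
  qed
  show "trans (iso_forms p a b)"
  proof (rule transI)
    fix X Y Z assume iso: "(X, Y) \<in> iso_forms p a b" "(Y, Z) \<in> iso_forms p a b"
    then have "Z \<in> labelled_forms p a b" by (auto simp: iso_forms_def)
    then obtain c q where q: "admissible p c q" "Z = Pf c q" using labelled_form_is_param_form by (metis prod.collapse)
    from iso(2) obtain B where B: "mdet B \<noteq> 0" "Y = Pf (c * mdet B) (\<lambda>j. act (adj B) (q j))"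
      using iso_forms_param_iff[OF q(1)] q(2) by blast
    from iso(1) obtain A where A: "mdet A \<noteq> 0"
      "X = Pf (c * mdet B * mdet A) (\<lambda>j. act (adj A) (act (adj B) (q j)))"
      unfolding B(2) iso_forms_param_iff[OF admissible_act[OF q(1) B(1)]] by blast
    have "X = Pf (c * mdet (mmul B A)) (\<lambda>j. act (adj (mmul B A)) (q j))"
      unfolding A(2) by (simp add: act_act adj_mmul mdet_mmul mult.assoc)
    then show "(X, Z) \<in> iso_forms p a b"
      unfolding q(2) iso_forms_param_iff[OF q(1)] using A(1) B(1) by (metis mdet_mmul mult_eq_0_iff)
  qed
qed

section \<open>Normal forms\<close>

text \<open>
  The zero is moved to infinity, pole \<open>p\<close> to \<open>0\<close> and pole \<open>p - 1\<close> to \<open>1\<close>; the latter gets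
  the index \<open>0\<close> in the coordinates \<open>x\<^sub>0, \<dots>, x\<^sub>N\<close> of the nonzero poles.
\<close>

abbreviation "pole_index \<equiv> label_index N"

abbreviation "\<beta> \<equiv> nonzero_orders N b"

definition normal_pos :: "(nat \<Rightarrow> complex) \<Rightarrow> nat \<Rightarrow> hvec" where
  "normal_pos x j = (if j = 0 then (1, 0) else (pole_pos N x (pole_index j), 1))"

text \<open>With the zero at (1, 0) its linear factor is the constant -1; the factor
  \<open>(- 1) ^ a\<close> compensates it, so that the form is c times
  \<open>pole_form\<close>.\<close>

definition normal_form :: "complex \<Rightarrow> (nat \<Rightarrow> complex) \<Rightarrow> form \<times> (nat \<Rightarrow> sphere)" where
  "normal_form c x = Pf (c * (- 1) ^ a) (normal_pos x)"

lemma bij_pole_index: "bij_betw pole_index {1..p} {..Suc N}"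
proof (rule bij_betwI[where g = "\<lambda>i. if i = Suc N then p else if i = 0 then p - 1 else i"])
  show "pole_index \<in> {1..p} \<rightarrow> {..Suc N}" by (auto simp: label_index_def pN)
  show "(\<lambda>i. if i = Suc N then p else if i = 0 then p - 1 else i) \<in> {..Suc N} \<rightarrow> {1..p}"
    by (auto simp: pN)
  show "(if pole_index j = Suc N then p else if pole_index j = 0 then p - 1 else pole_index j) = j"
    if "j \<in> {1..p}" for j using that by (simp add: label_index_def pN)
  show "pole_index (if i = Suc N then p else if i = 0 then p - 1 else i) = i" if "i \<in> {..Suc N}" for i
    using that by (simp add: label_index_def pN)
qed

lemma \<beta>1: "\<forall>j\<le>N. \<beta> j \<ge> 1"
proof (intro allI impI)
  fix j assume "j \<le> N"
  then show "\<beta> j \<ge> 1" using b1[of "p - 1"] b1[of j] pN by (cases "j = 0") (simp_all add: nonzero_orders_def)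
qed

lemma bp1: "b p \<ge> 1" using b1[of p] p2 by simp

lemma prod_poles: "(\<Prod>j=1..p. f (pole_index j) (b j)) = f (Suc N) (b p) * (\<Prod>i\<le>N. f i (\<beta> i))"
  for f :: "nat \<Rightarrow> nat \<Rightarrow> 'c::comm_monoid_mult"
proof -
  define g where "g i = (if i = Suc N then b p else \<beta> i)" for i
  have "(\<Prod>j=1..p. f (pole_index j) (b j)) = (\<Prod>j=1..p. f (pole_index j) (g (pole_index j)))"
    by (rule prod.cong) (auto simp: g_def label_index_def nonzero_orders_def pN)
  also have "\<dots> = (\<Prod>i\<le>Suc N. f i (g i))" by (rule prod.reindex_bij_betw[OF bij_pole_index])
  finally show ?thesis by (simp add: g_def mult.commute)
qed

lemma sum_poles: "(\<Sum>j=1..p. f (pole_index j) (b j)) = f (Suc N) (b p) + (\<Sum>i\<le>N. f i (\<beta> i))"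
  for f :: "nat \<Rightarrow> nat \<Rightarrow> 'c::comm_monoid_add"
proof -
  define g where "g i = (if i = Suc N then b p else \<beta> i)" for i
  have "(\<Sum>j=1..p. f (pole_index j) (b j)) = (\<Sum>j=1..p. f (pole_index j) (g (pole_index j)))"
    by (rule sum.cong) (auto simp: g_def label_index_def nonzero_orders_def pN)
  also have "\<dots> = (\<Sum>i\<le>Suc N. f i (g i))" by (rule sum.reindex_bij_betw[OF bij_pole_index])
  finally show ?thesis by (simp add: g_def add.commute)
qed

lemma degree_eq: "a + 2 - p = (\<Sum>j\<le>N. \<beta> j - 1) + (b p - 1)" and le_order: "p \<le> a + 2"
proof -
  have "(\<Sum>j\<le>N. \<beta> j) = (\<Sum>j\<le>N. (\<beta> j - 1) + 1)" using \<beta>1 by (intro sum.cong) auto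
  also have "\<dots> = (\<Sum>j\<le>N. \<beta> j - 1) + (N + 1)" by (subst sum.distrib) simp
  finally have "a + 2 = b p + ((\<Sum>j\<le>N. \<beta> j - 1) + (N + 1))"
    using sum_poles[of "\<lambda>_ m. m"] order_sum by simp
  then show "a + 2 - p = (\<Sum>j\<le>N. \<beta> j - 1) + (b p - 1)" "p \<le> a + 2" using bp1 pN by auto
qed

lemma normal_pos_admissible:
  assumes "c \<noteq> 0" "separated N x"
  shows "admissible p (c * (- 1) ^ a) (normal_pos x)"
  unfolding admissible_def
proof (intro conjI ballI impI)
  show "normal_pos x i \<noteq> 0" for i by (simp add: normal_pos_def zero_prod_def)
  fix i j assume ij: "i \<in> {0..p}" "j \<in> {0..p}" "i \<noteq> j"
  show "det2 (normal_pos x i) (normal_pos x j) \<noteq> 0"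
  proof (cases "i = 0 \<or> j = 0")
    case True
    then show ?thesis using ij(3) by (auto simp: normal_pos_def det2_def)
  next
    case False
    then have "i \<in> {1..p}" "j \<in> {1..p}" using ij by auto
    then have "pole_index i \<noteq> pole_index j" "pole_index i \<in> {..Suc N}" "pole_index j \<in> {..Suc N}"
      using inj_onD[OF bij_betw_imp_inj_on[OF bij_pole_index], of i j] ij(3) bij_betwE[OF bij_pole_index] by blast+
    then have "pole_pos N x (pole_index i) \<noteq> pole_pos N x (pole_index j)"
      using inj_onD[OF inj_on_pole_pos[OF assms(2)]] by blast
    then show ?thesis using False by (simp add: normal_pos_def det2_def)
  qed
qed (use assms in auto)

lemma fst_normal_form: "fst (normal_form c x) Chart0 z = c * pole_form N \<beta> (b p) x z"
proof -
  have s: "((- 1) ^ a * (- 1) ^ a :: complex) = 1" by (simp add: power_add[symmetric] mult_2[symmetric])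
  have "(\<Prod>j=1..p. det2 (hvec_of Chart0 z) (normal_pos x j) ^ b j) = (\<Prod>j=1..p. (z - pole_pos N x (pole_index j)) ^ b j)"
    by (rule prod.cong) (auto simp: normal_pos_def det2_def)
  also have "\<dots> = z ^ b p * (\<Prod>j\<le>N. (z - x j) ^ \<beta> j)"
    using prod_poles[of "\<lambda>i m. (z - pole_pos N x i) ^ m"] by (simp add: pole_pos_def)
  finally show ?thesis
    using s by (simp add: normal_form_def fst_param_form chart_sign_def pole_form_def normal_pos_def[of x 0] det2_def)
qed

text \<open>The isomorphism fixes infinity, the only zero, and the poles at 0 and 1, so its matrix
  is scalar. The poles then agree, and the constants are compared at a point where the form is
  nonzero.\<close>

lemma normal_form_unique:
  assumes iso: "(normal_form c x, normal_form c' x') \<in> iso_forms p a b"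
    and c: "c \<noteq> 0" "c' \<noteq> 0" and x: "separated N x" "separated N x'" "x 0 = 1" "x' 0 = 1"
  shows "c = c' \<and> (\<forall>j\<le>N. x j = x' j)"
proof -
  note adm = normal_pos_admissible[OF c(1) x(1)] and adm' = normal_pos_admissible[OF c(2) x(2)]
  from iso obtain A where A: "mdet A \<noteq> 0"
    "normal_form c x = Pf (c' * (- 1) ^ a * mdet A) (\<lambda>j. act (adj A) (normal_pos x' j))"
    unfolding normal_form_def[of c'] iso_forms_param_iff[OF adm'] by blast
  obtain m1 m2 m3 m4 where B: "adj A = (m1, m2, m3, m4)" by (cases "adj A")
  have detB: "m1 * m4 - m2 * m3 \<noteq> 0" using A(1) mdet_adj[of A] by (simp add: B)
  note adm'' = admissible_act[OF adm' A(1)]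
  have "hpoint (act (adj A) (normal_pos x' 0)) = hpoint (normal_pos x 0)"
  proof (rule ccontr)
    assume ne: "\<not> ?thesis"
    have "form_order (fst (normal_form c x)) (hpoint (act (adj A) (normal_pos x' 0))) = int a"
      unfolding A(2) using form_order_param_form(1)[OF adm'', of 0] by (simp add: expo_def)
    moreover have "form_order (fst (normal_form c x)) (hpoint (normal_pos x 0)) = int a"
      unfolding normal_form_def using form_order_param_form(1)[OF adm, of 0] by (simp add: expo_def)
    moreover obtain Z where "{y. form_order (fst (normal_form c x)) y > 0} = {Z}"
      using param_form_labelled[OF adm] by (auto simp: normal_form_def labelled_forms_def split_beta)
    ultimately show False using ne a1 by (metis (no_types, lifting) mem_Collect_eq of_nat_0_less_iff singletonD less_le_trans zero_less_one)
  qed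
  then have m3: "m3 = 0" by (auto simp: normal_pos_def B hpoint_def split: if_splits)
  with detB have m14: "m1 \<noteq> 0" "m4 \<noteq> 0" by auto
  have P: "hpoint (act (adj A) (normal_pos x' j)) = hpoint (normal_pos x j)" if "j \<in> {1..p}" for j
    using arg_cong[OF A(2), of "\<lambda>X. snd X j"] that by (simp add: normal_form_def snd_param_form)
  have eq: "(m1 * pole_pos N x' (pole_index j) + m2) / m4 = pole_pos N x (pole_index j)" if "j \<in> {1..p}" for j
    using P[OF that] that m14 by (simp add: normal_pos_def B m3 hpoint_def)
  have "m2 / m4 = 0" using eq[of p] p2 pN by (simp add: label_index_def pole_pos_def)
  then have m2: "m2 = 0" using m14 by simp
  have "m1 / m4 = 1" using eq[of "p - 1"] p2 pN x(3,4) m2 by (simp add: label_index_def pole_pos_def)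
  then have m1: "m1 = m4" using m14 by simp
  have pos: "pole_pos N x' (pole_index j) = pole_pos N x (pole_index j)" if "j \<in> {1..p}" for j
    using eq[OF that] m1 m2 m14 by simp
  have xx: "\<forall>j\<le>N. x j = x' j"
  proof (intro allI impI)
    fix i assume i: "i \<le> N"
    then have "i \<in> pole_index ` {1..p}" using bij_pole_index by (auto simp: bij_betw_def)
    then obtain j where "j \<in> {1..p}" "i = pole_index j" by blast
    with pos[of j] i show "x i = x' i" by (simp add: pole_pos_def)
  qed
  have act: "act (adj A) X = hscale m4 X" for X by (simp add: B m1 m2 m3 hscale_def)
  have npx: "normal_pos x' = normal_pos x" 
    using xx by (auto simp: fun_eq_iff normal_pos_def pole_pos_def)
  have "normal_form c x = Pf (c' * (- 1) ^ a * mdet A * m4 ^ a / (\<Prod>j=1..p. m4 ^ b j)) (normal_pos x')"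
    unfolding A(2) act by (rule param_form_hscale) (rule m14(2))
  also have "(\<Prod>j=1..p. m4 ^ b j) = m4 ^ (a + 2)" unfolding order_sum[symmetric] power_sum ..
  also have "mdet A = m4\<^sup>2" using mdet_adj[of A] by (simp add: B m1 m2 m3 power2_eq_square)
  also have "c' * (- 1) ^ a * m4\<^sup>2 * m4 ^ a / m4 ^ (a + 2) = c' * (- 1) ^ a"
    using m14 by (simp add: power_add power2_eq_square)
  finally have nf: "normal_form c x = normal_form c' x" by (simp add: npx normal_form_def)
  obtain z where z: "z \<notin> insert 0 (x ` {..N})" using ex_new_if_finite[OF infinite_UNIV_char_0, of "insert 0 (x ` {..N})"] by auto
  then have "pole_form N \<beta> (b p) x z \<noteq> 0" by (auto simp: pole_form_def)
  moreover have "c * pole_form N \<beta> (b p) x z = c' * pole_form N \<beta> (b p) x z"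
    unfolding fst_normal_form[symmetric] nf ..
  ultimately show ?thesis using xx by simp
qed

text \<open>Computed for every representative of a class, including those with a pole at infinity:
  the Moebius transformation read in a chart is a local biholomorphism pulling the normal form back
  to \<open>X\<close>.\<close>

lemma residues_iso_normal_form:
  assumes iso: "(X, normal_form c x) \<in> iso_forms p a b" and c: "c \<noteq> 0" and x: "separated N x"
  shows "residues p X = restrict (\<lambda>j. 2 * of_real pi * \<i> *
    (c * all_residues N (pole_residue N \<beta> (b p) x) (pole_index j))) {1..p}"
proof -
  note adm = normal_pos_admissible[OF c x]
  from iso obtain A where A: "mdet A \<noteq> 0"
    "X = Pf (c * (- 1) ^ a * mdet A) (\<lambda>j. act (adj A) (normal_pos x j))"
    unfolding normal_form_def iso_forms_param_iff[OF adm] by blast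
  have dec: "log_decomp {..Suc N} (pole_pos N x) (\<lambda>i. c * all_residues N (pole_residue N \<beta> (b p) x) i)
      (\<lambda>z. c * pole_form N \<beta> (b p) x z)"
    by (rule log_decomp_cmult[OF pole_form_residues(2)[OF \<beta>1 bp1 refl x]]) simp
  have res: "residue (fst X i) w0 = c * all_residues N (pole_residue N \<beta> (b p) x) (pole_index j)"
    if j: "j \<in> {1..p}" and w0: "point i w0 = snd X j" for i w0 j
  proof -
    let ?g = "\<lambda>w. coord Chart0 (mob A (point i w))"
    define S where "S = {w. den Chart0 (act A (hvec_of i w)) \<noteq> 0}"
    have opS: "open S" unfolding S_def
      by (intro open_Collect_neq holomorphic_on_imp_continuous_on act_hvec_holomorphic continuous_intros)
    have nz: "normal_pos x j \<noteq> 0" "act (adj A) (normal_pos x j) \<noteq> 0"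
      using A(1) act_nonzero[of "adj A"] by (auto simp: normal_pos_def zero_prod_def)
    have "mob A (point i w0) = mob A (hpoint (act (adj A) (normal_pos x j)))"
      using w0 j by (simp add: A(2) snd_param_form)
    also have "\<dots> = hpoint (normal_pos x j)" using A(1) nz by (simp add: mob_hpoint act_adj)
    also have "\<dots> = Some (pole_pos N x (pole_index j))" using j by (simp add: normal_pos_def hpoint_def)
    finally have m0: "mob A (point i w0) = Some (pole_pos N x (pole_index j))" .
    then have w0S: "w0 \<in> S" by (auto simp: S_def mob_point[OF A(1)] hpoint_def)
    have hol: "?g holomorphic_on S"
      using deriv_mob_coord[OF A(1), of Chart0 i] opS
      by (auto simp: S_def holomorphic_on_open)
    have dg: "deriv ?g w0 \<noteq> 0"
      using DERIV_imp_deriv[OF deriv_mob_coord[OF A(1), of Chart0 i w0]] w0S A(1) by (simp add: S_def)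
    have F: "fst X i w = c * pole_form N \<beta> (b p) x (?g w) * deriv ?g w" if "w \<in> S" for w
    proof -
      have "den Chart0 (act A (hvec_of i w)) \<noteq> 0" using that by (simp add: S_def)
      from param_form_change_chart[OF A(1) this, of "c * (- 1) ^ a" "normal_pos x"]
      show ?thesis unfolding A(2) normal_form_def[symmetric] fst_normal_form by simp
    qed
    have k: "pole_index j \<in> {..Suc N}" using bij_pole_index j by (auto simp: bij_betw_def)
    show ?thesis
      by (rule residue_pullback_log_decomp[OF dec _ inj_on_pole_pos[OF x] k opS hol w0S _ dg])
        (use m0 F in auto)
  qed
  have "form_residue (fst X) (snd X j) = 2 * of_real pi * \<i> *
    (c * all_residues N (pole_residue N \<beta> (b p) x) (pole_index j))" if j: "j \<in> {1..p}" for j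
  proof (cases "snd X j")
    case None
    then show ?thesis using res[OF j, of Chart1 0] by (simp add: form_residue_def)
  next
    case (Some z)
    then show ?thesis using res[OF j, of Chart0 z] by (simp add: form_residue_def)
  qed
  then show ?thesis by (simp add: residues_def split_beta restrict_def fun_eq_iff)
qed

text \<open>
  The Moebius transformation \<open>B\<close> below sends the zero to infinity, pole \<open>p\<close> to \<open>0\<close> and pole \<open>p - 1\<close>
  to \<open>1\<close>; its values on the other poles are cross ratios.
\<close>

definition norm_x :: "(nat \<Rightarrow> hvec) \<Rightarrow> nat \<Rightarrow> complex" where
  "norm_x q i = (if i = 0 then 1 else if i \<le> N then
     det2 (q i) (q p) * det2 (q (p - 1)) (q 0) / (det2 (q i) (q 0) * det2 (q (p - 1)) (q p)) else 0)"

text \<open>The scale factors by which the image of \<open>q j\<close> under the normalizing matrix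
  differs from \<open>normal_pos (norm_x q) j\<close>; \<open>norm_c\<close> collects them together
  with the determinant and the sign in \<open>normal_form\<close>.\<close>

definition norm_t :: "(nat \<Rightarrow> hvec) \<Rightarrow> nat \<Rightarrow> complex" where
  "norm_t q j = (if j = 0 then det2 (q 0) (q p) * det2 (q (p - 1)) (q 0)
     else det2 (q j) (q 0) * det2 (q (p - 1)) (q p))"

definition norm_c :: "complex \<Rightarrow> (nat \<Rightarrow> hvec) \<Rightarrow> complex" where
  "norm_c c q = c * (det2 (q (p - 1)) (q 0) * det2 (q (p - 1)) (q p) * det2 (q p) (q 0)) *
     norm_t q 0 ^ a / (\<Prod>j=1..p. norm_t q j ^ b j) * (- 1) ^ a"

lemma det2_self [simp]: "det2 X X = 0" by (simp add: det2_def)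

lemma norm_form:
  assumes q: "admissible p c q"
  shows "norm_c c q \<noteq> 0" "separated N (norm_x q)" "(Pf c q, normal_form (norm_c c q) (norm_x q)) \<in> iso_forms p a b"
proof -
  have d: "det2 (q i) (q j) \<noteq> 0" if "i \<le> p" "j \<le> p" "i \<noteq> j" for i j using q that by (auto simp: admissible_def)
  have t: "norm_t q j \<noteq> 0" if "j \<in> {0..p}" for j
    using that d p2 by (auto simp: norm_t_def)
  have c: "c \<noteq> 0" using q by (simp add: admissible_def)
  let ?n = "q (p - 1)"
  show "norm_c c q \<noteq> 0" using c t d[of "p - 1" 0] d[of "p - 1" p] d[of p 0] p2 by (auto simp: norm_c_def)
  \<comment> \<open>The rows are linear forms vanishing at the points \<open>q p\<close> and
    \<open>q 0\<close>, each scaled so that \<open>?n\<close> gets two equal components, that is,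
    goes to 1.\<close>
  define B where "B = (snd (q p) * det2 ?n (q 0), - fst (q p) * det2 ?n (q 0),
    snd (q 0) * det2 ?n (q p), - fst (q 0) * det2 ?n (q p))"
  have actB: "act B X = (det2 X (q p) * det2 ?n (q 0), det2 X (q 0) * det2 ?n (q p))" for X
    by (simp add: B_def det2_def algebra_simps)
  have detB: "mdet B = det2 ?n (q 0) * det2 ?n (q p) * det2 (q p) (q 0)"
    by (simp add: B_def det2_def algebra_simps)
  then have B0: "mdet B \<noteq> 0" using d[of "p - 1" 0] d[of "p - 1" p] d[of p 0] p2 by simp
  have nq: "act B (q j) = hscale (norm_t q j) (normal_pos (norm_x q) j)" if j: "j \<in> {0..p}" for j
  proof -
    consider "j = 0" | "j = p" "j \<noteq> 0" | "j = p - 1" "j \<noteq> 0" "j \<noteq> p" | "j \<in> {1..N}" using j pN by fastforce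
    then show ?thesis
    proof cases
      case 1
      then show ?thesis by (simp add: actB hscale_def normal_pos_def norm_t_def)
    next
      case 2
      then have "pole_index j = Suc N" by (simp add: label_index_def pN)
      with 2 show ?thesis by (simp add: actB hscale_def normal_pos_def norm_t_def pole_pos_def)
    next
      case 3
      then have "pole_index j = 0" by (simp add: label_index_def pN)
      with 3 show ?thesis by (simp add: actB hscale_def normal_pos_def norm_t_def norm_x_def pole_pos_def)
    next
      case 4
      then have "det2 (q j) (q 0) \<noteq> 0" "det2 ?n (q p) \<noteq> 0" "pole_index j = j" "j \<noteq> 0" "j \<le> N"
        using d[of j 0] d[of "p - 1" p] p2 pN by (auto simp: label_index_def)
      then show ?thesis
        by (simp add: actB hscale_def normal_pos_def norm_t_def norm_x_def pole_pos_def)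
    qed
  qed
  have "Pf (c * mdet B) (\<lambda>j. act B (q j)) = Pf (c * mdet B) (\<lambda>j. hscale (norm_t q j) (normal_pos (norm_x q) j))"
    by (rule param_form_cong) (rule nq)
  also have "\<dots> = Pf (c * mdet B * norm_t q 0 ^ a / (\<Prod>j=1..p. norm_t q j ^ b j)) (normal_pos (norm_x q))"
    by (rule param_form_hscale) (rule t)
  also have "c * mdet B * norm_t q 0 ^ a / (\<Prod>j=1..p. norm_t q j ^ b j) = norm_c c q * (- 1) ^ a"
  proof -
    have s: "((- 1) ^ a * (- 1) ^ a :: complex) = 1" by (simp add: power_add[symmetric] mult_2[symmetric])
    show ?thesis unfolding norm_c_def detB mult.assoc s by simp
  qed
  finally have nf: "Pf (c * mdet B) (\<lambda>j. act B (q j)) = normal_form (norm_c c q) (norm_x q)"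
    by (simp add: normal_form_def)
  have "(normal_form (norm_c c q) (norm_x q), Pf c q) \<in> iso_forms p a b"
    unfolding iso_forms_param_iff[OF q] using B0 nf by (intro exI[of _ "adj B"]) simp
  then show "(Pf c q, normal_form (norm_c c q) (norm_x q)) \<in> iso_forms p a b"
    using equiv_iso_forms by (meson equivE symD)
  have ne: "pole_pos N (norm_x q) (pole_index i) \<noteq> pole_pos N (norm_x q) (pole_index j)"
    if "i \<in> {1..p}" "j \<in> {1..p}" "i \<noteq> j" for i j
  proof -
    have "det2 (act B (q i)) (act B (q j)) \<noteq> 0" using d[of i j] that B0 by (simp add: det2_act_act)
    then have "det2 (normal_pos (norm_x q) i) (normal_pos (norm_x q) j) \<noteq> 0"
      using nq that by (simp add: det2_hscale)
    then show ?thesis using that by (simp add: normal_pos_def det2_def)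
  qed
  have inj: "inj_on (pole_pos N (norm_x q)) {..Suc N}"
  proof (rule inj_onI)
    fix k l assume kl: "k \<in> {..Suc N}" "l \<in> {..Suc N}" "pole_pos N (norm_x q) k = pole_pos N (norm_x q) l"
    then have "k \<in> pole_index ` {1..p}" "l \<in> pole_index ` {1..p}"
      by (simp_all only: bij_betw_imp_surj_on[OF bij_pole_index])
    then obtain i j where ij: "i \<in> {1..p}" "j \<in> {1..p}" "k = pole_index i" "l = pole_index j" by blast
    with ne[OF ij(1,2)] kl(3) show "k = l" by blast
  qed
  show "separated N (norm_x q)"
    unfolding separated_def
  proof (intro conjI allI impI)
    show "inj_on (norm_x q) {..N}"
      using inj_on_subset[OF inj, of "{..N}"] by (auto simp: inj_on_def pole_pos_def)
    fix j assume "j \<le> N"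
    then show "norm_x q j \<noteq> 0" using inj_onD[OF inj, of j "Suc N"] by (auto simp: pole_pos_def)
  qed
qed

end

section \<open>The covering\<close>

text \<open>The injection \<open>e\<close> into a metric space provides the separation of points.
  Around y, the set \<open>V\<close> is the intersection of the images of disjoint neighbourhoods of
  the fibre points, so every fibre over \<open>V\<close> has a point in each neighbourhood; equal
  cardinalities exclude any other point, and the neighbourhoods restricted to \<open>V\<close> are
  the sheets.\<close>

lemma covering_map_of_degreeI:
  fixes e :: "'a \<Rightarrow> 'c::metric_space"
  assumes f: "continuous_map X Y f" "open_map X Y f"
    and e: "continuous_map X euclidean e" "inj_on e (topspace X)"
    and fib: "\<And>y. y \<in> topspace Y \<Longrightarrow> finite {x \<in> topspace X. f x = y} \<and> card {x \<in> topspace X. f x = y} = d"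
    and d: "d > 0"
  shows "covering_map_of_degree d X Y f"
proof -
  let ?F = "\<lambda>y. {x \<in> topspace X. f x = y}"
  have ne: "?F y \<noteq> {}" if "y \<in> topspace Y" for y using fib[OF that] d by (metis card.empty less_irrefl)
  have surj: "f ` topspace X = topspace Y"
  proof (intro subset_antisym subsetI)
    fix y assume "y \<in> topspace Y"
    with ne[OF this] show "y \<in> f ` topspace X" by blast
  qed (use continuous_map_image_subset_topspace[OF f(1)] in blast)
  have ev: "\<exists>V. y \<in> V \<and> openin Y V \<and> (\<exists>\<U>. \<Union>\<U> = {x \<in> topspace X. f x \<in> V} \<and> (\<forall>U\<in>\<U>. openin X U) \<and>
      pairwise disjnt \<U> \<and> (\<forall>U\<in>\<U>. homeomorphic_map (subtopology X U) (subtopology Y V) f))"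
    if y: "y \<in> topspace Y" for y
  proof -
    have "finite (e ` ?F y)" using fib[OF y] by simp
    from finite_separating_balls[OF this] obtain \<epsilon> where
      \<epsilon>: "\<epsilon> > 0" "\<forall>u\<in>e ` ?F y. \<forall>v\<in>e ` ?F y. u \<noteq> v \<longrightarrow> ball u \<epsilon> \<inter> ball v \<epsilon> = {}" by blast
    define B where "B x = {z \<in> topspace X. e z \<in> ball (e x) \<epsilon>}" for x
    have opB: "openin X (B x)" for x
      unfolding B_def by (rule openin_continuous_map_preimage[OF e(1)]) simp
    have xB: "x \<in> B x" if "x \<in> ?F y" for x using that \<epsilon>(1) by (simp add: B_def)
    have disj: "x = x'" if "x \<in> ?F y" "x' \<in> ?F y" "z \<in> B x" "z \<in> B x'" for x x' z
    proof (rule ccontr)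
      assume "x \<noteq> x'"
      then have "e x \<noteq> e x'" using inj_onD[OF e(2), of x x'] that by blast
      then have "ball (e x) \<epsilon> \<inter> ball (e x') \<epsilon> = {}" using \<epsilon>(2) that by blast
      then show False using that unfolding B_def by blast
    qed
    define V where "V = (\<Inter>x\<in>?F y. f ` B x)"
    have opV: "openin Y V" unfolding V_def
      by (rule openin_INT2) (use fib[OF y] ne[OF y] opB f(2) in \<open>auto simp: open_map_def\<close>)
    have yV: "y \<in> V" unfolding V_def using xB by blast
    have VY: "V \<subseteq> topspace Y" using opV openin_subset by blast
    \<comment> \<open>One preimage is chosen in each neighbourhood. These are distinct by
      disjointness, and as many as the whole fibre.\<close>
    have unique: "\<exists>g. (\<forall>x\<in>?F y. g x \<in> B x \<and> f (g x) = v) \<and> g ` ?F y = ?F v" if v: "v \<in> V" for v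
    proof -
      have "\<forall>x\<in>?F y. \<exists>z. z \<in> B x \<and> f z = v" using v unfolding V_def by blast
      from this[unfolded bchoice_iff] obtain g where g: "\<forall>x\<in>?F y. g x \<in> B x \<and> f (g x) = v" by (elim exE)
      have "inj_on g (?F y)"
      proof (rule inj_onI)
        fix x x' assume x: "x \<in> ?F y" "x' \<in> ?F y" "g x = g x'"
        show "x = x'" by (rule disj[OF x(1,2), of "g x"]) (use g x in \<open>auto\<close>)
      qed
      then have "card (g ` ?F y) = card (?F v)"
        using fib[OF y] fib[of v] v VY by (auto simp: card_image)
      moreover have "g ` ?F y \<subseteq> ?F v" using g unfolding B_def by blast
      ultimately have "g ` ?F y = ?F v" using fib[of v] v VY by (intro card_subset_eq) auto
      with g show ?thesis by blast
    qed
    define C where "C x = {z \<in> B x. f z \<in> V}" for x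
    have opC: "openin X (C x)" for x
    proof -
      have "C x = B x \<inter> {z \<in> topspace X. f z \<in> V}" by (auto simp: C_def B_def)
      then show ?thesis using opB openin_continuous_map_preimage[OF f(1) opV] by (metis openin_Int)
    qed
    have CX: "C x \<subseteq> topspace X" for x using opC openin_subset by blast
    have un: "\<Union> (C ` ?F y) = {x \<in> topspace X. f x \<in> V}"
    proof (intro subset_antisym subsetI)
      fix z assume z: "z \<in> {x \<in> topspace X. f x \<in> V}"
      then obtain g where g: "\<forall>x\<in>?F y. g x \<in> B x \<and> f (g x) = f z" "g ` ?F y = ?F (f z)"
        using unique[of "f z"] by blast
      have "z \<in> g ` ?F y" unfolding g(2) using z by simp
      then obtain x where x: "x \<in> ?F y" "z = g x" by blast
      then have "z \<in> C x" using g(1) z unfolding C_def by blast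
      with x(1) show "z \<in> \<Union> (C ` ?F y)" by blast
    qed (use CX in \<open>auto simp: C_def\<close>)
    have pw: "pairwise disjnt (C ` ?F y)"
    proof (rule pairwiseI)
      fix U U' assume "U \<in> C ` ?F y" "U' \<in> C ` ?F y" "U \<noteq> U'"
      then obtain x x' where x: "x \<in> ?F y" "x' \<in> ?F y" "U = C x" "U' = C x'" "x \<noteq> x'" by blast
      then show "disjnt U U'" using disj[OF x(1,2)] unfolding disjnt_def C_def by blast
    qed
    have homeo: "homeomorphic_map (subtopology X (C x)) (subtopology Y V) f" if x: "x \<in> ?F y" for x
    proof (rule bijective_open_imp_homeomorphic_map)
      have tC: "topspace (subtopology X (C x)) = C x" using CX by auto
      have tV: "topspace (subtopology Y V) = V" using VY by auto
      show "continuous_map (subtopology X (C x)) (subtopology Y V) f"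
        by (rule continuous_map_into_subtopology[OF continuous_map_from_subtopology[OF f(1)]]) (auto simp: C_def)
      show "open_map (subtopology X (C x)) (subtopology Y V) f"
        unfolding open_map_def
      proof (intro allI impI)
        fix W assume "openin (subtopology X (C x)) W"
        then have W: "openin X W" "W \<subseteq> C x" using openin_open_subtopology[OF opC] by auto
        then have "openin Y (f ` W)" using f(2) by (auto simp: open_map_def)
        moreover have "f ` W \<subseteq> V" using W(2) by (auto simp: C_def)
        ultimately show "openin (subtopology Y V) (f ` W)" using openin_open_subtopology[OF opV] by blast
      qed
      have cover: "\<exists>z\<in>C x. f z = v" if "v \<in> V" for v
      proof -
        obtain z where "z \<in> B x" "f z = v" using \<open>v \<in> V\<close> x unfolding V_def by blast
        with that show ?thesis unfolding C_def by blast
      qed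
      show "f ` topspace (subtopology X (C x)) = topspace (subtopology Y V)"
        unfolding tC tV using cover by (auto simp: C_def)
      show "inj_on f (topspace (subtopology X (C x)))" unfolding tC
      proof (rule inj_onI)
        fix z z' assume z: "z \<in> C x" "z' \<in> C x" "f z = f z'"
        then have "f z \<in> V" by (simp add: C_def)
        from unique[OF this] obtain g where g: "\<forall>x\<in>?F y. g x \<in> B x \<and> f (g x) = f z" "g ` ?F y = ?F (f z)" by blast
        have only: "u = g x" if u: "u \<in> C x" "f u = f z" for u
        proof -
          have "u \<in> ?F (f z)" using u CX by blast
          then obtain x' where x': "x' \<in> ?F y" "u = g x'" unfolding g(2)[symmetric] by blast
          have "x' = x" by (rule disj[OF x'(1) x, of u]) (use g(1) x' u in \<open>auto simp: C_def\<close>)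
          with x' show ?thesis by simp
        qed
        show "z = z'" using only[of z] only[of z'] z by simp
      qed
    qed
    show ?thesis
      by (intro exI[of _ V] conjI yV opV exI[of _ "C ` ?F y"] un pw) (use opC homeo in auto)
  qed
  show ?thesis unfolding covering_map_of_degree_def covering_map_def
    by (intro conjI ballI f(1) surj ev) (use fib in auto)
qed

lemma fact_add: "fact (d + N) = (fact d * (\<Prod>i=1..N. d + i) :: nat)"
  by (induction N) (auto simp: algebra_simps)

section \<open>Coordinates on the stratum and on the residual space\<close>

context stratum_data
begin

text \<open>In the chart of the stratum slot 0 holds the multiplicative constant and the other slots
  the free poles; \<open>xof\<close> restores the normalized pole 1 in slot 0.\<close>

definition xof :: "(nat \<Rightarrow> complex) \<Rightarrow> nat \<Rightarrow> complex" where
  "xof v = v(0 := 1)"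

definition chart_set :: "(nat \<Rightarrow> complex) set" where
  "chart_set = {v \<in> cspace (Suc N). v 0 \<noteq> 0 \<and> separated N (xof v)}"

definition form_class :: "(nat \<Rightarrow> complex) \<Rightarrow> (form \<times> (nat \<Rightarrow> sphere)) set" where
  "form_class v = iso_forms p a b `` {normal_form (v 0) (xof v)}"

text \<open>The residual map in coordinates: the residue of pole p is dropped, being determined by
  the others, and the padding by 0 puts the values in \<open>cspace (Suc N)\<close>, of the same
  dimension as the chart.\<close>

definition nonzero_residues :: "(nat \<Rightarrow> complex) \<Rightarrow> nat \<Rightarrow> complex" where
  "nonzero_residues v j = (if j \<le> N then 2 * of_real pi * \<i> * v 0 * pole_residue N \<beta> (b p) (xof v) j else 0)"

definition extend_residues :: "(nat \<Rightarrow> complex) \<Rightarrow> nat \<Rightarrow> complex" where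
  "extend_residues l = restrict (\<lambda>j. all_residues N l (pole_index j)) {1..p}"

definition restrict_residues :: "(nat \<Rightarrow> complex) \<Rightarrow> nat \<Rightarrow> complex" where
  "restrict_residues \<rho> i = (if i = 0 then \<rho> (p - 1) else if i \<le> N then \<rho> i else 0)"

definition chart_of :: "complex \<Rightarrow> (nat \<Rightarrow> hvec) \<Rightarrow> nat \<Rightarrow> complex" where
  "chart_of c q = (norm_x q)(0 := norm_c c q)"

lemma sum_extend_residues: "(\<Sum>j=1..p. extend_residues l j) = 0"
proof -
  have "(\<Sum>j=1..p. extend_residues l j) = (\<Sum>j=1..p. all_residues N l (pole_index j))"
    by (rule sum.cong) (auto simp: extend_residues_def)
  also have "\<dots> = 0" using sum_poles[of "\<lambda>i _. all_residues N l i"] by (simp add: all_residues_def)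
  finally show ?thesis .
qed

lemma extend_residues_in_residual_space: "extend_residues l \<in> residual_space p"
  using sum_extend_residues by (simp add: residual_space_def) (simp add: extend_residues_def)

lemma extend_restrict_residues:
  assumes "\<rho> \<in> residual_space p"
  shows "extend_residues (restrict_residues \<rho>) = \<rho>"
proof
  fix j
  have ext: "\<rho> \<in> extensional {1..p}" and sum0: "(\<Sum>j=1..p. \<rho> j) = 0"
    using assms by (auto simp: residual_space_def PiE_def)
  define m where "m i = (if i = Suc N then \<rho> p else restrict_residues \<rho> i)" for i
  have eq: "\<rho> j = m (pole_index j)" if "j \<in> {1..p}" for j
  proof -
    consider "j = N + 2" | "j = N + 1" | "j \<in> {1..N}" using \<open>j \<in> {1..p}\<close> pN by fastforce
    then show ?thesis unfolding m_def restrict_residues_def by cases (auto simp: label_index_def pN)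
  qed
  have "(\<Sum>j=1..p. \<rho> j) = (\<Sum>j=1..p. m (pole_index j))" by (rule sum.cong) (auto simp: eq)
  also have "\<dots> = m (Suc N) + (\<Sum>i\<le>N. m i)" by (rule sum_poles)
  also have "(\<Sum>i\<le>N. m i) = (\<Sum>i\<le>N. restrict_residues \<rho> i)" by (rule sum.cong) (auto simp: m_def)
  finally have "m (Suc N) = - (\<Sum>i\<le>N. restrict_residues \<rho> i)" using sum0 by (simp add: eq_neg_iff_add_eq_0)
  then have "all_residues N (restrict_residues \<rho>) i = m i" if "i \<le> Suc N" for i
    using that by (auto simp: all_residues_def m_def le_Suc_eq)
  moreover have "pole_index j \<le> Suc N" if "j \<in> {1..p}" for j using bij_betwE[OF bij_pole_index] that by auto
  ultimately show "extend_residues (restrict_residues \<rho>) j = \<rho> j"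
    using eq ext by (cases "j \<in> {1..p}") (auto simp: extend_residues_def extensional_def)
qed

lemma restrict_extend_residues: "i \<le> N \<Longrightarrow> restrict_residues (extend_residues l) i = l i"
  unfolding restrict_residues_def extend_residues_def using pN by (auto simp: label_index_def all_residues_def)

text \<open>A nonempty set of indices up to N corresponds to a set of labels missing p, hence to a
  nonempty proper subset and a resonance hyperplane.\<close>

lemma nonresonant_restrict_residues:
  assumes "\<rho> \<in> residual_space p - resonance_arrangement p"
  shows "nonresonant N (restrict_residues \<rho>)"
  unfolding nonresonant_def
proof (intro allI impI)
  fix J assume J: "J \<noteq> {} \<and> J \<subseteq> {..N}"
  define h where "h i = (if i = 0 then N + 1 else i)" for i
  have inj: "inj_on h {..N}" by (auto simp: inj_on_def h_def)
  have I: "h ` J \<noteq> {}" "h ` J \<subset> {1..p}"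
  proof -
    have "h ` J \<subseteq> {1..N + 1}" using J by (auto simp: h_def)
    moreover have "{1..N + 1} \<subset> {1..p}" using pN by auto
    ultimately show "h ` J \<subset> {1..p}" by blast
  qed (use J in auto)
  have "\<rho> \<notin> resonance_hyperplane p (h ` J)" using assms I by (auto simp: resonance_arrangement_def)
  then have "(\<Sum>j\<in>h ` J. \<rho> j) \<noteq> 0" using assms by (auto simp: resonance_hyperplane_def)
  moreover have "(\<Sum>j\<in>h ` J. \<rho> j) = (\<Sum>j\<in>J. \<rho> (h j))"
    using inj_on_subset[OF inj] J by (subst sum.reindex) auto
  moreover have "(\<Sum>j\<in>J. \<rho> (h j)) = (\<Sum>j\<in>J. restrict_residues \<rho> j)"
    unfolding restrict_residues_def using J pN by (intro sum.cong) (auto simp: h_def)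
  ultimately show "(\<Sum>j\<in>J. restrict_residues \<rho> j) \<noteq> 0" by simp
qed

lemma xof_0 [simp]: "xof v 0 = 1"
  by (simp add: xof_def)

lemma chart_setD: "v \<in> chart_set \<Longrightarrow> v 0 \<noteq> 0" "v \<in> chart_set \<Longrightarrow> separated N (xof v)"
  "v \<in> chart_set \<Longrightarrow> v \<in> cspace (Suc N)"
  by (auto simp: chart_set_def)

lemma chart_set_admissible: "v \<in> chart_set \<Longrightarrow> admissible p (v 0 * (- 1) ^ a) (normal_pos (xof v))"
  by (intro normal_pos_admissible chart_setD)

lemma normal_form_labelled: "v \<in> chart_set \<Longrightarrow> normal_form (v 0) (xof v) \<in> labelled_forms p a b"
  unfolding normal_form_def by (intro param_form_labelled chart_set_admissible)

text \<open>All members of the class have the same residues, so \<open>the_elem\<close> in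
  \<open>residual_map\<close> picks from a genuine singleton.\<close>

lemma residual_map_form_class:
  assumes v: "v \<in> chart_set"
  shows "residual_map p (form_class v) = extend_residues (nonzero_residues v)"
proof -
  have "residues p X = extend_residues (nonzero_residues v)" if "X \<in> form_class v" for X
  proof -
    have "(X, normal_form (v 0) (xof v)) \<in> iso_forms p a b"
      using that equiv_iso_forms unfolding form_class_def by (meson Image_singleton_iff equivE symD)
    from residues_iso_normal_form[OF this chart_setD(1)[OF v] chart_setD(2)[OF v]]
    have "residues p X = restrict (\<lambda>j. 2 * of_real pi * \<i> *
      (v 0 * all_residues N (pole_residue N \<beta> (b p) (xof v)) (pole_index j))) {1..p}" .
    also have "\<dots> = extend_residues (nonzero_residues v)"
      unfolding extend_residues_def
      by (rule restrict_ext) (auto simp: all_residues_def nonzero_residues_def sum_distrib_left mult.assoc)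
    finally show ?thesis .
  qed
  moreover have "form_class v \<noteq> {}"
    unfolding form_class_def using equiv_class_self[OF equiv_iso_forms normal_form_labelled[OF v]] by blast
  ultimately have "residues p ` form_class v = {extend_residues (nonzero_residues v)}" by auto
  then show ?thesis by (simp add: residual_map_def)
qed

lemma form_class_in_stratum: "v \<in> chart_set \<Longrightarrow> form_class v \<in> stratum p a b"
  unfolding form_class_def stratum_def by (intro quotientI normal_form_labelled)

lemma inj_on_form_class: "inj_on form_class chart_set"
proof (rule inj_onI)
  fix v v' assume v: "v \<in> chart_set" "v' \<in> chart_set" and eq: "form_class v = form_class v'"
  have "(normal_form (v 0) (xof v), normal_form (v' 0) (xof v')) \<in> iso_forms p a b"
    using eq_equiv_class[OF eq[unfolded form_class_def] equiv_iso_forms normal_form_labelled[OF v(2)]] .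
  from normal_form_unique[OF this chart_setD(1)[OF v(1)] chart_setD(1)[OF v(2)] chart_setD(2)[OF v(1)] chart_setD(2)[OF v(2)]]
  have u: "v 0 = v' 0" "\<forall>j\<le>N. xof v j = xof v' j" by auto
  show "v = v'"
  proof
    fix i
    consider "i = 0" | "0 < i" "i \<le> N" | "i > N" by force
    then show "v i = v' i"
    proof cases
      case 2
      then have "xof v i = xof v' i" using u(2) by blast
      with 2 show ?thesis by (simp add: xof_def)
    next
      case 3
      then show ?thesis using chart_setD(3)[OF v(1)] chart_setD(3)[OF v(2)] by (simp add: cspace_def)
    qed (use u in simp)
  qed
qed

lemma xof_chart_of: "xof (chart_of c q) = norm_x q"
  by (auto simp: xof_def chart_of_def norm_x_def fun_eq_iff)

lemma chart_of_in_chart_set: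
  assumes "admissible p c q"
  shows "chart_of c q \<in> chart_set"
proof -
  have "chart_of c q \<in> cspace (Suc N)" by (auto simp: chart_of_def cspace_def norm_x_def)
  with norm_form[OF assms] show ?thesis by (simp add: chart_set_def xof_chart_of) (simp add: chart_of_def)
qed

lemma form_class_chart_of:
  assumes "admissible p c q"
  shows "form_class (chart_of c q) = iso_forms p a b `` {Pf c q}"
proof -
  have "(Pf c q, normal_form (chart_of c q 0) (xof (chart_of c q))) \<in> iso_forms p a b"
    using norm_form(3)[OF assms] unfolding xof_chart_of by (simp add: chart_of_def)
  from equiv_class_eq[OF equiv_iso_forms this] show ?thesis by (simp add: form_class_def)
qed

lemma stratum_eq: "stratum p a b = form_class ` chart_set"
proof (intro subset_antisym subsetI)
  fix C assume "C \<in> stratum p a b"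
  then obtain X where X: "X \<in> labelled_forms p a b" "C = iso_forms p a b `` {X}"
    unfolding stratum_def by (rule quotientE)
  obtain F P where FP: "X = (F, P)" by (cases X)
  obtain c q where q: "admissible p c q" "X = Pf c q"
    using labelled_form_is_param_form X(1) unfolding FP by blast
  then have "C = form_class (chart_of c q)" using X(2) form_class_chart_of by simp
  with chart_of_in_chart_set[OF q(1)] show "C \<in> form_class ` chart_set" by blast
qed (use form_class_in_stratum in blast)

definition chart_inv :: "(form \<times> (nat \<Rightarrow> sphere)) set \<Rightarrow> nat \<Rightarrow> complex" where
  "chart_inv = inv_into chart_set form_class"

lemma chart_inv_form_class: "v \<in> chart_set \<Longrightarrow> chart_inv (form_class v) = v"
  unfolding chart_inv_def by (rule inv_into_f_f[OF inj_on_form_class])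

lemma chart_inv: "C \<in> stratum p a b \<Longrightarrow> chart_inv C \<in> chart_set \<and> form_class (chart_inv C) = C"
  unfolding stratum_eq using chart_inv_form_class by auto

text \<open>Two successive final topologies collapse into one, so openness in the stratum is tested
  on the parameters.\<close>

lemma openin_stratum_top:
  "openin (stratum_top p a b) U \<longleftrightarrow> U \<subseteq> stratum p a b \<and>
    openin (params p) {y \<in> topspace (params p). iso_forms p a b `` {param_form p a b y} \<in> U}"
proof -
  have lab: "param_form p a b y \<in> labelled_forms p a b" if "y \<in> topspace (params p)" for y
    using that param_form_labelled by (auto simp: topspace_params)
  have top: "topspace (labelled_forms_top p a b) = labelled_forms p a b"
  proof (rule subset_antisym)
    show "topspace (labelled_forms_top p a b) \<subseteq> labelled_forms p a b"
      using openin_topspace[of "labelled_forms_top p a b"] unfolding labelled_forms_top_def openin_final_topology by blast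
    have "{x \<in> topspace (params p). param_form p a b x \<in> labelled_forms p a b} = topspace (params p)" using lab by auto
    then have "openin (labelled_forms_top p a b) (labelled_forms p a b)"
      unfolding labelled_forms_top_def openin_final_topology by simp
    then show "labelled_forms p a b \<subseteq> topspace (labelled_forms_top p a b)" by (rule openin_subset)
  qed
  have "{x \<in> topspace (params p). param_form p a b x \<in> {x \<in> labelled_forms p a b. iso_forms p a b `` {x} \<in> U}} =
      {y \<in> topspace (params p). iso_forms p a b `` {param_form p a b y} \<in> U}" using lab by auto
  then show ?thesis
    unfolding stratum_top_def openin_final_topology[of "stratum p a b"] top
    unfolding labelled_forms_top_def openin_final_topology by auto
qed

lemma topspace_stratum_top: "topspace (stratum_top p a b) = stratum p a b"
proof (rule subset_antisym)
  show "topspace (stratum_top p a b) \<subseteq> stratum p a b"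
    using openin_topspace[of "stratum_top p a b"] openin_stratum_top by blast
  have "{y \<in> topspace (params p). iso_forms p a b `` {param_form p a b y} \<in> stratum p a b} = topspace (params p)"
    using param_form_labelled unfolding topspace_params stratum_def by (auto intro!: quotientI)
  then have "openin (stratum_top p a b) (stratum p a b)" unfolding openin_stratum_top by simp
  then show "stratum p a b \<subseteq> topspace (stratum_top p a b)" by (rule openin_subset)
qed

lemma continuous_on_det2:
  assumes "continuous_on S f" "continuous_on S g"
  shows "continuous_on S (\<lambda>x. det2 (f x) (g x))"
  unfolding det2_def by (intro continuous_intros assms)

lemma continuous_on_chart_of:
  "continuous_on {y. admissible p (fst y) (snd y)} (\<lambda>y. chart_of (fst y) (snd y))"
proof (rule continuous_on_coordinatewise_then_product)
  let ?S = "{y :: complex \<times> (nat \<Rightarrow> hvec). admissible p (fst y) (snd y)}"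
  have s: "continuous_on ?S (\<lambda>y. snd y j)" for j
    by (rule continuous_on_compose2[OF continuous_on_product_coordinates[of j] continuous_on_snd[OF continuous_on_id]]) auto
  have dt: "continuous_on ?S (\<lambda>y. det2 (snd y i) (snd y j))" for i j by (intro continuous_on_det2 s)
  have nz: "det2 (snd y i) (snd y j) \<noteq> 0" if "y \<in> ?S" "i \<le> p" "j \<le> p" "i \<noteq> j" for y i j
    using that by (auto simp: admissible_def)
  have p1: "p - 1 \<le> p" "p - 1 \<noteq> p" "p - 1 \<noteq> 0" "p \<noteq> 0" using p2 by auto
  have t: "continuous_on ?S (\<lambda>y. norm_t (snd y) j)" for j
    unfolding norm_t_def by (cases "j = 0") (auto intro!: continuous_intros dt)
  have tn: "norm_t (snd y) j \<noteq> 0" if "y \<in> ?S" "j \<in> {1..p}" for y j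
    using that nz[OF that(1), of j 0] nz[OF that(1), of "p - 1" p] p1 by (auto simp: norm_t_def)
  fix i
  consider "i = 0" | "i \<in> {1..N}" | "i > N" by force
  then show "continuous_on ?S (\<lambda>y. chart_of (fst y) (snd y) i)"
  proof cases
    case 1
    have "continuous_on ?S (\<lambda>y. norm_c (fst y) (snd y))"
      unfolding norm_c_def
      by (intro continuous_intros dt t continuous_on_prod) (use tn in auto)
    then show ?thesis using 1 by (simp add: chart_of_def)
  next
    case 2
    have "continuous_on ?S (\<lambda>y. det2 (snd y i) (snd y p) * det2 (snd y (p - 1)) (snd y 0) /
       (det2 (snd y i) (snd y 0) * det2 (snd y (p - 1)) (snd y p)))"
    proof (intro continuous_intros dt ballI)
      fix y assume y: "y \<in> ?S"
      show "det2 (snd y i) (snd y 0) * det2 (snd y (p - 1)) (snd y p) \<noteq> 0"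
        using nz[OF y, of i 0] nz[OF y, of "p - 1" p] p1 2 pN by simp
    qed
    then show ?thesis using 2 by (simp add: chart_of_def norm_x_def)
  next
    case 3
    then show ?thesis by (simp add: chart_of_def norm_x_def)
  qed
qed

text \<open>Parameters are extensional functions with the product topology over
  \<open>{0..p}\<close>. Replacing their values outside by 0 makes them points of the full function
  space, where continuity on sets is available.\<close>

lemma continuous_map_params_euclidean:
  "continuous_map (params p) (top_of_set {y. admissible p (fst y) (snd y)})
    (\<lambda>y. (fst y, \<lambda>i. if i \<le> p then snd y i else 0))"
proof (rule continuous_map_into_subtopology)
  have f: "continuous_map (params p) euclidean (\<lambda>y. fst y)"
    unfolding params_def by (intro continuous_map_from_subtopology continuous_map_fst)
  have s: "continuous_map (params p) euclidean (\<lambda>y. snd y i)" if "i \<in> {0..p}" for i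
  proof -
    have "continuous_map (prod_topology euclidean (product_topology (\<lambda>_. euclidean) {0..p})) euclidean
        ((\<lambda>q. q i) \<circ> snd)"
      by (rule continuous_map_compose[OF continuous_map_snd continuous_map_product_projection[OF that]])
    then show ?thesis unfolding params_def by (intro continuous_map_from_subtopology) (simp add: o_def)
  qed
  have "continuous_map (params p) (product_topology (\<lambda>_. euclidean) UNIV) (\<lambda>y i. if i \<le> p then snd y i else 0)"
    unfolding continuous_map_componentwise_UNIV
  proof
    fix i show "continuous_map (params p) euclidean (\<lambda>y. if i \<le> p then snd y i else 0)"
      using s[of i] by (cases "i \<le> p") auto
  qed
  then have "continuous_map (params p) euclidean (\<lambda>y i. if i \<le> p then snd y i else 0)"
    by (simp add: euclidean_product_topology)
  with f have "continuous_map (params p) (prod_topology euclidean euclidean) (\<lambda>y. (fst y, \<lambda>i. if i \<le> p then snd y i else 0))"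
    unfolding continuous_map_pairwise o_def fst_conv snd_conv by blast
  then show "continuous_map (params p) euclidean (\<lambda>y. (fst y, \<lambda>i. if i \<le> p then snd y i else 0))"
    by (simp only: prod_topology_euclidean)
  show "(\<lambda>y. (fst y, \<lambda>i. if i \<le> p then snd y i else 0)) \<in> topspace (params p) \<rightarrow> {y. admissible p (fst y) (snd y)}"
    by (auto simp: topspace_params admissible_def)
qed

text \<open>On parameters the chart of the class is \<open>chart_of\<close>, an expression in
  determinants of pairs of homogeneous coordinates with nonvanishing denominators.\<close>

lemma continuous_map_chart_inv: "continuous_map (stratum_top p a b) (top_of_set chart_set) chart_inv"
  unfolding continuous_map_def
proof (intro conjI allI impI)
  show "chart_inv \<in> topspace (stratum_top p a b) \<rightarrow> topspace (top_of_set chart_set)"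
    using chart_inv by (auto simp: topspace_stratum_top)
  fix U assume U: "openin (top_of_set chart_set) U"
  let ?E = "\<lambda>y :: complex \<times> (nat \<Rightarrow> hvec). (fst y, \<lambda>i. if i \<le> p then snd y i else 0)"
  have E: "chart_of (fst (?E y)) (snd (?E y)) = chart_of (fst y) (snd y)" for y
    unfolding chart_of_def norm_x_def norm_c_def norm_t_def fun_eq_iff using pN by auto
  have "continuous_map (top_of_set {y. admissible p (fst y) (snd y)}) (top_of_set chart_set) (\<lambda>y. chart_of (fst y) (snd y))"
    using continuous_on_chart_of chart_of_in_chart_set by (auto simp: continuous_map_in_subtopology)
  from continuous_map_compose[OF continuous_map_params_euclidean this]
  have c: "continuous_map (params p) (top_of_set chart_set) (\<lambda>y. chart_of (fst y) (snd y))"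
    unfolding o_def E .
  have "{y \<in> topspace (params p). iso_forms p a b `` {param_form p a b y} \<in>
        {C \<in> topspace (stratum_top p a b). chart_inv C \<in> U}} =
      {y \<in> topspace (params p). chart_of (fst y) (snd y) \<in> U}"
  proof (rule Collect_cong, rule conj_cong[OF refl])
    fix y assume "y \<in> topspace (params p)"
    then have adm: "admissible p (fst y) (snd y)" by (auto simp: topspace_params)
    have "iso_forms p a b `` {param_form p a b y} = form_class (chart_of (fst y) (snd y))"
      using form_class_chart_of[OF adm] by simp
    then show "iso_forms p a b `` {param_form p a b y} \<in> {C \<in> topspace (stratum_top p a b). chart_inv C \<in> U} \<longleftrightarrow>
        chart_of (fst y) (snd y) \<in> U"
      using chart_of_in_chart_set[OF adm] by (simp add: topspace_stratum_top form_class_in_stratum chart_inv_form_class)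
  qed
  moreover have "openin (params p) {y \<in> topspace (params p). chart_of (fst y) (snd y) \<in> U}"
    by (rule openin_continuous_map_preimage[OF c U])
  ultimately show "openin (stratum_top p a b) {C \<in> topspace (stratum_top p a b). chart_inv C \<in> U}"
    unfolding openin_stratum_top by (auto simp: topspace_stratum_top)
qed

lemma continuous_on_xof: "continuous_on S xof"
proof (rule continuous_on_coordinatewise_then_product)
  fix i show "continuous_on S (\<lambda>v. xof v i)"
    by (cases "i = 0") (auto simp: xof_def intro!: continuous_on_subset[OF continuous_on_product_coordinates])
qed

lemma openin_chart_set: "openin (top_of_set (cspace (Suc N))) chart_set"
proof -
  have c: "continuous_on UNIV (\<lambda>v :: nat \<Rightarrow> complex. v i)" for i by simp
  have cx: "continuous_on UNIV (\<lambda>v. xof v i)" for i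
    by (rule continuous_on_product_then_coordinatewise[OF continuous_on_xof])
  have sep: "separated N x \<longleftrightarrow> (\<forall>i\<le>N. x i \<noteq> 0) \<and> (\<forall>i\<le>N. \<forall>j\<in>{..N} - {i}. x i \<noteq> x j)" for x
    by (auto simp: separated_def inj_on_def)
  have "{v. v 0 \<noteq> 0 \<and> separated N (xof v)} = {v. v 0 \<noteq> 0} \<inter> ((\<Inter>i\<in>{..N}. {v. xof v i \<noteq> 0}) \<inter>
      (\<Inter>i\<in>{..N}. \<Inter>j\<in>{..N} - {i}. {v. xof v i \<noteq> xof v j}))"
    unfolding sep by blast
  moreover have "open \<dots>"
    by (intro open_Int open_INT finite_atMost finite_Diff ballI open_Collect_neq c cx continuous_on_const)
  ultimately have "open {v. v 0 \<noteq> 0 \<and> separated N (xof v)}" by simp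
  then show ?thesis unfolding openin_open
    by (intro exI[of _ "{v. v 0 \<noteq> 0 \<and> separated N (xof v)}"]) (auto simp: chart_set_def)
qed

text \<open>The normal form is a continuous section from the chart into the parameters, so
  \<open>form_class\<close> is continuous; the preimage is open in complex space because the chart
  is.\<close>

lemma openin_form_class_preimage:
  assumes U: "openin (stratum_top p a b) U"
  shows "openin (top_of_set (cspace (Suc N))) {v \<in> chart_set. form_class v \<in> U}"
proof -
  let ?G = "\<lambda>v. (v 0 * (- 1) ^ a, restrict (normal_pos (xof v)) {0..p})"
  have c: "continuous_on chart_set (\<lambda>v :: nat \<Rightarrow> complex. v i)" for i
    by (rule continuous_on_subset[OF continuous_on_product_coordinates]) auto
  have cx: "continuous_on chart_set (\<lambda>v. xof v i)" for i
    by (rule continuous_on_product_then_coordinatewise[OF continuous_on_xof])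
  have G: "continuous_map (top_of_set chart_set) (params p) ?G"
    unfolding params_def
  proof (rule continuous_map_into_subtopology)
    have "continuous_map (top_of_set chart_set) (product_topology (\<lambda>_. euclidean) {0..p}) (\<lambda>v. restrict (normal_pos (xof v)) {0..p})"
      unfolding continuous_map_componentwise
    proof (intro conjI ballI)
      show "(\<lambda>v. restrict (normal_pos (xof v)) {0..p}) ` topspace (top_of_set chart_set) \<subseteq> extensional {0..p}" by auto
      fix k assume k: "k \<in> {0..p}"
      have "continuous_on chart_set (\<lambda>v. normal_pos (xof v) k)"
        unfolding normal_pos_def pole_pos_def
        by (cases "k = 0"; cases "pole_index k \<le> N") (auto intro!: continuous_intros cx)
      then show "continuous_map (top_of_set chart_set) euclidean (\<lambda>v. restrict (normal_pos (xof v)) {0..p} k)"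
        using k by simp
    qed
    moreover have "continuous_map (top_of_set chart_set) euclidean (\<lambda>v. v 0 * (- 1) ^ a)"
      by (simp) (intro continuous_intros c)
    ultimately show "continuous_map (top_of_set chart_set) (prod_topology euclidean (product_topology (\<lambda>_. euclidean) {0..p})) ?G"
      by (simp add: continuous_map_pairwise o_def)
    have "?G v \<in> topspace (params p)" if "v \<in> chart_set" for v
      using chart_set_admissible[OF that] by (auto simp: topspace_params admissible_def)
    then show "?G \<in> topspace (top_of_set chart_set) \<rightarrow> {(c, q). c \<noteq> 0 \<and> (\<forall>i\<in>{0..p}. q i \<noteq> 0) \<and>
        (\<forall>i\<in>{0..p}. \<forall>j\<in>{0..p}. i \<noteq> j \<longrightarrow> fst (q i) * snd (q j) \<noteq> fst (q j) * snd (q i))}"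
      unfolding params_def by auto
  qed
  have pf: "iso_forms p a b `` {param_form p a b (?G v)} = form_class v" for v
    unfolding form_class_def normal_form_def
    by (subst param_form_cong[of "restrict (normal_pos (xof v)) {0..p}" "normal_pos (xof v)"]) auto
  have "openin (params p) {y \<in> topspace (params p). iso_forms p a b `` {param_form p a b y} \<in> U}"
    using U unfolding openin_stratum_top by blast
  from openin_continuous_map_preimage[OF G this]
  have "openin (top_of_set chart_set) {v \<in> topspace (top_of_set chart_set).
      ?G v \<in> {y \<in> topspace (params p). iso_forms p a b `` {param_form p a b y} \<in> U}}" .
  also have "{v \<in> topspace (top_of_set chart_set).
      ?G v \<in> {y \<in> topspace (params p). iso_forms p a b `` {param_form p a b y} \<in> U}} = {v \<in> chart_set. form_class v \<in> U}"
    using continuous_map_funspace[OF G] pf by auto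
  finally show ?thesis using openin_trans openin_chart_set by blast
qed

lemma continuous_on_nonzero_residues: "continuous_on chart_set (\<lambda>v. nonzero_residues v j)"
proof (cases "j \<le> N")
  case True
  have c: "continuous_on chart_set (\<lambda>v :: nat \<Rightarrow> complex. v 0)"
    by (rule continuous_on_subset[OF continuous_on_product_coordinates]) auto
  have "continuous_on chart_set (\<lambda>v. pole_residue N \<beta> (b p) (xof v) j)"
    by (rule continuous_on_compose2[OF continuous_pole_residue[OF True] continuous_on_xof])
      (use \<beta>1 True chart_setD(2) in auto)
  then show ?thesis unfolding nonzero_residues_def using True by (simp, intro continuous_intros c)
qed (simp add: nonzero_residues_def)

section \<open>Fibres and openness of the residual map\<close>

definition "d = a + 2 - p"

lemma d_eq: "d = (\<Sum>j\<le>N. \<beta> j - 1) + (b p - 1)" and d_le: "(\<Sum>j\<le>N. \<beta> j - 1) \<le> d" and d_add: "d + N = a"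
  unfolding d_def using degree_eq le_order pN by auto

lemma fibre_eq_nonzero_residues:
  assumes v: "v \<in> chart_set"
  shows "\<forall>k\<in>{d+1..d+N}. fibre_eq N \<beta> (nonzero_residues v) k (xof v) = 0"
proof
  fix k assume k: "k \<in> {d+1..d+N}"
  have "fibre_eq N \<beta> (nonzero_residues v) k (xof v) =
      2 * of_real pi * \<i> * v 0 * fibre_eq N \<beta> (pole_residue N \<beta> (b p) (xof v)) k (xof v)"
    unfolding fibre_eq_linear sum_distrib_left by (rule sum.cong) (auto simp: nonzero_residues_def mult.assoc)
  then show "fibre_eq N \<beta> (nonzero_residues v) k (xof v) = 0"
    using pole_form_residues(1)[OF \<beta>1 bp1 d_eq chart_setD(2)[OF v]] k by simp
qed

lemma extend_nonzero_residues_eq_iff: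
  assumes "\<rho> \<in> residual_space p"
  shows "extend_residues (nonzero_residues v) = \<rho> \<longleftrightarrow> nonzero_residues v = restrict_residues \<rho>"
proof
  assume "extend_residues (nonzero_residues v) = \<rho>"
  then have "restrict_residues \<rho> i = nonzero_residues v i" if "i \<le> N" for i
    using restrict_extend_residues[OF that, of "nonzero_residues v"] by simp
  moreover have "restrict_residues \<rho> i = nonzero_residues v i" if "\<not> i \<le> N" for i
    using that by (auto simp: restrict_residues_def nonzero_residues_def)
  ultimately show "nonzero_residues v = restrict_residues \<rho>" by (metis ext)
qed (simp add: extend_restrict_residues[OF assms])

text \<open>Equal poles give equal residues of the form with constant 1, so the constant is
  recovered from a nonzero residue of index 0.\<close>

lemma same_residues_same_scale:
  assumes "nonzero_residues v = nonzero_residues v'" "nonzero_residues v 0 \<noteq> 0" "\<forall>i\<le>N. xof v i = xof v' i"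
    and "v \<in> chart_set" "v' \<in> chart_set"
  shows "v = v'"
proof
  have x: "xof v = xof v'"
  proof
    fix i show "xof v i = xof v' i"
      using assms(3) chart_setD(3)[OF assms(4)] chart_setD(3)[OF assms(5)]
      by (cases "i \<le> N") (auto simp: xof_def cspace_def)
  qed
  have v0: "v 0 = v' 0" using fun_cong[OF assms(1), of 0] assms(2) x by (auto simp: nonzero_residues_def)
  fix i show "v i = v' i" using fun_cong[OF x, of i] v0 by (cases "i = 0") (auto simp: xof_def)
qed

text \<open>Forgetting the constant is a bijection from the fibre to the normalized solutions of the
  polynomial system: nonresonance makes every solution separated, and the constant is then
  determined by the prescribed residues.\<close>

lemma card_residue_fibre:
  assumes lam: "\<rho> \<in> residual_space p - resonance_arrangement p"
  shows "finite {v \<in> chart_set. extend_residues (nonzero_residues v) = \<rho>} \<and>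
    card {v \<in> chart_set. extend_residues (nonzero_residues v) = \<rho>} = fact a div fact (a + 2 - p)"
proof -
  let ?l = "restrict_residues \<rho>"
  let ?A = "{v \<in> chart_set. extend_residues (nonzero_residues v) = \<rho>}"
  let ?B = "{w \<in> cspace (Suc N). w 0 = 1 \<and> (\<forall>k\<in>{d+1..d+N}. fibre_eq N \<beta> ?l k w = 0)}"
  note nr = nonresonant_restrict_residues[OF lam]
  have l0: "?l 0 \<noteq> 0" using nr[unfolded nonresonant_def, rule_format, of "{0}"] by simp
  have A: "v \<in> ?A \<longleftrightarrow> v \<in> chart_set \<and> nonzero_residues v = ?l" for v
    using extend_nonzero_residues_eq_iff[of \<rho> v] lam by auto
  have "bij_betw xof ?A ?B"
    unfolding bij_betw_def
  proof
    show "inj_on xof ?A"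
    proof (rule inj_onI)
      fix v v' assume v: "v \<in> ?A" "v' \<in> ?A" "xof v = xof v'"
      show "v = v'" by (rule same_residues_same_scale) (use v A l0 in auto)
    qed
    show "xof ` ?A = ?B"
    proof (intro subset_antisym subsetI)
      fix w assume "w \<in> xof ` ?A"
      then obtain v where v: "v \<in> ?A" "w = xof v" by blast
      then have v': "v \<in> chart_set" "nonzero_residues v = ?l" using A by blast+
      have "xof v \<in> cspace (Suc N)" using chart_setD(3)[OF v'(1)] by (auto simp: cspace_def xof_def)
      with fibre_eq_nonzero_residues[OF v'(1)] show "w \<in> ?B" unfolding v(2) v'(2) by simp
    next
      fix w assume w: "w \<in> ?B"
      have w1: "\<exists>i\<le>N. w i \<noteq> 0" using w by (intro exI[of _ 0]) auto
      have sep: "separated N w" by (rule nonresonant_fibre_separated[OF _ d_le nr w1]) (use w in blast)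
      have "\<exists>j\<le>N. ?l j \<noteq> 0" using l0 by blast
      from fibre_eq_iff_residues[OF \<beta>1 bp1 d_eq sep this] w obtain c where
        c: "c \<noteq> 0" "\<forall>j\<le>N. ?l j = c * pole_residue N \<beta> (b p) w j" by blast
      \<comment> \<open>The divisor is the factor by which the period exceeds the usual
        residue.\<close>
      define v where "v = w(0 := c / (2 * of_real pi * \<i>))"
      have xv: "xof v = w" using w by (auto simp: xof_def v_def fun_eq_iff)
      have "v \<in> chart_set" using w sep c by (auto simp: chart_set_def xv) (auto simp: v_def cspace_def)
      moreover have "nonzero_residues v = ?l"
      proof
        fix j
        have "2 * of_real pi * \<i> * v 0 = c" by (simp add: v_def)
        then show "nonzero_residues v j = ?l j"
          using c(2) by (cases "j \<le> N") (auto simp: nonzero_residues_def xv restrict_residues_def)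
      qed
      ultimately have "v \<in> ?A" using A by blast
      with xv show "w \<in> xof ` ?A" by blast
    qed
  qed
  then have "finite ?A = finite ?B" "card ?A = card ?B" using bij_betw_finite bij_betw_same_card by blast+
  moreover have "(\<Prod>i=1..N. d + i) = fact a div fact (a + 2 - p)"
    using fact_add[of d N] unfolding d_add d_def[symmetric] by simp
  ultimately show ?thesis using fibre_count[OF nr d_le] by simp
qed

lemma residue_map_open:
  assumes U: "openin (top_of_set (cspace (Suc N))) U" "U \<subseteq> chart_set"
    and v0: "v0 \<in> U" "extend_residues (nonzero_residues v0) \<in> residual_space p - resonance_arrangement p"
  shows "\<exists>V. openin (top_of_set (cspace (Suc N))) V \<and> nonzero_residues v0 \<in> V \<and> V \<subseteq> nonzero_residues ` U"
proof -
  have nr: "nonresonant N (nonzero_residues v0)"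
    using nonresonant_restrict_residues[OF v0(2)] extend_nonzero_residues_eq_iff[of _ v0] v0(2) by (metis DiffD1)
  have l0: "nonzero_residues v0 0 \<noteq> 0" using nr[unfolded nonresonant_def, rule_format, of "{0}"] by simp
  \<comment> \<open>Restricting to nonzero residue of index 0 permits recovering the constant, so
    that local uniqueness of the poles becomes injectivity.\<close>
  define W where "W = U \<inter> nonzero_residues -` {l. l 0 \<noteq> 0}"
  have cU: "continuous_on U nonzero_residues"
    by (rule continuous_on_coordinatewise_then_product) (rule continuous_on_subset[OF continuous_on_nonzero_residues U(2)])
  have "open {l :: nat \<Rightarrow> complex. l 0 \<noteq> 0}" by (intro open_Collect_neq) auto
  then have "openin (top_of_set U) W" unfolding W_def by (rule continuous_openin_preimage_gen[OF cU])
  then have opW: "openin (top_of_set (cspace (Suc N))) W" using U(1) openin_trans by blast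
  have WU: "W \<subseteq> U" by (auto simp: W_def)
  have WC: "W \<subseteq> chart_set" using WU U(2) by blast
  have v0W: "v0 \<in> W" using v0(1) l0 by (simp add: W_def)
  have "\<exists>T. open T \<and> v0 \<in> T \<and> (\<forall>w\<in>T \<inter> W. \<forall>w'\<in>T \<inter> W. nonzero_residues w = nonzero_residues w' \<longrightarrow>
    (\<forall>k\<in>{d+1..d+N}. fibre_eq N \<beta> (nonzero_residues w) k (xof w) = 0) \<longrightarrow>
    (\<forall>k\<in>{d+1..d+N}. fibre_eq N \<beta> (nonzero_residues w) k (xof w') = 0) \<longrightarrow> (\<forall>i\<le>N. xof w i = xof w' i))"
  proof (rule fibre_locally_unique[OF _ _ _ v0W d_le])
    show "continuous_on W (\<lambda>w. nonzero_residues w j)" for j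
      by (rule continuous_on_subset[OF continuous_on_nonzero_residues WC])
    show "continuous_on W (\<lambda>w. xof w j)" for j
      by (rule continuous_on_product_then_coordinatewise[OF continuous_on_xof])
    show "\<forall>k\<in>{d+1..d+N}. fibre_eq N \<beta> (nonzero_residues v0) k (xof v0) = 0"
      by (rule fibre_eq_nonzero_residues) (use v0W WC in blast)
    show "separated N (xof v0)" using chart_setD(2) v0W WC by blast
    show "\<exists>j\<le>N. nonzero_residues v0 j \<noteq> 0" using l0 by blast
  qed simp
  then obtain T where T: "open T" "v0 \<in> T" and inj: "\<forall>w\<in>T \<inter> W. \<forall>w'\<in>T \<inter> W. nonzero_residues w = nonzero_residues w' \<longrightarrow>
    (\<forall>k\<in>{d+1..d+N}. fibre_eq N \<beta> (nonzero_residues w) k (xof w) = 0) \<longrightarrow>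
    (\<forall>k\<in>{d+1..d+N}. fibre_eq N \<beta> (nonzero_residues w) k (xof w') = 0) \<longrightarrow> (\<forall>i\<le>N. xof w i = xof w' i)"
    by (elim exE conjE)
  have "openin (top_of_set (cspace (Suc N))) (nonzero_residues ` (T \<inter> W))"
  proof (rule invariance_of_domain_cspace)
    show "openin (top_of_set (cspace (Suc N))) (T \<inter> W)" using opW T(1) by (metis Int_commute openin_Int_open)
    show "continuous_on (T \<inter> W) nonzero_residues" by (rule continuous_on_subset[OF cU]) (use WU in blast)
    show "nonzero_residues ` (T \<inter> W) \<subseteq> cspace (Suc N)" by (auto simp: nonzero_residues_def cspace_def)
    show "inj_on nonzero_residues (T \<inter> W)"
    proof (rule inj_onI)
      fix w w' assume w: "w \<in> T \<inter> W" "w' \<in> T \<inter> W" "nonzero_residues w = nonzero_residues w'"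
      have wc: "w \<in> chart_set" "w' \<in> chart_set" using w WC by blast+
      have "\<forall>i\<le>N. xof w i = xof w' i"
        by (rule mp[OF mp[OF mp[OF bspec[OF bspec[OF inj w(1)] w(2)] w(3)] fibre_eq_nonzero_residues[OF wc(1)]]])
          (use fibre_eq_nonzero_residues[OF wc(2)] in \<open>simp only: w(3)\<close>)
      moreover have "nonzero_residues w 0 \<noteq> 0" using w(1) by (simp add: W_def)
      ultimately show "w = w'" using same_residues_same_scale w(3) wc by blast
    qed
  qed
  moreover have "nonzero_residues v0 \<in> nonzero_residues ` (T \<inter> W)" using T(2) v0W by blast
  moreover have "nonzero_residues ` (T \<inter> W) \<subseteq> nonzero_residues ` U" using WU by blast
  ultimately show ?thesis by blast
qed

lemma topspace_residual_space_top: "topspace (residual_space_top p) = residual_space p"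
  by (auto simp: residual_space_top_def residual_space_def)

lemma continuous_map_restrict_residues:
  "continuous_map (residual_space_top p) (top_of_set (cspace (Suc N))) restrict_residues"
proof (rule continuous_map_into_subtopology)
  have "continuous_map (residual_space_top p) euclidean (\<lambda>l. l j)" if "j \<in> {1..p}" for j
    unfolding residual_space_top_def
    by (rule continuous_map_from_subtopology[OF continuous_map_product_projection[OF that]])
  then have "continuous_map (residual_space_top p) euclidean (\<lambda>l. restrict_residues l i)" for i
    unfolding restrict_residues_def using pN by (cases "i = 0"; cases "i \<le> N") auto
  then have "continuous_map (residual_space_top p) (product_topology (\<lambda>_. euclidean) UNIV) restrict_residues"
    unfolding continuous_map_componentwise_UNIV by blast
  then show "continuous_map (residual_space_top p) euclidean restrict_residues"
    by (simp add: euclidean_product_topology)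
qed (auto simp: restrict_residues_def cspace_def)

lemma continuous_map_residual_map:
  "continuous_map (stratum_top p a b) (residual_space_top p) (residual_map p)"
proof -
  have R: "continuous_map (top_of_set chart_set) (residual_space_top p) (\<lambda>v. extend_residues (nonzero_residues v))"
    unfolding residual_space_top_def
  proof (rule continuous_map_into_subtopology)
    show "continuous_map (top_of_set chart_set) (product_topology (\<lambda>_. euclidean) {1..p}) (\<lambda>v. extend_residues (nonzero_residues v))"
      unfolding continuous_map_componentwise
    proof (intro conjI ballI)
      show "(\<lambda>v. extend_residues (nonzero_residues v)) ` topspace (top_of_set chart_set) \<subseteq> extensional {1..p}"
        by (auto simp: extend_residues_def)
      fix k assume "k \<in> {1..p}"
      then show "continuous_map (top_of_set chart_set) euclidean (\<lambda>v. extend_residues (nonzero_residues v) k)"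
        unfolding extend_residues_def all_residues_def
        by (cases "pole_index k \<le> N") (auto intro!: continuous_intros continuous_on_nonzero_residues)
    qed
  qed (use extend_residues_in_residual_space in auto)
  have "continuous_map (stratum_top p a b) (residual_space_top p) ((\<lambda>v. extend_residues (nonzero_residues v)) \<circ> chart_inv)"
    by (rule continuous_map_compose[OF continuous_map_chart_inv R])
  then show ?thesis
  proof (rule continuous_map_eq)
    fix C assume "C \<in> topspace (stratum_top p a b)"
    then have "C \<in> stratum p a b" by (simp add: topspace_stratum_top)
    from chart_inv[OF this] residual_map_form_class[of "chart_inv C"]
    show "((\<lambda>v. extend_residues (nonzero_residues v)) \<circ> chart_inv) C = residual_map p C" by simp
  qed
qed

theorem residual_covering:
  defines "Y \<equiv> residual_space p - resonance_arrangement p"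
  shows "covering_map_of_degree (fact a div fact (a + 2 - p))
    (subtopology (stratum_top p a b) {C \<in> stratum p a b. residual_map p C \<in> Y})
    (subtopology (residual_space_top p) Y) (residual_map p)"
\<comment> \<open>The global chart embeds the stratum into a metric space, which supplies the
  separation of the fibre points.\<close>
proof (rule covering_map_of_degreeI[where e = chart_inv])
  let ?S = "{C \<in> stratum p a b. residual_map p C \<in> Y}"
  let ?X = "subtopology (stratum_top p a b) ?S" and ?Y = "subtopology (residual_space_top p) Y"
  have tX: "topspace ?X = ?S" by (auto simp: topspace_stratum_top)
  have tY: "topspace ?Y = Y" by (auto simp: topspace_residual_space_top Y_def)
  show "continuous_map ?X ?Y (residual_map p)"
    by (rule continuous_map_into_subtopology[OF continuous_map_from_subtopology[OF continuous_map_residual_map]])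
      (auto simp: topspace_stratum_top)
  show "continuous_map ?X euclidean chart_inv"
    using continuous_map_chart_inv by (intro continuous_map_from_subtopology) (simp add: continuous_map_in_subtopology)
  show "inj_on chart_inv (topspace ?X)" unfolding tX
    by (rule inj_onI) (metis (no_types, lifting) chart_inv mem_Collect_eq)
  show "fact a div fact (a + 2 - p) > (0 :: nat)"
    using p2 by (simp add: div_greater_zero_iff fact_mono)
  show "finite {C \<in> topspace ?X. residual_map p C = y} \<and> card {C \<in> topspace ?X. residual_map p C = y} = fact a div fact (a + 2 - p)"
    if "y \<in> topspace ?Y" for y
  proof -
    have y: "y \<in> Y" using that tY by blast
    let ?A = "{v \<in> chart_set. extend_residues (nonzero_residues v) = y}"
    have "{C \<in> topspace ?X. residual_map p C = y} = form_class ` ?A"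
      unfolding tX unfolding stratum_eq using y residual_map_form_class by auto
    moreover have "inj_on form_class ?A" by (rule inj_on_subset[OF inj_on_form_class]) blast
    ultimately show ?thesis using card_residue_fibre[of y] y unfolding Y_def by (simp add: card_image)
  qed
  show "open_map ?X ?Y (residual_map p)"
    unfolding open_map_def
  proof (intro allI impI)
    fix W assume "openin ?X W"
    then obtain W0 where W0: "openin (stratum_top p a b) W0" "W = W0 \<inter> ?S" by (auto simp: openin_subtopology)
    let ?U = "{v \<in> chart_set. form_class v \<in> W0}"
    have opU: "openin (top_of_set (cspace (Suc N))) ?U" by (rule openin_form_class_preimage[OF W0(1)])
    show "openin ?Y (residual_map p ` W)"
    proof (subst openin_subopen, intro ballI)
      fix y assume "y \<in> residual_map p ` W"
      then obtain C where C: "C \<in> W0" "C \<in> stratum p a b" "residual_map p C \<in> Y" "y = residual_map p C"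
        unfolding W0(2) by blast
      define v0 where "v0 = chart_inv C"
      have v0: "v0 \<in> chart_set" "form_class v0 = C" using chart_inv[OF C(2)] by (auto simp: v0_def)
      have yv: "y = extend_residues (nonzero_residues v0)" unfolding C(4) v0(2)[symmetric] by (rule residual_map_form_class[OF v0(1)])
      have "\<exists>V. openin (top_of_set (cspace (Suc N))) V \<and> nonzero_residues v0 \<in> V \<and> V \<subseteq> nonzero_residues ` ?U"
        by (rule residue_map_open[OF opU]) (use v0 C yv in \<open>auto simp: Y_def\<close>)
      then obtain V where V: "openin (top_of_set (cspace (Suc N))) V" "nonzero_residues v0 \<in> V" "V \<subseteq> nonzero_residues ` ?U"
        by blast
      have yY: "y \<in> Y" using C by simp
      have "openin (residual_space_top p) {l \<in> topspace (residual_space_top p). restrict_residues l \<in> V}"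
        by (rule openin_continuous_map_preimage[OF continuous_map_restrict_residues V(1)])
      then have "openin ?Y ({l \<in> topspace (residual_space_top p). restrict_residues l \<in> V} \<inter> Y)"
        by (auto simp: openin_subtopology)
      moreover have "y \<in> {l \<in> topspace (residual_space_top p). restrict_residues l \<in> V} \<inter> Y"
        using V(2) yY extend_nonzero_residues_eq_iff[of y v0] yv by (simp add: topspace_residual_space_top Y_def)
      moreover have "{l \<in> topspace (residual_space_top p). restrict_residues l \<in> V} \<inter> Y \<subseteq> residual_map p ` W"
      proof
        fix l assume l: "l \<in> {l \<in> topspace (residual_space_top p). restrict_residues l \<in> V} \<inter> Y"
        then obtain v where v: "v \<in> ?U" "restrict_residues l = nonzero_residues v" using V(3) by blast
        have "l \<in> residual_space p" using l by (simp add: Y_def)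
        then have "extend_residues (nonzero_residues v) = l" using extend_nonzero_residues_eq_iff v(2) by simp
        then have "residual_map p (form_class v) = l" using residual_map_form_class v(1) by simp
        moreover have "form_class v \<in> W" using v(1) l calculation form_class_in_stratum by (auto simp: W0(2))
        ultimately show "l \<in> residual_map p ` W" by blast
      qed
      ultimately show "\<exists>T. openin ?Y T \<and> y \<in> T \<and> T \<subseteq> residual_map p ` W" by blast
    qed
  qed
qed

end

theorem theorem1p2:
  fixes p a :: nat and b :: "nat \<Rightarrow> nat"
  assumes "p \<ge> 2"
    and "a \<ge> 1"
    and "\<forall>j\<in>{1..p}. b j \<ge> 1"
    and "int a - (\<Sum>j=1..p. int (b j)) = -2"
  shows "covering_map_of_degree (fact a div fact (a + 2 - p))
           (subtopology (stratum_top p a b)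
              {C \<in> stratum p a b. residual_map p C \<in> residual_space p - resonance_arrangement p})
           (subtopology (residual_space_top p) (residual_space p - resonance_arrangement p))
           (residual_map p)"
proof -
  have "int (\<Sum>j=1..p. b j) = int (a + 2)" using assms(4) by simp
  then have "(\<Sum>j=1..p. b j) = a + 2" by (simp only: of_nat_eq_iff)
  then interpret stratum_data p a "p - 2" b
    using assms by unfold_locales auto
  show ?thesis by (rule residual_covering)
qed

end
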